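(* Let $n\ge1$ and $G=\mathrm{GL}_n$. For each $(p,m,r)\in\mathcal{PG}_{q,n}$, $\mathscr Z_{p,m,r}//G$ is an irreducible component of the GIT quotient $\mathscr K_{q,n}//G$, and $$\mathscr K_{q,n}//G=\bigcup_{(p,m,r)\in\mathcal{PG}_{q,n}}\mathscr Z_{p,m,r}//G.$$ Moreover, for every $(p,m,r)\in\mathcal{PG}_{q,n}$, $\dim\big(\mathscr Z_{p,m,r}//G\big)=n+(2-\ell)p$ if $\ell<\infty$, and $\dim\big(\mathscr Z_{p,m,r}//G\big)=n$ if $\ell=\infty$.
   Context: $K$ is an algebraically closed field of characteristic zero and $q\in K^*=K\setminus\{0\}$. Let $\ell$ be the smallest positive integer with $q^\ell=1$ if $q$ is a root of unity, and $\ell=\infty$ otherwise. For $n\ge1$, $\mathscr K_{q,n}=\{(A,B)\in M_{n\times n}(K)\times M_{n\times n}(K)\mid AB=qBA\}$, with the Zariski topology (as an algebraic set); $G=\mathrm{GL}_n(K)$ acts by $g\cdot(A,B)=(gAg^{-1},gBg^{-1})$. For a $G$-stable Zariski closed subset $Z\subseteq\mathscr K_{q,n}$ with coordinate ring $K[Z]$, $Z//G=\mathrm{Specmax}(K[Z]^G)$; $Z//G$ is regarded as a closed subvariety of $\mathscr K_{q,n}//G$ (the image of $Z$ under the quotient map $\mathscr K_{q,n}\to\mathscr K_{q,n}//G$). For $1\le i\le\ell$ (all $i\ge 1$ if $\ell=\infty$), $\mathscr D_{q,i}$ is the Zariski closure in $\mathscr K_{q,i}$ of the union of the $\mathrm{GL}_i$-orbits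 of all $(A,B)\in\mathscr K_{q,i}$ with $A=\mathrm{diag}(a,aq^{-1},\ldots,aq^{-(i-1)})$, $a\in K^*$. For $1\le i<\ell$, $\mathscr N_{q,i}$ is the Zariski closure in $\mathscr K_{q,i}$ of the union of the $\mathrm{GL}_i$-orbits of all $(J_i(0),B)\in\mathscr K_{q,i}$, where $J_i(0)$ is the $i\times i$ nilpotent Jordan block. For subsets $\mathscr V\subseteq\mathscr K_{q,i}$, $\mathscr W\subseteq\mathscr K_{q,j}$, $\mathscr V\oplus\mathscr W$ denotes the set of all pairs in $\mathscr K_{q,i+j}$ that are $\mathrm{GL}_{i+j}$-conjugate to $(\mathrm{diag}(A_1,A_2),\mathrm{diag}(B_1,B_2))$ with $(A_1,B_1)\in\mathscr V$, $(A_2,B_2)\in\mathscr W$; $\mathscr V^{\oplus m}$ is the $m$-fold iteration (and $\mathscr V^{\oplus 0}$ is omitted). Index set: if $1<\ell<\infty$, $\mathcal{PG}_{q,n}=\{(p,m,r)\in\mathbb Z_{\ge0}^3\mid \ell p+m+r=n\}$; if $\ell=1$, $\mathcal{PG}_{q,n}=\{(n,0,0)\}$; if $\ell=\infty$, $\mathcal{PG}_{q,n}=\{(0,m,r)\in\mathbb Z_{\ge0}^3\mid m+r=n\}$. The varieties: if $1<\ell<\infty$, $\mathscr Z_{p,m,r}=\overline{\mathscr D_{q,\ell}^{\oplus p}\oplus\mathscr D_{q,1}^{\oplus m}\oplus\mathscr N_{q,1}^{\oplus r}}$; if $\ell=1$, $\mathscr Z_{n,0,0}=\overline{\mathscr D_{q,1}^{\oplus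 n}}$; if $\ell=\infty$, $\mathscr Z_{0,m,r}=\overline{\mathscr D_{q,1}^{\oplus m}\oplus\mathscr N_{q,1}^{\oplus r}}$. Overlines denote Zariski closure in $\mathscr K_{q,n}$. *)

theory Defs
  imports
    "HOL-Analysis.Abstract_Topology"
    "HOL-Library.Extended_Nat"
    "HOL-Algebra.Ideal"
    "Jordan_Normal_Form.Jordan_Normal_Form"
begin

section \<open>Irreducibility and dimension in topological spaces\<close>

definition irreducible_in :: "'a topology \<Rightarrow> 'a set \<Rightarrow> bool" where
  "irreducible_in X S \<longleftrightarrow> S \<subseteq> topspace X \<and> S \<noteq> {} \<and>
     (\<forall>C D. closedin X C \<longrightarrow> closedin X D \<longrightarrow> S \<subseteq> C \<union> D \<longrightarrow> S \<subseteq> C \<or> S \<subseteq> D)"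

definition irreducible_component_of :: "'a topology \<Rightarrow> 'a set \<Rightarrow> bool" where
  "irreducible_component_of X S \<longleftrightarrow>
     irreducible_in X S \<and> (\<forall>T. irreducible_in X T \<longrightarrow> S \<subseteq> T \<longrightarrow> T = S)"

definition krull_dim :: "'a topology \<Rightarrow> enat" where
  "krull_dim X = Sup {enat k | k. \<exists>C :: nat \<Rightarrow> 'a set.
     (\<forall>i\<le>k. closedin X (C i) \<and> irreducible_in X (C i)) \<and> (\<forall>i<k. C i \<subset> C (Suc i))}"


section \<open>Pairs of matrices: polynomial functions, Zariski topology, conjugation\<close>

type_synonym 'a mat2 = "'a mat \<times> 'a mat"

abbreviation mat2_space :: "nat \<Rightarrow> 'a mat2 set" where
  "mat2_space n \<equiv> carrier_mat n n \<times> carrier_mat n n"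

inductive_set polyfun :: "nat \<Rightarrow> ('a::comm_ring_1 mat2 \<Rightarrow> 'a) set" for n where
  const: "(\<lambda>_. c) \<in> polyfun n"
| coord1: "i < n \<Longrightarrow> j < n \<Longrightarrow> (\<lambda>(A, B). A $$ (i, j)) \<in> polyfun n"
| coord2: "i < n \<Longrightarrow> j < n \<Longrightarrow> (\<lambda>(A, B). B $$ (i, j)) \<in> polyfun n"
| add: "f \<in> polyfun n \<Longrightarrow> g \<in> polyfun n \<Longrightarrow> (\<lambda>x. f x + g x) \<in> polyfun n"
| mult: "f \<in> polyfun n \<Longrightarrow> g \<in> polyfun n \<Longrightarrow> (\<lambda>x. f x * g x) \<in> polyfun n"

definition zariski :: "nat \<Rightarrow> 'a::idom mat2 topology" where
  "zariski n = topology (\<lambda>U. \<exists>F \<subseteq> polyfun n. U = {x \<in> mat2_space n. \<exists>f\<in>F. f x \<noteq> 0})"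

lemma openin_zariski:
  "openin (zariski n) U \<longleftrightarrow>
     (\<exists>F \<subseteq> polyfun n. U = {x \<in> mat2_space n. \<exists>f\<in>F. f x \<noteq> (0::'a::idom)})"
proof -
  let ?P = "\<lambda>U. \<exists>F \<subseteq> polyfun n. U = {x \<in> mat2_space n. \<exists>f\<in>F. f x \<noteq> (0::'a)}"
  have "istopology ?P"
    unfolding istopology_def
  proof (intro conjI allI impI)
    fix S T assume "?P S" "?P T"
    then obtain F G where F: "F \<subseteq> polyfun n" "S = {x \<in> mat2_space n. \<exists>f\<in>F. f x \<noteq> (0::'a)}"
      and G: "G \<subseteq> polyfun n" "T = {x \<in> mat2_space n. \<exists>f\<in>G. f x \<noteq> (0::'a)}" by (elim exE conjE)
    let ?H = "{h. \<exists>f\<in>F. \<exists>g\<in>G. h = (\<lambda>x. f x * g x)}"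
    have "?H \<subseteq> polyfun n" using F(1) G(1) by (auto intro!: polyfun.mult)
    moreover have "S \<inter> T = {x \<in> mat2_space n. \<exists>h\<in>?H. h x \<noteq> 0}"
      unfolding F(2) G(2) by fastforce
    ultimately show "?P (S \<inter> T)" by blast
  next
    fix \<K> assume K: "\<forall>K\<in>\<K>. ?P K"
    let ?H = "{f \<in> polyfun n. \<exists>K\<in>\<K>. {x \<in> mat2_space n. f x \<noteq> (0::'a)} \<subseteq> K}"
    have "\<Union>\<K> = {x \<in> mat2_space n. \<exists>h\<in>?H. h x \<noteq> 0}"
    proof (intro equalityI subsetI)
      fix x assume "x \<in> \<Union>\<K>"
      then obtain U where U: "U \<in> \<K>" "x \<in> U" by blast
      obtain F where F: "F \<subseteq> polyfun n" "U = {x \<in> mat2_space n. \<exists>f\<in>F. f x \<noteq> (0::'a)}"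
        using bspec[OF K U(1)] by (elim exE conjE)
      then obtain f where f: "f \<in> F" "f x \<noteq> 0" "x \<in> mat2_space n" using U by auto
      then have "{x \<in> mat2_space n. f x \<noteq> 0} \<subseteq> U" "f \<in> polyfun n" using F by auto
      with f U show "x \<in> {x \<in> mat2_space n. \<exists>h\<in>?H. h x \<noteq> 0}" by auto
    qed auto
    then show "?P (\<Union>\<K>)" by (intro exI[of _ ?H] conjI) auto
  qed
  then show ?thesis unfolding zariski_def by (simp add: topology_inverse')
qed

text \<open>\<^term>\<open>gl_orbit n (A, B)\<close> consists of the pairs $(PAP^{-1}, PBP^{-1})$ with
  $P$ invertible; \<^const>\<open>similar_mat_wit\<close> carries the inverse as its last argument.\<close>

definition gl_orbit :: "nat \<Rightarrow> 'a::semiring_1 mat2 \<Rightarrow> 'a mat2 set" where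
  "gl_orbit n x = {y \<in> mat2_space n. \<exists>P Q.
     similar_mat_wit (fst y) (fst x) P Q \<and> similar_mat_wit (snd y) (snd x) P Q}"


section \<open>The quotient of a stable closed set by conjugation\<close>

text \<open>Regular functions on \<open>Z\<close> are represented extensionally, as restrictions to \<open>Z\<close> of
  polynomial functions.\<close>

definition coord_ring :: "nat \<Rightarrow> 'a::comm_ring_1 mat2 set \<Rightarrow> ('a mat2 \<Rightarrow> 'a) ring" where
  "coord_ring n Z =
     \<lparr>carrier = (\<lambda>f. restrict f Z) ` polyfun n,
      monoid.mult = (\<lambda>f g. \<lambda>x\<in>Z. f x * g x), one = (\<lambda>x\<in>Z. 1),
      zero = (\<lambda>x\<in>Z. 0), add = (\<lambda>f g. \<lambda>x\<in>Z. f x + g x)\<rparr>"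

definition inv_ring :: "nat \<Rightarrow> 'a::comm_ring_1 mat2 set \<Rightarrow> ('a mat2 \<Rightarrow> 'a) ring" where
  "inv_ring n Z = (coord_ring n Z)
     \<lparr>carrier := {f \<in> carrier (coord_ring n Z). \<forall>x\<in>Z. \<forall>y \<in> gl_orbit n x \<inter> Z. f y = f x}\<rparr>"

definition specmax :: "('b, 'c) ring_scheme \<Rightarrow> 'b set topology" where
  "specmax R = topology (\<lambda>U. \<exists>S \<subseteq> carrier R. U = {M. maximalideal M R \<and> \<not> S \<subseteq> M})"

definition git_quotient :: "nat \<Rightarrow> 'a::comm_ring_1 mat2 set \<Rightarrow> ('a mat2 \<Rightarrow> 'a) set topology" where
  "git_quotient n Z = specmax (inv_ring n Z)"

definition quotient_map_on :: "nat \<Rightarrow> 'a::comm_ring_1 mat2 set \<Rightarrow> 'a mat2 \<Rightarrow> ('a mat2 \<Rightarrow> 'a) set" where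
  "quotient_map_on n X x = {f \<in> carrier (inv_ring n X). f x = 0}"

lemma openin_specmax:
  assumes "cring R"
  shows "openin (specmax R) U \<longleftrightarrow>
    (\<exists>S \<subseteq> carrier R. U = {M. maximalideal M R \<and> \<not> S \<subseteq> M})"
proof -
  interpret cring R by fact
  let ?P = "\<lambda>U. \<exists>S \<subseteq> carrier R. U = {M. maximalideal M R \<and> \<not> S \<subseteq> M}"
  have "istopology ?P"
    unfolding istopology_def
  proof (intro conjI allI impI)
    fix U V assume "?P U" "?P V"
    then obtain S T where S: "S \<subseteq> carrier R" "U = {M. maximalideal M R \<and> \<not> S \<subseteq> M}"
      and T: "T \<subseteq> carrier R" "V = {M. maximalideal M R \<and> \<not> T \<subseteq> M}" by (elim exE conjE)
    let ?H = "{s \<otimes>\<^bsub>R\<^esub> t | s t. s \<in> S \<and> t \<in> T}"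
    have H: "?H \<subseteq> carrier R" using S(1) T(1) by auto
    have "?H \<subseteq> M \<longleftrightarrow> S \<subseteq> M \<or> T \<subseteq> M" if M: "maximalideal M R" for M
    proof -
      interpret M: primeideal M R using M by (rule maximalideal_prime)
      show ?thesis
      proof
        assume "?H \<subseteq> M"
        then show "S \<subseteq> M \<or> T \<subseteq> M"
          using S(1) T(1) M.I_prime by blast
      next
        assume "S \<subseteq> M \<or> T \<subseteq> M"
        then show "?H \<subseteq> M"
          using S(1) T(1) M.I_l_closed M.I_r_closed by blast
      qed
    qed
    then have "U \<inter> V = {M. maximalideal M R \<and> \<not> ?H \<subseteq> M}"
      unfolding S(2) T(2) by blast
    with H show "?P (U \<inter> V)" by blast
  next
    fix \<K> assume K: "\<forall>K\<in>\<K>. ?P K"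
    let ?H = "{f \<in> carrier R. \<exists>K\<in>\<K>. {M. maximalideal M R \<and> f \<notin> M} \<subseteq> K}"
    have "\<Union>\<K> = {M. maximalideal M R \<and> \<not> ?H \<subseteq> M}"
    proof (intro equalityI subsetI)
      fix M assume "M \<in> \<Union>\<K>"
      then obtain U where U: "U \<in> \<K>" "M \<in> U" by blast
      obtain S where S: "S \<subseteq> carrier R" "U = {M. maximalideal M R \<and> \<not> S \<subseteq> M}"
        using bspec[OF K U(1)] by (elim exE conjE)
      with U obtain f where "f \<in> S" "f \<notin> M" "maximalideal M R" by blast
      moreover have "{M. maximalideal M R \<and> f \<notin> M} \<subseteq> U" unfolding S(2) using \<open>f \<in> S\<close> by auto
      then have "f \<in> ?H" using S(1) U(1) \<open>f \<in> S\<close> by auto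
      ultimately show "M \<in> {M. maximalideal M R \<and> \<not> ?H \<subseteq> M}" by blast
    qed auto
    then show "?P (\<Union>\<K>)" by (intro exI[of _ ?H] conjI) auto
  qed
  then show ?thesis unfolding specmax_def by (simp add: topology_inverse')
qed

lemma polyfun_minus: "f \<in> polyfun n \<Longrightarrow> (\<lambda>x. - f x) \<in> polyfun n"
  using polyfun.mult[OF polyfun.const[of "-1"], of f n] by simp

lemma cring_inv_ring: "cring (inv_ring n Z)"
proof (rule cringI)
  let ?R = "inv_ring n Z"
  have carrier: "carrier ?R = {f. (\<exists>g\<in>polyfun n. f = restrict g Z) \<and>
      (\<forall>x\<in>Z. \<forall>y \<in> gl_orbit n x \<inter> Z. f y = f x)}"
    by (auto simp: inv_ring_def coord_ring_def)
  have ops [simp]: "monoid.mult ?R = (\<lambda>f g. \<lambda>x\<in>Z. f x * g x)" "one ?R = (\<lambda>x\<in>Z. 1)"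
      "zero ?R = (\<lambda>x\<in>Z. 0)" "add ?R = (\<lambda>f g. \<lambda>x\<in>Z. f x + g x)"
    by (simp_all add: inv_ring_def coord_ring_def)
  have ext: "f = restrict f Z" if "f \<in> carrier ?R" for f
    using that unfolding carrier by auto
  have mem: "h \<in> carrier ?R" if "g \<in> polyfun n" "h = restrict g Z"
    "\<And>x y. x \<in> Z \<Longrightarrow> y \<in> gl_orbit n x \<inter> Z \<Longrightarrow> h y = h x" for g h
    using that unfolding carrier by blast
  have one: "(\<lambda>x\<in>Z. 1) \<in> carrier ?R" and zero: "(\<lambda>x\<in>Z. 0) \<in> carrier ?R"
    unfolding carrier by (auto intro: polyfun.const)
  have mult: "(\<lambda>x\<in>Z. f x * g x) \<in> carrier ?R" and add: "(\<lambda>x\<in>Z. f x + g x) \<in> carrier ?R"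
    if f: "f \<in> carrier ?R" and g: "g \<in> carrier ?R" for f g
  proof -
    obtain f' g' where f': "f' \<in> polyfun n" "f = restrict f' Z" and
      g': "g' \<in> polyfun n" "g = restrict g' Z"
      using f g unfolding carrier by blast
    have inv: "f y = f x" "g y = g x" if "x \<in> Z" "y \<in> gl_orbit n x \<inter> Z" for x y
      using f g that unfolding carrier by blast+
    show "(\<lambda>x\<in>Z. f x * g x) \<in> carrier ?R"
    proof (rule mem[OF polyfun.mult[OF f'(1) g'(1)]])
      show "(\<lambda>x\<in>Z. f x * g x) = restrict (\<lambda>x. f' x * g' x) Z" unfolding f' g' by auto
    qed (use inv in simp)
    show "(\<lambda>x\<in>Z. f x + g x) \<in> carrier ?R"
    proof (rule mem[OF polyfun.add[OF f'(1) g'(1)]])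
      show "(\<lambda>x\<in>Z. f x + g x) = restrict (\<lambda>x. f' x + g' x) Z" unfolding f' g' by auto
    qed (use inv in simp)
  qed
  have minus: "(\<lambda>x\<in>Z. - f x) \<in> carrier ?R" if f: "f \<in> carrier ?R" for f
  proof -
    obtain f' where f': "f' \<in> polyfun n" "f = restrict f' Z"
      using f unfolding carrier by blast
    have inv: "f y = f x" if "x \<in> Z" "y \<in> gl_orbit n x \<inter> Z" for x y
      using f that unfolding carrier by blast
    show ?thesis
    proof (rule mem[OF polyfun_minus[OF f'(1)]])
      show "(\<lambda>x\<in>Z. - f x) = restrict (\<lambda>x. - f' x) Z" unfolding f' by auto
    qed (use inv in simp)
  qed
  have restr: "restrict f Z = f" if "f \<in> carrier ?R" for f
    using ext[OF that] by simp
  have add_laws: "f \<oplus>\<^bsub>?R\<^esub> g \<oplus>\<^bsub>?R\<^esub> h = f \<oplus>\<^bsub>?R\<^esub> (g \<oplus>\<^bsub>?R\<^esub> h)" "f \<oplus>\<^bsub>?R\<^esub> g = g \<oplus>\<^bsub>?R\<^esub> f" for f g h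
    by (auto simp: restrict_def fun_eq_iff add.assoc add.commute)
  have mult_laws: "f \<otimes>\<^bsub>?R\<^esub> g \<otimes>\<^bsub>?R\<^esub> h = f \<otimes>\<^bsub>?R\<^esub> (g \<otimes>\<^bsub>?R\<^esub> h)" "f \<otimes>\<^bsub>?R\<^esub> g = g \<otimes>\<^bsub>?R\<^esub> f" for f g h
    by (auto simp: restrict_def fun_eq_iff mult.assoc mult.commute)
  show "abelian_group ?R"
  proof (rule abelian_groupI)
    fix f assume f: "f \<in> carrier ?R"
    show "\<exists>g\<in>carrier ?R. g \<oplus>\<^bsub>?R\<^esub> f = \<zero>\<^bsub>?R\<^esub>"
      using minus[OF f] by (intro bexI[of _ "\<lambda>x\<in>Z. - f x"]) (auto simp: restrict_def)
    have "(\<lambda>x\<in>Z. (\<lambda>x\<in>Z. 0) x + f x) = restrict f Z" by auto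
    then show "\<zero>\<^bsub>?R\<^esub> \<oplus>\<^bsub>?R\<^esub> f = f" using restr[OF f] by simp
  next
    fix f g assume "f \<in> carrier ?R" "g \<in> carrier ?R"
    then show "f \<oplus>\<^bsub>?R\<^esub> g \<in> carrier ?R" unfolding ops by (rule add)
  next
    show "\<zero>\<^bsub>?R\<^esub> \<in> carrier ?R" unfolding ops by (rule zero)
  qed (rule add_laws)+
  show "comm_monoid ?R"
  proof (rule comm_monoidI)
    fix f assume f: "f \<in> carrier ?R"
    have "(\<lambda>x\<in>Z. (\<lambda>x\<in>Z. 1) x * f x) = restrict f Z" by auto
    then show "\<one>\<^bsub>?R\<^esub> \<otimes>\<^bsub>?R\<^esub> f = f" using restr[OF f] by simp
  next
    fix f g assume "f \<in> carrier ?R" "g \<in> carrier ?R"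
    then show "f \<otimes>\<^bsub>?R\<^esub> g \<in> carrier ?R" unfolding ops by (rule mult)
  next
    show "\<one>\<^bsub>?R\<^esub> \<in> carrier ?R" unfolding ops by (rule one)
  qed (rule mult_laws)+
  show "(f \<oplus>\<^bsub>?R\<^esub> g) \<otimes>\<^bsub>?R\<^esub> h = f \<otimes>\<^bsub>?R\<^esub> h \<oplus>\<^bsub>?R\<^esub> g \<otimes>\<^bsub>?R\<^esub> h" for f g h
    by (simp add: restrict_def fun_eq_iff distrib_right)
qed


section \<open>The \<open>q\<close>-commuting variety\<close>

definition q_order :: "'a::monoid_mult \<Rightarrow> enat" where
  "q_order q = (if \<exists>k>0. q ^ k = 1 then enat (LEAST k. k > 0 \<and> q ^ k = 1) else \<infinity>)"

definition qcomm :: "'a::comm_ring_1 \<Rightarrow> nat \<Rightarrow> 'a mat2 set" where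
  "qcomm q n = {(A, B) \<in> mat2_space n. A * B = q \<cdot>\<^sub>m (B * A)}"

definition zclosure :: "'a::idom \<Rightarrow> nat \<Rightarrow> 'a mat2 set \<Rightarrow> 'a mat2 set" where
  "zclosure q n S = subtopology (zariski n) (qcomm q n) closure_of S"

text \<open>\<open>Dvar q i\<close> is meant for \<open>1 \<le> i \<le> q_order q\<close>, and \<open>Nvar q i\<close> for \<open>1 \<le> i < q_order q\<close>.\<close>

definition Dvar :: "'a::field \<Rightarrow> nat \<Rightarrow> 'a mat2 set" where
  "Dvar q i = zclosure q i (\<Union> (gl_orbit i `
     {(A, B) \<in> qcomm q i. \<exists>a. a \<noteq> 0 \<and> A = mat_diag i (\<lambda>k. a * inverse q ^ k)}))"

definition Nvar :: "'a::field \<Rightarrow> nat \<Rightarrow> 'a mat2 set" where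
  "Nvar q i = zclosure q i (\<Union> (gl_orbit i ` {(A, B) \<in> qcomm q i. A = jordan_block i 0}))"

text \<open>For \<open>V \<subseteq> qcomm q i\<close> and \<open>W \<subseteq> qcomm q j\<close>.\<close>

definition direct_sum ::
    "'a::comm_ring_1 \<Rightarrow> nat \<Rightarrow> nat \<Rightarrow> 'a mat2 set \<Rightarrow> 'a mat2 set \<Rightarrow> 'a mat2 set" where
  "direct_sum q i j V W = {x \<in> qcomm q (i + j). \<exists>(A1, B1) \<in> V. \<exists>(A2, B2) \<in> W.
     x \<in> gl_orbit (i + j) (diag_block_mat [A1, A2], diag_block_mat [B1, B2])}"

text \<open>The zeroth power is \<open>qcomm q 0\<close>, whose only element is the pair of \<open>0 \<times> 0\<close> matrices.
  Adding it to a conjugation-stable set changes nothing (lemma \<open>direct_sum_unit\<close>), so a summand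
  with exponent zero is in effect omitted.\<close>

fun direct_power :: "'a::comm_ring_1 \<Rightarrow> nat \<Rightarrow> 'a mat2 set \<Rightarrow> nat \<Rightarrow> 'a mat2 set" where
  "direct_power q i V 0 = qcomm q 0"
| "direct_power q i V (Suc k) = direct_sum q i (i * k) V (direct_power q i V k)"

lemma direct_sum_unit:
  assumes V: "V \<subseteq> qcomm q i" and stable: "\<And>x. x \<in> V \<Longrightarrow> gl_orbit i x \<subseteq> V"
  shows "direct_sum q i 0 V (qcomm q 0) = V" "direct_sum q 0 i (qcomm q 0) V = V"
proof -
  have unit: "qcomm q 0 = {(0\<^sub>m 0 0, 0\<^sub>m 0 0)}"
    unfolding qcomm_def by (auto intro!: eq_matI)
  have blocks: "diag_block_mat [A, 0\<^sub>m 0 0] = A" "diag_block_mat [0\<^sub>m 0 0, A] = A"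
    for A :: "'a mat"
    by (auto intro!: eq_matI simp: Let_def)
  have refl: "x \<in> gl_orbit i x" if "x \<in> V" for x
  proof -
    from that V have "x \<in> mat2_space i" by (auto simp: qcomm_def)
    then show ?thesis
      unfolding gl_orbit_def by (auto intro!: exI[of _ "1\<^sub>m i"] similar_mat_wit_refl)
  qed
  have eq: "{x \<in> qcomm q i. \<exists>(A, B) \<in> V. x \<in> gl_orbit i (A, B)} = V"
    using V stable refl by (auto simp: split_beta) blast+
  show "direct_sum q i 0 V (qcomm q 0) = V" "direct_sum q 0 i (qcomm q 0) V = V"
    using eq by (simp_all add: direct_sum_def unit blocks del: diag_block_mat.simps)
qed

text \<open>For \<open>q_order q = 1\<close> only \<open>(n, 0, 0)\<close> is an index: \<open>Nvar q 1\<close> is not available, and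
  \<open>Dvar q (q_order q)\<close> coincides with \<open>Dvar q 1\<close>.\<close>

definition PG :: "'a::monoid_mult \<Rightarrow> nat \<Rightarrow> (nat \<times> nat \<times> nat) set" where
  "PG q n = (case q_order q of
     enat l \<Rightarrow> if l = 1 then {(n, 0, 0)} else {(p, m, r). l * p + m + r = n}
   | \<infinity> \<Rightarrow> {(p, m, r). p = 0 \<and> m + r = n})"

definition Zvar :: "'a::field \<Rightarrow> nat \<Rightarrow> nat \<times> nat \<times> nat \<Rightarrow> 'a mat2 set" where
  "Zvar q n = (\<lambda>(p, m, r). zclosure q n (case q_order q of
     enat l \<Rightarrow>
       if l = 1 then direct_power q 1 (Dvar q 1) p
       else direct_sum q (l * p) (m + r) (direct_power q l (Dvar q l) p)
              (direct_sum q m r (direct_power q 1 (Dvar q 1) m) (direct_power q 1 (Nvar q 1) r))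
   | \<infinity> \<Rightarrow> direct_sum q m r (direct_power q 1 (Dvar q 1) m) (direct_power q 1 (Nvar q 1) r)))"

abbreviation Kquot :: "'a::comm_ring_1 \<Rightarrow> nat \<Rightarrow> ('a mat2 \<Rightarrow> 'a) set topology" where
  "Kquot q n \<equiv> git_quotient n (qcomm q n)"

text \<open>The quotient of a stable closed \<open>Z \<subseteq> qcomm q n\<close>, regarded as a subset of
  \<^term>\<open>Kquot q n\<close>.\<close>

definition quot_image :: "'a::comm_ring_1 \<Rightarrow> nat \<Rightarrow> 'a mat2 set \<Rightarrow> ('a mat2 \<Rightarrow> 'a) set set" where
  "quot_image q n Z = quotient_map_on n (qcomm q n) ` Z"

end

theory Submission
  imports Defs "HOL-Library.Function_Algebras"
begin

text \<open>The theorem is true because the quotient is covered by explicit families of direct sums of simple pairs,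
  and each family is finite onto its image.

  Let \<open>A B = q B A\<close>. An eigenvector of \<open>A\<close>, moved around by \<open>B\<close>, yields either
  a common eigenvector, on which one of the two matrices is zero unless \<open>q = 1\<close>, or, if \<open>q\<close>
  is a primitive root of unity of order \<open>L\<close>, an invariant subspace of dimension \<open>L\<close> with a
  basis of eigenvectors of \<open>A\<close> that \<open>B\<close> permutes cyclically up to a common factor
  (\<open>simple_subpair\<close>). Conjugation with \<open>diag (s, \<dots>, s, 1, \<dots>, 1)\<close> for
  \<open>s\<close> tending to zero splits off this subspace (\<open>split_invariant_subspace\<close>). By induction
  the closure of every orbit contains a direct sum of \<open>p\<close> cyclic pairs, \<open>m\<close> lines with
  \<open>B = 0\<close> and \<open>r\<close> lines with \<open>A = 0\<close> (\<open>semisimplification\<close>), and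
  invariants do not distinguish a pair from its degenerations. For each type \<open>t = (p, m, r)\<close> these direct
  sums form a family \<open>generic_pair q L t\<close> with \<open>N = 2 p + m + r\<close> free parameters, and
  \<open>Zvar q n t\<close> contains the family and lies in the closure of its orbits (\<open>Zvar_generic\<close>).

  Each of these families has a closed irreducible image of dimension \<open>N\<close>. The reason is that each
  parameter is an eigenvalue of \<open>A\<close> or of \<open>B\<close>, hence a root of a monic polynomial whose
  coefficients are invariants: the parameters are integral over the invariants pulled back to the affine space of
  parameters (\<open>quotient_param_generic\<close>). So a proper ideal of the ring of pulled back invariants has a
  zero in affine space: it remains proper when the parameters are adjoined, by Nakayama's lemma, and there the
  Nullstellensatz applies (\<open>common_zero_of_proper_ideal\<close>). The maximal ideals of the ring of invariants
  therefore come from values of the parameters (\<open>maximal_ideals_are_points\<close>). The dimension is at most \<open>N\<close> because \<open>N +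
  1\<close> polynomials in \<open>N\<close> variables are algebraically dependent, and at least \<open>N\<close>
  because the closures of the images of the coordinate subspaces form a strictly increasing chain of irreducible sets
  (\<open>integral_parametrization.krull_dim_eq\<close>). As \<open>n = L p + m + r\<close>, this is the dimension
  claimed.

  Finally, no image contains another one. Set all parameters of a family to \<open>1\<close>. If a member of another
  family has the same invariants, its eigenvalues are zero or roots of unity, and counting with traces of products
  \<open>A ^ k * B ^ l\<close> shows that its type is at least as large in each entry, hence equal
  (\<open>PG_separated\<close>). The finitely many closed irreducible images cover the quotient without inclusions
  among them, so they are its irreducible components.\<close>


hide_const (open) module.smult

section \<open>Extending a point along one variable\<close>

text \<open>The rings needed are rings of functions on affine space and rings pulled back to it, all inside one ring
  of functions. Subrings and their ideals are therefore sets in a commutative ring given by its type.\<close>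

definition unital_subring :: "'r::comm_ring_1 set \<Rightarrow> bool" where
  "unital_subring A \<longleftrightarrow> 1 \<in> A \<and> (\<forall>x\<in>A. \<forall>y\<in>A. x + y \<in> A \<and> x * y \<in> A) \<and> (\<forall>x\<in>A. - x \<in> A)"

definition ideal_in :: "'r::comm_ring_1 set \<Rightarrow> 'r set \<Rightarrow> bool" where
  "ideal_in B J \<longleftrightarrow> J \<subseteq> B \<and> 0 \<in> J \<and> (\<forall>x\<in>J. \<forall>y\<in>J. x + y \<in> J) \<and> (\<forall>x\<in>J. \<forall>b\<in>B. b * x \<in> J)"

definition prime_in :: "'r::comm_ring_1 set \<Rightarrow> 'r set \<Rightarrow> bool" where
  "prime_in B P \<longleftrightarrow> ideal_in B P \<and> 1 \<notin> P \<and> (\<forall>x\<in>B. \<forall>y\<in>B. x * y \<in> P \<longrightarrow> x \<in> P \<or> y \<in> P)"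

definition polys_over :: "'r::comm_ring_1 set \<Rightarrow> 'r poly set" where
  "polys_over A = {p. \<forall>i. coeff p i \<in> A}"

definition adjoin :: "'r::comm_ring_1 set \<Rightarrow> 'r \<Rightarrow> 'r set" where
  "adjoin A x = (\<lambda>p. poly p x) ` polys_over A"

lemma unital_subringD:
  assumes "unital_subring A"
  shows "1 \<in> A" "0 \<in> A" "x \<in> A \<Longrightarrow> y \<in> A \<Longrightarrow> x + y \<in> A" "x \<in> A \<Longrightarrow> y \<in> A \<Longrightarrow> x * y \<in> A"
    "x \<in> A \<Longrightarrow> - x \<in> A" "x \<in> A \<Longrightarrow> y \<in> A \<Longrightarrow> x - y \<in> A" "x \<in> A \<Longrightarrow> x ^ k \<in> A"
proof -
  have 1: "1 \<in> A" and add: "\<And>x y. x \<in> A \<Longrightarrow> y \<in> A \<Longrightarrow> x + y \<in> A"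
    and mult: "\<And>x y. x \<in> A \<Longrightarrow> y \<in> A \<Longrightarrow> x * y \<in> A" and minus: "\<And>x. x \<in> A \<Longrightarrow> - x \<in> A"
    using assms unfolding unital_subring_def by blast+
  show "0 \<in> A" using add[OF 1 minus[OF 1]] by simp
  show "x \<in> A \<Longrightarrow> x ^ k \<in> A" for x by (induction k) (auto intro: 1 mult)
  show "x \<in> A \<Longrightarrow> y \<in> A \<Longrightarrow> x - y \<in> A" for x y using add[of x "- y"] minus by simp
qed (use assms in \<open>unfold unital_subring_def, blast+\<close>)

lemma unital_subring_sum:
  "unital_subring A \<Longrightarrow> (\<And>i. i \<in> I \<Longrightarrow> f i \<in> A) \<Longrightarrow> sum f I \<in> A"
  by (induction I rule: infinite_finite_induct) (auto simp: unital_subringD)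

lemma ideal_inD:
  assumes "ideal_in B J" "unital_subring B"
  shows "x \<in> J \<Longrightarrow> x \<in> B" "0 \<in> J" "x \<in> J \<Longrightarrow> y \<in> J \<Longrightarrow> x + y \<in> J"
    "x \<in> J \<Longrightarrow> b \<in> B \<Longrightarrow> b * x \<in> J" "x \<in> J \<Longrightarrow> b \<in> B \<Longrightarrow> x * b \<in> J"
    "x \<in> J \<Longrightarrow> - x \<in> J" "x \<in> J \<Longrightarrow> y \<in> J \<Longrightarrow> x - y \<in> J"
proof -
  have add: "\<And>x y. x \<in> J \<Longrightarrow> y \<in> J \<Longrightarrow> x + y \<in> J" and mult: "\<And>x b. x \<in> J \<Longrightarrow> b \<in> B \<Longrightarrow> b * x \<in> J"
    using assms unfolding ideal_in_def by blast+
  have minus: "- x \<in> J" if "x \<in> J" for x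
    using mult[OF that, of "- 1"] unital_subringD[OF assms(2)] by simp
  show "x \<in> J \<Longrightarrow> - x \<in> J" by (rule minus)
  show "x \<in> J \<Longrightarrow> y \<in> J \<Longrightarrow> x - y \<in> J" using add[of x "- y"] minus by simp
  show "x \<in> J \<Longrightarrow> b \<in> B \<Longrightarrow> x * b \<in> J" using mult[of x b] by (simp add: mult.commute)
qed (use assms in \<open>unfold ideal_in_def, blast+\<close>)

lemma ideal_in_sum:
  assumes "ideal_in B J" "unital_subring B" "\<And>i. i \<in> I \<Longrightarrow> f i \<in> J"
  shows "sum f I \<in> J"
  using assms(3) by (induction I rule: infinite_finite_induct) (auto simp: ideal_inD[OF assms(1,2)])

lemma prime_inD:
  assumes "prime_in B P"
  shows "ideal_in B P" "1 \<notin> P" "x \<in> B \<Longrightarrow> y \<in> B \<Longrightarrow> x * y \<in> P \<Longrightarrow> x \<in> P \<or> y \<in> P"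
  using assms unfolding prime_in_def by blast+

lemma prime_in_power:
  assumes "prime_in B P" "unital_subring B" "x \<in> B" "x \<notin> P"
  shows "x ^ k \<notin> P"
proof (induction k)
  case (Suc k)
  then show ?case
    using prime_inD(3)[OF assms(1,3), of "x ^ k"] assms unital_subringD[OF assms(2)] by auto
qed (use assms prime_inD in auto)

lemma polys_over_closed:
  assumes A: "unital_subring A"
  shows "p \<in> polys_over A \<Longrightarrow> r \<in> polys_over A \<Longrightarrow> p + r \<in> polys_over A"
    "p \<in> polys_over A \<Longrightarrow> r \<in> polys_over A \<Longrightarrow> p - r \<in> polys_over A"
    "p \<in> polys_over A \<Longrightarrow> r \<in> polys_over A \<Longrightarrow> p * r \<in> polys_over A"
    "p \<in> polys_over A \<Longrightarrow> - p \<in> polys_over A"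
    "c \<in> A \<Longrightarrow> p \<in> polys_over A \<Longrightarrow> smult c p \<in> polys_over A"
    "c \<in> A \<Longrightarrow> monom c k \<in> polys_over A"
    "c \<in> A \<Longrightarrow> [:c:] \<in> polys_over A"
    "p \<in> polys_over A \<Longrightarrow> coeff p i \<in> A"
proof -
  note d = unital_subringD[OF A]
  show "p \<in> polys_over A \<Longrightarrow> r \<in> polys_over A \<Longrightarrow> p * r \<in> polys_over A"
  proof -
    assume "p \<in> polys_over A" "r \<in> polys_over A"
    then show "p * r \<in> polys_over A"
      unfolding polys_over_def by (simp add: coeff_mult unital_subring_sum[OF A] d(4))
  qed
qed (auto simp: polys_over_def coeff_pCons unital_subringD(2-6)[OF A] split: nat.split)

lemma unital_subring_adjoin:
  assumes A: "unital_subring A" shows "unital_subring (adjoin A x)"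
proof -
  note c = polys_over_closed[OF A]
  have "poly p x + poly r x \<in> adjoin A x \<and> poly p x * poly r x \<in> adjoin A x \<and> - poly p x \<in> adjoin A x"
    if "p \<in> polys_over A" "r \<in> polys_over A" for p r
    unfolding adjoin_def
    using imageI[OF c(1)[OF that], of "\<lambda>p. poly p x"] imageI[OF c(3)[OF that], of "\<lambda>p. poly p x"]
      imageI[OF c(4)[OF that(1)], of "\<lambda>p. poly p x"] by simp
  moreover have "1 \<in> adjoin A x"
    unfolding adjoin_def using c(7)[OF unital_subringD(1)[OF A]] by (intro image_eqI[of _ _ "[:1:]"]) simp_all
  moreover have "\<exists>p\<in>polys_over A. u = poly p x" if "u \<in> adjoin A x" for u
    using that unfolding adjoin_def by blast
  ultimately show ?thesis unfolding unital_subring_def by metis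
qed

lemma adjoin_gen:
  assumes A: "unital_subring A" shows "x \<in> adjoin A x"
  unfolding adjoin_def using polys_over_closed(6)[OF A unital_subringD(1)[OF A]]
  by (intro image_eqI[of _ _ "monom 1 1"]) (simp_all add: poly_monom)

lemma adjoin_base: "unital_subring A \<Longrightarrow> A \<subseteq> adjoin A x"
proof
  fix c assume "unital_subring A" "c \<in> A"
  then show "c \<in> adjoin A x"
    unfolding adjoin_def by (intro image_eqI[of _ _ "[:c:]"] polys_over_closed(7)) simp_all
qed

lemma poly_in_adjoin: "p \<in> polys_over A \<Longrightarrow> poly p x \<in> adjoin A x"
  unfolding adjoin_def by auto

text \<open>Division with remainder without leaving \<open>A\<close>: the price is a power of the leading coefficient.\<close>

lemma pseudo_division:
  fixes F H :: "'a::comm_ring_1 poly"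
  assumes A: "unital_subring A" and F: "F \<in> polys_over A" "F \<noteq> 0" and H: "H \<in> polys_over A"
  shows "\<exists>k Q R. Q \<in> polys_over A \<and> R \<in> polys_over A \<and> smult (lead_coeff F ^ k) H = F * Q + R \<and>
    degree Q \<le> degree H - degree F \<and> (R = 0 \<or> degree R < degree F)"
  using H
proof (induction "degree H" arbitrary: H rule: less_induct)
  case less
  note c = polys_over_closed[OF A] and d = unital_subringD[OF A]
  let ?f = "lead_coeff F"
  have fA: "?f \<in> A" using F(1) by (rule c(8))
  show ?case
  proof (cases "H = 0 \<or> degree H < degree F")
    case True
    have "0 \<in> polys_over A" by (simp add: polys_over_def d(2))
    with True less.prems show ?thesis
      by (intro exI[of _ "0::nat"] exI[of _ "0::'a poly"] exI[of _ H]) auto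
  next
    case False
    define e where "e = degree H - degree F"
    define G where "G = smult ?f H - monom (lead_coeff H) e * F"
    have G: "G \<in> polys_over A" unfolding G_def
      by (intro c(2) c(5) c(3) c(6) c(8) fA F less.prems)
    have step: "smult ?f H = F * monom (lead_coeff H) e + G" unfolding G_def by (simp add: mult.commute)
    have degm: "degree (monom (lead_coeff H) e) \<le> e" by (rule degree_monom_le)
    have deH: "degree H = e + degree F" using False e_def by simp
    have degG: "degree G \<le> degree H" unfolding G_def
      by (intro degree_diff_le order.trans[OF degree_mult_le]) (use deH degm degree_smult_le[of ?f H] in simp_all)
    have topG: "coeff G (degree H) = 0" unfolding G_def deH
      by (simp add: coeff_monom_mult deH)
    show ?thesis
    proof (cases "degree G < degree H")
      case True
      obtain k Q R where kQR: "Q \<in> polys_over A" "R \<in> polys_over A" "smult (?f ^ k) G = F * Q + R"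
        "degree Q \<le> degree G - degree F" "R = 0 \<or> degree R < degree F"
        using less.hyps[OF True G] by blast
      let ?Q = "smult (?f ^ k) (monom (lead_coeff H) e) + Q"
      have "smult (?f ^ Suc k) H = smult (?f ^ k) (smult ?f H)" by (simp add: mult.commute)
      also have "\<dots> = F * smult (?f ^ k) (monom (lead_coeff H) e) + smult (?f ^ k) G"
        unfolding step by (simp only: smult_add_right mult_smult_right)
      also have "\<dots> = F * ?Q + R" unfolding kQR(3) by (simp only: distrib_left add.assoc)
      finally have "smult (?f ^ Suc k) H = F * ?Q + R" .
      moreover have "degree ?Q \<le> degree H - degree F"
        using kQR(4) True degm e_def by (intro degree_add_le order.trans[OF degree_smult_le]) linarith+
      moreover have "?Q \<in> polys_over A" by (intro c(1) c(5) c(6) c(8) d(7) fA kQR less.prems)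
      ultimately show ?thesis using kQR(2,5)
        by (intro exI[of _ "Suc k"] exI[of _ ?Q] exI[of _ R]) simp
    next
      case False2: False
      then have "degree G = degree H" using degG by simp
      with topG have G0: "G = 0" by (simp flip: leading_coeff_0_iff)
      then have "degree H = 0" using False2 by simp
      moreover have "smult (?f ^ 1) H = F * monom (lead_coeff H) e + 0" using step G0 by simp
      moreover have "monom (lead_coeff H) e \<in> polys_over A" by (intro c(6) c(8) less.prems)
      moreover have "0 \<in> polys_over A" by (simp add: polys_over_def d(2))
      moreover have "degree (monom (lead_coeff H) e) \<le> degree H - degree F" using degm e_def by simp
      ultimately show ?thesis
        by (intro exI[of _ "1::nat"] exI[of _ "monom (lead_coeff H) e"] exI[of _ "0::'a poly"]) simp
    qed
  qed
qed

text \<open>One step of the Nullstellensatz. If \<open>x\<close> is transcendental over \<open>A\<close> modulo \<open>P\<close>, all polynomial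
  relations die coefficientwise under \<open>\<eta>\<close>, and any \<open>t\<close> that is not a root of the image of \<open>b\<close> will do.
  Otherwise take a relation \<open>F\<close> of minimal degree and a nonzero constant in the ideal generated by \<open>F\<close>
  and \<open>b\<close>, which exists by the Euclidean algorithm over the fraction field of \<open>A / (P \<inter> A)\<close>;
  \<open>a\<close> is the product of this constant with the leading coefficient of \<open>F\<close>, and \<open>t\<close> is a root of the image
  of \<open>F\<close>.\<close>

lemma extension_step:
  fixes A P :: "'r::comm_ring_1 set"
  assumes A: "unital_subring A" and P: "prime_in (adjoin A x) P"
    and b: "b \<in> adjoin A x" "b \<notin> P"
  obtains a where "a \<in> A" "a \<notin> P"
    "\<And>\<eta> :: 'r \<Rightarrow> 'k::{alg_closed_field, field_char_0}. comm_ring_hom \<eta> \<Longrightarrow> (\<And>c. c \<in> P \<inter> A \<Longrightarrow> \<eta> c = 0) \<Longrightarrow> \<eta> a \<noteq> 0 \<Longrightarrow>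
       \<exists>t. (\<forall>p\<in>polys_over A. poly p x \<in> P \<longrightarrow> poly (map_poly \<eta> p) t = 0) \<and>
           (\<forall>p\<in>polys_over A. poly p x = b \<longrightarrow> poly (map_poly \<eta> p) t \<noteq> 0)"
proof -
  let ?B = "adjoin A x"
  note c = polys_over_closed[OF A] and d = unital_subringD[OF A]
  have B: "unital_subring ?B" by (rule unital_subring_adjoin[OF A])
  note e = unital_subringD[OF B]
  have PI: "ideal_in ?B P" using prime_inD[OF P] by blast
  note I = ideal_inD[OF PI B]
  have AB: "A \<subseteq> ?B" by (rule adjoin_base[OF A])
  have xB: "x \<in> ?B" by (rule adjoin_gen[OF A])
  have pB: "poly p x \<in> ?B" if "p \<in> polys_over A" for p using that by (rule poly_in_adjoin)
  obtain pb where pb: "pb \<in> polys_over A" "b = poly pb x" using b(1) unfolding adjoin_def by auto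
  define Bad where "Bad = {p \<in> polys_over A. poly p x \<in> P \<and> (\<exists>i. coeff p i \<notin> P)}"
  show ?thesis
  proof (cases "Bad = {}")
    case True
    then have dead: "coeff p i \<in> P \<inter> A" if "p \<in> polys_over A" "poly p x \<in> P" for p i
      using that c(8) unfolding Bad_def by blast
    \<comment> \<open>\<open>b\<close> itself is not in \<open>P\<close>, so the coefficients of an expression of \<open>b\<close> cannot all die.\<close>
    obtain i where i: "coeff pb i \<notin> P"
    proof -
      have "\<not> (\<forall>i. coeff pb i \<in> P)"
      proof
        assume *: "\<forall>i. coeff pb i \<in> P"
        have "b \<in> P" unfolding pb poly_altdef
          by (rule ideal_in_sum[OF PI B]) (use * I(5) e(7) xB in auto)
        then show False using b by simp
      qed
      then show ?thesis using that by blast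
    qed
    show ?thesis
    proof (rule that[of "coeff pb i"])
      fix \<eta> :: "'r \<Rightarrow> 'k"
      assume h: "comm_ring_hom \<eta>" and P0: "\<And>c. c \<in> P \<inter> A \<Longrightarrow> \<eta> c = 0" and a: "\<eta> (coeff pb i) \<noteq> 0"
      interpret h: comm_ring_hom \<eta> by fact
      interpret map_poly_comm_ring_hom \<eta> ..
      have mp: "map_poly \<eta> p = 0" if "p \<in> polys_over A" "poly p x \<in> P" for p
        using dead[OF that] P0 by (intro poly_eqI) (simp add: coeff_map_poly)
      have "map_poly \<eta> pb \<noteq> 0" using a by (metis coeff_0 coeff_map_poly h.hom_zero)
      then have "finite {t. poly (map_poly \<eta> pb) t = 0}" by (rule poly_roots_finite)
      then obtain t where t: "poly (map_poly \<eta> pb) t \<noteq> 0"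
        using ex_new_if_finite[OF infinite_UNIV_char_0] by blast
      have "poly (map_poly \<eta> p) t \<noteq> 0" if "p \<in> polys_over A" "poly p x = b" for p
      proof -
        have "map_poly \<eta> (p - pb) = 0"
          by (rule mp[OF c(2)[OF that(1) pb(1)]]) (use that pb I(2) in auto)
        then show ?thesis using t by (simp add: hom_distribs)
      qed
      with mp show "\<exists>t. (\<forall>p\<in>polys_over A. poly p x \<in> P \<longrightarrow> poly (map_poly \<eta> p) t = 0) \<and>
           (\<forall>p\<in>polys_over A. poly p x = b \<longrightarrow> poly (map_poly \<eta> p) t \<noteq> 0)"
        by (intro exI[of _ t]) auto
    qed (use i c(8)[OF pb(1)] in auto)
  next
    case False
    then obtain F where F: "F \<in> Bad" and Fmin: "\<And>p. p \<in> Bad \<Longrightarrow> degree F \<le> degree p"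
      using exists_least_iff[of "\<lambda>k. \<exists>p\<in>Bad. degree p = k"] by (metis ex_in_conv not_le)
    have FA: "F \<in> polys_over A" and FP: "poly F x \<in> P" and F0: "\<exists>i. coeff F i \<notin> P"
      using F unfolding Bad_def by auto
    have low: "coeff p i \<in> P \<inter> A" if "p \<in> polys_over A" "poly p x \<in> P" "p = 0 \<or> degree p < degree F" for p i
    proof (cases "p = 0")
      case False
      then have "p \<notin> Bad" using Fmin[of p] that by auto
      then show ?thesis using that c(8) unfolding Bad_def by blast
    qed (use I(2) d(2) in auto)
    define f where "f = lead_coeff F"
    have fA: "f \<in> A" unfolding f_def using FA by (rule c(8))
    have F_nz: "F \<noteq> 0" using F0 I(2) by auto
    have reduce: "p - monom (lead_coeff p) (degree p) = 0 \<or> degree (p - monom (lead_coeff p) (degree p)) < degree p" for p :: "'r poly"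
    proof (cases "degree p = 0")
      case True
      then show ?thesis by (metis degree_0_id monom_0 diff_self)
    next
      case False
      have "degree (p - monom (lead_coeff p) (degree p)) \<le> degree p"
        by (rule degree_diff_le) (auto simp: degree_monom_le)
      moreover have "coeff (p - monom (lead_coeff p) (degree p)) (degree p) = 0" by simp
      ultimately show ?thesis by (metis leading_coeff_0_iff order_le_less)
    qed
    have monP: "poly (monom u k) x \<in> P" if "u \<in> P" for u k
      using that I(5) e(7) xB by (simp add: poly_monom)
    have fP: "f \<notin> P"
    proof
      assume f: "f \<in> P"
      let ?G = "F - monom (lead_coeff F) (degree F)"
      have GA: "?G \<in> polys_over A" by (intro c(2) c(6) c(8) FA)
      have "coeff ?G i \<in> P" for i
        using low[of ?G i] GA reduce[of F] I(7)[OF FP monP[OF f[unfolded f_def]]] by auto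
      then have "coeff F i \<in> P" for i
        using I(3)[of "coeff ?G i" "coeff (monom (lead_coeff F) (degree F)) i"] f I(2) unfolding f_def
        by (cases "degree F = i") (fastforce simp: )+
      then show False using F0 by blast
    qed
    have dF: "degree F > 0"
    proof (rule ccontr)
      assume "\<not> degree F > 0"
      then have "F = [:f:]" unfolding f_def by (metis degree_0_id gr0I)
      then show False using FP fP by simp
    qed
    have fk: "f ^ k \<in> A" "f ^ k \<notin> P" for k
      using d(7)[OF fA] fA fP prime_in_power[OF P B] AB by auto
    \<comment> \<open>\<open>C\<close> is the ideal generated by \<open>b\<close> without \<open>P\<close>; its element \<open>H\<close> of least degree turns out to be constant.\<close>
    define C where "C = {p \<in> polys_over A. (\<exists>w\<in>polys_over A. poly p x - b * poly w x \<in> P) \<and> poly p x \<notin> P}"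
    have "pb \<in> C" unfolding C_def using pb b I(2) d(1)
      by (auto intro!: bexI[of _ "[:1:]"] c)
    then obtain H where H: "H \<in> C" and Hmin: "\<And>p. p \<in> C \<Longrightarrow> degree H \<le> degree p"
      using exists_least_iff[of "\<lambda>k. \<exists>p\<in>C. degree p = k"] by (metis not_le)
    have CA: "p \<in> polys_over A" "poly p x \<notin> P" if "p \<in> C" for p using that unfolding C_def by auto
    have C_zero: "p \<noteq> 0" if "p \<in> C" for p using CA[OF that] I(2) by auto
    define h where "h = lead_coeff H"
    have hA: "h \<in> A" unfolding h_def using CA(1)[OF H] by (rule c(8))
    have C_sub: "p - r \<in> C \<or> poly (p - r) x \<in> P"
      if "p \<in> C" "r \<in> polys_over A" "poly r x \<in> P" for p r
    proof -
      obtain w where w: "w \<in> polys_over A" "poly p x - b * poly w x \<in> P" using \<open>p \<in> C\<close> C_def by auto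
      have "poly (p - r) x - b * poly w x \<in> P" using I(7)[OF w(2) that(3)] by (simp add: algebra_simps)
      then show ?thesis unfolding C_def using w(1) c(2)[OF CA(1)[OF that(1)] that(2)] by blast
    qed
    have C_smult: "smult u p \<in> C" if "p \<in> C" "u \<in> A" "u \<notin> P" for p u
    proof -
      obtain w where w: "w \<in> polys_over A" "poly p x - b * poly w x \<in> P" using \<open>p \<in> C\<close> C_def by auto
      have "u * (poly p x - b * poly w x) \<in> P" using I(4)[OF w(2)] that(2) AB by auto
      then have "poly (smult u p) x - b * poly (smult u w) x \<in> P" by (simp add: algebra_simps)
      moreover have "poly (smult u p) x \<notin> P"
        using prime_inD(3)[OF P, of u "poly p x"] that CA[OF that(1)] pB AB by auto
      ultimately show ?thesis unfolding C_def using c(5)[OF that(2) w(1)] c(5)[OF that(2) CA(1)[OF that(1)]] by blast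
    qed
    have hP: "h \<notin> P"
    proof
      assume hP: "h \<in> P"
      let ?m = "monom (lead_coeff H) (degree H)"
      have m: "?m \<in> polys_over A" "poly ?m x \<in> P" using monP[OF hP, of "degree H"] c(6)[OF hA, of "degree H"] unfolding h_def by auto
      have "poly (H - ?m) x \<notin> P" using I(3)[OF _ m(2), of "poly (H - ?m) x"] CA(2)[OF H] by auto
      then have "H - ?m \<in> C" using C_sub[OF H m] by blast
      then show False using Hmin[of "H - ?m"] reduce[of H] C_zero[of "H - ?m"] by auto
    qed
    have hk: "h ^ k \<in> A" "h ^ k \<notin> P" for k
      using d(7)[OF hA] hA hP prime_in_power[OF P B] AB by auto
    have H_lt: "degree H < degree F"
    proof (rule ccontr)
      assume ge: "\<not> ?thesis"
      obtain k Q R where QR: "Q \<in> polys_over A" "R \<in> polys_over A" "smult (f ^ k) H = F * Q + R"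
        "R = 0 \<or> degree R < degree F"
        using pseudo_division[OF A FA F_nz CA(1)[OF H]] unfolding f_def by blast
      have FQ: "F * Q \<in> polys_over A" "poly (F * Q) x \<in> P"
        using c(3)[OF FA QR(1)] I(5)[OF FP pB[OF QR(1)]] by auto
      have s: "smult (f ^ k) H \<in> C" using C_smult[OF H fk] .
      have R: "R = smult (f ^ k) H - F * Q" using QR by simp
      have "poly R x \<notin> P" using I(3)[OF _ FQ(2), of "poly R x"] CA(2)[OF s] by (auto simp: R)
      then have "R \<in> C" using C_sub[OF s FQ] R by auto
      then show False using Hmin[of R] QR(4) C_zero[of R] ge by auto
    qed
    have H0: "degree H = 0"
    proof (rule ccontr)
      assume pos: "degree H \<noteq> 0"
      have H_nz: "H \<noteq> 0" using C_zero H by blast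
      obtain k Q R where QR: "Q \<in> polys_over A" "R \<in> polys_over A" "smult (h ^ k) F = H * Q + R"
        "degree Q \<le> degree F - degree H" "R = 0 \<or> degree R < degree H"
        using pseudo_division[OF A CA(1)[OF H] H_nz FA] unfolding h_def by blast
      have RP: "poly R x \<in> P"
      proof (rule ccontr)
        assume *: "poly R x \<notin> P"
        obtain w where w: "w \<in> polys_over A" "poly H x - b * poly w x \<in> P" using H C_def by auto
        have "h ^ k * poly F x - poly Q x * (poly H x - b * poly w x) \<in> P"
          by (intro I(7) I(4) w FP pB QR) (use hk AB in auto)
        moreover have "h ^ k * poly F x = poly H x * poly Q x + poly R x"
          using arg_cong[OF QR(3), of "\<lambda>p. poly p x"] by simp
        ultimately have "poly R x - b * poly (- (Q * w)) x \<in> P" by (simp add: algebra_simps)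
        moreover have "- (Q * w) \<in> polys_over A" by (intro c(3,4) w QR)
        ultimately have "R \<in> C" unfolding C_def using QR * by blast
        then show False using Hmin[of R] C_zero[of R] QR(5) by auto
      qed
      have "poly H x * poly Q x = h ^ k * poly F x - poly R x"
        using arg_cong[OF QR(3), of "\<lambda>p. poly p x"] by simp
      also have "\<dots> \<in> P" by (intro I(7) I(4) RP FP) (use hk AB in auto)
      finally have "poly Q x \<in> P"
        using prime_inD(3)[OF P pB[OF CA(1)[OF H]] pB[OF QR(1)]] CA(2)[OF H] by blast
      then have Qc: "coeff Q i \<in> P" for i
      proof -
        have "degree Q < degree F" using QR(4) pos dF by linarith
        then show ?thesis using low[of Q i] QR(1) \<open>poly Q x \<in> P\<close> by blast
      qed
      have "h ^ k * f = coeff (H * Q + R) (degree F)"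
        using arg_cong[OF QR(3), of "\<lambda>p. coeff p (degree F)"] by (simp add: f_def)
      also have "\<dots> = coeff (H * Q) (degree F)" using QR(5) H_lt by (auto simp: coeff_eq_0)
      also have "\<dots> \<in> P" unfolding coeff_mult
        by (intro ideal_in_sum[OF PI B] I(4) Qc) (use c(8)[OF CA(1)[OF H]] AB in auto)
      finally show False using prime_inD(3)[OF P, of "h ^ k" f] hk fP fA AB by auto
    qed
    then have H_const: "H = [:h:]" unfolding h_def by (metis degree_0_id)
    obtain w where w: "w \<in> polys_over A" "poly H x - b * poly w x \<in> P" using H C_def by auto
    show ?thesis
    proof (rule that[of "f * h"])
      show "f * h \<in> A" using fA hA d by blast
      show "f * h \<notin> P" using prime_inD(3)[OF P, of f h] fA hA fP hP AB by auto
      fix \<eta> :: "'r \<Rightarrow> 'k"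
      assume hom: "comm_ring_hom \<eta>" and P0: "\<And>c. c \<in> P \<inter> A \<Longrightarrow> \<eta> c = 0" and a: "\<eta> (f * h) \<noteq> 0"
      interpret h: comm_ring_hom \<eta> by fact
      interpret m: map_poly_comm_ring_hom \<eta> ..
      have f0: "\<eta> f \<noteq> 0" "\<eta> h \<noteq> 0" using a by (auto simp: hom_distribs)
      have "coeff (map_poly \<eta> F) (degree F) \<noteq> 0" using f0 by (simp add: f_def)
      then have "degree (map_poly \<eta> F) > 0" using dF le_degree[of "map_poly \<eta> F" "degree F"] by linarith
      then obtain t where t: "poly (map_poly \<eta> F) t = 0" using alg_closed_imp_poly_has_root by blast
      have van: "poly (map_poly \<eta> p) t = 0" if p: "p \<in> polys_over A" "poly p x \<in> P" for p
      proof -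
        obtain k Q R where QR: "Q \<in> polys_over A" "R \<in> polys_over A" "smult (f ^ k) p = F * Q + R"
          "R = 0 \<or> degree R < degree F"
          using pseudo_division[OF A FA F_nz p(1)] unfolding f_def by blast
        have "poly R x = f ^ k * poly p x - poly F x * poly Q x"
          using arg_cong[OF QR(3), of "\<lambda>p. poly p x"] by simp
        also have "\<dots> \<in> P" by (intro I(7) I(4) I(5) p FP pB QR) (use fk AB in auto)
        finally have "map_poly \<eta> R = 0"
          using low[OF QR(2) _ QR(4)] P0 by (intro poly_eqI) (simp add: coeff_map_poly)
        then have "smult (\<eta> f ^ k) (map_poly \<eta> p) = map_poly \<eta> F * map_poly \<eta> Q"
          using arg_cong[OF QR(3), of "map_poly \<eta>"] by (simp add: hom_distribs)
        from arg_cong[OF this, of "\<lambda>p. poly p t"] show ?thesis using t f0 by simp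
      qed
      have "poly (map_poly \<eta> p) t \<noteq> 0" if p: "p \<in> polys_over A" "poly p x = b" for p
      proof -
        have "poly (map_poly \<eta> (H - p * w)) t = 0"
          by (rule van[OF c(2)[OF CA(1)[OF H] c(3)[OF p(1) w(1)]]]) (use w(2) p(2) in simp)
        then show ?thesis using f0 by (auto simp: hom_distribs H_const)
      qed
      with van show "\<exists>t. (\<forall>p\<in>polys_over A. poly p x \<in> P \<longrightarrow> poly (map_poly \<eta> p) t = 0) \<and>
           (\<forall>p\<in>polys_over A. poly p x = b \<longrightarrow> poly (map_poly \<eta> p) t \<noteq> 0)"
        by (intro exI[of _ t]) auto
    qed
  qed
qed


section \<open>Integral extensions and a Nullstellensatz for subalgebras\<close>

definition integral_over :: "'r::comm_ring_1 set \<Rightarrow> 'r \<Rightarrow> bool" where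
  "integral_over A x \<longleftrightarrow> (\<exists>d c. (\<forall>i<d. c i \<in> A) \<and> x ^ d = (\<Sum>i<d. c i * x ^ i))"

text \<open>Nakayama's lemma by elimination of one generator at a time instead of a determinant: the relation
  for the last generator lets one replace it in the others after multiplying by \<open>1 - j d d\<close>, which is
  again of the form one plus an element of \<open>J\<close>.\<close>

lemma nakayama:
  fixes e :: "nat \<Rightarrow> 'r::comm_ring_1"
  assumes A: "unital_subring A" and J: "ideal_in A J"
    and rel: "\<And>i. i < d \<Longrightarrow> \<exists>j. (\<forall>k<d. j k \<in> J) \<and> e i = (\<Sum>k<d. j k * e k)"
  shows "\<exists>u\<in>J. \<forall>i<d. (1 + u) * e i = 0"
  using rel
proof (induction d)
  case 0
  then show ?case using ideal_inD(2)[OF J A] by blast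
next
  case (Suc d)
  note I = ideal_inD[OF J A]
  obtain j where j: "\<And>i k. i \<le> d \<Longrightarrow> k \<le> d \<Longrightarrow> j i k \<in> J"
    and e: "\<And>i. i \<le> d \<Longrightarrow> e i = (\<Sum>k<d. j i k * e k) + j i d * e d"
    using Suc.prems unfolding less_Suc_eq_le lessThan_Suc
    by (simp add: less_Suc_eq_le add.commute) metis
  define w where "w = 1 - j d d"
  have wA: "w \<in> A" unfolding w_def
    using unital_subringD(6)[OF A unital_subringD(1)[OF A] I(1)[OF j[OF order_refl order_refl]]] .
  have we: "w * e d = (\<Sum>k<d. j d k * e k)"
    using e[of d] by (simp add: w_def algebra_simps)
  have "\<exists>j'. (\<forall>k<d. j' k \<in> J) \<and> e i = (\<Sum>k<d. j' k * e k)" if i: "i < d" for i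
  proof (intro exI conjI allI impI)
    let ?j = "\<lambda>k. w * j i k + j i d * j d k + (if k = i then j d d else 0)"
    have "w * e i = (\<Sum>k<d. w * j i k * e k) + j i d * (w * e d)"
      using arg_cong[OF e[of i], of "(*) w"] i
      by (simp add: distrib_left sum_distrib_left mult.assoc mult.left_commute)
    also have "\<dots> = (\<Sum>k<d. (w * j i k + j i d * j d k) * e k)"
      unfolding we by (simp add: distrib_right sum.distrib sum_distrib_left mult.assoc)
    finally have "e i = (\<Sum>k<d. (w * j i k + j i d * j d k) * e k) + j d d * e i"
      by (simp add: w_def algebra_simps)
    also have "j d d * e i = (\<Sum>k<d. (if k = i then j d d else 0) * e k)"
      using i by (simp add: if_distrib[of "\<lambda>x. x * _"] sum.delta cong: if_cong)
    finally show "e i = (\<Sum>k<d. ?j k * e k)"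
      by (simp add: distrib_right sum.distrib)
    fix k assume "k < d"
    then show "?j k \<in> J"
      using i by (intro I(3) I(4)) (use j[of i k] j[of d k] j[of i d] j[of d d] wA I(1,2) in auto)
  qed
  then obtain u where u: "u \<in> J" "\<And>i. i < d \<Longrightarrow> (1 + u) * e i = 0" using Suc.IH by blast
  show ?case
  proof (intro bexI allI impI)
    show "w * u - j d d \<in> J" by (intro I(7) I(4) u(1) wA j) simp_all
    have r: "(1 + (w * u - j d d)) * y = w * ((1 + u) * y)" for y
      by (simp add: w_def algebra_simps)
    have "(1 + u) * (w * e d) = 0"
      unfolding we sum_distrib_left
      by (rule sum.neutral) (use u(2) in \<open>simp add: mult.left_commute[of "1 + u"]\<close>)
    then have "w * ((1 + u) * e d) = 0" by (simp add: mult.left_commute[of "1 + u"])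
    moreover fix i assume "i < Suc d"
    ultimately show "(1 + (w * u - j d d)) * e i = 0" unfolding r using u(2)[of i]
      by (cases "i = d") simp_all
  qed
qed

text \<open>The ideal of \<open>A[x]\<close> generated by \<open>J\<close> consists of the values of the polynomials with coefficients in \<open>J\<close>.\<close>

lemma polys_over_ideal:
  assumes A: "unital_subring A" and J: "ideal_in A J"
  shows "ideal_in (adjoin A x) ((\<lambda>p. poly p x) ` polys_over J)" (is "ideal_in _ ?JB")
    and "J \<subseteq> (\<lambda>p. poly p x) ` polys_over J"
proof -
  note I = ideal_inD[OF J A]
  have JA: "p \<in> polys_over A" if "p \<in> polys_over J" for p
    using that I(1) unfolding polys_over_def by blast
  have add: "p + r \<in> polys_over J" if "p \<in> polys_over J" "r \<in> polys_over J" for p r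
    using that I(3) unfolding polys_over_def by simp
  have mult: "r * p \<in> polys_over J" if "p \<in> polys_over J" "r \<in> polys_over A" for p r
    using that unfolding polys_over_def by (simp add: coeff_mult ideal_in_sum[OF J A] I(4))
  have J0: "0 \<in> polys_over J" unfolding polys_over_def using I(2) by simp
  show "ideal_in (adjoin A x) ?JB"
    unfolding ideal_in_def
  proof (intro conjI ballI)
    show "?JB \<subseteq> adjoin A x" unfolding adjoin_def using JA by blast
    show "0 \<in> ?JB" using imageI[OF J0, of "\<lambda>p. poly p x"] by simp
    fix u assume "u \<in> ?JB"
    then obtain p where p: "p \<in> polys_over J" "u = poly p x" by blast
    show "u + v \<in> ?JB" if v: "v \<in> ?JB" for v
    proof -
      obtain r where r: "r \<in> polys_over J" "v = poly r x" using v by blast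
      show ?thesis using imageI[OF add[OF p(1) r(1)], of "\<lambda>p. poly p x"] p(2) r(2) by simp
    qed
    show "v * u \<in> ?JB" if v: "v \<in> adjoin A x" for v
    proof -
      obtain r where r: "r \<in> polys_over A" "v = poly r x" using v unfolding adjoin_def by blast
      show ?thesis using imageI[OF mult[OF p(1) r(1)], of "\<lambda>p. poly p x"] p(2) r(2) by simp
    qed
  qed
  show "J \<subseteq> ?JB"
  proof
    fix y assume "y \<in> J"
    then have "[:y:] \<in> polys_over J" using I(2) unfolding polys_over_def
      by (simp add: coeff_pCons split: nat.split)
    then show "y \<in> ?JB" by (rule rev_image_eqI) simp
  qed
qed

text \<open>\<open>A[x]\<close> is a finite \<open>A\<close>-module, so by Nakayama's lemma a proper ideal of \<open>A\<close> stays proper.\<close>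

lemma proper_extension:
  fixes x :: "'r::comm_ring_1"
  assumes A: "unital_subring A" and J: "ideal_in A J" and J1: "1 \<notin> J" and x: "integral_over A x"
  shows "1 \<notin> (\<lambda>p. poly p x) ` polys_over J" (is "1 \<notin> ?JB")
proof
  note I = ideal_inD[OF J A] and D = unital_subringD[OF A]
  assume 1: "1 \<in> ?JB"
  obtain d c where c: "\<And>i. i < d \<Longrightarrow> c i \<in> A" and xd: "x ^ d = (\<Sum>i<d. c i * x ^ i)"
    using x unfolding integral_over_def by blast
  have d: "d > 0"
  proof (rule ccontr)
    assume "\<not> d > 0"
    then have "(1::'r) = 0" using xd by simp
    then show False using J1 I(2) by simp
  qed
  have "\<exists>a. (\<forall>i<d. a i \<in> A) \<and> x ^ k = (\<Sum>i<d. a i * x ^ i)" for k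
  proof (induction k)
    case 0
    have "x ^ 0 = (\<Sum>i<d. (if i = 0 then 1 else 0) * x ^ i)"
      using d by (simp add: if_distrib[of "\<lambda>u. u * _"] sum.delta cong: if_cong)
    then show ?case using D(1,2) by (intro exI[of _ "\<lambda>i. if i = 0 then 1 else 0"]) simp
  next
    case (Suc k)
    then obtain a where a: "\<And>i. i < d \<Longrightarrow> a i \<in> A" "x ^ k = (\<Sum>i<d. a i * x ^ i)" by blast
    obtain d' where d': "d = Suc d'" using d by (cases d) auto
    have "x ^ Suc k = (\<Sum>i<d. a i * x ^ Suc i)"
      by (simp add: a(2) sum_distrib_left mult.left_commute)
    also have "\<dots> = (\<Sum>i<d'. a i * x ^ Suc i) + a d' * x ^ d" by (simp add: d')
    also have "(\<Sum>i<d'. a i * x ^ Suc i) = (\<Sum>i<d. (case i of 0 \<Rightarrow> 0 | Suc i' \<Rightarrow> a i') * x ^ i)"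
      unfolding d' sum.lessThan_Suc_shift by simp
    also have "a d' * x ^ d = (\<Sum>i<d. a d' * c i * x ^ i)"
      unfolding xd by (simp add: sum_distrib_left mult.assoc)
    finally have "x ^ Suc k = (\<Sum>i<d. ((case i of 0 \<Rightarrow> 0 | Suc i' \<Rightarrow> a i') + a d' * c i) * x ^ i)"
      by (simp add: sum.distrib distrib_right)
    moreover have "(case i of 0 \<Rightarrow> 0 | Suc i' \<Rightarrow> a i') + a d' * c i \<in> A" if "i < d" for i
      by (intro D(3) D(4) c a(1)) (use that a(1) D(2) d' in \<open>auto split: nat.split\<close>)
    ultimately show ?case
      by (intro exI[of _ "\<lambda>i. (case i of 0 \<Rightarrow> 0 | Suc i' \<Rightarrow> a i') + a d' * c i"]) simp
  qed
  then obtain a where a: "\<And>k i. i < d \<Longrightarrow> a k i \<in> A" "\<And>k. x ^ k = (\<Sum>i<d. a k i * x ^ i)" by metis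
  have form: "\<exists>j. (\<forall>i<d. j i \<in> J) \<and> y = (\<Sum>i<d. j i * x ^ i)" if y: "y \<in> ?JB" for y
  proof -
    obtain p where p: "p \<in> polys_over J" "y = poly p x" using y by blast
    let ?j = "\<lambda>i. \<Sum>k\<le>degree p. coeff p k * a k i"
    have "y = (\<Sum>k\<le>degree p. coeff p k * (\<Sum>i<d. a k i * x ^ i))"
      unfolding p(2) poly_altdef a(2)[symmetric] ..
    also have "\<dots> = (\<Sum>i<d. ?j i * x ^ i)"
      unfolding sum_distrib_left sum_distrib_right by (subst sum.swap) (simp add: mult.assoc)
    finally have "y = (\<Sum>i<d. ?j i * x ^ i)" .
    moreover have "?j i \<in> J" if "i < d" for i
      by (rule ideal_in_sum[OF J A], rule I(5)) (use p(1) a(1)[OF that] in \<open>auto simp: polys_over_def\<close>)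
    ultimately show ?thesis by (intro exI[of _ ?j]) simp
  qed
  have B: "unital_subring (adjoin A x)" by (rule unital_subring_adjoin[OF A])
  have "\<exists>j. (\<forall>k<d. j k \<in> J) \<and> x ^ i = (\<Sum>k<d. j k * x ^ k)" for i
    using form ideal_inD(4)[OF polys_over_ideal(1)[OF A J] B 1, of "x ^ i"]
      unital_subringD(7)[OF B adjoin_gen[OF A]] by simp
  then obtain u where "u \<in> J" "\<forall>i<d. (1 + u) * x ^ i = 0" using nakayama[OF A J, of d "\<lambda>i. x ^ i"] by blast
  with d have "1 = - u" by (metis add_eq_0_iff mult.right_neutral power_0 add.commute)
  with I(6)[OF \<open>u \<in> J\<close>] J1 show False by simp
qed

lemma exists_prime_above:
  assumes B: "unital_subring B" and J: "ideal_in B J" and J1: "1 \<notin> J"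
  obtains P where "prime_in B P" "J \<subseteq> P"
proof -
  let ?S = "{P. ideal_in B P \<and> 1 \<notin> P \<and> J \<subseteq> P}"
  have "\<exists>M\<in>?S. \<forall>X\<in>?S. M \<subseteq> X \<longrightarrow> X = M"
  proof (rule subset_Zorn_nonempty)
    show "?S \<noteq> {}" using J J1 by blast
    fix C assume C: "C \<noteq> {}" "subset.chain ?S C"
    have CS: "\<And>P. P \<in> C \<Longrightarrow> ideal_in B P \<and> 1 \<notin> P \<and> J \<subseteq> P" and tot: "\<And>P Q. P \<in> C \<Longrightarrow> Q \<in> C \<Longrightarrow> P \<subseteq> Q \<or> Q \<subseteq> P"
      using C(2) unfolding subset.chain_def by auto
    have "ideal_in B (\<Union>C)"
      unfolding ideal_in_def
    proof (intro conjI ballI)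
      show "\<Union>C \<subseteq> B" using CS unfolding ideal_in_def by blast
      show "0 \<in> \<Union>C" using C(1) CS unfolding ideal_in_def by blast
      fix u assume "u \<in> \<Union>C"
      then obtain P where P: "P \<in> C" "u \<in> P" by blast
      show "b * u \<in> \<Union>C" if "b \<in> B" for b using P CS[OF P(1)] that unfolding ideal_in_def by blast
      fix v assume "v \<in> \<Union>C"
      then obtain Q where Q: "Q \<in> C" "v \<in> Q" by blast
      show "u + v \<in> \<Union>C"
      proof (cases "P \<subseteq> Q")
        case True
        then show ?thesis using P Q ideal_inD(3)[OF conjunct1[OF CS[OF Q(1)]] B] by blast
      next
        case False
        then have "Q \<subseteq> P" using tot P Q by blast
        then show ?thesis using P Q ideal_inD(3)[OF conjunct1[OF CS[OF P(1)]] B] by blast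
      qed
    qed
    then show "\<Union>C \<in> ?S" using CS C(1) by blast
  qed
  then obtain M where MS: "M \<in> ?S" and maxS: "\<forall>X\<in>?S. M \<subseteq> X \<longrightarrow> X = M" by (elim bexE)
  from MS have M: "ideal_in B M" "1 \<notin> M" "J \<subseteq> M" by simp_all
  have max: "X = M" if "ideal_in B X" "1 \<notin> X" "M \<subseteq> X" for X
    using bspec[OF maxS, of X] that M(3) by simp
  note I = ideal_inD[OF M(1) B] and D = unital_subringD[OF B]
  have unit: "\<exists>m\<in>M. \<exists>b\<in>B. 1 = m + b * x" if x: "x \<in> B" "x \<notin> M" for x
  proof -
    let ?X = "{m + b * x | m b. m \<in> M \<and> b \<in> B}"
    have "ideal_in B ?X"
      unfolding ideal_in_def
    proof (intro conjI ballI)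
      show "?X \<subseteq> B" using I(1) D(3,4) x(1) by blast
      show "0 \<in> ?X" using I(2) D(2) by (intro CollectI exI[of _ 0]) simp
      fix u assume "u \<in> ?X"
      then obtain m b where u: "m \<in> M" "b \<in> B" "u = m + b * x" by blast
      show "c * u \<in> ?X" if c: "c \<in> B" for c
        using I(4)[OF u(1) c] D(4)[OF c u(2)] u(3)
        by (intro CollectI exI[of _ "c * m"] exI[of _ "c * b"]) (simp add: distrib_left mult.assoc)
      fix v assume "v \<in> ?X"
      then obtain m' b' where v: "m' \<in> M" "b' \<in> B" "v = m' + b' * x" by blast
      show "u + v \<in> ?X"
        using I(3)[OF u(1) v(1)] D(3)[OF u(2) v(2)] u(3) v(3)
        by (intro CollectI exI[of _ "m + m'"] exI[of _ "b + b'"]) (simp add: algebra_simps)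
    qed
    moreover have "M \<subseteq> ?X"
    proof
      fix m assume "m \<in> M"
      then show "m \<in> ?X" using D(2) by (intro CollectI exI[of _ m] exI[of _ 0]) simp
    qed
    moreover have "x \<in> ?X" using I(2) D(1) by (intro CollectI exI[of _ 0] exI[of _ 1]) simp
    ultimately have "1 \<in> ?X" using max[of ?X] x(2) by auto
    then show ?thesis by blast
  qed
  have "x \<in> M \<or> y \<in> M" if x: "x \<in> B" and y: "y \<in> B" and xy: "x * y \<in> M" for x y
  proof (rule ccontr)
    assume "\<not> (x \<in> M \<or> y \<in> M)"
    then obtain m b m' b' where m: "m \<in> M" "b \<in> B" "1 = m + b * x" "m' \<in> M" "b' \<in> B" "1 = m' + b' * y"
      using unit[OF x] unit[OF y] by blast
    have "1 = (m + b * x) * (m' + b' * y)" by (simp flip: m(3,6))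
    also have "\<dots> = (m' + b' * y) * m + (b * x) * m' + (b * b') * (x * y)" by (simp add: algebra_simps)
    also have "\<dots> \<in> M" by (intro I(3) I(4) m D(3) D(4) x y xy I(1)[OF m(4)])
    finally show False using M(2) by simp
  qed
  then have "prime_in B M" unfolding prime_in_def using M by blast
  then show ?thesis using that M(3) by blast
qed

lemma adjoin_least:
  assumes "unital_subring C" "A \<subseteq> C" "x \<in> C" shows "adjoin A x \<subseteq> C"
proof
  fix y assume "y \<in> adjoin A x"
  then obtain p where p: "p \<in> polys_over A" "y = poly p x" unfolding adjoin_def by blast
  show "y \<in> C"
    unfolding p(2) poly_altdef
    by (rule unital_subring_sum[OF assms(1)], rule unital_subringD(4)[OF assms(1)])
      (use p(1) assms unital_subringD(7)[OF assms(1)] in \<open>auto simp: polys_over_def\<close>)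
qed

text \<open>Polynomial functions of the first \<open>N\<close> coordinates of an infinite sequence: in this encoding the rings for
  different \<open>N\<close> are subrings of one ring, and \<open>N\<close> can be the variable of an induction.\<close>

definition var :: "nat \<Rightarrow> (nat \<Rightarrow> 'a) \<Rightarrow> 'a" where "var i = (\<lambda>v. v i)"

inductive_set mpfun :: "nat \<Rightarrow> ((nat \<Rightarrow> 'a::comm_ring_1) \<Rightarrow> 'a) set" for N where
  const: "(\<lambda>_. c) \<in> mpfun N"
| var: "i < N \<Longrightarrow> var i \<in> mpfun N"
| add: "f \<in> mpfun N \<Longrightarrow> g \<in> mpfun N \<Longrightarrow> f + g \<in> mpfun N"
| mult: "f \<in> mpfun N \<Longrightarrow> g \<in> mpfun N \<Longrightarrow> f * g \<in> mpfun N"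

lemma unital_subring_mpfun: "unital_subring (mpfun N)"
proof -
  have "1 \<in> mpfun N" unfolding one_fun_def by (rule mpfun.const)
  moreover have "- f \<in> mpfun N" if "f \<in> mpfun N" for f :: "(nat \<Rightarrow> 'a) \<Rightarrow> 'a"
  proof -
    have "- f = (\<lambda>_. - 1) * f" by (rule ext) simp
    then show ?thesis using mpfun.mult[OF mpfun.const that] by metis
  qed
  ultimately show ?thesis unfolding unital_subring_def by (blast intro: mpfun.add mpfun.mult)
qed

lemma mpfun_Suc: "mpfun (Suc N) = adjoin (mpfun N) (var N :: (nat \<Rightarrow> 'a::comm_ring_1) \<Rightarrow> 'a)"
proof
  have mono: "f \<in> mpfun (Suc N)" if "f \<in> mpfun N" for f :: "(nat \<Rightarrow> 'a) \<Rightarrow> 'a"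
    using that
  proof induction
    case (const c) show ?case by (rule mpfun.const)
  next
    case (var i) then show ?case by (intro mpfun.var) simp
  qed (rule mpfun.add mpfun.mult; assumption)+
  show "adjoin (mpfun N) (var N :: (nat \<Rightarrow> 'a) \<Rightarrow> 'a) \<subseteq> mpfun (Suc N)"
    by (rule adjoin_least[OF unital_subring_mpfun]) (auto intro: mono mpfun.var)
  note D = unital_subringD[OF unital_subring_adjoin[OF unital_subring_mpfun[of N]]]
  show "mpfun (Suc N) \<subseteq> adjoin (mpfun N) (var N :: (nat \<Rightarrow> 'a) \<Rightarrow> 'a)"
  proof
    fix f :: "(nat \<Rightarrow> 'a) \<Rightarrow> 'a" assume "f \<in> mpfun (Suc N)"
    then show "f \<in> adjoin (mpfun N) (var N)"
    proof induction
      case (const c)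
      then show ?case using adjoin_base[OF unital_subring_mpfun] mpfun.const by blast
    next
      case (var i)
      show ?case
      proof (cases "i = N")
        case True
        then show ?thesis using adjoin_gen[OF unital_subring_mpfun] by simp
      next
        case False
        then have "var i \<in> mpfun N" using var by (intro mpfun.var) simp
        then show ?thesis using adjoin_base[OF unital_subring_mpfun] by blast
      qed
    next
      case (add f g)
      show ?case by (rule D(3)[OF add.IH])
    next
      case (mult f g)
      show ?case by (rule D(4)[OF mult.IH])
    qed
  qed
qed

lemma mpfun_local: "f \<in> mpfun N \<Longrightarrow> (\<And>i. i < N \<Longrightarrow> v i = w i) \<Longrightarrow> f v = f w"
  by (induction rule: mpfun.induct) (simp_all add: var_def)

lemma comm_ring_hom_eval: "comm_ring_hom (\<lambda>f :: 'x \<Rightarrow> 'a::comm_ring_1. f v)"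
  by unfold_locales simp_all

lemma eval_poly_fun:
  fixes p :: "('x \<Rightarrow> 'a::comm_ring_1) poly"
  shows "poly p f v = poly (map_poly (\<lambda>g. g v) p) (f v)"
proof -
  interpret h: comm_ring_hom "\<lambda>f :: 'x \<Rightarrow> 'a. f v" by (rule comm_ring_hom_eval)
  interpret m: map_poly_comm_ring_hom "\<lambda>f :: 'x \<Rightarrow> 'a. f v" ..
  show ?thesis by (simp only: h.poly_map_poly)
qed

text \<open>Points are extended one coordinate at a time by \<open>extension_step\<close>; the condition \<open>b v \<noteq> 0\<close> is what
  makes the induction go through.\<close>

lemma nullstellensatz_prime:
  fixes P :: "((nat \<Rightarrow> 'a::{alg_closed_field, field_char_0}) \<Rightarrow> 'a) set"
  assumes "prime_in (mpfun N) P" "b \<in> mpfun N" "b \<notin> P"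
  shows "\<exists>v. (\<forall>f\<in>P. f v = 0) \<and> b v \<noteq> 0"
  using assms
proof (induction N arbitrary: P b)
  case 0
  have const: "\<exists>c. f = (\<lambda>_. c)" if "f \<in> mpfun 0" for f :: "(nat \<Rightarrow> 'a) \<Rightarrow> 'a"
    using that by (induction rule: mpfun.induct) (auto simp: plus_fun_def times_fun_def)
  note I = ideal_inD[OF prime_inD(1)[OF 0(1)] unital_subring_mpfun]
  have "f (\<lambda>_. 0) = 0" if f: "f \<in> P" for f
  proof (rule ccontr)
    assume nz: "f (\<lambda>_. 0) \<noteq> 0"
    obtain c where c: "f = (\<lambda>_. c)" using const[OF I(1)[OF f]] by blast
    have "(\<lambda>_. inverse c) * f \<in> P" by (rule I(4)[OF f mpfun.const])
    also have "(\<lambda>_. inverse c) * f = 1" using nz by (intro ext) (simp add: c)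
    finally show False using prime_inD(2)[OF 0(1)] by (simp add: one_fun_def)
  qed
  moreover have "b (\<lambda>_. 0) \<noteq> 0"
  proof
    assume z: "b (\<lambda>_. 0) = 0"
    obtain c where "b = (\<lambda>_. c)" using const[OF 0(2)] by blast
    with z have "b = 0" by (simp add: zero_fun_def)
    with I(2) 0(3) show False by metis
  qed
  ultimately show ?case by blast
next
  case (Suc N)
  let ?A = "mpfun N :: ((nat \<Rightarrow> 'a) \<Rightarrow> 'a) set" and ?x = "var N :: (nat \<Rightarrow> 'a) \<Rightarrow> 'a"
  have A: "unital_subring ?A" by (rule unital_subring_mpfun)
  have P: "prime_in (adjoin ?A ?x) P" "b \<in> adjoin ?A ?x" using Suc.prems(1,2) by (simp_all only: mpfun_Suc)
  note B = unital_subring_adjoin[OF A, of ?x]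
  note I = ideal_inD[OF prime_inD(1)[OF P(1)] B]
  have AB: "?A \<subseteq> adjoin ?A ?x" by (rule adjoin_base[OF A])
  obtain a where a: "a \<in> ?A" "a \<notin> P" and ext: "\<And>\<eta> :: ((nat \<Rightarrow> 'a) \<Rightarrow> 'a) \<Rightarrow> 'a. comm_ring_hom \<eta> \<Longrightarrow> (\<And>c. c \<in> P \<inter> ?A \<Longrightarrow> \<eta> c = 0) \<Longrightarrow> \<eta> a \<noteq> 0 \<Longrightarrow>
       \<exists>t. (\<forall>p\<in>polys_over ?A. poly p ?x \<in> P \<longrightarrow> poly (map_poly \<eta> p) t = 0) \<and>
           (\<forall>p\<in>polys_over ?A. poly p ?x = b \<longrightarrow> poly (map_poly \<eta> p) t \<noteq> 0)"
    using extension_step[OF A P(1) P(2) Suc.prems(3)] by (metis (no_types, lifting))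
  have "ideal_in ?A (P \<inter> ?A)"
    unfolding ideal_in_def
    using unital_subringD(2-4)[OF A] I(2,3) I(4)[OF _ subsetD[OF AB]] by simp
  then have PA: "prime_in ?A (P \<inter> ?A)"
    unfolding prime_in_def
    using prime_inD(2)[OF P(1)] prime_inD(3)[OF P(1) subsetD[OF AB] subsetD[OF AB]] by blast
  have "\<exists>v. (\<forall>f\<in>P \<inter> ?A. f v = 0) \<and> a v \<noteq> 0" by (rule Suc.IH[OF PA a(1)]) (use a(2) in simp)
  then obtain v where v: "\<And>f. f \<in> P \<inter> ?A \<Longrightarrow> f v = 0" "a v \<noteq> 0" by blast
  obtain t where t: "\<And>p. p \<in> polys_over ?A \<Longrightarrow> poly p ?x \<in> P \<Longrightarrow> poly (map_poly (\<lambda>f. f v) p) t = 0"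
    "\<And>p. p \<in> polys_over ?A \<Longrightarrow> poly p ?x = b \<Longrightarrow> poly (map_poly (\<lambda>f. f v) p) t \<noteq> 0"
    using ext[OF comm_ring_hom_eval, of v] v by metis
  define w where "w = v(N := t)"
  have ev: "poly p ?x w = poly (map_poly (\<lambda>f. f v) p) t" if p: "p \<in> polys_over ?A" for p
  proof -
    have "coeff p i w = coeff p i v" for i
      by (rule mpfun_local[of _ N]) (use p in \<open>auto simp: polys_over_def w_def\<close>)
    then have "map_poly (\<lambda>f. f w) p = map_poly (\<lambda>f. f v) p"
      by (intro poly_eqI) (simp add: coeff_map_poly)
    then show ?thesis by (simp add: eval_poly_fun) (simp add: var_def w_def)
  qed
  have "f w = 0" if f: "f \<in> P" for f
  proof -
    obtain p where p: "p \<in> polys_over ?A" "f = poly p ?x" using I(1)[OF f] unfolding adjoin_def by blast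
    then show ?thesis using ev[OF p(1)] t(1)[OF p(1)] f by simp
  qed
  moreover have "b w \<noteq> 0"
  proof -
    obtain p where p: "p \<in> polys_over ?A" "b = poly p ?x" using P(2) unfolding adjoin_def by blast
    then show ?thesis using ev[OF p(1)] t(2)[OF p(1)] by simp
  qed
  ultimately show ?case by blast
qed

text \<open>Lying over and the Nullstellensatz combined: the ideal stays proper when the coordinates are adjoined
  one after the other, and a prime ideal of the full polynomial ring has a zero.\<close>

theorem common_zero_of_proper_ideal:
  fixes T :: "((nat \<Rightarrow> 'a::{alg_closed_field, field_char_0}) \<Rightarrow> 'a) set"
  assumes T: "unital_subring T" "T \<subseteq> mpfun N" and cst: "\<And>c. (\<lambda>_. c) \<in> T"
    and int: "\<And>i. i < N \<Longrightarrow> integral_over T (var i)"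
    and J: "ideal_in T J" "1 \<notin> J"
  shows "\<exists>v. \<forall>f\<in>J. f v = 0"
proof -
  have "\<exists>A J'. unital_subring A \<and> T \<subseteq> A \<and> mpfun k \<subseteq> A \<and> A \<subseteq> mpfun N \<and> ideal_in A J' \<and> 1 \<notin> J' \<and> J \<subseteq> J'"
    if "k \<le> N" for k
    using that
  proof (induction k)
    case 0
    have "f \<in> T" if "f \<in> mpfun 0" for f
      using that
    proof induction
      case (const c) show ?case by (rule cst)
    next
      case (add f g) show ?case by (rule unital_subringD(3)[OF T(1) add.IH])
    next
      case (mult f g) show ?case by (rule unital_subringD(4)[OF T(1) mult.IH])
    qed simp
    then show ?case using T J by blast
  next
    case (Suc k)
    then obtain A J' where A: "unital_subring A" "T \<subseteq> A" "mpfun k \<subseteq> A" "A \<subseteq> mpfun N"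
      and J': "ideal_in A J'" "1 \<notin> J'" "J \<subseteq> J'" by (metis Suc_leD)
    let ?x = "var k :: (nat \<Rightarrow> 'a) \<Rightarrow> 'a"
    have x: "integral_over A ?x"
      using int[of k] Suc.prems A(2) unfolding integral_over_def by (meson Suc_le_lessD subsetD)
    have xN: "?x \<in> mpfun N" using Suc.prems by (intro mpfun.var) simp
    have B: "unital_subring (adjoin A ?x)" by (rule unital_subring_adjoin[OF A(1)])
    have AB: "A \<subseteq> adjoin A ?x" by (rule adjoin_base[OF A(1)])
    have "mpfun (Suc k) \<subseteq> adjoin A ?x"
      unfolding mpfun_Suc by (rule adjoin_least[OF B _ adjoin_gen[OF A(1)]]) (use A(3) AB in blast)
    moreover have "adjoin A ?x \<subseteq> mpfun N" by (rule adjoin_least[OF unital_subring_mpfun A(4) xN])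
    moreover have "J \<subseteq> (\<lambda>p. poly p ?x) ` polys_over J'"
      by (rule order_trans[OF J'(3) polys_over_ideal(2)[OF A(1) J'(1)]])
    moreover note polys_over_ideal(1)[OF A(1) J'(1), of ?x] proper_extension[OF A(1) J'(1,2) x]
      order_trans[OF A(2) AB] B
    ultimately show ?case
      by (intro exI[of _ "adjoin A ?x"] exI[of _ "(\<lambda>p. poly p ?x) ` polys_over J'"] conjI)
  qed
  from this[OF order_refl] obtain A J' where "unital_subring A" "mpfun N \<subseteq> A" "A \<subseteq> mpfun N"
    and J': "ideal_in A J'" "1 \<notin> J'" "J \<subseteq> J'" by blast
  then have A: "A = mpfun N" by (intro subset_antisym)
  obtain P where P: "prime_in (mpfun N) P" "J' \<subseteq> P"
    using exists_prime_above[OF unital_subring_mpfun J'(1)[unfolded A] J'(2)] by blast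
  have "\<exists>v. (\<forall>f\<in>P. f v = 0) \<and> (1 :: (nat \<Rightarrow> 'a) \<Rightarrow> 'a) v \<noteq> 0"
    by (rule nullstellensatz_prime[OF P(1) unital_subringD(1)[OF unital_subring_mpfun] prime_inD(2)[OF P(1)]])
  then show ?thesis using P(2) J'(3) by blast
qed


section \<open>Krull dimension of a space with an integral parametrization\<close>

lemma mpfun_on_line:
  assumes "f \<in> mpfun N"
  shows "\<exists>p. \<forall>t. f (\<lambda>i. v i + t * (w i - v i)) = poly p t"
  using assms
proof induction
  case (const c)
  show ?case by (intro exI[of _ "[:c:]"]) simp
next
  case (var i)
  show ?case by (intro exI[of _ "[:v i, w i - v i:]"]) (simp add: var_def)
next
  case (add f g)
  then obtain p r where "\<forall>t. f (\<lambda>i. v i + t * (w i - v i)) = poly p t"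
    "\<forall>t. g (\<lambda>i. v i + t * (w i - v i)) = poly r t" by blast
  then show ?case by (intro exI[of _ "p + r"]) simp
next
  case (mult f g)
  then obtain p r where "\<forall>t. f (\<lambda>i. v i + t * (w i - v i)) = poly p t"
    "\<forall>t. g (\<lambda>i. v i + t * (w i - v i)) = poly r t" by blast
  then show ?case by (intro exI[of _ "p * r"]) simp
qed

text \<open>Polynomial functions have no zero divisors: restrict to a line through two points where the
  factors do not vanish.\<close>

lemma mpfun_no_zero_divisors:
  fixes f g :: "(nat \<Rightarrow> 'a::field_char_0) \<Rightarrow> 'a"
  assumes f: "f \<in> mpfun N" "f v \<noteq> 0" and g: "g \<in> mpfun N" "g w \<noteq> 0"
  shows "\<exists>u. f u \<noteq> 0 \<and> g u \<noteq> 0"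
proof -
  obtain p where p: "\<And>t. f (\<lambda>i. v i + t * (w i - v i)) = poly p t" using mpfun_on_line[OF f(1)] by blast
  obtain r where r: "\<And>t. g (\<lambda>i. v i + t * (w i - v i)) = poly r t" using mpfun_on_line[OF g(1)] by blast
  have "poly p 0 \<noteq> 0" "poly r 1 \<noteq> 0" using f(2) g(2) by (simp_all flip: p r)
  then have "p * r \<noteq> 0" by auto
  then have "\<exists>t. poly (p * r) t \<noteq> 0" using poly_all_0_iff_0[of "p * r"] by blast
  then obtain t where "poly p t \<noteq> 0" "poly r t \<noteq> 0" by auto
  then show ?thesis by (metis p r)
qed

text \<open>The polynomial functions of degree at most \<open>d\<close> in each variable form a space of dimension at most
  \<open>(d + 1) ^ N\<close>. Comparing this with the number of monomials of bounded degree in \<open>N + 1\<close> functions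
  gives an algebraic relation.\<close>

definition scale_fun :: "'a::field \<Rightarrow> ('x \<Rightarrow> 'a) \<Rightarrow> 'x \<Rightarrow> 'a" where
  "scale_fun c f = (\<lambda>x. c * f x)"

interpretation fun_space: vector_space "scale_fun :: 'a::field \<Rightarrow> ('x \<Rightarrow> 'a) \<Rightarrow> 'x \<Rightarrow> 'a"
  by unfold_locales (simp_all add: scale_fun_def fun_eq_iff algebra_simps)

definition box_monomials :: "nat \<Rightarrow> nat \<Rightarrow> ((nat \<Rightarrow> 'a::field) \<Rightarrow> 'a) set" where
  "box_monomials N d = (\<lambda>e v. \<Prod>i<N. v i ^ e i) ` ({..<N} \<rightarrow>\<^sub>E {..d})"

definition box :: "nat \<Rightarrow> nat \<Rightarrow> ((nat \<Rightarrow> 'a::field) \<Rightarrow> 'a) set" where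
  "box N d = fun_space.span (box_monomials N d)"

lemma finite_box_monomials: "finite (box_monomials N d)"
  unfolding box_monomials_def by (intro finite_imageI finite_PiE) auto

lemma card_box_monomials: "card (box_monomials N d) \<le> (d + 1) ^ N"
proof -
  have "card (box_monomials N d :: ((nat \<Rightarrow> 'a) \<Rightarrow> 'a) set) \<le> card ({..<N} \<rightarrow>\<^sub>E {..d})"
    unfolding box_monomials_def by (intro card_image_le finite_PiE) auto
  then show ?thesis by (simp add: card_PiE)
qed

lemma box_monomial: "(\<And>i. i < N \<Longrightarrow> e i \<le> d) \<Longrightarrow> (\<lambda>v. \<Prod>i<N. v i ^ e i) \<in> box_monomials N d"
  unfolding box_monomials_def by (rule image_eqI[of _ _ "restrict e {..<N}"]) auto

lemma box_mono: "d \<le> d' \<Longrightarrow> box N d \<subseteq> box N d'"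
  unfolding box_def box_monomials_def by (intro fun_space.span_mono image_mono PiE_mono) auto

lemma box_mult:
  assumes f: "f \<in> box N d" and g: "g \<in> box N d'"
  shows "f * g \<in> box N (d + d')"
proof -
  have mono: "m * m' \<in> box N (d + d')" if "m \<in> box_monomials N d" "m' \<in> box_monomials N d'"
    for m m' :: "(nat \<Rightarrow> 'a) \<Rightarrow> 'a"
  proof -
    obtain e where e: "e \<in> {..<N} \<rightarrow>\<^sub>E {..d}" "m = (\<lambda>v. \<Prod>i<N. v i ^ e i)"
      using \<open>m \<in> _\<close> unfolding box_monomials_def by blast
    obtain e' where e': "e' \<in> {..<N} \<rightarrow>\<^sub>E {..d'}" "m' = (\<lambda>v. \<Prod>i<N. v i ^ e' i)"
      using \<open>m' \<in> _\<close> unfolding box_monomials_def by blast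
    have "m * m' = (\<lambda>v. \<Prod>i<N. v i ^ (e i + e' i))"
      by (rule ext) (simp add: e(2) e'(2) power_add prod.distrib)
    also have "\<dots> \<in> box_monomials N (d + d')"
      by (rule box_monomial) (use e(1) e'(1) in \<open>auto intro!: add_mono\<close>)
    finally show ?thesis unfolding box_def by (rule fun_space.span_base)
  qed
  have left: "f * m' \<in> box N (d + d')" if m': "m' \<in> box_monomials N d'" for m'
    using f unfolding box_def
  proof (induction rule: fun_space.span_induct_alt)
    case base
    then show ?case unfolding mult_zero_left by (rule fun_space.span_zero)
  next
    case (step c x y)
    have "(scale_fun c x + y) * m' = scale_fun c (x * m') + y * m'"
      by (rule ext) (simp add: scale_fun_def algebra_simps)
    then show ?case
      using fun_space.span_add[OF fun_space.span_scale[OF mono[OF step(1) m', unfolded box_def]] step(2)] by metis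
  qed
  show ?thesis
    using g unfolding box_def
  proof (induction rule: fun_space.span_induct_alt)
    case base
    then show ?case unfolding mult_zero_right by (rule fun_space.span_zero)
  next
    case (step c x y)
    have "f * (scale_fun c x + y) = scale_fun c (f * x) + f * y"
      by (rule ext) (simp add: scale_fun_def algebra_simps)
    then show ?case
      using fun_space.span_add[OF fun_space.span_scale[OF left[OF step(1), unfolded box_def]] step(2)] by metis
  qed
qed

lemma const_in_box: "(\<lambda>_. c) \<in> box N d"
proof -
  have "(\<lambda>v. \<Prod>i<N. v i ^ 0) \<in> box N d"
    unfolding box_def by (rule fun_space.span_base, rule box_monomial) simp
  from fun_space.span_scale[OF this[unfolded box_def], of c] show ?thesis
    by (simp add: box_def scale_fun_def)
qed

lemma mpfun_in_box: "f \<in> mpfun N \<Longrightarrow> \<exists>d. f \<in> box N d"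
proof (induction rule: mpfun.induct)
  case (const c)
  show ?case using const_in_box by blast
next
  case (var i)
  have "var i = (\<lambda>v. \<Prod>j<N. v j ^ (if j = i then 1 else 0) :: 'a)"
    using var by (simp add: var_def if_distrib[of "\<lambda>k. _ ^ k"] cong: if_cong)
  also have "\<dots> \<in> box N 1"
    unfolding box_def by (rule fun_space.span_base, rule box_monomial) simp
  finally show ?case by blast
next
  case (add f g)
  then obtain d d' where "f \<in> box N d" "g \<in> box N d'" by blast
  then have "f \<in> box N (max d d')" "g \<in> box N (max d d')"
    using box_mono[of d "max d d'" N] box_mono[of d' "max d d'" N] by auto
  then show ?case unfolding box_def by (blast intro: fun_space.span_add)
next
  case (mult f g)
  then show ?case using box_mult by blast
qed

fun power_prod :: "(nat \<Rightarrow> 'r::comm_ring_1) \<Rightarrow> nat list \<Rightarrow> 'r" where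
  "power_prod g [] = 1"
| "power_prod g (a # e) = g 0 ^ a * power_prod (\<lambda>i. g (Suc i)) e"

lemma power_prod_closed:
  assumes "unital_subring A" "\<And>i. i < length e \<Longrightarrow> g i \<in> A"
  shows "power_prod g e \<in> A"
  using assms(2)
proof (induction e arbitrary: g)
  case Nil
  show ?case by (simp add: unital_subringD(1)[OF assms(1)])
next
  case (Cons a e)
  show ?case unfolding power_prod.simps
    by (intro unital_subringD(4,7)[OF assms(1)] Cons.IH Cons.prems) simp_all
qed

lemma power_prod_in_box:
  assumes "\<And>i. i < length e \<Longrightarrow> g i \<in> box N d"
  shows "power_prod g e \<in> box N (d * sum_list e)"
  using assms
proof (induction e arbitrary: g)
  case Nil
  show ?case by (simp add: one_fun_def const_in_box)
next
  case (Cons a e)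
  have "g 0 ^ a \<in> box N (d * a)"
  proof (induction a)
    case 0
    show ?case by (simp add: one_fun_def const_in_box)
  next
    case (Suc a)
    then show ?case using box_mult[OF Cons.prems[of 0] Suc] by (simp only: power_Suc mult_Suc_right list.size zero_less_Suc)
  qed
  moreover have "power_prod (\<lambda>i. g (Suc i)) e \<in> box N (d * sum_list e)"
    by (rule Cons.IH, rule Cons.prems) simp
  ultimately show ?case using box_mult by (simp only: power_prod.simps sum_list.Cons distrib_left)
qed

text \<open>Elements \<open>g i\<close> that witness the strict inclusions of a chain of primes are algebraically independent:
  divide a relation by the highest possible power of \<open>g 0\<close>, which is not in the smallest prime, and reduce it
  modulo \<open>g 0\<close>, which lies in the next one.\<close>

lemma chain_witnesses_independent:
  fixes T :: "('x \<Rightarrow> 'a::field) set"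
  assumes T: "unital_subring T" and cst: "\<And>c. (\<lambda>_. c) \<in> T"
    and "\<And>i. i \<le> k \<Longrightarrow> prime_in T (I i)" "\<And>i. i < k \<Longrightarrow> I i \<subseteq> I (Suc i)"
    "\<And>i. i < k \<Longrightarrow> g i \<in> I (Suc i) - I i"
    and "finite E" "\<And>e. e \<in> E \<Longrightarrow> length e = k" "(\<Sum>e\<in>E. (\<lambda>_. c e) * power_prod g e) \<in> I 0" "e \<in> E"
  shows "c e = 0"
  using assms(3-)
proof (induction k arbitrary: I g E c e)
  case 0
  note P = 0(1)[OF order_refl]
  have E: "E = {[]}" using 0(5,7) by auto
  have "(\<lambda>_. c []) \<in> I 0" using 0(6) unfolding E by simp
  show ?case
  proof (rule ccontr)
    assume "c e \<noteq> 0"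
    then have nz: "c [] \<noteq> 0" using 0(7) E by simp
    have "(\<lambda>_. inverse (c [])) * (\<lambda>_. c []) \<in> I 0"
      by (rule ideal_inD(4)[OF prime_inD(1)[OF P] T \<open>(\<lambda>_. c []) \<in> I 0\<close> cst])
    also have "(\<lambda>_. inverse (c [])) * (\<lambda>_. c []) = (1 :: 'x \<Rightarrow> 'a)" using nz by (intro ext) simp
    finally show False using prime_inD(2)[OF P] by contradiction
  qed
next
  case (Suc k)
  have P0: "prime_in T (I 0)" and P1: "prime_in T (I 1)" using Suc.prems(1)[of 0] Suc.prems(1)[of 1] by simp_all
  note I0 = ideal_inD[OF prime_inD(1)[OF P0] T] and I1 = ideal_inD[OF prime_inD(1)[OF P1] T]
  note D = unital_subringD[OF T]
  have I01: "I 0 \<subseteq> I 1" using Suc.prems(2)[of 0] by simp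
  have g0: "g 0 \<in> I 1" "g 0 \<notin> I 0" using Suc.prems(3)[of 0] by auto
  have gT: "g i \<in> T" if "i < Suc k" for i
  proof -
    have "g i \<in> I (Suc i)" using Suc.prems(3)[OF that] by simp
    moreover have "prime_in T (I (Suc i))" by (rule Suc.prems(1)) (use that in simp)
    ultimately show ?thesis using ideal_inD(1)[OF prime_inD(1) T] by blast
  qed
  define g' where "g' = (\<lambda>i. g (Suc i))"
  have pp: "power_prod g' e \<in> T" if "length e = k" for e
    by (rule power_prod_closed[OF T]) (use gT that in \<open>simp add: g'_def\<close>)
  show ?case
  proof (rule ccontr)
    assume ce: "c e \<noteq> 0"
    define S where "S = {e \<in> E. c e \<noteq> 0}"
    have fS: "finite S" "S \<noteq> {}" using Suc.prems(4,7) ce unfolding S_def by auto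
    define a where "a = Min (hd ` S)"
    have Sform: "e' = hd e' # tl e'" "length (tl e') = k" "a \<le> hd e'" if "e' \<in> S" for e'
      using Suc.prems(5)[of e'] that fS unfolding S_def a_def by (auto simp: length_Suc_conv)
    define t where "t = (\<lambda>e'. (\<lambda>_. c e') * (g 0 ^ (hd e' - a) * power_prod g' (tl e')))"
    have tT: "t e' \<in> T" if "e' \<in> S" for e'
      unfolding t_def by (intro D(4) D(7) cst gT pp Sform(2)[OF that]) simp
    have "(\<Sum>e\<in>E. (\<lambda>_. c e) * power_prod g e) = (\<Sum>e\<in>S. (\<lambda>_. c e) * power_prod g e)"
    proof (rule sum.mono_neutral_right[OF Suc.prems(4)])
      show "S \<subseteq> E" unfolding S_def by blast
      show "\<forall>i\<in>E - S. (\<lambda>_. c i) * power_prod g i = 0"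
        unfolding S_def by (auto simp: fun_eq_iff)
    qed
    also have "\<dots> = (\<Sum>e\<in>S. g 0 ^ a * t e)"
    proof (rule sum.cong[OF refl])
      fix e' assume e': "e' \<in> S"
      have "power_prod g e' = g 0 ^ hd e' * power_prod g' (tl e')"
        by (subst Sform(1)[OF e']) (simp only: power_prod.simps g'_def)
      also have "g 0 ^ hd e' = g 0 ^ a * g 0 ^ (hd e' - a)"
        using Sform(3)[OF e'] by (simp flip: power_add)
      finally show "(\<lambda>_. c e') * power_prod g e' = g 0 ^ a * t e'"
        unfolding t_def by (simp only: mult.assoc mult.left_commute)
    qed
    also have "\<dots> = g 0 ^ a * (\<Sum>e\<in>S. t e)" by (simp only: sum_distrib_left)
    finally have "g 0 ^ a * (\<Sum>e\<in>S. t e) \<in> I 0" using Suc.prems(6) by (simp only:)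
    moreover have "g 0 ^ a \<in> T" by (intro D(7) gT) simp
    moreover have "g 0 ^ a \<notin> I 0" by (rule prime_in_power[OF P0 T gT g0(2)]) simp
    moreover have "(\<Sum>e\<in>S. t e) \<in> T" by (rule unital_subring_sum[OF T tT])
    ultimately have "(\<Sum>e\<in>S. t e) \<in> I 0" using prime_inD(3)[OF P0] by blast
    then have sumI: "(\<Sum>e\<in>S. t e) \<in> I 1" using I01 by blast
    define S0 where "S0 = {e \<in> S. hd e = a}"
    have "(\<Sum>e\<in>S. t e) = (\<Sum>e\<in>S - S0. t e) + (\<Sum>e\<in>S0. t e)"
      by (rule sum.subset_diff) (auto simp: S0_def fS)
    moreover have "(\<Sum>e\<in>S - S0. t e) \<in> I 1"
    proof (rule ideal_in_sum[OF prime_inD(1)[OF P1] T])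
      fix e' assume e': "e' \<in> S - S0"
      then have "e' \<in> S" "hd e' - a > 0" using Sform(3)[of e'] unfolding S0_def by auto
      then obtain b where b: "hd e' - a = Suc b" by (metis gr0_implies_Suc)
      have "(\<lambda>_. c e') * (g 0 ^ b * power_prod g' (tl e')) * g 0 \<in> I 1"
        by (intro I1(4) g0(1) D(4) D(7) cst gT pp Sform(2)[OF \<open>e' \<in> S\<close>]) simp
      also have "(\<lambda>_. c e') * (g 0 ^ b * power_prod g' (tl e')) * g 0 = t e'"
        unfolding t_def b by (simp only: power_Suc mult.assoc mult.commute mult.left_commute)
      finally show "t e' \<in> I 1" .
    qed
    ultimately have S0I: "(\<Sum>e\<in>S0. t e) \<in> I 1"
      using I1(7)[OF sumI] by (metis add_diff_cancel_left')
    have inj: "inj_on tl S0"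
    proof (rule inj_onI)
      fix x y assume "x \<in> S0" "y \<in> S0" "tl x = tl y"
      then show "x = y" using Sform(1)[of x] Sform(1)[of y] unfolding S0_def by auto
    qed
    have "(\<Sum>e\<in>S0. t e) = (\<Sum>e\<in>S0. (\<lambda>_. c (a # tl e)) * power_prod g' (tl e))"
    proof (rule sum.cong[OF refl])
      fix e' assume e': "e' \<in> S0"
      then have h: "hd e' = a" "e' \<in> S" unfolding S0_def by auto
      then have "c (a # tl e') = c e'" using Sform(1)[of e'] by simp
      then show "t e' = (\<lambda>_. c (a # tl e')) * power_prod g' (tl e')"
        unfolding t_def h(1) by (simp only: diff_self_eq_0 power_0 mult_1_left)
    qed
    also have "\<dots> = (\<Sum>e\<in>tl ` S0. (\<lambda>_. c (a # e)) * power_prod g' e)"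
      by (simp only: sum.reindex[OF inj] o_def)
    finally have rel: "(\<Sum>e\<in>tl ` S0. (\<lambda>_. c (a # e)) * power_prod g' e) \<in> I (Suc 0)"
      using S0I by simp
    have "a \<in> hd ` S" unfolding a_def using fS by (intro Min_in) auto
    then obtain e0 where e0: "e0 \<in> S0" unfolding S0_def by blast
    have "c (a # tl e0) = 0"
    proof (rule Suc.IH[of "\<lambda>i. I (Suc i)" g' "tl ` S0" "\<lambda>e. c (a # e)"])
      show "prime_in T (I (Suc i))" if "i \<le> k" for i using Suc.prems(1) that by simp
      show "I (Suc i) \<subseteq> I (Suc (Suc i))" if "i < k" for i using Suc.prems(2) that by simp
      show "g' i \<in> I (Suc (Suc i)) - I (Suc i)" if "i < k" for i
        unfolding g'_def using Suc.prems(3)[of "Suc i"] that by simp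
      show "finite (tl ` S0)" using fS unfolding S0_def by simp
      show "length e = k" if "e \<in> tl ` S0" for e using that Sform(2) unfolding S0_def by auto
      show "(\<Sum>e\<in>tl ` S0. (\<lambda>_. c (a # e)) * power_prod g' e) \<in> I (Suc 0)" by (rule rel)
      show "tl e0 \<in> tl ` S0" using e0 by blast
    qed
    moreover have "a # tl e0 = e0" "c e0 \<noteq> 0" using e0 Sform(1)[of e0] unfolding S0_def S_def by auto
    ultimately show False by simp
  qed
qed

text \<open>A chain of \<open>N + 2\<close> primes has \<open>N + 1\<close> witnesses. The \<open>B ^ (N + 1)\<close> monomials with exponents below \<open>B\<close> in them
  are linearly independent, but they lie in a space whose dimension is at most a constant times \<open>B ^ N\<close>.\<close>

lemma prime_chain_length:
  fixes T :: "((nat \<Rightarrow> 'a::field) \<Rightarrow> 'a) set"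
  assumes T: "unital_subring T" "T \<subseteq> mpfun N" and cst: "\<And>c. (\<lambda>_. c) \<in> T"
    and P: "\<And>i. i \<le> Suc N \<Longrightarrow> prime_in T (I i)" and mono: "\<And>i. i < Suc N \<Longrightarrow> I i \<subset> I (Suc i)"
  shows False
proof -
  have "\<exists>g. \<forall>i<Suc N. g i \<in> I (Suc i) - I i" using mono by (intro choice) blast
  then obtain g where g: "\<And>i. i < Suc N \<Longrightarrow> g i \<in> I (Suc i) - I i" by blast
  have gN: "g i \<in> mpfun N" if "i < Suc N" for i
  proof -
    have "g i \<in> I (Suc i)" using g[OF that] by simp
    moreover have "prime_in T (I (Suc i))" by (rule P) (use that in simp)
    ultimately show ?thesis using ideal_inD(1)[OF prime_inD(1) T(1)] T(2) by blast
  qed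
  have "\<exists>d. \<forall>i<Suc N. g i \<in> box N (d i)" using mpfun_in_box[OF gN] by (intro choice) blast
  then obtain d where d: "\<And>i. i < Suc N \<Longrightarrow> g i \<in> box N (d i)" by blast
  define D where "D = (\<Sum>i<Suc N. d i)"
  have gD: "g i \<in> box N D" if "i < Suc N" for i
    using d[OF that] box_mono[of "d i" D N] member_le_sum[of i "{..<Suc N}" d] that unfolding D_def by auto
  \<comment> \<open>Large enough for \<open>((D * Suc N + 1) * B) ^ N < B ^ Suc N\<close>.\<close>
  define B where "B = (D * Suc N + 1) ^ N + 1"
  define L where "L = {e :: nat list. set e \<subseteq> {..<B} \<and> length e = Suc N}"
  have fL: "finite L" unfolding L_def by (rule finite_lists_length_eq) simp
  have cardL: "card L = B ^ Suc N" unfolding L_def by (subst card_lists_length_eq) simp_all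
  have zero: "c e = 0" if "E \<subseteq> L" "(\<Sum>e\<in>E. (\<lambda>_. c e) * power_prod g e) = 0" "e \<in> E" for E c e
  proof (rule chain_witnesses_independent[OF T(1) cst, of "Suc N" I g E c])
    show "finite E" using that(1) fL by (rule finite_subset)
    show "length e = Suc N" if "e \<in> E" for e using that \<open>E \<subseteq> L\<close> unfolding L_def by auto
    show "(\<Sum>e\<in>E. (\<lambda>_. c e) * power_prod g e) \<in> I 0"
      unfolding that(2) by (rule ideal_inD(2)[OF prime_inD(1)[OF P] T(1)]) simp
  qed (use P mono g that in auto)
  have scale: "scale_fun c f = (\<lambda>_. c) * f" for c and f :: "(nat \<Rightarrow> 'a) \<Rightarrow> 'a"
    by (rule ext) (simp add: scale_fun_def)
  have inj: "inj_on (power_prod g) L"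
  proof (rule inj_onI, rule ccontr)
    fix x y assume xy: "x \<in> L" "y \<in> L" "power_prod g x = power_prod g y" "x \<noteq> y"
    let ?c = "\<lambda>e. if e = x then 1 else - 1 :: 'a"
    have "(\<Sum>e\<in>{x, y}. (\<lambda>_. ?c e) * power_prod g e) = 0"
      using xy(3,4) by (auto simp: fun_eq_iff)
    then have "?c x = 0" by (rule zero[rotated]) (use xy in auto)
    then show False by simp
  qed
  have indep: "fun_space.independent (power_prod g ` L)"
  proof
    assume "fun_space.dependent (power_prod g ` L)"
    then obtain u m where u: "m \<in> power_prod g ` L" "u m \<noteq> 0"
      "(\<Sum>m\<in>power_prod g ` L. scale_fun (u m) m) = 0"
      using fL by (subst (asm) fun_space.dependent_finite) blast+
    from u(1) obtain e where e: "e \<in> L" "m = power_prod g e" by blast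
    have "(\<Sum>e\<in>L. (\<lambda>_. u (power_prod g e)) * power_prod g e) = 0"
      using u(3) by (simp only: sum.reindex[OF inj] o_def scale)
    then have "u (power_prod g e) = 0" by (rule zero[rotated]) (use e in auto)
    then show False using u(2) e(2) by simp
  qed
  define d' where "d' = D * (Suc N * B)"
  have "power_prod g e \<in> box N d'" if e: "e \<in> L" for e
  proof -
    have "sum_list e \<le> length e * B"
      by (rule order_trans[OF sum_list_mono[of e "\<lambda>x. x" "\<lambda>_. B", simplified]])
        (use e in \<open>auto simp: L_def sum_list_triv\<close>)
    then have "D * sum_list e \<le> d'" using e unfolding d'_def L_def by simp
    moreover have "power_prod g e \<in> box N (D * sum_list e)"
      by (rule power_prod_in_box, rule gD) (use e in \<open>simp add: L_def\<close>)
    ultimately show ?thesis using box_mono by blast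
  qed
  then have "power_prod g ` L \<subseteq> fun_space.span (box_monomials N d')" unfolding box_def by blast
  from fun_space.independent_span_bound[OF finite_box_monomials indep this]
  have "card (power_prod g ` L) \<le> card (box_monomials N d' :: ((nat \<Rightarrow> 'a) \<Rightarrow> 'a) set)" by simp
  then have "B ^ Suc N \<le> (d' + 1) ^ N"
    unfolding card_image[OF inj] cardL using card_box_monomials[of N d', where 'a = 'a] by linarith
  also have "\<dots> \<le> ((D * Suc N + 1) * B) ^ N"
    by (rule power_mono) (simp_all add: d'_def B_def algebra_simps)
  also have "\<dots> = (D * Suc N + 1) ^ N * B ^ N" by (rule power_mult_distrib)
  also have "\<dots> < B * B ^ N"
    by (rule mult_strict_right_mono) (simp_all add: B_def)
  finally show False by simp
qed

text \<open>The projection of affine space onto its coordinate subspace of dimension \<open>i\<close>.\<close>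

definition trunc :: "nat \<Rightarrow> (nat \<Rightarrow> 'a::zero) \<Rightarrow> nat \<Rightarrow> 'a" where
  "trunc i v = (\<lambda>j. if j < i then v j else 0)"

lemma mpfun_trunc: "f \<in> mpfun N \<Longrightarrow> (\<lambda>v. f (trunc i v)) \<in> mpfun N"
proof (induction rule: mpfun.induct)
  case (const c)
  show ?case by (rule mpfun.const)
next
  case (var j)
  have "(\<lambda>v. var j (trunc i v) :: 'a) = (if j < i then var j else (\<lambda>_. 0))"
    by (simp add: var_def trunc_def)
  moreover have "(if j < i then var j else (\<lambda>_. 0 :: 'a)) \<in> mpfun N"
    by (cases "j < i", simp_all only: if_True if_False) (intro mpfun.var var mpfun.const)+
  ultimately show ?case by (simp only:)
next
  case (add f g)
  then show ?case using mpfun.add[OF add.IH] by (simp add: plus_fun_def)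
next
  case (mult f g)
  then show ?case using mpfun.mult[OF mult.IH] by (simp add: times_fun_def)
qed

text \<open>A space \<open>X\<close> that is the image of affine \<open>N\<close>-space and whose closed sets are cut out by a ring \<open>T\<close> of polynomial
  functions over which the coordinates are integral. Then \<open>X\<close> has dimension \<open>N\<close>: at most \<open>N\<close> by the bound on the length of
  a chain of primes in \<open>T\<close>, at least \<open>N\<close> because integrality keeps the closures of the images of the coordinate
  subspaces apart.\<close>

locale integral_parametrization =
  fixes X :: "'p topology" and \<pi> :: "(nat \<Rightarrow> 'a::{alg_closed_field, field_char_0}) \<Rightarrow> 'p"
    and N :: nat and T :: "((nat \<Rightarrow> 'a) \<Rightarrow> 'a) set"
  assumes topspace: "topspace X = range \<pi>"
    and T: "unital_subring T" "T \<subseteq> mpfun N" and cst: "\<And>c. (\<lambda>_. c) \<in> T"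
    and int: "\<And>i. i < N \<Longrightarrow> integral_over T (var i)"
    and fibre: "\<And>g v w. g \<in> T \<Longrightarrow> \<pi> v = \<pi> w \<Longrightarrow> g v = g w"
    and closed: "\<And>C. closedin X C \<longleftrightarrow> C \<subseteq> range \<pi> \<and> (\<exists>F\<subseteq>T. \<forall>v. \<pi> v \<in> C \<longleftrightarrow> (\<forall>g\<in>F. g v = 0))"
begin

text \<open>The vanishing ideals of a chain of irreducible closed sets form a chain of primes.\<close>

lemma chain_bound:
  assumes C: "\<And>i. i \<le> k \<Longrightarrow> closedin X (C i) \<and> irreducible_in X (C i)"
    and mono: "\<And>i. i < k \<Longrightarrow> C i \<subset> C (Suc i)"
  shows "k \<le> N"
proof (rule ccontr)
  assume k: "\<not> k \<le> N"
  define J where "J = (\<lambda>i. {g \<in> T. \<forall>v. \<pi> v \<in> C (Suc N - i) \<longrightarrow> g v = 0})"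
  note D = unital_subringD[OF T(1)]
  show False
  proof (rule prime_chain_length[OF T cst, of J])
    fix i assume "i \<le> Suc N"
    define c where "c = C (Suc N - i)"
    have c: "irreducible_in X c" unfolding c_def using C[of "Suc N - i"] k by simp
    have J: "J i = {g \<in> T. \<forall>v. \<pi> v \<in> c \<longrightarrow> g v = 0}" unfolding J_def c_def ..
    have "ideal_in T (J i)"
      unfolding ideal_in_def J using D(2,3,4) by auto
    moreover have "1 \<notin> J i"
    proof -
      obtain x where x: "x \<in> c" "x \<in> topspace X" using c unfolding irreducible_in_def by blast
      then obtain v where "x = \<pi> v" using topspace by blast
      then show ?thesis unfolding J using x by auto
    qed
    moreover have "f \<in> J i \<or> g \<in> J i" if f: "f \<in> T" and g: "g \<in> T" and fg: "f * g \<in> J i" for f g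
    proof -
      let ?Z = "\<lambda>g. \<pi> ` {v. g v = 0}"
      have Z: "\<pi> v \<in> ?Z h \<longleftrightarrow> h v = 0" if h: "h \<in> T" for h v
      proof
        assume "\<pi> v \<in> ?Z h"
        then obtain w where "\<pi> v = \<pi> w" "h w = 0" by blast
        then show "h v = 0" using fibre[OF h, of v w] by simp
      qed blast
      have cl: "closedin X (?Z h)" if "h \<in> T" for h
      proof -
        have "\<forall>v. \<pi> v \<in> ?Z h \<longleftrightarrow> (\<forall>g\<in>{h}. g v = 0)" using Z[OF that] by simp
        moreover have "{h} \<subseteq> T" "?Z h \<subseteq> range \<pi>" using that by blast+
        ultimately show ?thesis unfolding closed by blast
      qed
      have "c \<subseteq> ?Z f \<union> ?Z g"
      proof
        fix x assume x: "x \<in> c"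
        then have "x \<in> range \<pi>" using c topspace unfolding irreducible_in_def by blast
        then obtain v where v: "x = \<pi> v" by blast
        then have "f v * g v = 0" using fg x unfolding J by simp
        then show "x \<in> ?Z f \<union> ?Z g" using v by auto
      qed
      then have "c \<subseteq> ?Z f \<or> c \<subseteq> ?Z g" using c cl[OF f] cl[OF g] unfolding irreducible_in_def by blast
      then show ?thesis unfolding J using Z[OF f] Z[OF g] f g by blast
    qed
    ultimately show "prime_in T (J i)" unfolding prime_in_def by blast
  next
    fix i assume i: "i < Suc N"
    have ii: "Suc (Suc N - Suc i) = Suc N - i" using i by simp
    have lt: "C (Suc N - Suc i) \<subset> C (Suc N - i)"
      using mono[of "Suc N - Suc i"] k i unfolding ii by simp
    then obtain x where x: "x \<in> C (Suc N - i)" "x \<notin> C (Suc N - Suc i)" by blast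
    have cl: "closedin X (C (Suc N - Suc i))" "irreducible_in X (C (Suc N - i))"
      using C[of "Suc N - Suc i"] C[of "Suc N - i"] k by simp_all
    have "x \<in> range \<pi>" using x(1) cl(2) topspace unfolding irreducible_in_def by auto
    then obtain v where v: "x = \<pi> v" by blast
    obtain F where F: "F \<subseteq> T" "\<And>v. \<pi> v \<in> C (Suc N - Suc i) \<longleftrightarrow> (\<forall>g\<in>F. g v = 0)"
      using cl(1) unfolding closed by blast
    obtain g where g: "g \<in> F" "g v \<noteq> 0" using F(2)[of v] x(2) v by blast
    have "g \<in> J (Suc i)" using g(1) F unfolding J_def by blast
    moreover have "g \<notin> J i" using g(2) x(1) v unfolding J_def by blast
    moreover have "J i \<subseteq> J (Suc i)" unfolding J_def using lt by blast
    ultimately show "J i \<subset> J (Suc i)" by blast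
  qed
qed

text \<open>The closure of the image of the coordinate subspace of dimension \<open>i\<close>.\<close>

definition coord_closure :: "nat \<Rightarrow> 'p set" where
  "coord_closure i = \<pi> ` {v. \<forall>g\<in>T. (\<forall>w. g (trunc i w) = 0) \<longrightarrow> g v = 0}"

lemma in_coord_closure:
  "\<pi> v \<in> coord_closure i \<longleftrightarrow> (\<forall>g\<in>T. (\<forall>w. g (trunc i w) = 0) \<longrightarrow> g v = 0)"
proof
  assume "\<pi> v \<in> coord_closure i"
  then obtain u where u: "\<pi> v = \<pi> u" "\<forall>g\<in>T. (\<forall>w. g (trunc i w) = 0) \<longrightarrow> g u = 0"
    unfolding coord_closure_def by blast
  then show "\<forall>g\<in>T. (\<forall>w. g (trunc i w) = 0) \<longrightarrow> g v = 0" using fibre[of _ v u] by metis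
qed (auto simp: coord_closure_def)

lemma closedin_coord_closure: "closedin X (coord_closure i)"
proof -
  have "\<forall>v. \<pi> v \<in> coord_closure i \<longleftrightarrow> (\<forall>g\<in>{g\<in>T. \<forall>w. g (trunc i w) = 0}. g v = 0)"
    unfolding in_coord_closure by blast
  moreover have "{g\<in>T. \<forall>w. g (trunc i w) = 0} \<subseteq> T" "coord_closure i \<subseteq> range \<pi>"
    unfolding coord_closure_def by blast+
  ultimately show ?thesis unfolding closed by blast
qed

text \<open>Restricted to the coordinate subspace, the functions are polynomial and hence have no zero divisors.\<close>

lemma irreducible_coord_closure: "irreducible_in X (coord_closure i)"
  unfolding irreducible_in_def
proof (intro conjI allI impI)
  show "coord_closure i \<subseteq> topspace X" unfolding topspace coord_closure_def by blast
  have tr: "\<pi> (trunc i w) \<in> coord_closure i" for w unfolding in_coord_closure by blast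
  then show "coord_closure i \<noteq> {}" by blast
  fix C D assume C: "closedin X C" and D: "closedin X D" and sub: "coord_closure i \<subseteq> C \<union> D"
  obtain F where F: "F \<subseteq> T" "\<And>v. \<pi> v \<in> C \<longleftrightarrow> (\<forall>g\<in>F. g v = 0)" using C unfolding closed by blast
  obtain G where G: "G \<subseteq> T" "\<And>v. \<pi> v \<in> D \<longleftrightarrow> (\<forall>g\<in>G. g v = 0)" using D unfolding closed by blast
  have wit: "\<exists>g\<in>H. \<exists>w. g (trunc i w) \<noteq> 0"
    if nsub: "\<not> coord_closure i \<subseteq> E" and H: "H \<subseteq> T" "\<And>v. \<pi> v \<in> E \<longleftrightarrow> (\<forall>g\<in>H. g v = 0)" for E H
  proof -
    obtain x where x: "x \<in> coord_closure i" "x \<notin> E" using nsub by (auto simp: subset_iff)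
    from x(1) obtain v where v: "x = \<pi> v" unfolding coord_closure_def by blast
    obtain g where g: "g \<in> H" "g v \<noteq> 0" using x(2) H(2)[of v] v by blast
    have "\<not> (\<forall>w. g (trunc i w) = 0)"
      using x(1)[unfolded v in_coord_closure] subsetD[OF H(1) g(1)] g(2) by blast
    then show ?thesis using g(1) by blast
  qed
  show "coord_closure i \<subseteq> C \<or> coord_closure i \<subseteq> D"
  proof (rule ccontr)
    assume "\<not> ?thesis"
    then obtain f v g w where f: "f \<in> F" "f (trunc i v) \<noteq> 0" and g: "g \<in> G" "g (trunc i w) \<noteq> 0"
      using wit[of C F, OF _ F] wit[of D G, OF _ G] by auto
    have "f \<in> mpfun N" "g \<in> mpfun N" using f(1) g(1) F(1) G(1) T(2) by blast+
    from mpfun_no_zero_divisors[OF mpfun_trunc[OF this(1)] f(2) mpfun_trunc[OF this(2)] g(2)]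
    obtain u where u: "f (trunc i u) \<noteq> 0" "g (trunc i u) \<noteq> 0" by blast
    then have "\<pi> (trunc i u) \<notin> C" "\<pi> (trunc i u) \<notin> D" using F(2) G(2) f(1) g(1) by blast+
    then show False using sub tr by blast
  qed
qed

text \<open>The inclusions are strict because the constant coefficient of an integral equation of minimal degree
  for the coordinate \<open>i\<close> on the coordinate subspace of dimension \<open>i + 1\<close> vanishes where this coordinate
  does, but not everywhere.\<close>

lemma coord_closure_strict:
  assumes i: "i < N" shows "coord_closure i \<subset> coord_closure (Suc i)"
proof -
  have tt: "trunc (Suc i) (trunc i w) = trunc i w" for w :: "nat \<Rightarrow> 'a"
    by (auto simp: trunc_def)
  have sub: "coord_closure i \<subseteq> coord_closure (Suc i)"
  proof
    fix x assume x: "x \<in> coord_closure i"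
    then obtain v where v: "x = \<pi> v" unfolding coord_closure_def by blast
    show "x \<in> coord_closure (Suc i)"
      using x unfolding v in_coord_closure by (metis tt)
  qed
  define Q where "Q = (\<lambda>n. \<exists>c. (\<forall>j<n. c j \<in> T) \<and>
    (\<forall>w. trunc (Suc i) w i ^ n + (\<Sum>j<n. c j (trunc (Suc i) w) * trunc (Suc i) w i ^ j) = 0))"
  have "\<exists>n. Q n"
  proof -
    obtain d c where c: "\<forall>j<d. c j \<in> T" "var i ^ d = (\<Sum>j<d. c j * var i ^ j)"
      using int[OF i] unfolding integral_over_def by blast
    have pw: "(f ^ k) v = f v ^ k" for f :: "(nat \<Rightarrow> 'a) \<Rightarrow> 'a" and k v
      by (induction k) simp_all
    have sm: "(\<Sum>j<d. F j) v = (\<Sum>j<d. F j v)" for F :: "nat \<Rightarrow> (nat \<Rightarrow> 'a) \<Rightarrow> 'a" and v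
      by (induction d) simp_all
    have "v i ^ d = (\<Sum>j<d. c j v * v i ^ j)" for v
      using fun_cong[OF c(2), of v] by (simp add: pw sm) (simp add: var_def)
    then have "Q d" unfolding Q_def
      using c(1) unital_subringD(5)[OF T(1)]
      by (intro exI[of _ "\<lambda>j. - c j"]) (simp add: sum_negf)
    then show ?thesis ..
  qed
  define n where "n = (LEAST n. Q n)"
  have Qn: "Q n" unfolding n_def using \<open>\<exists>n. Q n\<close> by (rule LeastI_ex)
  have least: "\<not> Q m" if "m < n" for m using not_less_Least that unfolding n_def by blast
  obtain c where c: "\<forall>j<n. c j \<in> T"
    "\<And>w. trunc (Suc i) w i ^ n + (\<Sum>j<n. c j (trunc (Suc i) w) * trunc (Suc i) w i ^ j) = 0"
    using Qn unfolding Q_def by blast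
  have "n \<noteq> 0"
  proof
    assume "n = 0"
    with c(2)[of undefined] show False by simp
  qed
  then obtain m where m: "n = Suc m" by (cases n) auto
  have eq: "trunc (Suc i) w i * (trunc (Suc i) w i ^ m + (\<Sum>j<m. c (Suc j) (trunc (Suc i) w) * trunc (Suc i) w i ^ j))
      + c 0 (trunc (Suc i) w) = 0" for w
    using c(2)[of w] unfolding m sum.lessThan_Suc_shift
    by (simp add: distrib_left sum_distrib_left mult.left_commute add_ac)
  have c0: "c 0 (trunc i w) = 0" for w
    using eq[of "trunc i w"] unfolding tt by (simp add: trunc_def)
  have c0T: "c 0 \<in> T" using c(1) m by simp
  have "\<exists>w. c 0 (trunc (Suc i) w) \<noteq> 0"
  proof (rule ccontr)
    assume none: "\<not> ?thesis"
    let ?h = "\<lambda>v. v i ^ m + (\<Sum>j<m. c (Suc j) v * v i ^ j)"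
    note M = unital_subringD[OF unital_subring_mpfun[of N]]
    have pw: "(\<lambda>v. v i ^ k) \<in> mpfun N" for k
    proof (induction k)
      case 0
      show ?case unfolding power_0 by (rule mpfun.const)
    next
      case (Suc k)
      show ?case using mpfun.mult[OF mpfun.var[OF i] Suc] by (simp add: times_fun_def var_def)
    qed
    have sm: "(\<lambda>v. \<Sum>j<k. F j v) \<in> mpfun N" if "\<And>j. j < k \<Longrightarrow> F j \<in> mpfun N"
      for k and F :: "nat \<Rightarrow> (nat \<Rightarrow> 'a) \<Rightarrow> 'a"
      using that
    proof (induction k)
      case 0
      show ?case by (simp add: mpfun.const)
    next
      case (Suc k)
      have "(\<lambda>v. \<Sum>j<k. F j v) + F k \<in> mpfun N" by (rule mpfun.add) (use Suc in simp_all)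
      then show ?case by (simp add: plus_fun_def)
    qed
    have "(\<lambda>v. \<Sum>j<m. c (Suc j) v * v i ^ j) \<in> mpfun N"
    proof (rule sm)
      fix j assume "j < m"
      then have "c (Suc j) \<in> mpfun N" using c(1) T(2) m by auto
      from mpfun.mult[OF this pw[of j]] show "(\<lambda>v. c (Suc j) v * v i ^ j) \<in> mpfun N"
        by (simp add: times_fun_def)
    qed
    from mpfun.add[OF pw[of m] this] have h: "?h \<in> mpfun N" by (simp add: plus_fun_def)
    have "\<not> Q m" by (rule least) (simp add: m)
    then have "\<exists>w. ?h (trunc (Suc i) w) \<noteq> 0"
      unfolding Q_def using c(1) m by (metis Suc_less_eq)
    then obtain w where w: "?h (trunc (Suc i) w) \<noteq> 0" by blast
    have v1: "(\<lambda>v. var i (trunc (Suc i) v)) \<in> mpfun N" by (rule mpfun_trunc[OF mpfun.var[OF i]])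
    have "var i (trunc (Suc i) (\<lambda>_. 1)) \<noteq> (0::'a)" by (simp add: var_def trunc_def)
    from mpfun_no_zero_divisors[OF v1 this mpfun_trunc[OF h] w]
    obtain u where "var i (trunc (Suc i) u) \<noteq> 0" "?h (trunc (Suc i) u) \<noteq> 0" by blast
    moreover have "var i (trunc (Suc i) u) * ?h (trunc (Suc i) u) = 0"
      using eq[of u] none unfolding var_def by simp
    ultimately show False by simp
  qed
  then obtain w where w: "c 0 (trunc (Suc i) w) \<noteq> 0" by blast
  have "\<pi> (trunc (Suc i) w) \<in> coord_closure (Suc i)" unfolding in_coord_closure by blast
  moreover have "\<pi> (trunc (Suc i) w) \<notin> coord_closure i"
    unfolding in_coord_closure using w c0 c0T by blast
  ultimately show ?thesis using sub by blast
qed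

lemma irreducible_topspace: "irreducible_in X (topspace X)"
proof -
  have "coord_closure N = topspace X"
  proof
    show "topspace X \<subseteq> coord_closure N"
    proof
      fix x assume "x \<in> topspace X"
      then obtain v where v: "x = \<pi> v" using topspace by blast
      have "g v = g (trunc N v)" if "g \<in> T" for g
        by (rule mpfun_local[of _ N]) (use that T(2) in \<open>auto simp: trunc_def\<close>)
      then show "x \<in> coord_closure N" unfolding v in_coord_closure by metis
    qed
  qed (unfold topspace coord_closure_def, blast)
  then show ?thesis using irreducible_coord_closure[of N] by simp
qed

lemma krull_dim_eq: "krull_dim X = enat N"
proof -
  have "\<exists>C :: nat \<Rightarrow> 'p set. (\<forall>i\<le>N. closedin X (C i) \<and> irreducible_in X (C i)) \<and> (\<forall>i<N. C i \<subset> C (Suc i))"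
    using closedin_coord_closure irreducible_coord_closure coord_closure_strict
    by (intro exI[of _ coord_closure] conjI allI impI)
  then have "enat N \<le> krull_dim X" unfolding krull_dim_def by (intro Sup_upper) blast
  moreover have "krull_dim X \<le> enat N"
    unfolding krull_dim_def
  proof (rule Sup_least)
    fix x assume "x \<in> {enat k | k. \<exists>C :: nat \<Rightarrow> 'p set.
     (\<forall>i\<le>k. closedin X (C i) \<and> irreducible_in X (C i)) \<and> (\<forall>i<k. C i \<subset> C (Suc i))}"
    then obtain k and C :: "nat \<Rightarrow> 'p set" where k: "x = enat k"
      and C: "\<forall>i\<le>k. closedin X (C i) \<and> irreducible_in X (C i)" "\<forall>i<k. C i \<subset> C (Suc i)"
      by (elim CollectE exE conjE)
    have "k \<le> N" by (rule chain_bound[of k C]) (use C in simp_all)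
    then show "x \<le> enat N" unfolding k by simp
  qed
  ultimately show ?thesis by simp
qed

end


section \<open>Maximal ideals of rings of invariants\<close>

lemma inv_ring_carrier:
  "f \<in> carrier (inv_ring n Z) \<longleftrightarrow>
     (\<exists>g\<in>polyfun n. f = restrict g Z) \<and> (\<forall>x\<in>Z. \<forall>y \<in> gl_orbit n x \<inter> Z. f y = f x)"
  by (auto simp: inv_ring_def coord_ring_def)

lemma inv_ring_ops:
  "monoid.mult (inv_ring n Z) = (\<lambda>f g. \<lambda>x\<in>Z. f x * g x)" "one (inv_ring n Z) = (\<lambda>x\<in>Z. 1)"
  "zero (inv_ring n Z) = (\<lambda>x\<in>Z. 0)" "add (inv_ring n Z) = (\<lambda>f g. \<lambda>x\<in>Z. f x + g x)"
  by (simp_all add: inv_ring_def coord_ring_def)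

lemma inv_ring_ext: "f \<in> carrier (inv_ring n Z) \<Longrightarrow> restrict f Z = f"
  unfolding inv_ring_carrier by auto

lemma inv_ring_closed:
  assumes "f \<in> carrier (inv_ring n Z)" "g \<in> carrier (inv_ring n Z)"
  shows "(\<lambda>x\<in>Z. f x + g x) \<in> carrier (inv_ring n Z)" "(\<lambda>x\<in>Z. f x * g x) \<in> carrier (inv_ring n Z)"
proof -
  interpret R: cring "inv_ring n Z" by (rule cring_inv_ring)
  show "(\<lambda>x\<in>Z. f x + g x) \<in> carrier (inv_ring n Z)" "(\<lambda>x\<in>Z. f x * g x) \<in> carrier (inv_ring n Z)"
    using R.a_closed[OF assms] R.m_closed[OF assms] by (simp_all only: inv_ring_ops)
qed

lemma inv_ring_const: "(\<lambda>x\<in>Z. c) \<in> carrier (inv_ring n Z)"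
proof -
  have "(\<lambda>_. c) \<in> polyfun n" by (rule polyfun.const)
  then show ?thesis unfolding inv_ring_carrier by auto
qed

lemma inv_ring_ideal:
  assumes "ideal M (inv_ring n Z)"
  shows "f \<in> M \<Longrightarrow> f \<in> carrier (inv_ring n Z)" "(\<lambda>x\<in>Z. 0) \<in> M"
    "f \<in> M \<Longrightarrow> g \<in> M \<Longrightarrow> (\<lambda>x\<in>Z. f x + g x) \<in> M"
    "f \<in> M \<Longrightarrow> g \<in> carrier (inv_ring n Z) \<Longrightarrow> (\<lambda>x\<in>Z. g x * f x) \<in> M"
proof -
  interpret M: ideal M "inv_ring n Z" by fact
  show "f \<in> M \<Longrightarrow> f \<in> carrier (inv_ring n Z)" by (rule M.a_Hcarr)
  show "(\<lambda>x\<in>Z. 0) \<in> M" using additive_subgroup.zero_closed[OF M.is_additive_subgroup] by (simp only: inv_ring_ops)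
  show "f \<in> M \<Longrightarrow> g \<in> M \<Longrightarrow> (\<lambda>x\<in>Z. f x + g x) \<in> M"
    using additive_subgroup.a_closed[OF M.is_additive_subgroup, of f g] by (simp only: inv_ring_ops)
  show "f \<in> M \<Longrightarrow> g \<in> carrier (inv_ring n Z) \<Longrightarrow> (\<lambda>x\<in>Z. g x * f x) \<in> M"
    using M.I_l_closed[of f g] by (simp only: inv_ring_ops)
qed

text \<open>Modulo the ideal a function \<open>f\<close> is the constant \<open>f x\<close>, and constants are invariant; so the quotient is a field.\<close>

lemma maximalideal_at_point:
  fixes Z :: "'a::field mat2 set"
  assumes x: "x \<in> Z"
  shows "maximalideal (quotient_map_on n Z x) (inv_ring n Z)"
proof -
  interpret R: cring "inv_ring n Z" by (rule cring_inv_ring)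
  let ?M = "quotient_map_on n Z x"
  have M: "f \<in> ?M \<longleftrightarrow> f \<in> carrier (inv_ring n Z) \<and> f x = 0" for f
    unfolding quotient_map_on_def by simp
  have neg: "(\<lambda>y\<in>Z. (\<lambda>y\<in>Z. - 1) y * f y) \<in> carrier (inv_ring n Z)" if "f \<in> carrier (inv_ring n Z)" for f :: "'a mat2 \<Rightarrow> 'a"
    by (rule inv_ring_closed(2)[OF inv_ring_const that])
  have neg_eq: "\<ominus>\<^bsub>inv_ring n Z\<^esub> f = (\<lambda>y\<in>Z. (\<lambda>y\<in>Z. - 1) y * f y)" if f: "f \<in> carrier (inv_ring n Z)" for f
  proof (rule R.minus_equality[OF _ f neg[OF f]])
    show "(\<lambda>y\<in>Z. (\<lambda>y\<in>Z. - 1) y * f y) \<oplus>\<^bsub>inv_ring n Z\<^esub> f = \<zero>\<^bsub>inv_ring n Z\<^esub>"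
      unfolding inv_ring_ops by (rule restrict_ext) simp
  qed
  have "ideal ?M (inv_ring n Z)"
  proof (rule idealI)
    show "ring (inv_ring n Z)" by (rule R.ring_axioms)
    show "subgroup ?M (add_monoid (inv_ring n Z))"
    proof (rule R.add.subgroupI)
      show "?M \<subseteq> carrier (inv_ring n Z)" using M by blast
      have "(\<lambda>x\<in>Z. 0) \<in> ?M" unfolding M using inv_ring_const x by simp
      then show "?M \<noteq> {}" by blast
      fix f assume f: "f \<in> ?M"
      then show "\<ominus>\<^bsub>inv_ring n Z\<^esub> f \<in> ?M"
        using neg_eq[of f] neg[of f] x unfolding M by simp
      fix g assume "g \<in> ?M"
      with f show "f \<oplus>\<^bsub>inv_ring n Z\<^esub> g \<in> ?M"
        unfolding M inv_ring_ops using inv_ring_closed(1)[of f n Z g] x by simp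
    qed
    fix f g assume f: "f \<in> ?M" and g: "g \<in> carrier (inv_ring n Z)"
    then show "g \<otimes>\<^bsub>inv_ring n Z\<^esub> f \<in> ?M" "f \<otimes>\<^bsub>inv_ring n Z\<^esub> g \<in> ?M"
      unfolding M inv_ring_ops using inv_ring_closed(2)[of f n Z g] inv_ring_closed(2)[of g n Z f] x
      by simp_all
  qed
  then show ?thesis
  proof (rule maximalidealI)
    have "(\<lambda>x\<in>Z. 1) \<notin> ?M" unfolding M using x by simp
    then show "carrier (inv_ring n Z) \<noteq> ?M" using inv_ring_const by blast
    fix J assume J: "ideal J (inv_ring n Z)" "?M \<subseteq> J"
    note I = inv_ring_ideal[OF J(1)]
    show "J = ?M \<or> J = carrier (inv_ring n Z)"
    proof (cases "J = ?M")
      case False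
      then obtain g where g: "g \<in> J" "g \<notin> ?M" using J(2) by blast
      then have gx: "g \<in> carrier (inv_ring n Z)" "g x \<noteq> 0" using I(1) M by blast+
      have "f \<in> J" if f: "f \<in> carrier (inv_ring n Z)" for f
      proof -
        define c where "c = f x / g x"
        define g' where "g' = (\<lambda>y\<in>Z. (\<lambda>y\<in>Z. c) y * g y)"
        have g': "g' \<in> J" unfolding g'_def by (rule I(4)[OF g(1) inv_ring_const])
        define h where "h = (\<lambda>y\<in>Z. f y + (\<lambda>y\<in>Z. (\<lambda>y\<in>Z. - 1) y * g' y) y)"
        have "h \<in> carrier (inv_ring n Z)" unfolding h_def by (rule inv_ring_closed(1)[OF f neg[OF I(1)[OF g']]])
        moreover have "h x = 0" using x gx by (simp add: h_def g'_def c_def)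
        ultimately have "h \<in> J" using J(2) M by blast
        from I(3)[OF this g'] have "(\<lambda>y\<in>Z. h y + g' y) \<in> J" .
        also have "(\<lambda>y\<in>Z. h y + g' y) = restrict f Z" by (rule restrict_ext) (simp add: h_def)
        finally show "f \<in> J" using inv_ring_ext[OF f] by simp
      qed
      then show ?thesis using I(1) by blast
    qed simp
  qed
qed

text \<open>A family \<open>\<phi>\<close> of points of \<open>Z\<close> with polynomial entries whose parameters are integral over the pulled back invariants.
  The invariants then separate the parameters up to finitely many choices, and the image of \<open>\<phi>\<close> in the quotient of \<open>Z\<close> is
  closed, irreducible and of dimension \<open>N\<close>.\<close>

locale quotient_param =
  fixes n :: nat and Z :: "'a::{alg_closed_field, field_char_0} mat2 set"
    and \<phi> :: "(nat \<Rightarrow> 'a) \<Rightarrow> 'a mat2" and N :: nat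
  assumes \<phi>Z: "\<phi> v \<in> Z"
    and poly: "f \<in> polyfun n \<Longrightarrow> (\<lambda>v. f (\<phi> v)) \<in> mpfun N"
    and int: "i < N \<Longrightarrow> integral_over ((\<lambda>f v. f (\<phi> v)) ` carrier (inv_ring n Z)) (var i)"
begin

abbreviation "T \<equiv> (\<lambda>f v. f (\<phi> v)) ` carrier (inv_ring n Z)"

lemma subring_T: "unital_subring T" "T \<subseteq> mpfun N" "(\<lambda>_. c) \<in> T"
proof -
  have const: "(\<lambda>_. c) \<in> T" for c
    using \<phi>Z by (intro image_eqI[of _ _ "\<lambda>x\<in>Z. c"] inv_ring_const) simp
  then show "(\<lambda>_. c) \<in> T" .
  have add: "f + g \<in> T" and mult: "f * g \<in> T" if "f \<in> T" "g \<in> T" for f g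
  proof -
    obtain f' g' where f': "f' \<in> carrier (inv_ring n Z)" "f = (\<lambda>v. f' (\<phi> v))"
      and g': "g' \<in> carrier (inv_ring n Z)" "g = (\<lambda>v. g' (\<phi> v))" using \<open>f \<in> T\<close> \<open>g \<in> T\<close> by blast
    show "f + g \<in> T"
      by (rule image_eqI[OF _ inv_ring_closed(1)[OF f'(1) g'(1)]]) (simp add: f' g' \<phi>Z fun_eq_iff)
    show "f * g \<in> T"
      by (rule image_eqI[OF _ inv_ring_closed(2)[OF f'(1) g'(1)]]) (simp add: f' g' \<phi>Z fun_eq_iff)
  qed
  have "1 \<in> T" using const[of 1] by (simp only: one_fun_def)
  moreover have "- f \<in> T" if "f \<in> T" for f
  proof -
    have "- f = (\<lambda>_. - 1) * f" by (rule ext) simp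
    then show ?thesis using mult[OF const that] by metis
  qed
  ultimately show "unital_subring T" unfolding unital_subring_def using add mult by blast
  show "T \<subseteq> mpfun N"
  proof
    fix h assume "h \<in> T"
    then obtain f where f: "h = (\<lambda>v. f (\<phi> v))" "f \<in> carrier (inv_ring n Z)" by blast
    from f(2) have "\<exists>g\<in>polyfun n. f = restrict g Z" unfolding inv_ring_carrier by (rule conjunct1)
    then obtain g where "g \<in> polyfun n" "f = restrict g Z" ..
    with f(1) show "h \<in> mpfun N" using poly[of g] \<phi>Z by simp
  qed
qed

text \<open>Thanks to the hypothesis \<open>K\<close> the pulled back ideal is proper: if \<open>f\<close> is the constant \<open>1\<close> along the family, \<open>1 - f\<close> vanishes
  there and is in \<open>M\<close>. So \<open>common_zero_of_proper_ideal\<close> applies.\<close>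

lemma zero_of_ideal:
  assumes M: "ideal M (inv_ring n Z)" "M \<noteq> carrier (inv_ring n Z)"
    and K: "\<And>f. f \<in> carrier (inv_ring n Z) \<Longrightarrow> (\<And>v. f (\<phi> v) = 0) \<Longrightarrow> f \<in> M"
  shows "\<exists>v. M \<subseteq> quotient_map_on n Z (\<phi> v)"
proof -
  note I = inv_ring_ideal[OF M(1)]
  interpret M: ideal M "inv_ring n Z" by (rule M(1))
  have one: "(\<lambda>x\<in>Z. 1) \<notin> M"
    using M.one_imp_carrier M(2) by (simp only: inv_ring_ops) blast
  let ?J = "(\<lambda>f v. f (\<phi> v)) ` M"
  have "ideal_in T ?J"
    unfolding ideal_in_def
  proof (intro conjI ballI)
    show "?J \<subseteq> T" using I(1) by blast
    show "0 \<in> ?J" by (rule image_eqI[OF _ I(2)]) (simp add: fun_eq_iff \<phi>Z)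
    fix h assume "h \<in> ?J"
    then obtain f where f: "f \<in> M" "h = (\<lambda>v. f (\<phi> v))" by blast
    show "h + h' \<in> ?J" if h': "h' \<in> ?J" for h'
    proof -
      obtain g where g: "g \<in> M" "h' = (\<lambda>v. g (\<phi> v))" using h' by blast
      show ?thesis by (rule image_eqI[OF _ I(3)[OF f(1) g(1)]]) (simp add: f g \<phi>Z fun_eq_iff)
    qed
    show "h' * h \<in> ?J" if h': "h' \<in> T" for h'
    proof -
      obtain g where g: "g \<in> carrier (inv_ring n Z)" "h' = (\<lambda>v. g (\<phi> v))" using h' by blast
      show ?thesis by (rule image_eqI[OF _ I(4)[OF f(1) g(1)]]) (simp add: f g \<phi>Z fun_eq_iff)
    qed
  qed
  moreover have "1 \<notin> ?J"
  proof
    assume "1 \<in> ?J"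
    then obtain f where f: "f \<in> M" "1 = (\<lambda>v. f (\<phi> v))" by blast
    have f1: "f (\<phi> v) = 1" for v using fun_cong[OF f(2), of v] by simp
    define g where "g = (\<lambda>x\<in>Z. (\<lambda>x\<in>Z. 1) x + (\<lambda>x\<in>Z. (\<lambda>x\<in>Z. - 1) x * f x) x)"
    have "g \<in> carrier (inv_ring n Z)"
      unfolding g_def by (intro inv_ring_closed inv_ring_const I(1)[OF f(1)])
    moreover have "g (\<phi> v) = 0" for v using f1 \<phi>Z by (simp add: g_def)
    ultimately have "g \<in> M" by (rule K)
    from I(3)[OF this f(1)] have "(\<lambda>x\<in>Z. g x + f x) \<in> M" .
    also have "(\<lambda>x\<in>Z. g x + f x) = (\<lambda>x\<in>Z. 1)" by (rule restrict_ext) (simp add: g_def)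
    finally show False using one by contradiction
  qed
  ultimately obtain v where v: "\<forall>h\<in>?J. h v = 0"
    using common_zero_of_proper_ideal[OF subring_T(1,2,3) int] by blast
  have "M \<subseteq> quotient_map_on n Z (\<phi> v)"
  proof
    fix f assume f: "f \<in> M"
    with v have "f (\<phi> v) = 0" by fast
    then show "f \<in> quotient_map_on n Z (\<phi> v)" unfolding quotient_map_on_def using I(1)[OF f] by simp
  qed
  then show ?thesis by (intro exI[of _ v])
qed

lemma maximal_above_kernel:
  assumes M: "maximalideal M (inv_ring n Z)"
    and K: "\<And>f. f \<in> carrier (inv_ring n Z) \<Longrightarrow> (\<And>v. f (\<phi> v) = 0) \<Longrightarrow> f \<in> M"
  shows "\<exists>v. M = quotient_map_on n Z (\<phi> v)"
proof -
  interpret M: maximalideal M "inv_ring n Z" by (rule M)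
  obtain v where v: "M \<subseteq> quotient_map_on n Z (\<phi> v)"
    using zero_of_ideal[OF M.ideal_axioms _ K] M.I_notcarr by metis
  interpret V: maximalideal "quotient_map_on n Z (\<phi> v)" "inv_ring n Z"
    by (rule maximalideal_at_point[OF \<phi>Z])
  have "quotient_map_on n Z (\<phi> v) = M"
    using M.I_maximal[OF V.ideal_axioms v] V.I_notcarr V.a_subset by blast
  then show ?thesis by blast
qed

definition points :: "('a mat2 \<Rightarrow> 'a) set set" where
  "points = range (\<lambda>v. quotient_map_on n Z (\<phi> v))"

lemma points_iff:
  "M \<in> points \<longleftrightarrow> maximalideal M (inv_ring n Z) \<and> {f \<in> carrier (inv_ring n Z). \<forall>v. f (\<phi> v) = 0} \<subseteq> M"
proof
  assume "M \<in> points"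
  then show "maximalideal M (inv_ring n Z) \<and> {f \<in> carrier (inv_ring n Z). \<forall>v. f (\<phi> v) = 0} \<subseteq> M"
    unfolding points_def using maximalideal_at_point[OF \<phi>Z] by (auto simp: quotient_map_on_def)
next
  assume "maximalideal M (inv_ring n Z) \<and> {f \<in> carrier (inv_ring n Z). \<forall>v. f (\<phi> v) = 0} \<subseteq> M"
  then show "M \<in> points" unfolding points_def using maximal_above_kernel[of M] by auto
qed

lemma topspace_git_quotient: "topspace (git_quotient n Z) = {M. maximalideal M (inv_ring n Z)}"
proof -
  note o = openin_specmax[OF cring_inv_ring, of n Z]
  have "openin (specmax (inv_ring n Z)) {M. maximalideal M (inv_ring n Z)}"
  proof -
    have "\<not> {\<lambda>x\<in>Z. 1} \<subseteq> M" if "maximalideal M (inv_ring n Z)" for M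
    proof -
      interpret M: maximalideal M "inv_ring n Z" by (rule that)
      show ?thesis using M.one_imp_carrier M.I_notcarr by (auto simp: inv_ring_ops)
    qed
    then show ?thesis unfolding o using inv_ring_const[of 1 Z n]
      by (intro exI[of _ "{\<lambda>x\<in>Z. 1}"]) auto
  qed
  moreover have "U \<subseteq> {M. maximalideal M (inv_ring n Z)}" if "openin (specmax (inv_ring n Z)) U" for U
    using that unfolding o by blast
  ultimately show ?thesis unfolding git_quotient_def topspace_def by blast
qed

lemma closedin_git_quotient:
  "closedin (git_quotient n Z) C \<longleftrightarrow>
    (\<exists>S\<subseteq>carrier (inv_ring n Z). C = {M. maximalideal M (inv_ring n Z) \<and> S \<subseteq> M})"
proof -
  note o = openin_specmax[OF cring_inv_ring, of n Z]
  have eq: "{M. maximalideal M (inv_ring n Z)} - C = {M. maximalideal M (inv_ring n Z) \<and> \<not> S \<subseteq> M} \<longleftrightarrow>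
      C = {M. maximalideal M (inv_ring n Z) \<and> S \<subseteq> M}" if "C \<subseteq> {M. maximalideal M (inv_ring n Z)}" for S
    using that by blast
  show ?thesis
    unfolding closedin_def topspace_git_quotient
    unfolding git_quotient_def o
    using eq by (intro iffI; elim conjE exE; blast)
qed

lemma closedin_points: "closedin (git_quotient n Z) points"
  unfolding closedin_git_quotient
  by (intro exI[of _ "{f \<in> carrier (inv_ring n Z). \<forall>v. f (\<phi> v) = 0}"]) (auto simp: points_iff)

sublocale integral_parametrization "subtopology (git_quotient n Z) points"
  "\<lambda>v. quotient_map_on n Z (\<phi> v)" N T
proof
  have sub: "points \<subseteq> topspace (git_quotient n Z)"
    unfolding topspace_git_quotient using points_iff by blast
  then show "topspace (subtopology (git_quotient n Z) points) = range (\<lambda>v. quotient_map_on n Z (\<phi> v))"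
    unfolding points_def by auto
  show "g v = g w" if g: "g \<in> T" and eq: "quotient_map_on n Z (\<phi> v) = quotient_map_on n Z (\<phi> w)" for g v w
  proof -
    obtain f where f: "f \<in> carrier (inv_ring n Z)" "g = (\<lambda>v. f (\<phi> v))" using g by blast
    define h where "h = (\<lambda>x\<in>Z. f x + (\<lambda>x\<in>Z. - f (\<phi> v)) x)"
    have "h \<in> carrier (inv_ring n Z)" unfolding h_def by (rule inv_ring_closed(1)[OF f(1) inv_ring_const])
    moreover have "h (\<phi> v) = 0" using \<phi>Z by (simp add: h_def)
    ultimately have "h \<in> quotient_map_on n Z (\<phi> w)" unfolding eq[symmetric] by (simp add: quotient_map_on_def)
    then show ?thesis using \<phi>Z f(2) by (simp add: h_def quotient_map_on_def)
  qed
  fix C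
  have mem: "quotient_map_on n Z (\<phi> v) \<in> points" for v unfolding points_def by blast
  show "closedin (subtopology (git_quotient n Z) points) C \<longleftrightarrow>
      C \<subseteq> range (\<lambda>v. quotient_map_on n Z (\<phi> v)) \<and>
      (\<exists>F\<subseteq>T. \<forall>v. (quotient_map_on n Z (\<phi> v) \<in> C) = (\<forall>g\<in>F. g v = 0))" (is "?l \<longleftrightarrow> ?r")
  proof
    assume ?l
    then obtain S where S: "S \<subseteq> carrier (inv_ring n Z)"
      "C = {M. maximalideal M (inv_ring n Z) \<and> S \<subseteq> M} \<inter> points"
      unfolding closedin_subtopology closedin_git_quotient by blast
    have "(quotient_map_on n Z (\<phi> v) \<in> C) = (\<forall>g\<in>(\<lambda>f v. f (\<phi> v)) ` S. g v = 0)" for v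
      using S(1) mem[of v] maximalideal_at_point[OF \<phi>Z, of n v] unfolding S(2)
      by (auto simp: quotient_map_on_def)
    moreover have "(\<lambda>f v. f (\<phi> v)) ` S \<subseteq> T" using S(1) by blast
    moreover have "C \<subseteq> range (\<lambda>v. quotient_map_on n Z (\<phi> v))" using S(2) unfolding points_def by blast
    ultimately show ?r by blast
  next
    assume ?r
    then obtain F where F: "F \<subseteq> T" "\<And>v. (quotient_map_on n Z (\<phi> v) \<in> C) = (\<forall>g\<in>F. g v = 0)"
      and C: "C \<subseteq> range (\<lambda>v. quotient_map_on n Z (\<phi> v))" by blast
    define S where "S = {f \<in> carrier (inv_ring n Z). (\<lambda>v. f (\<phi> v)) \<in> F}"
    have "(\<forall>g\<in>F. g v = 0) \<longleftrightarrow> S \<subseteq> quotient_map_on n Z (\<phi> v)" for v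
    proof
      assume *: "\<forall>g\<in>F. g v = 0"
      show "S \<subseteq> quotient_map_on n Z (\<phi> v)"
      proof
        fix f assume "f \<in> S"
        then have "f \<in> carrier (inv_ring n Z)" "(\<lambda>v. f (\<phi> v)) \<in> F" unfolding S_def by simp_all
        with * show "f \<in> quotient_map_on n Z (\<phi> v)" unfolding quotient_map_on_def by fast
      qed
    next
      assume *: "S \<subseteq> quotient_map_on n Z (\<phi> v)"
      show "\<forall>g\<in>F. g v = 0"
      proof
        fix g assume g: "g \<in> F"
        then obtain f where f: "f \<in> carrier (inv_ring n Z)" "g = (\<lambda>v. f (\<phi> v))" using F(1) by blast
        then have "f \<in> S" unfolding S_def using g by simp
        with * have "f \<in> quotient_map_on n Z (\<phi> v)" by (rule subsetD)
        then show "g v = 0" unfolding f(2) quotient_map_on_def by simp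
      qed
    qed
    then have eq: "quotient_map_on n Z (\<phi> v) \<in> C \<longleftrightarrow> S \<subseteq> quotient_map_on n Z (\<phi> v)" for v
      by (simp only: F(2))
    have "C = {M. maximalideal M (inv_ring n Z) \<and> S \<subseteq> M} \<inter> points"
    proof (intro equalityI subsetI)
      fix M assume "M \<in> C"
      then obtain v where v: "M = quotient_map_on n Z (\<phi> v)" using C by blast
      show "M \<in> {M. maximalideal M (inv_ring n Z) \<and> S \<subseteq> M} \<inter> points"
        using eq[of v] \<open>M \<in> C\<close> mem[of v] maximalideal_at_point[OF \<phi>Z, of n v] unfolding v by simp
    next
      fix M assume "M \<in> {M. maximalideal M (inv_ring n Z) \<and> S \<subseteq> M} \<inter> points"
      then obtain v where "M = quotient_map_on n Z (\<phi> v)" "S \<subseteq> M" unfolding points_def by blast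
      then show "M \<in> C" using eq[of v] by simp
    qed
    moreover have "S \<subseteq> carrier (inv_ring n Z)" unfolding S_def by blast
    ultimately show ?l unfolding closedin_subtopology closedin_git_quotient by blast
  qed
qed (use subring_T int in auto)

lemma irreducible_points: "irreducible_in (git_quotient n Z) points"
proof -
  have sub: "points \<subseteq> topspace (git_quotient n Z)"
    unfolding topspace_git_quotient using points_iff by blast
  then have top: "topspace (subtopology (git_quotient n Z) points) = points" by auto
  show ?thesis
    unfolding irreducible_in_def
  proof (intro conjI allI impI)
    show "points \<noteq> {}" unfolding points_def by blast
    fix C D assume "closedin (git_quotient n Z) C" "closedin (git_quotient n Z) D" "points \<subseteq> C \<union> D"
    then have "closedin (subtopology (git_quotient n Z) points) (C \<inter> points)"
      "closedin (subtopology (git_quotient n Z) points) (D \<inter> points)" "points \<subseteq> (C \<inter> points) \<union> (D \<inter> points)"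
      unfolding closedin_subtopology by blast+
    then show "points \<subseteq> C \<or> points \<subseteq> D"
      using irreducible_topspace unfolding irreducible_in_def top by blast
  qed (rule sub)
qed

end

text \<open>An invariant function that vanishes on all the parametrized points is zero; multiplying elements of the
  kernels outside \<open>M\<close> shows that a maximal ideal contains one of the kernels.\<close>

lemma maximal_ideals_are_points:
  fixes Z :: "'a::{alg_closed_field, field_char_0} mat2 set"
  assumes fin: "finite I" and par: "\<And>t. t \<in> I \<Longrightarrow> quotient_param n Z (\<phi> t) (N t)"
    and dense: "\<And>f x. f \<in> carrier (inv_ring n Z) \<Longrightarrow> x \<in> Z \<Longrightarrow> (\<And>t v. t \<in> I \<Longrightarrow> f (\<phi> t v) = 0) \<Longrightarrow> f x = 0"
    and M: "maximalideal M (inv_ring n Z)"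
  shows "\<exists>t\<in>I. \<exists>v. M = quotient_map_on n Z (\<phi> t v)"
proof -
  interpret R: cring "inv_ring n Z" by (rule cring_inv_ring)
  interpret M: maximalideal M "inv_ring n Z" by (rule M)
  interpret P: primeideal M "inv_ring n Z" by (rule R.maximalideal_prime[OF M])
  have "\<exists>t\<in>I. \<forall>f\<in>carrier (inv_ring n Z). (\<forall>v. f (\<phi> t v) = 0) \<longrightarrow> f \<in> M"
  proof (rule ccontr)
    assume "\<not> ?thesis"
    then have "\<forall>t\<in>I. \<exists>f. f \<in> carrier (inv_ring n Z) \<and> (\<forall>v. f (\<phi> t v) = 0) \<and> f \<notin> M" by blast
    from bchoice[OF this] obtain F where
      F: "\<forall>t\<in>I. F t \<in> carrier (inv_ring n Z) \<and> (\<forall>v. F t (\<phi> t v) = 0) \<and> F t \<notin> M" ..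
    have "\<exists>g\<in>carrier (inv_ring n Z). g \<notin> M \<and> (\<forall>t\<in>J. \<forall>v. \<phi> t v \<in> Z \<longrightarrow> g (\<phi> t v) = 0)" if "J \<subseteq> I" for J
      using finite_subset[OF that fin] that
    proof (induction J rule: finite_induct)
      case empty
      have "\<one>\<^bsub>inv_ring n Z\<^esub> \<notin> M" using M.one_imp_carrier M.I_notcarr by auto
      then show ?case using R.one_closed by blast
    next
      case (insert t J)
      then obtain g where g: "g \<in> carrier (inv_ring n Z)" "g \<notin> M"
        "\<forall>t\<in>J. \<forall>v. \<phi> t v \<in> Z \<longrightarrow> g (\<phi> t v) = 0" by blast
      have t: "F t \<in> carrier (inv_ring n Z)" "\<forall>v. F t (\<phi> t v) = 0" "F t \<notin> M" using F insert.prems by blast+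
      have "F t \<otimes>\<^bsub>inv_ring n Z\<^esub> g \<notin> M" using P.I_prime[OF t(1) g(1)] t(3) g(2) by blast
      moreover have "\<forall>s\<in>insert t J. \<forall>v. \<phi> s v \<in> Z \<longrightarrow> (F t \<otimes>\<^bsub>inv_ring n Z\<^esub> g) (\<phi> s v) = 0"
        using g(3) t(2) by (simp add: inv_ring_ops)
      ultimately show ?case using R.m_closed[OF t(1) g(1)] by blast
    qed
    from this[OF order_refl] obtain g where g: "g \<in> carrier (inv_ring n Z)" "g \<notin> M"
        "\<forall>t\<in>I. \<forall>v. \<phi> t v \<in> Z \<longrightarrow> g (\<phi> t v) = 0" by blast
    have "g (\<phi> t v) = 0" if "t \<in> I" for t v
      using g(3) that quotient_param.\<phi>Z[OF par[OF that]] by blast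
    then have "g x = 0" if "x \<in> Z" for x using dense[OF g(1) that] by blast
    then have "restrict g Z = (\<lambda>x\<in>Z. 0)" by (intro restrict_ext) simp
    then have "g = \<zero>\<^bsub>inv_ring n Z\<^esub>" using inv_ring_ext[OF g(1)] by (simp only: inv_ring_ops)
    then show False using g(2) additive_subgroup.zero_closed[OF M.is_additive_subgroup] by simp
  qed
  then obtain t where t: "t \<in> I" "\<And>f. f \<in> carrier (inv_ring n Z) \<Longrightarrow> (\<And>v. f (\<phi> t v) = 0) \<Longrightarrow> f \<in> M" by blast
  have "\<exists>v. M = quotient_map_on n Z (\<phi> t v)"
    by (rule quotient_param.maximal_above_kernel[OF par[OF t(1)] M t(2)])
  then show ?thesis using t(1) by blast
qed


section \<open>Closures of unions of orbits\<close>

text \<open>The inverse of the conjugating matrix is a separate argument, so that conjugation is visibly polynomial in the pair and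
  both can be given explicitly.\<close>

definition conj2 :: "'a::semiring_1 mat \<Rightarrow> 'a mat \<Rightarrow> 'a mat2 \<Rightarrow> 'a mat2" where
  "conj2 P Q x = (P * fst x * Q, P * snd x * Q)"

definition inverse_pair :: "nat \<Rightarrow> 'a::semiring_1 mat \<Rightarrow> 'a mat \<Rightarrow> bool" where
  "inverse_pair n P Q \<longleftrightarrow> P \<in> carrier_mat n n \<and> Q \<in> carrier_mat n n \<and> P * Q = 1\<^sub>m n \<and> Q * P = 1\<^sub>m n"

lemma conj2_carrier:
  "inverse_pair n P Q \<Longrightarrow> x \<in> mat2_space n \<Longrightarrow> conj2 P Q x \<in> mat2_space n"
  unfolding conj2_def inverse_pair_def by (auto simp: mem_Times_iff)

lemma in_gl_orbit:
  assumes x: "x \<in> mat2_space n"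
  shows "y \<in> gl_orbit n x \<longleftrightarrow> (\<exists>P Q. inverse_pair n P Q \<and> y = conj2 P Q x)"
proof
  assume "y \<in> gl_orbit n x"
  then obtain P Q where y: "y \<in> mat2_space n"
    and s: "similar_mat_wit (fst y) (fst x) P Q" "similar_mat_wit (snd y) (snd x) P Q"
    unfolding gl_orbit_def by blast
  have dims: "dim_row (fst y) = n" "dim_row (snd y) = n" using y by (auto simp: mem_Times_iff)
  have "inverse_pair n P Q" "y = conj2 P Q x"
    using s dims unfolding similar_mat_wit_def Let_def inverse_pair_def conj2_def by (auto simp: prod_eq_iff)
  then show "\<exists>P Q. inverse_pair n P Q \<and> y = conj2 P Q x" by blast
next
  assume "\<exists>P Q. inverse_pair n P Q \<and> y = conj2 P Q x"
  then obtain P Q where PQ: "inverse_pair n P Q" "y = conj2 P Q x" by blast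
  have "y \<in> mat2_space n" unfolding PQ(2) by (rule conj2_carrier[OF PQ(1) x])
  moreover have "similar_mat_wit (fst y) (fst x) P Q" "similar_mat_wit (snd y) (snd x) P Q"
    using PQ x unfolding similar_mat_wit_def Let_def inverse_pair_def conj2_def by (auto simp: mem_Times_iff)
  ultimately show "y \<in> gl_orbit n x" unfolding gl_orbit_def by blast
qed

lemma conj2_compose:
  assumes "inverse_pair n P Q" "inverse_pair n P' Q'" "x \<in> mat2_space n"
  shows "conj2 P Q (conj2 P' Q' x) = conj2 (P * P') (Q' * Q) x"
    and "inverse_pair n (P * P') (Q' * Q)"
proof -
  have c: "P \<in> carrier_mat n n" "Q \<in> carrier_mat n n" "P' \<in> carrier_mat n n" "Q' \<in> carrier_mat n n"
    and e: "P * Q = 1\<^sub>m n" "Q * P = 1\<^sub>m n" "P' * Q' = 1\<^sub>m n" "Q' * P' = 1\<^sub>m n"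
    and x: "fst x \<in> carrier_mat n n" "snd x \<in> carrier_mat n n"
    using assms unfolding inverse_pair_def by (auto simp: mem_Times_iff)
  have m: "P * (P' * M * Q') * Q = (P * P') * M * (Q' * Q)" if "M \<in> carrier_mat n n" for M
    using c that by (simp add: assoc_mult_mat[of _ n n _ n _ n])
  show "conj2 P Q (conj2 P' Q' x) = conj2 (P * P') (Q' * Q) x"
    unfolding conj2_def using m[OF x(1)] m[OF x(2)] by simp
  have "(P * P') * (Q' * Q) = P * (P' * Q') * Q" using c by (simp add: assoc_mult_mat[of _ n n _ n _ n])
  moreover have "(Q' * Q) * (P * P') = Q' * (Q * P) * P'" using c by (simp add: assoc_mult_mat[of _ n n _ n _ n])
  ultimately show "inverse_pair n (P * P') (Q' * Q)"
    unfolding inverse_pair_def using c e by simp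
qed

lemma gl_orbit_refl: "x \<in> mat2_space n \<Longrightarrow> x \<in> gl_orbit n x"
proof -
  assume x: "x \<in> mat2_space n"
  have "inverse_pair n (1\<^sub>m n) (1\<^sub>m n :: 'a mat)" unfolding inverse_pair_def by simp
  moreover have "x = conj2 (1\<^sub>m n) (1\<^sub>m n) x" using x unfolding conj2_def by (auto simp: mem_Times_iff prod_eq_iff)
  ultimately show ?thesis unfolding in_gl_orbit[OF x] by blast
qed

lemma gl_orbit_space: "y \<in> gl_orbit n x \<Longrightarrow> y \<in> mat2_space n"
  unfolding gl_orbit_def by blast

lemma gl_orbit_trans:
  assumes "x \<in> mat2_space n" "y \<in> gl_orbit n x" "z \<in> gl_orbit n y"
  shows "z \<in> gl_orbit n x"
proof -
  obtain P Q where y: "inverse_pair n P Q" "y = conj2 P Q x" using assms(2) in_gl_orbit[OF assms(1)] by blast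
  obtain P' Q' where z: "inverse_pair n P' Q'" "z = conj2 P' Q' y"
    using assms(3) in_gl_orbit[OF gl_orbit_space[OF assms(2)]] by blast
  show ?thesis
    unfolding in_gl_orbit[OF assms(1)] z(2) y(2)
    using conj2_compose[OF z(1) y(1) assms(1)] by blast
qed

text \<open>Functions that agree with a polynomial function on the matrices of size \<open>n\<close>. Identities between matrix entries hold only there.\<close>

definition poly_on :: "nat \<Rightarrow> ('a::comm_ring_1 mat2 \<Rightarrow> 'a) \<Rightarrow> bool" where
  "poly_on n F \<longleftrightarrow> (\<exists>g\<in>polyfun n. \<forall>x\<in>mat2_space n. F x = g x)"

lemma poly_on_const: "poly_on n (\<lambda>_. c)"
  unfolding poly_on_def using polyfun.const[of c n] by (intro bexI[of _ "\<lambda>_. c"]) simp_all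

lemma poly_on_add: "poly_on n F \<Longrightarrow> poly_on n G \<Longrightarrow> poly_on n (\<lambda>x. F x + G x)"
proof -
  assume "poly_on n F" "poly_on n G"
  then obtain f g where "f \<in> polyfun n" "g \<in> polyfun n"
    and eq: "\<forall>x\<in>mat2_space n. F x = f x" "\<forall>x\<in>mat2_space n. G x = g x"
    unfolding poly_on_def by (elim bexE)
  then have "(\<lambda>x. f x + g x) \<in> polyfun n" by (intro polyfun.add)
  with eq show ?thesis unfolding poly_on_def by (intro bexI[of _ "\<lambda>x. f x + g x"]) simp_all
qed

lemma poly_on_mult: "poly_on n F \<Longrightarrow> poly_on n G \<Longrightarrow> poly_on n (\<lambda>x. F x * G x)"
proof -
  assume "poly_on n F" "poly_on n G"
  then obtain f g where "f \<in> polyfun n" "g \<in> polyfun n"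
    and eq: "\<forall>x\<in>mat2_space n. F x = f x" "\<forall>x\<in>mat2_space n. G x = g x"
    unfolding poly_on_def by (elim bexE)
  then have "(\<lambda>x. f x * g x) \<in> polyfun n" by (intro polyfun.mult)
  with eq show ?thesis unfolding poly_on_def by (intro bexI[of _ "\<lambda>x. f x * g x"]) simp_all
qed

lemma poly_on_sum: "(\<And>i. i \<in> I \<Longrightarrow> poly_on n (F i)) \<Longrightarrow> poly_on n (\<lambda>x. \<Sum>i\<in>I. F i x)"
proof (induction I rule: infinite_finite_induct)
  case (insert i I)
  have "poly_on n (\<lambda>x. F i x + (\<Sum>i\<in>I. F i x))" by (rule poly_on_add) (use insert in simp_all)
  then show ?case using insert.hyps by simp
qed (simp_all add: poly_on_const)

lemma poly_on_coord:
  assumes "i < n" "j < n"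
  shows "poly_on n (\<lambda>x. fst x $$ (i, j))" "poly_on n (\<lambda>x. snd x $$ (i, j))"
proof -
  show "poly_on n (\<lambda>x. fst x $$ (i, j))" unfolding poly_on_def
    by (rule bexI[OF _ polyfun.coord1[OF assms]]) (simp add: split_beta)
  show "poly_on n (\<lambda>x. snd x $$ (i, j))" unfolding poly_on_def
    by (rule bexI[OF _ polyfun.coord2[OF assms]]) (simp add: split_beta)
qed

lemma poly_on_cong: "poly_on n F \<Longrightarrow> (\<And>x. x \<in> mat2_space n \<Longrightarrow> G x = F x) \<Longrightarrow> poly_on n G"
  unfolding poly_on_def by (elim bexE, rule bexI) simp_all

definition poly_map :: "nat \<Rightarrow> nat \<Rightarrow> ('a::comm_ring_1 mat2 \<Rightarrow> 'a mat2) \<Rightarrow> bool" where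
  "poly_map n n' h \<longleftrightarrow> (\<forall>x\<in>mat2_space n. h x \<in> mat2_space n') \<and>
     (\<forall>i<n'. \<forall>j<n'. poly_on n (\<lambda>x. fst (h x) $$ (i, j)) \<and> poly_on n (\<lambda>x. snd (h x) $$ (i, j)))"

lemma poly_map_comp:
  assumes h: "poly_map n n' h" and f: "f \<in> polyfun n'"
  shows "poly_on n (\<lambda>x. f (h x))"
  using f
proof induction
  case (const c)
  show ?case by (rule poly_on_const)
next
  case (coord1 i j)
  then have "poly_on n (\<lambda>x. fst (h x) $$ (i, j))" using h unfolding poly_map_def by simp
  then show ?case by (simp add: split_beta)
next
  case (coord2 i j)
  then have "poly_on n (\<lambda>x. snd (h x) $$ (i, j))" using h unfolding poly_map_def by simp
  then show ?case by (simp add: split_beta)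
next
  case (add f g)
  show ?case by (rule poly_on_add[OF add.IH])
next
  case (mult f g)
  show ?case by (rule poly_on_mult[OF mult.IH])
qed

text \<open>The Zariski closure of the union of the orbits of the points of \<open>S\<close>, in the space of all pairs of matrices.\<close>

definition orbit_closure :: "nat \<Rightarrow> 'a::comm_ring_1 mat2 set \<Rightarrow> 'a mat2 set" where
  "orbit_closure n S = {x \<in> mat2_space n.
     \<forall>f\<in>polyfun n. (\<forall>s\<in>S. \<forall>y\<in>gl_orbit n s. f y = 0) \<longrightarrow> f x = 0}"

lemma orbit_closure_space: "x \<in> orbit_closure n S \<Longrightarrow> x \<in> mat2_space n"
  unfolding orbit_closure_def by blast

lemma orbit_closureD:
  assumes "x \<in> orbit_closure n S" "poly_on n f" "\<And>s y. s \<in> S \<Longrightarrow> y \<in> gl_orbit n s \<Longrightarrow> f y = 0"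
  shows "f x = 0"
proof -
  obtain g where g: "g \<in> polyfun n" "\<And>x. x \<in> mat2_space n \<Longrightarrow> f x = g x"
    using assms(2) unfolding poly_on_def by blast
  have "g y = 0" if "s \<in> S" "y \<in> gl_orbit n s" for s y
    using assms(3)[OF that] g(2)[OF gl_orbit_space[OF that(2)]] by simp
  then have "g x = 0" using assms(1) g(1) unfolding orbit_closure_def by blast
  then show ?thesis using g(2)[OF orbit_closure_space[OF assms(1)]] by simp
qed

lemma orbit_closureI:
  assumes "x \<in> mat2_space n"
    "\<And>f. f \<in> polyfun n \<Longrightarrow> (\<And>s y. s \<in> S \<Longrightarrow> y \<in> gl_orbit n s \<Longrightarrow> f y = 0) \<Longrightarrow> f x = 0"
  shows "x \<in> orbit_closure n S"
  using assms unfolding orbit_closure_def by simp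

lemma polyfun_poly_on: "f \<in> polyfun n \<Longrightarrow> poly_on n f"
  unfolding poly_on_def by (intro bexI[of _ f]) simp_all

lemma orbit_in_closure: "s \<in> S \<Longrightarrow> y \<in> gl_orbit n s \<Longrightarrow> y \<in> orbit_closure n S"
  by (rule orbit_closureI) (auto intro: gl_orbit_space)

lemma closure_base: "S \<subseteq> mat2_space n \<Longrightarrow> s \<in> S \<Longrightarrow> s \<in> orbit_closure n S"
  by (rule orbit_in_closure[OF _ gl_orbit_refl]) auto

text \<open>Polynomial maps are continuous.\<close>

lemma orbit_closure_map:
  assumes h: "poly_map n n' h" and S: "\<And>s y. s \<in> S \<Longrightarrow> y \<in> gl_orbit n s \<Longrightarrow> h y \<in> orbit_closure n' S'"
    and x: "x \<in> orbit_closure n S"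
  shows "h x \<in> orbit_closure n' S'"
proof (rule orbit_closureI)
  show "h x \<in> mat2_space n'" using h orbit_closure_space[OF x] unfolding poly_map_def by blast
  fix f assume f: "f \<in> polyfun n'" "\<And>s y. s \<in> S' \<Longrightarrow> y \<in> gl_orbit n' s \<Longrightarrow> f y = 0"
  show "f (h x) = 0"
  proof (rule orbit_closureD[OF x poly_map_comp[OF h f(1)]])
    fix s y assume "s \<in> S" "y \<in> gl_orbit n s"
    from S[OF this] show "f (h y) = 0" by (rule orbit_closureD[OF _ polyfun_poly_on[OF f(1)] f(2)])
  qed
qed

lemma entry_triple_product:
  assumes "P \<in> carrier_mat n n" "M \<in> carrier_mat n n" "Q \<in> carrier_mat n n" "i < n" "j < n"
  shows "(P * M * Q) $$ (i, j) = (\<Sum>k<n. P $$ (i, k) * (\<Sum>l<n. M $$ (k, l) * Q $$ (l, j)))"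
  using assms by (simp add: scalar_prod_def lessThan_atLeast0)

lemma poly_map_conj2:
  assumes "inverse_pair n P Q" shows "poly_map n n (conj2 P Q)"
proof -
  have c: "P \<in> carrier_mat n n" "Q \<in> carrier_mat n n" using assms unfolding inverse_pair_def by auto
  have e: "poly_on n (\<lambda>x. \<Sum>k<n. P $$ (i, k) * (\<Sum>l<n. fst x $$ (k, l) * Q $$ (l, j)))"
    "poly_on n (\<lambda>x. \<Sum>k<n. P $$ (i, k) * (\<Sum>l<n. snd x $$ (k, l) * Q $$ (l, j)))" for i j
    by (intro poly_on_sum poly_on_mult poly_on_const poly_on_coord; simp)+
  show ?thesis unfolding poly_map_def
  proof (intro conjI allI impI ballI)
    show "conj2 P Q x \<in> mat2_space n" if "x \<in> mat2_space n" for x by (rule conj2_carrier[OF assms that])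
    fix i j assume ij: "i < n" "j < n"
    note t = entry_triple_product[OF c(1) _ c(2) ij]
    show "poly_on n (\<lambda>x. fst (conj2 P Q x) $$ (i, j))"
      by (rule poly_on_cong[OF e(1)[of i j]]) (simp add: conj2_def t mem_Times_iff)
    show "poly_on n (\<lambda>x. snd (conj2 P Q x) $$ (i, j))"
      by (rule poly_on_cong[OF e(2)[of i j]]) (simp add: conj2_def t mem_Times_iff)
  qed
qed

lemma orbit_closure_stable:
  assumes S: "S \<subseteq> mat2_space n" and x: "x \<in> orbit_closure n S" and y: "y \<in> gl_orbit n x"
  shows "y \<in> orbit_closure n S"
proof -
  obtain P Q where PQ: "inverse_pair n P Q" "y = conj2 P Q x"
    using y in_gl_orbit[OF orbit_closure_space[OF x]] by blast
  show ?thesis unfolding PQ(2)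
  proof (rule orbit_closure_map[OF poly_map_conj2[OF PQ(1)] _ x])
    fix s z assume s: "s \<in> S" and z: "z \<in> gl_orbit n s"
    have "s \<in> mat2_space n" using S s by blast
    moreover have "conj2 P Q z \<in> gl_orbit n z" using in_gl_orbit[OF gl_orbit_space[OF z]] PQ(1) by blast
    ultimately have "conj2 P Q z \<in> gl_orbit n s" using gl_orbit_trans[OF _ z] by blast
    then show "conj2 P Q z \<in> orbit_closure n S" by (rule orbit_in_closure[OF s])
  qed
qed

lemma orbit_closure_trans:
  assumes S': "S' \<subseteq> mat2_space n" and sub: "S \<subseteq> orbit_closure n S'" and x: "x \<in> orbit_closure n S"
  shows "x \<in> orbit_closure n S'"
proof (rule orbit_closureI)
  show "x \<in> mat2_space n" by (rule orbit_closure_space[OF x])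
  fix f assume f: "f \<in> polyfun n" "\<And>s y. s \<in> S' \<Longrightarrow> y \<in> gl_orbit n s \<Longrightarrow> f y = 0"
  show "f x = 0"
  proof (rule orbit_closureD[OF x polyfun_poly_on[OF f(1)]])
    fix s y assume "s \<in> S" "y \<in> gl_orbit n s"
    then have "y \<in> orbit_closure n S'" using orbit_closure_stable[OF S'] sub by blast
    then show "f y = 0" by (rule orbit_closureD[OF _ polyfun_poly_on[OF f(1)] f(2)])
  qed
qed

text \<open>A polynomial that vanishes at all but finitely many points of a line vanishes on it; this is how
  degenerations are produced.\<close>

lemma polyfun_curve:
  fixes f :: "'a::field_char_0 mat2 \<Rightarrow> 'a"
  assumes f: "f \<in> polyfun n"
    and \<psi>: "\<And>i j. i < n \<Longrightarrow> j < n \<Longrightarrow> \<exists>p. \<forall>s. fst (\<psi> s) $$ (i, j) = poly p s"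
      "\<And>i j. i < n \<Longrightarrow> j < n \<Longrightarrow> \<exists>p. \<forall>s. snd (\<psi> s) $$ (i, j) = poly p s"
    and fin: "finite {s. f (\<psi> s) \<noteq> 0}"
  shows "f (\<psi> s) = 0"
proof -
  have "\<exists>p. \<forall>s. f (\<psi> s) = poly p s"
    using f
  proof induction
    case (const c)
    show ?case by (intro exI[of _ "[:c:]"]) simp
  next
    case (coord1 i j)
    then show ?case using \<psi>(1) by (simp add: split_beta)
  next
    case (coord2 i j)
    then show ?case using \<psi>(2) by (simp add: split_beta)
  next
    case (add f g)
    then obtain p r where "\<forall>s. f (\<psi> s) = poly p s" "\<forall>s. g (\<psi> s) = poly r s" by blast
    then show ?case by (intro exI[of _ "p + r"]) simp
  next
    case (mult f g)
    then obtain p r where "\<forall>s. f (\<psi> s) = poly p s" "\<forall>s. g (\<psi> s) = poly r s" by blast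
    then show ?case by (intro exI[of _ "p * r"]) simp
  qed
  then obtain p where p: "\<And>s. f (\<psi> s) = poly p s" by blast
  have "p = 0"
  proof (rule ccontr)
    assume "p \<noteq> 0"
    then have "finite {s. poly p s = 0}" by (rule poly_roots_finite)
    moreover have "{s. poly p s = 0} \<union> {s. f (\<psi> s) \<noteq> 0} = UNIV" using p by auto
    ultimately show False using fin infinite_UNIV_char_0 by (metis finite_UnI)
  qed
  then show ?thesis using p by simp
qed

lemma orbit_closure_curve:
  fixes \<psi> :: "'a::field_char_0 \<Rightarrow> 'a mat2"
  assumes \<psi>: "\<And>s. \<psi> s \<in> mat2_space n"
      "\<And>i j. i < n \<Longrightarrow> j < n \<Longrightarrow> \<exists>p. \<forall>s. fst (\<psi> s) $$ (i, j) = poly p s"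
      "\<And>i j. i < n \<Longrightarrow> j < n \<Longrightarrow> \<exists>p. \<forall>s. snd (\<psi> s) $$ (i, j) = poly p s"
    and fin: "finite {s. \<psi> s \<notin> orbit_closure n S}"
  shows "\<psi> s \<in> orbit_closure n S"
proof (rule orbit_closureI[OF \<psi>(1)])
  fix f assume f: "f \<in> polyfun n" "\<And>s y. s \<in> S \<Longrightarrow> y \<in> gl_orbit n s \<Longrightarrow> f y = 0"
  have "f (\<psi> s) = 0" if "\<psi> s \<in> orbit_closure n S" for s
    by (rule orbit_closureD[OF that polyfun_poly_on[OF f(1)] f(2)])
  then have "{s. f (\<psi> s) \<noteq> 0} \<subseteq> {s. \<psi> s \<notin> orbit_closure n S}" by blast
  from polyfun_curve[OF f(1) \<psi>(2,3) finite_subset[OF this fin]] show "f (\<psi> s) = 0" .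
qed

lemma zclosure_iff:
  fixes q :: "'a::field"
  shows "x \<in> zclosure q n S \<longleftrightarrow> x \<in> qcomm q n \<and>
    (\<forall>f\<in>polyfun n. (\<forall>s\<in>S \<inter> qcomm q n. f s = 0) \<longrightarrow> f x = 0)"
proof -
  have q: "qcomm q n \<subseteq> mat2_space n" unfolding qcomm_def by blast
  have "openin (zariski n) (mat2_space n :: 'a mat2 set)"
    unfolding openin_zariski
    by (intro exI[of _ "{\<lambda>_. 1}"]) (auto intro: polyfun.const)
  moreover have "U \<subseteq> mat2_space n" if "openin (zariski n) U" for U :: "'a mat2 set"
    using that unfolding openin_zariski by blast
  ultimately have top: "topspace (zariski n) = (mat2_space n :: 'a mat2 set)"
    unfolding topspace_def by blast
  then have top': "topspace (subtopology (zariski n) (qcomm q n)) = qcomm q n" using q by auto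
  show ?thesis
  proof
    assume "x \<in> zclosure q n S"
    then have x: "x \<in> qcomm q n"
      and cl: "\<And>T. x \<in> T \<Longrightarrow> openin (subtopology (zariski n) (qcomm q n)) T \<Longrightarrow> \<exists>y\<in>S. y \<in> T"
      unfolding zclosure_def in_closure_of top' by auto
    have "f x = 0" if f: "f \<in> polyfun n" "\<forall>s\<in>S \<inter> qcomm q n. f s = 0" for f
    proof (rule ccontr)
      assume fx: "f x \<noteq> 0"
      let ?U = "{x \<in> mat2_space n. \<exists>g\<in>{f}. g x \<noteq> 0}"
      have "openin (zariski n) ?U" unfolding openin_zariski using f(1) by (intro exI[of _ "{f}"]) simp
      then have "openin (subtopology (zariski n) (qcomm q n)) (?U \<inter> qcomm q n)"
        by (rule openin_subtopology_Int)
      moreover have "x \<in> ?U \<inter> qcomm q n" using fx x q by auto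
      ultimately have "\<exists>y\<in>S. y \<in> ?U \<inter> qcomm q n" using cl[of "?U \<inter> qcomm q n"] by simp
      then show False using f(2) by auto
    qed
    with x show "x \<in> qcomm q n \<and> (\<forall>f\<in>polyfun n. (\<forall>s\<in>S \<inter> qcomm q n. f s = 0) \<longrightarrow> f x = 0)" by blast
  next
    assume r: "x \<in> qcomm q n \<and> (\<forall>f\<in>polyfun n. (\<forall>s\<in>S \<inter> qcomm q n. f s = 0) \<longrightarrow> f x = 0)"
    show "x \<in> zclosure q n S"
      unfolding zclosure_def in_closure_of top'
    proof (intro conjI allI impI)
      show "x \<in> qcomm q n" using r by (rule conjunct1)
      fix T assume T: "x \<in> T \<and> openin (subtopology (zariski n) (qcomm q n)) T"
      then obtain U where U: "openin (zariski n) U" "T = U \<inter> qcomm q n" unfolding openin_subtopology by blast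
      obtain F where F: "F \<subseteq> polyfun n" "U = {x \<in> mat2_space n. \<exists>f\<in>F. f x \<noteq> 0}"
        using U(1) unfolding openin_zariski by blast
      from T obtain f where f: "f \<in> F" "f x \<noteq> 0" unfolding U(2) F(2) by blast
      have "f \<in> polyfun n" using f(1) F(1) by (rule subsetD[rotated])
      then have "\<not> (\<forall>s\<in>S \<inter> qcomm q n. f s = 0)" using r f(2) by blast
      then obtain s where s: "s \<in> S" "s \<in> qcomm q n" "f s \<noteq> 0" by blast
      have "s \<in> mat2_space n" using s(2) q by (rule subsetD[rotated])
      then have "s \<in> T" unfolding U(2) F(2) using f(1) s(2,3) by (intro IntI CollectI conjI bexI[of _ f])
      then show "\<exists>y. y \<in> S \<and> y \<in> T" using s(1) by (intro exI[of _ s] conjI)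
    qed
  qed
qed

lemma zclosure_orbit_closure:
  fixes q :: "'a::field"
  assumes "S \<subseteq> orbit_closure n S'" shows "zclosure q n S \<subseteq> orbit_closure n S'"
proof
  fix x assume x: "x \<in> zclosure q n S"
  show "x \<in> orbit_closure n S'"
  proof (rule orbit_closureI)
    show "x \<in> mat2_space n" using x unfolding zclosure_iff qcomm_def by blast
    fix f assume f: "f \<in> polyfun n" "\<And>s y. s \<in> S' \<Longrightarrow> y \<in> gl_orbit n s \<Longrightarrow> f y = 0"
    have "f s = 0" if "s \<in> S" for s
      by (rule orbit_closureD[OF subsetD[OF assms that] polyfun_poly_on[OF f(1)] f(2)])
    then show "f x = 0" using x f(1) unfolding zclosure_iff by blast
  qed
qed

lemma qcomm_stable:
  fixes q :: "'a::comm_ring_1"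
  assumes x: "x \<in> qcomm q n" and y: "y \<in> gl_orbit n x" shows "y \<in> qcomm q n"
proof -
  obtain A B where AB: "x = (A, B)" "A \<in> carrier_mat n n" "B \<in> carrier_mat n n" "A * B = q \<cdot>\<^sub>m (B * A)"
    using x unfolding qcomm_def by blast
  have "x \<in> mat2_space n" using AB by simp
  then obtain P Q where PQ: "inverse_pair n P Q" "y = conj2 P Q x" using y in_gl_orbit by blast
  have c: "P \<in> carrier_mat n n" "Q \<in> carrier_mat n n" "Q * P = 1\<^sub>m n" using PQ(1) unfolding inverse_pair_def by auto
  have m: "(P * M * Q) * (P * M' * Q) = P * (M * M') * Q" if "M \<in> carrier_mat n n" "M' \<in> carrier_mat n n" for M M'
  proof -
    have "(P * M * Q) * (P * M' * Q) = P * M * (Q * P) * M' * Q"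
      using c(1,2) that by (simp add: assoc_mult_mat[of _ n n _ n _ n])
    also have "\<dots> = P * (M * M') * Q" unfolding c(3) using c that by (simp add: assoc_mult_mat[of _ n n _ n _ n])
    finally show ?thesis .
  qed
  have "P * (q \<cdot>\<^sub>m (B * A)) * Q = q \<cdot>\<^sub>m (P * (B * A) * Q)"
    using c AB by (simp add: mult_smult_distrib[of _ n n _ n] mult_smult_assoc_mat[of _ n n _ n])
  then show ?thesis
    unfolding PQ(2) qcomm_def conj2_def AB(1) using c AB m[OF AB(2,3)] m[OF AB(3,2)] by simp
qed

lemma zclosure_stable:
  fixes q :: "'a::field"
  assumes S: "\<And>s y. s \<in> S \<Longrightarrow> y \<in> gl_orbit n s \<Longrightarrow> y \<in> S" and x: "x \<in> zclosure q n S" and y: "y \<in> gl_orbit n x"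
  shows "y \<in> zclosure q n S"
  unfolding zclosure_iff
proof (intro conjI ballI impI)
  have xq: "x \<in> qcomm q n" using x unfolding zclosure_iff by blast
  then show "y \<in> qcomm q n" by (rule qcomm_stable[OF _ y])
  have xs: "x \<in> mat2_space n" using xq unfolding qcomm_def by blast
  obtain P Q where PQ: "inverse_pair n P Q" "y = conj2 P Q x" using y in_gl_orbit[OF xs] by blast
  fix f assume f: "f \<in> polyfun n" "\<forall>s\<in>S \<inter> qcomm q n. f s = 0"
  obtain g where g: "g \<in> polyfun n" "\<And>x. x \<in> mat2_space n \<Longrightarrow> f (conj2 P Q x) = g x"
    using poly_map_comp[OF poly_map_conj2[OF PQ(1)] f(1)] unfolding poly_on_def by blast
  have "g s = 0" if s: "s \<in> S \<inter> qcomm q n" for s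
  proof -
    have ss: "s \<in> mat2_space n" using s unfolding qcomm_def by blast
    have o: "conj2 P Q s \<in> gl_orbit n s" using in_gl_orbit[OF ss] PQ(1) by blast
    have "conj2 P Q s \<in> S \<inter> qcomm q n" using S[OF _ o] qcomm_stable[OF _ o] s by blast
    then show ?thesis using f(2) g(2)[OF ss] by simp
  qed
  then have "g x = 0" using x g(1) unfolding zclosure_iff by blast
  then show "f y = 0" using g(2)[OF xs] PQ(2) by simp
qed

section \<open>Direct sums of pairs\<close>

definition dsum :: "'a::zero mat2 \<Rightarrow> 'a mat2 \<Rightarrow> 'a mat2" where
  "dsum x y = (diag_block_mat [fst x, fst y], diag_block_mat [snd x, snd y])"

definition dsums :: "'a::zero mat2 list \<Rightarrow> 'a mat2" where
  "dsums xs = foldr dsum xs (0\<^sub>m 0 0, 0\<^sub>m 0 0)"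

lemma dsums_simps: "dsums [] = (0\<^sub>m 0 0, 0\<^sub>m 0 0)" "dsums (x # xs) = dsum x (dsums xs)"
  by (simp_all add: dsums_def)

lemma diag_block_two:
  assumes "A \<in> carrier_mat i i" "B \<in> carrier_mat j j"
  shows "diag_block_mat [A, B] = four_block_mat A (0\<^sub>m i j) (0\<^sub>m j i) B"
  using assms by (intro eq_matI) (auto simp: Let_def)

lemma dsum_four_block:
  assumes "x \<in> mat2_space i" "y \<in> mat2_space j"
  shows "dsum x y = (four_block_mat (fst x) (0\<^sub>m i j) (0\<^sub>m j i) (fst y),
    four_block_mat (snd x) (0\<^sub>m i j) (0\<^sub>m j i) (snd y))"
  unfolding dsum_def using assms
  by (simp add: diag_block_two[of _ i _ j] mem_Times_iff del: diag_block_mat.simps)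

lemma dsum_space:
  assumes "x \<in> mat2_space i" "y \<in> mat2_space j" shows "dsum x y \<in> mat2_space (i + j)"
  unfolding dsum_four_block[OF assms] using assms by (auto simp: mem_Times_iff)

lemma dsum_entry:
  assumes "x \<in> mat2_space i" "y \<in> mat2_space j" "a < i + j" "b < i + j"
  shows "fst (dsum x y) $$ (a, b) = (if a < i then if b < i then fst x $$ (a, b) else 0
      else if b < i then 0 else fst y $$ (a - i, b - i))"
    "snd (dsum x y) $$ (a, b) = (if a < i then if b < i then snd x $$ (a, b) else 0
      else if b < i then 0 else snd y $$ (a - i, b - i))"
  unfolding dsum_four_block[OF assms(1,2)] using assms by (auto simp: mem_Times_iff)

lemma dsum_unit:
  assumes "x \<in> mat2_space n"
  shows "dsum (0\<^sub>m 0 0, 0\<^sub>m 0 0) x = x" "dsum x (0\<^sub>m 0 0, 0\<^sub>m 0 0) = x"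
proof -
  have u: "(0\<^sub>m 0 0, 0\<^sub>m 0 0) \<in> mat2_space 0" by simp
  note s = dsum_space[OF u assms] dsum_space[OF assms u]
  show "dsum (0\<^sub>m 0 0, 0\<^sub>m 0 0) x = x"
    using s assms dsum_entry[OF u assms] by (auto simp: prod_eq_iff mem_Times_iff intro!: eq_matI)
  show "dsum x (0\<^sub>m 0 0, 0\<^sub>m 0 0) = x"
    using s assms dsum_entry[OF assms u] by (auto simp: prod_eq_iff mem_Times_iff intro!: eq_matI)
qed

lemma dsum_assoc:
  assumes "x \<in> mat2_space i" "y \<in> mat2_space j" "z \<in> mat2_space k"
  shows "dsum (dsum x y) z = dsum x (dsum y z)"
proof -
  have d: "fst x \<in> carrier_mat i i" "snd x \<in> carrier_mat i i" "fst y \<in> carrier_mat j j" "snd y \<in> carrier_mat j j"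
    "fst z \<in> carrier_mat k k" "snd z \<in> carrier_mat k k" using assms by (auto simp: mem_Times_iff)
  have m: "diag_block_mat [diag_block_mat [A, B], C] = diag_block_mat [A, diag_block_mat [B, C]]"
    if "A \<in> carrier_mat i i" "B \<in> carrier_mat j j" "C \<in> carrier_mat k k" for A B C :: "'a mat"
    using that by (intro eq_matI) (auto simp: Let_def)
  show ?thesis unfolding dsum_def using m d by (simp del: diag_block_mat.simps)
qed

lemma poly_map_dsum:
  assumes "y \<in> mat2_space j" shows "poly_map i (i + j) (\<lambda>x. dsum x y)"
  unfolding poly_map_def
proof (intro conjI allI impI ballI)
  show "dsum x y \<in> mat2_space (i + j)" if "x \<in> mat2_space i" for x by (rule dsum_space[OF that assms])
  fix a b assume ab: "a < i + j" "b < i + j"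
  have "poly_on i (\<lambda>x. if a < i then if b < i then fst x $$ (a, b) else 0
      else if b < i then 0 else fst y $$ (a - i, b - i))"
    by (cases "a < i"; cases "b < i"; simp add: poly_on_const poly_on_coord)
  then show "poly_on i (\<lambda>x. fst (dsum x y) $$ (a, b))"
    by (rule poly_on_cong) (rule dsum_entry(1)[OF _ assms ab])
  have "poly_on i (\<lambda>x. if a < i then if b < i then snd x $$ (a, b) else 0
      else if b < i then 0 else snd y $$ (a - i, b - i))"
    by (cases "a < i"; cases "b < i"; simp add: poly_on_const poly_on_coord)
  then show "poly_on i (\<lambda>x. snd (dsum x y) $$ (a, b))"
    by (rule poly_on_cong) (rule dsum_entry(2)[OF _ assms ab])
qed

lemma poly_map_dsum':
  assumes "x \<in> mat2_space i" shows "poly_map j (i + j) (\<lambda>y. dsum x y)"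
  unfolding poly_map_def
proof (intro conjI allI impI ballI)
  show "dsum x y \<in> mat2_space (i + j)" if "y \<in> mat2_space j" for y by (rule dsum_space[OF assms that])
  fix a b assume ab: "a < i + j" "b < i + j"
  have "poly_on j (\<lambda>y. if a < i then if b < i then fst x $$ (a, b) else 0
      else if b < i then 0 else fst y $$ (a - i, b - i))"
    using ab by (cases "a < i"; cases "b < i"; simp add: poly_on_const poly_on_coord)
  then show "poly_on j (\<lambda>y. fst (dsum x y) $$ (a, b))"
    by (rule poly_on_cong) (rule dsum_entry(1)[OF assms _ ab])
  have "poly_on j (\<lambda>y. if a < i then if b < i then snd x $$ (a, b) else 0
      else if b < i then 0 else snd y $$ (a - i, b - i))"
    using ab by (cases "a < i"; cases "b < i"; simp add: poly_on_const poly_on_coord)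
  then show "poly_on j (\<lambda>y. snd (dsum x y) $$ (a, b))"
    by (rule poly_on_cong) (rule dsum_entry(2)[OF assms _ ab])
qed

lemma block_diag_mult:
  fixes A B C D :: "'a::comm_ring_1 mat"
  assumes "A \<in> carrier_mat i i" "B \<in> carrier_mat j j" "C \<in> carrier_mat i i" "D \<in> carrier_mat j j"
  shows "four_block_mat A (0\<^sub>m i j) (0\<^sub>m j i) B * four_block_mat C (0\<^sub>m i j) (0\<^sub>m j i) D =
    four_block_mat (A * C) (0\<^sub>m i j) (0\<^sub>m j i) (B * D)"
  using assms by (subst mult_four_block_mat[OF assms(1) _ _ assms(2) assms(3) _ _ assms(4)]) auto

lemma dsum_orbit:
  fixes x y :: "'a::comm_ring_1 mat2"
  assumes x: "x \<in> mat2_space i" and y: "y \<in> mat2_space j"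
    and x': "x' \<in> gl_orbit i x" and y': "y' \<in> gl_orbit j y"
  shows "dsum x' y' \<in> gl_orbit (i + j) (dsum x y)"
proof -
  obtain P Q where P: "inverse_pair i P Q" "x' = conj2 P Q x" using x' in_gl_orbit[OF x] by blast
  obtain P' Q' where P': "inverse_pair j P' Q'" "y' = conj2 P' Q' y" using y' in_gl_orbit[OF y] by blast
  let ?f = "\<lambda>A B. four_block_mat A (0\<^sub>m i j) (0\<^sub>m j i) (B :: 'a mat)"
  have c: "P \<in> carrier_mat i i" "Q \<in> carrier_mat i i" "P' \<in> carrier_mat j j" "Q' \<in> carrier_mat j j"
    and xy: "fst x \<in> carrier_mat i i" "snd x \<in> carrier_mat i i" "fst y \<in> carrier_mat j j" "snd y \<in> carrier_mat j j"
    using P(1) P'(1) x y unfolding inverse_pair_def by (auto simp: mem_Times_iff)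
  have "inverse_pair (i + j) (?f P P') (?f Q Q')"
    using P(1) P'(1) c unfolding inverse_pair_def by (simp add: block_diag_mult[of _ i _ j])
  moreover have "dsum x' y' = conj2 (?f P P') (?f Q Q') (dsum x y)"
    unfolding dsum_four_block[OF gl_orbit_space[OF x'] gl_orbit_space[OF y']] dsum_four_block[OF x y]
    unfolding P(2) P'(2) conj2_def
    using c xy by (simp add: block_diag_mult[of _ i _ j])
  ultimately show ?thesis unfolding in_gl_orbit[OF dsum_space[OF x y]] by (intro exI conjI)
qed

lemma dsum_commute:
  fixes x y :: "'a::comm_ring_1 mat2"
  assumes x: "x \<in> mat2_space i" and y: "y \<in> mat2_space j"
  shows "dsum x y \<in> gl_orbit (i + j) (dsum y x)"
proof -
  let ?P = "four_block_mat (0\<^sub>m i j) (1\<^sub>m i) (1\<^sub>m j) (0\<^sub>m j i) :: 'a mat"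
  let ?Q = "four_block_mat (0\<^sub>m j i) (1\<^sub>m j) (1\<^sub>m i) (0\<^sub>m i j) :: 'a mat"
  have c: "?P \<in> carrier_mat (i + j) (j + i)" "?Q \<in> carrier_mat (j + i) (i + j)" by (auto simp: add.commute)
  have PQ: "?P * ?Q = 1\<^sub>m (i + j)"
    by (subst mult_four_block_mat[of _ i j _ i _ j _ _ i _ j]) (auto simp: four_block_one_mat)
  have QP: "?Q * ?P = 1\<^sub>m (j + i)"
    by (subst mult_four_block_mat[of _ j i _ j _ i _ _ j _ i]) (auto simp: four_block_one_mat)
  have "inverse_pair (i + j) ?P ?Q"
    unfolding inverse_pair_def using PQ QP by (auto simp: add.commute)
  moreover have "?P * four_block_mat B (0\<^sub>m j i) (0\<^sub>m i j) A * ?Q = four_block_mat A (0\<^sub>m i j) (0\<^sub>m j i) B"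
    if "A \<in> carrier_mat i i" "B \<in> carrier_mat j j" for A B :: "'a mat"
  proof -
    have "?P * four_block_mat B (0\<^sub>m j i) (0\<^sub>m i j) A = four_block_mat (0\<^sub>m i j) A B (0\<^sub>m j i)"
      using that by (subst mult_four_block_mat[of _ i j _ i _ j _ _ j _ i]) auto
    also have "\<dots> * ?Q = four_block_mat A (0\<^sub>m i j) (0\<^sub>m j i) B"
      using that by (subst mult_four_block_mat[of _ i j _ i _ j _ _ i _ j]) auto
    finally show ?thesis .
  qed
  then have "dsum x y = conj2 ?P ?Q (dsum y x)"
    unfolding dsum_four_block[OF x y] dsum_four_block[OF y x] conj2_def
    using x y by (simp add: mem_Times_iff)
  moreover have yx: "dsum y x \<in> mat2_space (i + j)" using dsum_space[OF y x] by (simp add: add.commute)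
  ultimately show ?thesis unfolding in_gl_orbit[OF yx] by (intro exI conjI)
qed

lemma dsum_qcomm:
  assumes "x \<in> qcomm q i" "y \<in> qcomm q j" shows "dsum x y \<in> qcomm q (i + j)"
proof -
  have s: "x \<in> mat2_space i" "y \<in> mat2_space j" using assms unfolding qcomm_def by blast+
  have c: "fst x \<in> carrier_mat i i" "snd x \<in> carrier_mat i i" "fst y \<in> carrier_mat j j" "snd y \<in> carrier_mat j j"
    "fst x * snd x = q \<cdot>\<^sub>m (snd x * fst x)" "fst y * snd y = q \<cdot>\<^sub>m (snd y * fst y)"
    using assms unfolding qcomm_def by auto
  have "fst (dsum x y) * snd (dsum x y) = q \<cdot>\<^sub>m (snd (dsum x y) * fst (dsum x y))"
    unfolding dsum_four_block[OF s] using c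
    by (simp add: block_diag_mult[of _ i _ j] smult_four_block_mat[of _ i i _ j _ j])
  then show ?thesis using dsum_space[OF s] unfolding qcomm_def by (simp add: split_beta mem_Times_iff)
qed

text \<open>Continuity of the direct sum in each summand separately; the orbits take care of the conjugations of the two blocks.\<close>

lemma dsum_closure:
  fixes S :: "'a::comm_ring_1 mat2 set"
  assumes S: "S \<subseteq> mat2_space i" and S': "S' \<subseteq> mat2_space j"
    and x: "x \<in> orbit_closure i S" and y: "y \<in> orbit_closure j S'"
  shows "dsum x y \<in> orbit_closure (i + j) {dsum s s' | s s'. s \<in> S \<and> s' \<in> S'}" (is "_ \<in> orbit_closure _ ?D")
proof -
  have left: "dsum x z' \<in> orbit_closure (i + j) ?D" if s': "s' \<in> S'" "z' \<in> gl_orbit j s'" for s' z'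
  proof (rule orbit_closure_map[OF poly_map_dsum[OF gl_orbit_space[OF s'(2)]] _ x])
    fix s z assume s: "s \<in> S" "z \<in> gl_orbit i s"
    have "dsum z z' \<in> gl_orbit (i + j) (dsum s s')"
      by (rule dsum_orbit[OF _ _ s(2) s'(2)]) (use s(1) s'(1) S S' in blast)+
    then show "dsum z z' \<in> orbit_closure (i + j) ?D" by (rule orbit_in_closure[rotated]) (use s(1) s'(1) in blast)
  qed
  show ?thesis by (rule orbit_closure_map[OF poly_map_dsum'[OF orbit_closure_space[OF x]] left y])
qed

lemma dsums_space:
  "set xs \<subseteq> mat2_space i \<Longrightarrow> dsums xs \<in> mat2_space (i * length xs)"
proof (induction xs)
  case Nil
  show ?case by (simp add: dsums_simps)
next
  case (Cons x xs)
  then show ?case using dsum_space[of x i "dsums xs" "i * length xs"] by (simp add: dsums_simps)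
qed

lemma dsums_qcomm: "set xs \<subseteq> qcomm q i \<Longrightarrow> dsums xs \<in> qcomm q (i * length xs)"
proof (induction xs)
  case Nil
  show ?case by (auto simp: dsums_simps qcomm_def intro!: eq_matI)
next
  case (Cons x xs)
  then show ?case using dsum_qcomm[of x q i "dsums xs" "i * length xs"] by (simp add: dsums_simps)
qed

lemma in_direct_sum: "x \<in> direct_sum q i j V W \<longleftrightarrow>
  x \<in> qcomm q (i + j) \<and> (\<exists>v\<in>V. \<exists>w\<in>W. x \<in> gl_orbit (i + j) (dsum v w))"
  unfolding direct_sum_def dsum_def by (simp add: split_beta del: diag_block_mat.simps)

lemma direct_sum_mem:
  assumes "v \<in> V" "w \<in> W" "v \<in> qcomm q i" "w \<in> qcomm q j" shows "dsum v w \<in> direct_sum q i j V W"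
proof -
  have "dsum v w \<in> qcomm q (i + j)" by (rule dsum_qcomm[OF assms(3,4)])
  moreover from this have "dsum v w \<in> gl_orbit (i + j) (dsum v w)"
    by (intro gl_orbit_refl) (simp add: qcomm_def split_beta mem_Times_iff)
  ultimately show ?thesis unfolding in_direct_sum using assms(1,2) by blast
qed

lemma direct_sum_stable:
  assumes V: "V \<subseteq> mat2_space i" and W: "W \<subseteq> mat2_space j"
    and x: "x \<in> direct_sum q i j V W" and y: "y \<in> gl_orbit (i + j) x"
  shows "y \<in> direct_sum q i j V W"
proof -
  obtain v w where vw: "v \<in> V" "w \<in> W" "x \<in> gl_orbit (i + j) (dsum v w)" and xq: "x \<in> qcomm q (i + j)"
    using x unfolding in_direct_sum by blast
  have "dsum v w \<in> mat2_space (i + j)" by (rule dsum_space) (use vw V W in blast)+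
  then have "y \<in> gl_orbit (i + j) (dsum v w)" by (rule gl_orbit_trans[OF _ vw(3) y])
  then show ?thesis unfolding in_direct_sum using vw(1,2) qcomm_stable[OF xq y] by blast
qed

lemma direct_sum_closure:
  fixes S :: "'a::comm_ring_1 mat2 set"
  assumes S: "S \<subseteq> mat2_space i" and S': "S' \<subseteq> mat2_space j"
    and V: "V \<subseteq> orbit_closure i S" and W: "W \<subseteq> orbit_closure j S'"
  shows "direct_sum q i j V W \<subseteq> orbit_closure (i + j) {dsum s s' | s s'. s \<in> S \<and> s' \<in> S'}" (is "_ \<subseteq> orbit_closure _ ?D")
proof
  fix x assume "x \<in> direct_sum q i j V W"
  then obtain v w where vw: "v \<in> V" "w \<in> W" "x \<in> gl_orbit (i + j) (dsum v w)" unfolding in_direct_sum by blast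
  have D: "?D \<subseteq> mat2_space (i + j)" using dsum_space S S' by blast
  show "x \<in> orbit_closure (i + j) ?D"
    by (rule orbit_closure_stable[OF D dsum_closure[OF S S'] vw(3)]) (use vw V W in blast)+
qed

lemma direct_power_qcomm: "direct_power q i V k \<subseteq> qcomm q (i * k)"
  by (cases k) (auto simp: in_direct_sum)

lemma direct_power_closure:
  fixes S :: "'a::comm_ring_1 mat2 set"
  assumes S: "S \<subseteq> mat2_space i" and V: "V \<subseteq> orbit_closure i S"
  shows "direct_power q i V k \<subseteq> orbit_closure (i * k) {dsums xs | xs. length xs = k \<and> set xs \<subseteq> S}"
proof (induction k)
  case 0
  have "qcomm q 0 \<subseteq> {(0\<^sub>m 0 0, 0\<^sub>m 0 0)}" unfolding qcomm_def by (auto intro!: eq_matI)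
  moreover have "(0\<^sub>m 0 0, 0\<^sub>m 0 0) \<in> orbit_closure 0 {dsums xs | xs. length xs = 0 \<and> set xs \<subseteq> S}"
    by (rule closure_base) (auto simp: dsums_simps)
  ultimately show ?case by auto
next
  case (Suc k)
  let ?D = "\<lambda>k. {dsums xs | xs. length xs = k \<and> set xs \<subseteq> S}"
  have D: "?D k \<subseteq> mat2_space (i * k)" using dsums_space S by blast
  have eq: "{dsum s s' | s s'. s \<in> S \<and> s' \<in> ?D k} = ?D (Suc k)"
  proof (intro equalityI subsetI)
    fix x assume "x \<in> {dsum s s' | s s'. s \<in> S \<and> s' \<in> ?D k}"
    then obtain s xs where "s \<in> S" "length xs = k" "set xs \<subseteq> S" "x = dsum s (dsums xs)" by blast
    then show "x \<in> ?D (Suc k)" by (intro CollectI exI[of _ "s # xs"]) (simp add: dsums_simps)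
  next
    fix x assume "x \<in> ?D (Suc k)"
    then obtain xs where xs: "length xs = Suc k" "set xs \<subseteq> S" "x = dsums xs" by blast
    then obtain s ys where "xs = s # ys" by (cases xs) auto
    with xs have "x = dsum s (dsums ys)" "s \<in> S" "dsums ys \<in> ?D k" by (auto simp: dsums_simps)
    then show "x \<in> {dsum s s' | s s'. s \<in> S \<and> s' \<in> ?D k}" by blast
  qed
  from direct_sum_closure[OF S D V Suc, of q] show ?case unfolding eq by simp
qed

lemma direct_power_mem:
  assumes V: "V \<subseteq> qcomm q i" shows "set xs \<subseteq> V \<Longrightarrow> dsums xs \<in> direct_power q i V (length xs)"
proof (induction xs)
  case Nil
  show ?case using dsums_qcomm[of "[]" q 0] by simp
next
  case (Cons x xs)
  have "dsum x (dsums xs) \<in> direct_sum q i (i * length xs) V (direct_power q i V (length xs))"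
    by (rule direct_sum_mem) (use Cons V dsums_qcomm[of xs q i] in auto)
  then show ?case by (simp add: dsums_simps)
qed


section \<open>Linear independence and invariant subspaces\<close>

text \<open>Families indexed by natural numbers below \<open>d\<close>, so that the dimension can vary in inductions and the family can serve as
  the columns of a matrix.\<close>

definition lin_indep :: "nat \<Rightarrow> nat \<Rightarrow> (nat \<Rightarrow> 'a::field vec) \<Rightarrow> bool" where
  "lin_indep n d w \<longleftrightarrow> (\<forall>j<d. w j \<in> carrier_vec n) \<and>
     (\<forall>c. (\<forall>i<n. (\<Sum>j<d. c j * w j $ i) = 0) \<longrightarrow> (\<forall>j<d. c j = 0))"

definition lin_comb :: "nat \<Rightarrow> nat \<Rightarrow> (nat \<Rightarrow> 'a::field) \<Rightarrow> (nat \<Rightarrow> 'a vec) \<Rightarrow> 'a vec" where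
  "lin_comb n d c w = vec n (\<lambda>i. \<Sum>j<d. c j * w j $ i)"

lemma mult_mat_vec_index:
  assumes "A \<in> carrier_mat n m" "u \<in> carrier_vec m" "i < n"
  shows "(A *\<^sub>v u) $ i = (\<Sum>k<m. A $$ (i, k) * u $ k)"
  using assms by (simp add: scalar_prod_def lessThan_atLeast0)

lemma mult_mat_lin_comb:
  assumes A: "A \<in> carrier_mat n n" and w: "\<And>j. j < d \<Longrightarrow> w j \<in> carrier_vec n"
  shows "A *\<^sub>v lin_comb n d c w = lin_comb n d c (\<lambda>j. A *\<^sub>v w j)"
proof (rule eq_vecI)
  fix i assume "i < dim_vec (lin_comb n d c (\<lambda>j. A *\<^sub>v w j))"
  then have i: "i < n" by (simp add: lin_comb_def)
  have "(A *\<^sub>v lin_comb n d c w) $ i = (\<Sum>k<n. \<Sum>j<d. c j * (A $$ (i, k) * w j $ k))"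
    using mult_mat_vec_index[OF A _ i, of "lin_comb n d c w"]
    by (simp add: lin_comb_def sum_distrib_left mult.left_commute)
  also have "\<dots> = (\<Sum>j<d. c j * (\<Sum>k<n. A $$ (i, k) * w j $ k))"
    by (subst sum.swap) (simp add: sum_distrib_left)
  also have "\<dots> = lin_comb n d c (\<lambda>j. A *\<^sub>v w j) $ i"
    using mult_mat_vec_index[OF A w i] i by (simp add: lin_comb_def del: index_mult_mat_vec)
  finally show "(A *\<^sub>v lin_comb n d c w) $ i = lin_comb n d c (\<lambda>j. A *\<^sub>v w j) $ i" .
qed (use A in \<open>simp add: lin_comb_def\<close>)

lemma dependent_vectors:
  fixes w :: "nat \<Rightarrow> nat \<Rightarrow> 'a::field"
  assumes "n < d"
  shows "\<exists>c. (\<exists>j<d. c j \<noteq> 0) \<and> (\<forall>i<n. (\<Sum>j<d. c j * w j i) = 0)"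
proof -
  define M where "M = mat d d (\<lambda>(i, j). if i < n then w j i else 0)"
  have M: "M \<in> carrier_mat d d" unfolding M_def by simp
  let ?e = "vec d (\<lambda>i. if i = n then 1 else 0 :: 'a)"
  have "M\<^sup>T *\<^sub>v ?e = 0\<^sub>v d"
  proof (rule eq_vecI)
    fix i assume "i < dim_vec (0\<^sub>v d :: 'a vec)"
    then have i: "i < d" by simp
    have "(M\<^sup>T *\<^sub>v ?e) $ i = (\<Sum>k<d. M\<^sup>T $$ (i, k) * ?e $ k)"
      by (rule mult_mat_vec_index) (use M i in auto)
    also have "\<dots> = 0" by (rule sum.neutral) (use i in \<open>auto simp: M_def\<close>)
    finally show "(M\<^sup>T *\<^sub>v ?e) $ i = 0\<^sub>v d $ i" using i by simp
  qed (use M in simp)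
  moreover have "?e \<in> carrier_vec d" by simp
  moreover have "?e \<noteq> 0\<^sub>v d"
  proof
    assume "?e = 0\<^sub>v d"
    then have "?e $ n = 0\<^sub>v d $ n" by simp
    then show False using assms by simp
  qed
  moreover have "M\<^sup>T \<in> carrier_mat d d" using M by simp
  ultimately have "det M\<^sup>T = 0" using det_0_iff_vec_prod_zero_field by blast
  then have "det M = 0" using det_transpose[OF M] by simp
  then obtain v where v: "v \<in> carrier_vec d" "v \<noteq> 0\<^sub>v d" "M *\<^sub>v v = 0\<^sub>v d"
    using det_0_iff_vec_prod_zero_field[OF M] by blast
  have "\<exists>j<d. v $ j \<noteq> 0"
  proof (rule ccontr)
    assume "\<not> ?thesis"
    then have "v = 0\<^sub>v d" using v(1) by (intro eq_vecI) auto
    then show False using v(2) by simp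
  qed
  moreover have "(\<Sum>j<d. v $ j * w j i) = 0" if i: "i < n" for i
  proof -
    have "(M *\<^sub>v v) $ i = (\<Sum>k<d. M $$ (i, k) * v $ k)"
      by (rule mult_mat_vec_index[OF M v(1)]) (use i assms in simp)
    also have "\<dots> = (\<Sum>j<d. v $ j * w j i)"
      by (rule sum.cong) (use i assms in \<open>auto simp: M_def mult.commute\<close>)
    finally show ?thesis using v(3) i assms by simp
  qed
  ultimately show ?thesis by (intro exI[of _ "\<lambda>j. v $ j"]) simp
qed

lemma lin_indep_le:
  assumes "lin_indep n d w" shows "d \<le> n"
proof (rule ccontr)
  assume "\<not> d \<le> n"
  then obtain c where "\<exists>j<d. c j \<noteq> 0" "\<forall>i<n. (\<Sum>j<d. c j * w j $ i) = 0"
    using dependent_vectors[of n d "\<lambda>j i. w j $ i"] by auto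
  then show False using assms unfolding lin_indep_def by blast
qed

text \<open>If every unit vector were a combination of \<open>d < n\<close> vectors, the \<open>n\<close> coefficient vectors would be
  dependent, hence so would be the unit vectors.\<close>

lemma lin_indep_extend_one:
  assumes w: "lin_indep n d w" and d: "d < n"
  shows "\<exists>k<n. lin_indep n (Suc d) (w(d := unit_vec n k))"
proof (rule ccontr)
  assume none: "\<not> ?thesis"
  have wc: "w j \<in> carrier_vec n" if "j < d" for j using w that unfolding lin_indep_def by blast
  have comb: "\<exists>b. \<forall>i<n. unit_vec n k $ i = (\<Sum>j<d. b j * w j $ i)" if k: "k < n" for k
  proof -
    let ?w = "w(d := unit_vec n k)"
    have "\<forall>j<Suc d. ?w j \<in> carrier_vec n" using wc by (simp add: less_Suc_eq)
    moreover have "\<not> lin_indep n (Suc d) ?w" using none k by blast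
    ultimately obtain c where c: "\<forall>i<n. (\<Sum>j<Suc d. c j * ?w j $ i) = 0" "\<exists>j<Suc d. c j \<noteq> 0"
      unfolding lin_indep_def by blast
    have eq: "(\<Sum>j<d. c j * w j $ i) + c d * unit_vec n k $ i = 0" if "i < n" for i
      using c(1) that by simp
    have "c d \<noteq> 0"
    proof
      assume cd: "c d = 0"
      then have "\<forall>i<n. (\<Sum>j<d. c j * w j $ i) = 0" using eq by simp
      then have "\<forall>j<d. c j = 0" using w unfolding lin_indep_def by blast
      then show False using c(2) cd by (auto simp: less_Suc_eq)
    qed
    have "unit_vec n k $ i = (\<Sum>j<d. (- c j / c d) * w j $ i)" if i: "i < n" for i
    proof -
      have "unit_vec n k $ i = - (\<Sum>j<d. c j * w j $ i) / c d"
        using eq[OF i] \<open>c d \<noteq> 0\<close> by (simp add: field_simps add_eq_0_iff del: index_unit_vec)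
      also have "\<dots> = (\<Sum>j<d. (- c j / c d) * w j $ i)"
        by (simp add: sum_negf[symmetric] sum_divide_distrib)
      finally show ?thesis .
    qed
    then show ?thesis by (intro exI[of _ "\<lambda>j. - c j / c d"] allI impI)
  qed
  have "\<forall>k\<in>{..<n}. \<exists>b. \<forall>i<n. unit_vec n k $ i = (\<Sum>j<d. b j * w j $ i)"
  proof
    fix k assume "k \<in> {..<n}"
    then show "\<exists>b. \<forall>i<n. unit_vec n k $ i = (\<Sum>j<d. b j * w j $ i)" by (intro comb) simp
  qed
  from bchoice[OF this] obtain b where
    bs: "\<forall>k\<in>{..<n}. \<forall>i<n. unit_vec n k $ i = (\<Sum>j<d. b k j * w j $ i)" ..
  have b: "unit_vec n k $ i = (\<Sum>j<d. b k j * w j $ i)" if "k < n" "i < n" for k i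
    using bspec[OF bs, of k] that by (simp del: index_unit_vec)
  obtain c where c: "\<exists>k<n. c k \<noteq> 0" "\<forall>j<d. (\<Sum>k<n. c k * b k j) = 0"
    using dependent_vectors[OF d, of b] by blast
  have "c i = 0" if i: "i < n" for i
  proof -
    have "c i = (\<Sum>k<n. c k * unit_vec n k $ i)"
      using i by (simp add: if_distrib[of "\<lambda>x. _ * x"] sum.delta cong: if_cong)
    also have "\<dots> = (\<Sum>k<n. \<Sum>j<d. c k * (b k j * w j $ i))"
      using b i by (simp add: sum_distrib_left del: index_unit_vec)
    also have "\<dots> = (\<Sum>j<d. (\<Sum>k<n. c k * b k j) * w j $ i)"
      by (subst sum.swap) (simp add: sum_distrib_right mult.assoc)
    also have "\<dots> = 0" using c(2) by simp
    finally show ?thesis .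
  qed
  then show False using c(1) by blast
qed

lemma lin_indep_extend:
  assumes "lin_indep n d w"
  shows "\<exists>w'. (\<forall>j<d. w' j = w j) \<and> lin_indep n n w'"
  using assms
proof (induction "n - d" arbitrary: d w)
  case 0
  then have "d = n" using lin_indep_le[of n d w] by simp
  then show ?case using 0 by blast
next
  case (Suc m)
  then have d: "d < n" by simp
  obtain k where k: "lin_indep n (Suc d) (w(d := unit_vec n k))"
    using lin_indep_extend_one[OF Suc.prems d] by blast
  have "m = n - Suc d" using Suc.hyps(2) by simp
  from Suc.hyps(1)[OF this k] obtain w' where
    "\<forall>j<Suc d. w' j = (w(d := unit_vec n k)) j" "lin_indep n n w'" by (elim exE conjE)
  then show ?case by (intro exI[of _ w']) (simp add: less_Suc_eq)
qed

lemma lin_indep_inverse: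
  assumes "lin_indep n n w"
  shows "\<exists>Q. inverse_pair n (mat n n (\<lambda>(i, j). w j $ i)) Q"
proof -
  let ?P = "mat n n (\<lambda>(i, j). w j $ i)"
  have P: "?P \<in> carrier_mat n n" by simp
  have "det ?P \<noteq> 0"
  proof
    assume "det ?P = 0"
    then obtain v where v: "v \<in> carrier_vec n" "v \<noteq> 0\<^sub>v n" "?P *\<^sub>v v = 0\<^sub>v n"
      using det_0_iff_vec_prod_zero_field[OF P] by blast
    have "(\<Sum>j<n. v $ j * w j $ i) = 0" if i: "i < n" for i
    proof -
      have "(?P *\<^sub>v v) $ i = (\<Sum>k<n. ?P $$ (i, k) * v $ k)" by (rule mult_mat_vec_index[OF P v(1) i])
      also have "\<dots> = (\<Sum>j<n. v $ j * w j $ i)"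
        by (rule sum.cong) (use i in \<open>auto simp: mult.commute\<close>)
      finally show ?thesis using v(3) i by simp
    qed
    then have "\<forall>j<n. v $ j = 0" using assms unfolding lin_indep_def by blast
    then have "v = 0\<^sub>v n" using v(1) by (intro eq_vecI) auto
    then show False using v(2) by simp
  qed
  from det_non_zero_imp_unit[OF P this] obtain Q where
    "Q \<in> carrier_mat n n" "Q * ?P = 1\<^sub>m n" "?P * Q = 1\<^sub>m n"
    unfolding Units_def ring_mat_def by auto
  then show ?thesis unfolding inverse_pair_def using P by blast
qed

text \<open>The Vandermonde matrix is invertible: evaluate the relation on the Lagrange polynomial of \<open>lam j\<close>.\<close>

lemma power_sums_zero:
  fixes y lam :: "nat \<Rightarrow> 'a::field"
  assumes sums: "\<And>k. (\<Sum>j<d. y j * lam j ^ k) = 0"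
    and dist: "\<And>i j. i < d \<Longrightarrow> j < d \<Longrightarrow> i \<noteq> j \<Longrightarrow> lam i \<noteq> lam j" and j: "j < d"
  shows "y j = 0"
proof -
  have all: "(\<Sum>i<d. y i * poly g (lam i)) = 0" for g
  proof -
    have "(\<Sum>i<d. y i * poly g (lam i)) = (\<Sum>i<d. \<Sum>k\<le>degree g. coeff g k * (y i * lam i ^ k))"
      by (simp add: poly_altdef sum_distrib_left mult.left_commute)
    also have "\<dots> = (\<Sum>k\<le>degree g. coeff g k * (\<Sum>i<d. y i * lam i ^ k))"
      by (subst sum.swap) (simp add: sum_distrib_left)
    finally show ?thesis using sums by simp
  qed
  define g where "g = (\<Prod>i\<in>{..<d} - {j}. [:- lam i, 1:])"
  have pg: "poly g x = (\<Prod>i\<in>{..<d} - {j}. x - lam i)" for x unfolding g_def by (simp add: poly_prod)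
  have "(\<Sum>i<d. y i * poly g (lam i)) = y j * poly g (lam j) + (\<Sum>i\<in>{..<d} - {j}. y i * poly g (lam i))"
    by (rule sum.remove) (use j in auto)
  moreover have "(\<Sum>i\<in>{..<d} - {j}. y i * poly g (lam i)) = 0"
    by (rule sum.neutral) (auto simp: pg)
  ultimately have "y j * poly g (lam j) = 0" using all[of g] by simp
  moreover have "poly g (lam j) \<noteq> 0" unfolding pg using dist j by auto
  ultimately show ?thesis by simp
qed

lemma eigenvectors_indep:
  assumes A: "A \<in> carrier_mat n n" and w: "\<And>j. j < d \<Longrightarrow> w j \<in> carrier_vec n" "\<And>j. j < d \<Longrightarrow> w j \<noteq> 0\<^sub>v n"
    and ev: "\<And>j. j < d \<Longrightarrow> A *\<^sub>v w j = lam j \<cdot>\<^sub>v w j"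
    and dist: "\<And>i j. i < d \<Longrightarrow> j < d \<Longrightarrow> i \<noteq> j \<Longrightarrow> lam i \<noteq> lam j"
  shows "lin_indep n d w"
  unfolding lin_indep_def
proof (intro conjI allI impI)
  show "w j \<in> carrier_vec n" if "j < d" for j by (rule w(1)[OF that])
  have e: "(A *\<^sub>v w j) $ i = lam j * w j $ i" if "j < d" "i < n" for i j
    unfolding ev[OF that(1)] using carrier_vecD[OF w(1)[OF that(1)]] that by simp
  fix c j assume c: "\<forall>i<n. (\<Sum>j<d. c j * w j $ i) = 0" and j: "j < d"
  have pw: "lin_comb n d (\<lambda>j. c j * lam j ^ k) w = 0\<^sub>v n" for k
  proof (induction k)
    case 0
    show ?case using c by (intro eq_vecI) (simp_all add: lin_comb_def)
  next
    case (Suc k)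
    have "lin_comb n d (\<lambda>j. c j * lam j ^ Suc k) w = A *\<^sub>v lin_comb n d (\<lambda>j. c j * lam j ^ k) w"
    proof -
      have "A *\<^sub>v lin_comb n d (\<lambda>j. c j * lam j ^ k) w = lin_comb n d (\<lambda>j. c j * lam j ^ k) (\<lambda>j. A *\<^sub>v w j)"
        by (rule mult_mat_lin_comb[OF A w(1)])
      also have "\<dots> = lin_comb n d (\<lambda>j. c j * lam j ^ Suc k) w"
        by (intro eq_vecI) (simp_all add: lin_comb_def e mult_ac del: index_mult_mat_vec)
      finally show ?thesis by (rule sym)
    qed
    moreover have "A *\<^sub>v 0\<^sub>v n = 0\<^sub>v n" using A by (intro eq_vecI) auto
    ultimately show ?case using Suc by simp
  qed
  have ex: "\<exists>i<n. w j $ i \<noteq> 0"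
  proof (rule ccontr)
    assume "\<not> ?thesis"
    then have "w j = 0\<^sub>v n" using w(1)[OF j] by (intro eq_vecI) auto
    then show False using w(2)[OF j] by simp
  qed
  then obtain i where i: "i < n" "w j $ i \<noteq> 0" by blast
  have "(\<Sum>j<d. (c j * w j $ i) * lam j ^ k) = 0" for k
  proof -
    have "lin_comb n d (\<lambda>j. c j * lam j ^ k) w $ i = 0" using pw[of k] i by simp
    then show ?thesis using i by (simp add: lin_comb_def mult_ac)
  qed
  then have "c j * w j $ i = 0" by (rule power_sums_zero[OF _ dist j]) 
  then show "c j = 0" using i by simp
qed

lemma exists_eigenvector:
  fixes M :: "'a::alg_closed_field mat"
  assumes M: "M \<in> carrier_mat m m" and "m > 0"
  shows "\<exists>y \<mu>. y \<in> carrier_vec m \<and> y \<noteq> 0\<^sub>v m \<and> M *\<^sub>v y = \<mu> \<cdot>\<^sub>v y"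
proof -
  have "degree (char_poly M) > 0" using degree_monic_char_poly[OF M] assms(2) by simp
  then obtain \<mu> where "poly (char_poly M) \<mu> = 0" using alg_closed_imp_poly_has_root by blast
  then have "eigenvalue M \<mu>" using eigenvalue_root_char_poly[OF M] by blast
  then obtain y where "eigenvector M y \<mu>" unfolding eigenvalue_def by blast
  then show ?thesis unfolding eigenvector_def using M by auto
qed

text \<open>An operator that preserves an eigenspace of \<open>A\<close> has an eigenvector in it: it acts on the span of the
  iterates of a vector by a companion matrix.\<close>

lemma common_eigenvector:
  fixes A C :: "'a::alg_closed_field mat"
  assumes A: "A \<in> carrier_mat n n" and C: "C \<in> carrier_mat n n"
    and v: "v \<in> carrier_vec n" "v \<noteq> 0\<^sub>v n" "A *\<^sub>v v = \<mu> \<cdot>\<^sub>v v"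
    and stable: "\<And>u. u \<in> carrier_vec n \<Longrightarrow> A *\<^sub>v u = \<mu> \<cdot>\<^sub>v u \<Longrightarrow> A *\<^sub>v (C *\<^sub>v u) = \<mu> \<cdot>\<^sub>v (C *\<^sub>v u)"
  shows "\<exists>w \<nu>. w \<in> carrier_vec n \<and> w \<noteq> 0\<^sub>v n \<and> A *\<^sub>v w = \<mu> \<cdot>\<^sub>v w \<and> C *\<^sub>v w = \<nu> \<cdot>\<^sub>v w"
proof -
  define u where "u = (\<lambda>k. ((\<lambda>x. C *\<^sub>v x) ^^ k) v)"
  have u0: "u 0 = v" and uS: "u (Suc k) = C *\<^sub>v u k" for k by (simp_all add: u_def)
  have uc: "u k \<in> carrier_vec n" for k by (induction k) (use v C in \<open>simp_all add: u0 uS\<close>)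
  have uA: "A *\<^sub>v u k = \<mu> \<cdot>\<^sub>v u k" for k
    by (induction k) (use v uc stable in \<open>simp_all add: u0 uS\<close>)
  define m where "m = (LEAST m. \<not> lin_indep n (Suc m) u)"
  have "\<not> lin_indep n (Suc n) u" using lin_indep_le[of n "Suc n" u] by auto
  then have nm: "\<not> lin_indep n (Suc m) u" unfolding m_def by (rule LeastI)
  have im: "lin_indep n m u"
  proof (cases m)
    case 0
    then show ?thesis by (simp add: lin_indep_def)
  next
    case (Suc m')
    then show ?thesis using not_less_Least[of m' "\<lambda>m. \<not> lin_indep n (Suc m) u"] unfolding m_def[symmetric] by simp
  qed
  obtain c where c: "\<forall>i<n. (\<Sum>j<Suc m. c j * u j $ i) = 0" "\<exists>j<Suc m. c j \<noteq> 0"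
    using nm uc unfolding lin_indep_def by blast
  have eq: "(\<Sum>j<m. c j * u j $ i) + c m * u m $ i = 0" if "i < n" for i using c(1) that by simp
  have cm: "c m \<noteq> 0"
  proof
    assume cm: "c m = 0"
    then have "\<forall>i<n. (\<Sum>j<m. c j * u j $ i) = 0" using eq by simp
    then have "\<forall>j<m. c j = 0" using im unfolding lin_indep_def by blast
    then show False using c(2) cm by (auto simp: less_Suc_eq)
  qed
  define a where "a = (\<lambda>j. - c j / c m)"
  have um: "u m = lin_comb n m a u"
  proof (rule eq_vecI)
    fix i assume "i < dim_vec (lin_comb n m a u)"
    then have i: "i < n" by (simp add: lin_comb_def)
    have "u m $ i = - (\<Sum>j<m. c j * u j $ i) / c m"
      using eq[OF i] cm by (simp add: field_simps add_eq_0_iff)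
    also have "\<dots> = (\<Sum>j<m. a j * u j $ i)" unfolding a_def
      by (simp add: sum_negf[symmetric] sum_divide_distrib)
    finally show "u m $ i = lin_comb n m a u $ i" using i by (simp add: lin_comb_def)
  qed (use uc in \<open>simp add: lin_comb_def carrier_vecD\<close>)
  have m: "m > 0"
  proof (rule ccontr)
    assume "\<not> m > 0"
    then have "v = lin_comb n 0 a u" using um u0 by simp
    then have "v = 0\<^sub>v n" by (simp add: lin_comb_def zero_vec_def)
    then show False using v(2) by simp
  qed
  define M where "M = mat m m (\<lambda>(k, j). if Suc j < m then (if k = Suc j then 1 else 0) else a k)"
  have M: "M \<in> carrier_mat m m" unfolding M_def by simp
  have col: "u (Suc j) $ i = (\<Sum>k<m. M $$ (k, j) * u k $ i)" if j: "j < m" and i: "i < n" for j i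
  proof (cases "Suc j < m")
    case True
    then have "(\<Sum>k<m. M $$ (k, j) * u k $ i) = (\<Sum>k<m. if k = Suc j then u k $ i else 0)"
      using j by (intro sum.cong) (auto simp: M_def)
    then show ?thesis using True by (simp add: sum.delta)
  next
    case False
    then have "Suc j = m" using j by simp
    then have "(\<Sum>k<m. M $$ (k, j) * u k $ i) = (\<Sum>k<m. a k * u k $ i)"
      using j by (intro sum.cong) (auto simp: M_def)
    also have "\<dots> = u m $ i" by (subst um) (simp add: lin_comb_def i)
    finally show ?thesis using \<open>Suc j = m\<close> by simp
  qed
  obtain y \<nu> where y: "y \<in> carrier_vec m" "y \<noteq> 0\<^sub>v m" "M *\<^sub>v y = \<nu> \<cdot>\<^sub>v y"
    using exists_eigenvector[OF M m] by blast
  define w where "w = lin_comb n m (\<lambda>j. y $ j) u"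
  have wc: "w \<in> carrier_vec n" by (simp add: w_def lin_comb_def)
  moreover have "w \<noteq> 0\<^sub>v n"
  proof
    assume w0: "w = 0\<^sub>v n"
    have "(\<Sum>j<m. y $ j * u j $ i) = 0" if i: "i < n" for i
    proof -
      have "w $ i = 0" using w0 i by simp
      then show ?thesis using i by (simp add: w_def lin_comb_def)
    qed
    then have "\<forall>j<m. y $ j = 0" using im unfolding lin_indep_def by blast
    then have "y = 0\<^sub>v m" using y(1) by (intro eq_vecI) auto
    then show False using y(2) by simp
  qed
  moreover have "A *\<^sub>v w = \<mu> \<cdot>\<^sub>v w"
    unfolding w_def mult_mat_lin_comb[OF A uc] uA
    by (intro eq_vecI) (auto simp: lin_comb_def sum_distrib_left carrier_vecD[OF uc] mult.left_commute)
  moreover have "C *\<^sub>v w = \<nu> \<cdot>\<^sub>v w"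
  proof (rule eq_vecI)
    fix i assume "i < dim_vec (\<nu> \<cdot>\<^sub>v w)"
    then have i: "i < n" by (simp add: w_def lin_comb_def)
    have "(C *\<^sub>v w) $ i = (\<Sum>j<m. y $ j * u (Suc j) $ i)"
      unfolding w_def mult_mat_lin_comb[OF C uc] using i by (simp add: lin_comb_def uS)
    also have "\<dots> = (\<Sum>j<m. \<Sum>k<m. (M $$ (k, j) * y $ j) * u k $ i)"
      using col i by (simp add: sum_distrib_left mult_ac)
    also have "\<dots> = (\<Sum>k<m. (\<Sum>j<m. M $$ (k, j) * y $ j) * u k $ i)"
      by (subst sum.swap) (simp add: sum_distrib_right)
    also have "\<dots> = (\<Sum>k<m. (\<nu> * y $ k) * u k $ i)"
    proof (rule sum.cong[OF refl])
      fix k assume k: "k \<in> {..<m}"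
      have "(\<Sum>j<m. M $$ (k, j) * y $ j) = (M *\<^sub>v y) $ k"
        by (rule mult_mat_vec_index[OF M y(1), symmetric]) (use k in simp)
      also have "\<dots> = \<nu> * y $ k" using y k by simp
      finally show "(\<Sum>j<m. M $$ (k, j) * y $ j) * u k $ i = (\<nu> * y $ k) * u k $ i" by simp
    qed
    also have "\<dots> = (\<nu> \<cdot>\<^sub>v w) $ i" using i by (simp add: w_def lin_comb_def sum_distrib_left mult.assoc)
    finally show "(C *\<^sub>v w) $ i = (\<nu> \<cdot>\<^sub>v w) $ i" .
  qed (use C in \<open>simp add: w_def lin_comb_def\<close>)
  ultimately show ?thesis by blast
qed

section \<open>Degeneration to a direct sum\<close>

lemma sum_lessThan_split:
  fixes d m :: nat
  shows "(\<Sum>k<d + m. f k) = (\<Sum>k<d. f k) + (\<Sum>k<m. f (d + k) :: 'a::comm_monoid_add)"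
  by (induction m) (simp_all add: add.assoc)

lemma mat_mult_entry:
  assumes "M \<in> carrier_mat n n" "M' \<in> carrier_mat n n" "i < n" "j < n"
  shows "(M * M') $$ (i, j) = (\<Sum>k<n. M $$ (i, k) * M' $$ (k, j))"
  using assms by (simp add: scalar_prod_def lessThan_atLeast0)

text \<open>An invariant subspace of dimension \<open>d\<close> makes the pair block triangular. Conjugation with
  \<open>diag (s, \<dots>, s, 1, \<dots>, 1)\<close> multiplies the off-diagonal block by \<open>s\<close>, so the block diagonal pair is in the
  closure of the orbit.\<close>

lemma split_invariant_subspace:
  fixes q :: "'a::field_char_0"
  assumes x: "x \<in> qcomm q n" and \<beta>: "\<beta> \<in> mat2_space d" and w: "lin_indep n d w"
    and Aw: "\<And>j. j < d \<Longrightarrow> fst x *\<^sub>v w j = lin_comb n d (\<lambda>k. fst \<beta> $$ (k, j)) w"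
    and Bw: "\<And>j. j < d \<Longrightarrow> snd x *\<^sub>v w j = lin_comb n d (\<lambda>k. snd \<beta> $$ (k, j)) w"
  shows "\<exists>y\<in>qcomm q (n - d). dsum \<beta> y \<in> orbit_closure n {x}"
proof -
  have dn: "d \<le> n" by (rule lin_indep_le[OF w])
  have xs: "x \<in> mat2_space n" using x unfolding qcomm_def by blast
  have xc: "fst x \<in> carrier_mat n n" "snd x \<in> carrier_mat n n" using xs by (auto simp: mem_Times_iff)
  obtain w' where w': "\<And>j. j < d \<Longrightarrow> w' j = w j" "lin_indep n n w'" using lin_indep_extend[OF w] by blast
  define P where "P = mat n n (\<lambda>(i, j). w' j $ i)"
  obtain Q where PQ: "inverse_pair n P Q" using lin_indep_inverse[OF w'(2)] unfolding P_def by blast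
  then have QP: "inverse_pair n Q P" unfolding inverse_pair_def by blast
  have c: "P \<in> carrier_mat n n" "Q \<in> carrier_mat n n" "Q * P = 1\<^sub>m n" using PQ unfolding inverse_pair_def by auto
  define z where "z = conj2 Q P x"
  have zs: "z \<in> mat2_space n" unfolding z_def by (rule conj2_carrier[OF QP xs])
  have zo: "z \<in> gl_orbit n x" unfolding in_gl_orbit[OF xs] z_def using QP by blast
  have zq: "z \<in> qcomm q n" by (rule qcomm_stable[OF x zo])
  have block: "(Q * M * P) $$ (i, j) = (if i < d then N $$ (i, j) else 0)"
    if M: "M \<in> carrier_mat n n" and Mw: "\<And>j. j < d \<Longrightarrow> M *\<^sub>v w j = lin_comb n d (\<lambda>k. N $$ (k, j)) w"
      and i: "i < n" and j: "j < d" for M N :: "'a mat" and i j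
  proof -
    have jn: "j < n" using j dn by simp
    have colP: "col P j = w j" using w' j jn by (intro eq_vecI) (auto simp: P_def lin_indep_def carrier_vecD)
    have MP: "(M * P) $$ (k, j) = (\<Sum>l<d. N $$ (l, j) * w l $ k)" if k: "k < n" for k
    proof -
      have "(M * P) $$ (k, j) = row M k \<bullet> col P j" using M c k jn by simp
      also have "\<dots> = (M *\<^sub>v w j) $ k" unfolding colP using M k by simp
      finally show ?thesis unfolding Mw[OF j] using k by (simp add: lin_comb_def)
    qed
    have "(Q * M * P) $$ (i, j) = (Q * (M * P)) $$ (i, j)" using M c by (simp add: assoc_mult_mat[of _ n n _ n _ n])
    also have "\<dots> = (\<Sum>k<n. Q $$ (i, k) * (M * P) $$ (k, j))"
      by (rule mat_mult_entry) (use M c i jn in auto)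
    also have "\<dots> = (\<Sum>k<n. \<Sum>l<d. N $$ (l, j) * (Q $$ (i, k) * P $$ (k, l)))"
      using MP w' dn by (intro sum.cong refl) (auto simp: P_def sum_distrib_left mult_ac)
    also have "\<dots> = (\<Sum>l<d. \<Sum>k<n. N $$ (l, j) * (Q $$ (i, k) * P $$ (k, l)))" by (rule sum.swap)
    also have "\<dots> = (\<Sum>l<d. N $$ (l, j) * (Q * P) $$ (i, l))"
    proof (rule sum.cong[OF refl])
      fix l assume "l \<in> {..<d}"
      then have l: "l < n" using dn by simp
      show "(\<Sum>k<n. N $$ (l, j) * (Q $$ (i, k) * P $$ (k, l))) = N $$ (l, j) * (Q * P) $$ (i, l)"
        unfolding mat_mult_entry[OF c(2,1) i l] sum_distrib_left ..
    qed
    also have "\<dots> = (\<Sum>l<d. if l = i then N $$ (l, j) else 0)"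
      unfolding c(3) using i dn by (intro sum.cong) auto
    finally show ?thesis by (simp add: sum.delta)
  qed
  have zA: "fst z $$ (i, j) = (if i < d then fst \<beta> $$ (i, j) else 0)" and
    zB: "snd z $$ (i, j) = (if i < d then snd \<beta> $$ (i, j) else 0)" if "i < n" "j < d" for i j
    unfolding z_def conj2_def using block[OF xc(1) Aw that] block[OF xc(2) Bw that] by simp_all
  let ?low = "\<lambda>M :: 'a mat. mat (n - d) (n - d) (\<lambda>(i, j). M $$ (d + i, d + j))"
  define y where "y = (?low (fst z), ?low (snd z))"
  have zc: "fst z \<in> carrier_mat n n" "snd z \<in> carrier_mat n n" using zs by (auto simp: mem_Times_iff)
  have low_mult: "?low M * ?low M' = ?low (M * M')"
    if "M \<in> carrier_mat n n" "M' \<in> carrier_mat n n" "\<And>i j. d \<le> i \<Longrightarrow> i < n \<Longrightarrow> j < d \<Longrightarrow> M $$ (i, j) = 0"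
    for M M' :: "'a mat"
  proof (rule eq_matI)
    fix i j assume "i < dim_row (?low (M * M'))" "j < dim_col (?low (M * M'))"
    then have ij: "i < n - d" "j < n - d" by auto
    have n: "n = d + (n - d)" using dn by simp
    have "(M * M') $$ (d + i, d + j) = (\<Sum>k<d + (n - d). M $$ (d + i, k) * M' $$ (k, d + j))"
      using mat_mult_entry[OF that(1,2), of "d + i" "d + j"] ij n by simp
    also have "\<dots> = (\<Sum>k<n - d. M $$ (d + i, d + k) * M' $$ (d + k, d + j))"
      unfolding sum_lessThan_split using that(3)[of "d + i"] ij by simp
    finally show "(?low M * ?low M') $$ (i, j) = ?low (M * M') $$ (i, j)"
      using ij mat_mult_entry[of "?low M" "n - d" "?low M'" i j] by simp
  qed auto
  have "fst y * snd y = ?low (fst z * snd z)" unfolding y_def using low_mult[OF zc] zA by simp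
  also have "fst z * snd z = q \<cdot>\<^sub>m (snd z * fst z)" using zq unfolding qcomm_def by auto
  also have "?low (q \<cdot>\<^sub>m (snd z * fst z)) = q \<cdot>\<^sub>m ?low (snd z * fst z)"
    using zc by (intro eq_matI) auto
  also have "?low (snd z * fst z) = snd y * fst y" unfolding y_def using low_mult[OF zc(2,1)] zB by simp
  finally have yq: "y \<in> qcomm q (n - d)" unfolding qcomm_def y_def by simp
  have ys: "y \<in> mat2_space (n - d)" unfolding y_def by simp
  let ?s = "\<lambda>s (M :: 'a mat). mat n n (\<lambda>(i, j). if i < d \<and> d \<le> j then s * M $$ (i, j) else M $$ (i, j))"
  define \<psi> where "\<psi> = (\<lambda>s. (?s s (fst z), ?s s (snd z)))"
  have "\<psi> 0 = dsum \<beta> y"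
  proof -
    have sp: "dsum \<beta> y \<in> mat2_space n" using dsum_space[OF \<beta> ys] dn by simp
    have "?s 0 (fst z) = fst (dsum \<beta> y)"
    proof (rule eq_matI)
      fix i j assume "i < dim_row (fst (dsum \<beta> y))" "j < dim_col (fst (dsum \<beta> y))"
      then have "i < n" "j < n" using sp by (auto simp: mem_Times_iff)
      then show "?s 0 (fst z) $$ (i, j) = fst (dsum \<beta> y) $$ (i, j)"
        using dsum_entry(1)[OF \<beta> ys, of i j] dn zA[of i j] by (auto simp: y_def)
    qed (use sp in \<open>auto simp: mem_Times_iff\<close>)
    moreover have "?s 0 (snd z) = snd (dsum \<beta> y)"
    proof (rule eq_matI)
      fix i j assume "i < dim_row (snd (dsum \<beta> y))" "j < dim_col (snd (dsum \<beta> y))"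
      then have "i < n" "j < n" using sp by (auto simp: mem_Times_iff)
      then show "?s 0 (snd z) $$ (i, j) = snd (dsum \<beta> y) $$ (i, j)"
        using dsum_entry(2)[OF \<beta> ys, of i j] dn zB[of i j] by (auto simp: y_def)
    qed (use sp in \<open>auto simp: mem_Times_iff\<close>)
    ultimately show ?thesis unfolding \<psi>_def by (simp add: prod_eq_iff)
  qed
  moreover have "\<psi> 0 \<in> orbit_closure n {x}"
  proof (rule orbit_closure_curve)
    show "\<psi> s \<in> mat2_space n" for s unfolding \<psi>_def by simp
    have lin: "\<exists>p. \<forall>s. ?s s M $$ (i, j) = poly p s" if "i < n" "j < n" for M i j
    proof (cases "i < d \<and> d \<le> j")
      case True
      then show ?thesis using that by (intro exI[of _ "[:0, M $$ (i, j):]"]) simp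
    next
      case False
      then show ?thesis using that by (intro exI[of _ "[:M $$ (i, j):]"]) auto
    qed
    show "\<exists>p. \<forall>s. fst (\<psi> s) $$ (i, j) = poly p s" if "i < n" "j < n" for i j
      using lin[OF that] unfolding \<psi>_def by simp
    show "\<exists>p. \<forall>s. snd (\<psi> s) $$ (i, j) = poly p s" if "i < n" "j < n" for i j
      using lin[OF that] unfolding \<psi>_def by simp
    have "\<psi> s \<in> orbit_closure n {x}" if s: "s \<noteq> 0" for s
    proof -
      let ?D = "mat_diag n (\<lambda>i. if i < d then s else 1)" and ?E = "mat_diag n (\<lambda>i. if i < d then inverse s else 1)"
      have one: "(\<lambda>i. (if i < d then s else 1) * (if i < d then inverse s else 1)) = (\<lambda>_. 1)"
        "(\<lambda>i. (if i < d then inverse s else 1) * (if i < d then s else 1)) = (\<lambda>_. 1)"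
        using s by auto
      have DE: "inverse_pair n ?D ?E" unfolding inverse_pair_def by (simp add: one)
      have "?D * M * ?E = ?s s M" if M: "M \<in> carrier_mat n n" "\<And>i j. d \<le> i \<Longrightarrow> i < n \<Longrightarrow> j < d \<Longrightarrow> M $$ (i, j) = 0" for M
        using s M by (simp add: mat_diag_mult_left[OF M(1)] mat_diag_mult_right[of _ n n]) (auto intro!: eq_matI)
      then have "\<psi> s = conj2 ?D ?E z" unfolding \<psi>_def conj2_def using zc zA zB by simp
      then have "\<psi> s \<in> gl_orbit n z" unfolding in_gl_orbit[OF zs] using DE by blast
      then have "\<psi> s \<in> gl_orbit n x" by (rule gl_orbit_trans[OF xs zo])
      then show ?thesis by (rule orbit_in_closure[rotated]) simp
    qed
    then have "{s. \<psi> s \<notin> orbit_closure n {x}} \<subseteq> {0}" by blast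
    then show "finite {s. \<psi> s \<notin> orbit_closure n {x}}" by (rule finite_subset) simp
  qed
  ultimately show ?thesis using yq by auto
qed


section \<open>Simple pairs and semisimplification\<close>

definition primitive_root :: "'a::monoid_mult \<Rightarrow> nat \<Rightarrow> bool" where
  "primitive_root q L \<longleftrightarrow> L > 0 \<and> q ^ L = 1 \<and> (\<forall>k. 0 < k \<and> k < L \<longrightarrow> q ^ k \<noteq> 1)"

text \<open>The simple pairs are lines, on which \<open>A\<close> or \<open>B\<close> is zero unless \<open>q = 1\<close>, and, for nonzero \<open>a\<close> and \<open>b\<close> and a primitive root of
  unity of order \<open>L\<close>, the cyclic pairs of size \<open>L\<close>: \<open>A\<close> is diagonal with \<open>L\<close> different eigenvalues, and \<open>B\<close> permutes the
  eigenspaces cyclically.\<close>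

definition line :: "'a \<Rightarrow> 'a \<Rightarrow> 'a mat2" where
  "line a b = (mat 1 1 (\<lambda>_. a), mat 1 1 (\<lambda>_. b))"

definition cyclic_pair :: "'a::field \<Rightarrow> nat \<Rightarrow> 'a \<Rightarrow> 'a \<Rightarrow> 'a mat2" where
  "cyclic_pair q L a b = (mat_diag L (\<lambda>k. a * inverse q ^ k),
     mat L L (\<lambda>(i, j). if j = (i + 1) mod L then b else 0))"

lemma primitive_root_nonzero: "primitive_root (q :: 'a::field) L \<Longrightarrow> q \<noteq> 0"
  unfolding primitive_root_def by (auto simp: power_0_left)

lemma primitive_root_shift:
  fixes q :: "'a::field"
  assumes q: "primitive_root q L" and i: "i < L"
  shows "q * inverse q ^ ((i + 1) mod L) = inverse q ^ i"
proof -
  have q0: "q \<noteq> 0" by (rule primitive_root_nonzero[OF q])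
  show ?thesis
  proof (cases "i + 1 < L")
    case True
    then show ?thesis using q0 by simp
  next
    case False
    then have "i + 1 = L" using i by simp
    moreover have "q ^ (i + 1) = 1" using q calculation unfolding primitive_root_def by simp
    then have "inverse q ^ i = q" using q0 by (simp add: power_inverse field_simps)
    ultimately show ?thesis by simp
  qed
qed

lemma power_eq_imp:
  fixes q :: "'a::field"
  assumes "q \<noteq> 0" "q ^ i = q ^ j" "i < j" shows "q ^ (j - i) = 1"
  using assms by (simp add: power_diff)

lemma primitive_root_inj:
  fixes q :: "'a::field"
  assumes q: "primitive_root q L" and ij: "i < L" "j < L" "inverse q ^ i = inverse q ^ j"
  shows "i = j"
proof (rule ccontr)
  assume ne: "i \<noteq> j"
  have q0: "q \<noteq> 0" by (rule primitive_root_nonzero[OF q])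
  have eq: "q ^ i = q ^ j" using ij(3) by (simp add: power_inverse)
  have no: "q ^ k \<noteq> 1" if "0 < k" "k < L" for k using q that unfolding primitive_root_def by blast
  show False
  proof (cases "i < j")
    case True
    then show False using power_eq_imp[OF q0 eq True] no[of "j - i"] ij by simp
  next
    case False
    then have "j < i" using ne by simp
    then show False using power_eq_imp[OF q0 eq[symmetric]] no[of "i - j"] ij by simp
  qed
qed

lemma line_space: "line a b \<in> mat2_space 1"
  unfolding line_def by simp

lemma line_qcomm: "a * b = q * (b * a) \<longleftrightarrow> line a b \<in> qcomm q 1"
proof -
  have "mat 1 1 (\<lambda>_. a) * mat 1 1 (\<lambda>_. b) = mat 1 1 (\<lambda>_. a * b)" for a b :: 'a
    by (rule eq_matI) (simp_all add: scalar_prod_def)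
  moreover have "q \<cdot>\<^sub>m mat 1 1 (\<lambda>_. b * a) = mat 1 1 (\<lambda>_. q * (b * a))" by (rule eq_matI) simp_all
  moreover have "mat 1 1 (\<lambda>_. u) = mat 1 1 (\<lambda>_. v) \<longleftrightarrow> u = v" for u v :: 'a
  proof
    assume "mat 1 1 (\<lambda>_. u) = mat 1 1 (\<lambda>_. v)"
    then have "mat 1 1 (\<lambda>_. u) $$ (0, 0) = mat 1 1 (\<lambda>_. v) $$ (0, 0)" by (simp only:)
    then show "u = v" by simp
  qed simp
  ultimately show ?thesis unfolding line_def qcomm_def by simp
qed

lemma cyclic_pair_space: "cyclic_pair q L a b \<in> mat2_space L"
  unfolding cyclic_pair_def by simp

lemma weighted_cycle_qcomm:
  fixes q :: "'a::field"
  assumes q: "primitive_root q L"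
  shows "(mat_diag L (\<lambda>k. a * inverse q ^ k), mat L L (\<lambda>(i, j). if j = (i + 1) mod L then w i else 0)) \<in> qcomm q L"
proof -
  let ?B = "mat L L (\<lambda>(i, j). if j = (i + 1) mod L then w i else 0)"
  have B: "?B \<in> carrier_mat L L" by simp
  have "a * inverse q ^ i * (if j = (i + 1) mod L then w i else 0) =
      q * ((if j = (i + 1) mod L then w i else 0) * (a * inverse q ^ j))" if "i < L" for i j
    using primitive_root_shift[OF q that] by (simp add: mult_ac)
  then have "mat_diag L (\<lambda>k. a * inverse q ^ k) * ?B = q \<cdot>\<^sub>m (?B * mat_diag L (\<lambda>k. a * inverse q ^ k))"
    unfolding mat_diag_mult_left[OF B] mat_diag_mult_right[OF B] by (intro eq_matI) auto
  then show ?thesis unfolding qcomm_def by simp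
qed

lemma cyclic_pair_qcomm: "primitive_root q L \<Longrightarrow> cyclic_pair q L a b \<in> qcomm q L"
  unfolding cyclic_pair_def by (rule weighted_cycle_qcomm)

lemma split_line:
  fixes q :: "'a::field_char_0"
  assumes x: "x \<in> qcomm q n" and u: "u \<in> carrier_vec n" "u \<noteq> 0\<^sub>v n"
    and ev: "fst x *\<^sub>v u = a \<cdot>\<^sub>v u" "snd x *\<^sub>v u = b \<cdot>\<^sub>v u"
  shows "\<exists>y\<in>qcomm q (n - 1). dsum (line a b) y \<in> orbit_closure n {x}" and "1 \<le> n"
proof -
  have "\<exists>i<n. u $ i \<noteq> 0"
  proof (rule ccontr)
    assume "\<not> ?thesis"
    then have "u = 0\<^sub>v n" using u(1) by (intro eq_vecI) auto
    then show False using u(2) by simp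
  qed
  then have ind: "lin_indep n 1 (\<lambda>_. u)" unfolding lin_indep_def using u(1) by auto
  then show "1 \<le> n" by (rule lin_indep_le)
  show "\<exists>y\<in>qcomm q (n - 1). dsum (line a b) y \<in> orbit_closure n {x}"
  proof (rule split_invariant_subspace[OF x line_space ind])
    fix j :: nat assume j: "j < 1"
    show "fst x *\<^sub>v u = lin_comb n 1 (\<lambda>k. fst (line a b) $$ (k, j)) (\<lambda>_. u)"
      unfolding ev using u(1) j by (intro eq_vecI) (simp_all add: lin_comb_def line_def carrier_vecD)
    show "snd x *\<^sub>v u = lin_comb n 1 (\<lambda>k. snd (line a b) $$ (k, j)) (\<lambda>_. u)"
      unfolding ev using u(1) j by (intro eq_vecI) (simp_all add: lin_comb_def line_def carrier_vecD)
  qed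
qed

lemma pow_mat_vec:
  fixes B :: "'a::comm_ring_1 mat"
  assumes B: "B \<in> carrier_mat n n"
  shows "u \<in> carrier_vec n \<Longrightarrow> (B ^\<^sub>m k) *\<^sub>v u = ((\<lambda>x. B *\<^sub>v x) ^^ k) u"
proof (induction k arbitrary: u)
  case 0
  then show ?case using B by simp
next
  case (Suc k)
  have "(B ^\<^sub>m Suc k) *\<^sub>v u = (B ^\<^sub>m k) *\<^sub>v (B *\<^sub>v u)"
    using B Suc.prems by (simp add: assoc_mult_mat_vec[of _ n n _ n])
  also have "\<dots> = ((\<lambda>x. B *\<^sub>v x) ^^ k) (B *\<^sub>v u)" by (rule Suc.IH) (use B Suc.prems in simp)
  finally show ?case by (simp add: funpow_swap1)
qed

lemma smult_mat_vec:
  fixes c :: "'a::comm_ring_1"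
  assumes "M \<in> carrier_mat n n" "u \<in> carrier_vec n"
  shows "(c \<cdot>\<^sub>m M) *\<^sub>v u = c \<cdot>\<^sub>v (M *\<^sub>v u)"
  using assms by (intro eq_vecI) (auto simp: scalar_prod_def sum_distrib_left mult.assoc)

text \<open>Every pair contains a simple pair. If \<open>A\<close> has an eigenvector \<open>v\<close> with nonzero eigenvalue, the vectors
  \<open>B ^ k v\<close> are zero or eigenvectors of \<open>A\<close> for eigenvalues differing by powers of \<open>q\<close>. Either one of them is zero,
  and the last nonzero one spans an invariant line, or \<open>q\<close> is a primitive root of some order \<open>L\<close>, and \<open>v\<close> can be
  chosen as an eigenvector of \<open>B ^ L\<close>, so that \<open>L\<close> of them span a cyclic pair. If \<open>A\<close> is nilpotent, \<open>B\<close> has an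
  eigenvector in the kernel of \<open>A\<close>.\<close>

lemma simple_subpair:
  fixes q :: "'a::{alg_closed_field, field_char_0}"
  assumes q: "q \<noteq> 0" and per: "primitive_root q L \<or> (\<forall>k>0. q ^ k \<noteq> 1)"
    and x: "x \<in> qcomm q n" and n: "n > 0"
  shows "\<exists>d \<beta>. 0 < d \<and> d \<le> n \<and> ((d = 1 \<and> (\<exists>a. \<beta> = line a 0)) \<or> (d = 1 \<and> (\<exists>b. \<beta> = line 0 b)) \<or>
      (primitive_root q L \<and> d = L \<and> (\<exists>a b. \<beta> = cyclic_pair q L a b))) \<and>
    (\<exists>y\<in>qcomm q (n - d). dsum \<beta> y \<in> orbit_closure n {x})"
proof -
  obtain A B where AB: "x = (A, B)" "A \<in> carrier_mat n n" "B \<in> carrier_mat n n" "A * B = q \<cdot>\<^sub>m (B * A)"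
    using x unfolding qcomm_def by blast
  let ?f = "\<lambda>u. B *\<^sub>v u"
  have comm: "A *\<^sub>v (B *\<^sub>v u) = (q * \<mu>) \<cdot>\<^sub>v (B *\<^sub>v u)" if u: "u \<in> carrier_vec n" "A *\<^sub>v u = \<mu> \<cdot>\<^sub>v u" for u \<mu>
  proof -
    have BA: "B * A \<in> carrier_mat n n" using AB by simp
    have "A *\<^sub>v (B *\<^sub>v u) = (q \<cdot>\<^sub>m (B * A)) *\<^sub>v u"
      using AB(2,3) u(1) by (simp add: assoc_mult_mat_vec[of _ n n _ n, symmetric] AB(4))
    also have "\<dots> = q \<cdot>\<^sub>v ((B * A) *\<^sub>v u)" by (rule smult_mat_vec[OF BA u(1)])
    also have "(B * A) *\<^sub>v u = B *\<^sub>v (\<mu> \<cdot>\<^sub>v u)" using AB(2,3) u by (simp add: assoc_mult_mat_vec[of _ n n _ n])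
    also have "\<dots> = \<mu> \<cdot>\<^sub>v (B *\<^sub>v u)" by (rule mult_mat_vec[OF AB(3) u(1)])
    finally show ?thesis using AB(3) u(1) by (simp add: smult_smult_assoc)
  qed
  have iter: "(?f ^^ k) u \<in> carrier_vec n" "A *\<^sub>v (?f ^^ k) u = (q ^ k * \<mu>) \<cdot>\<^sub>v (?f ^^ k) u"
    if u: "u \<in> carrier_vec n" "A *\<^sub>v u = \<mu> \<cdot>\<^sub>v u" for u k \<mu>
  proof -
    have "(?f ^^ k) u \<in> carrier_vec n \<and> A *\<^sub>v (?f ^^ k) u = (q ^ k * \<mu>) \<cdot>\<^sub>v (?f ^^ k) u"
    proof (induction k)
      case (Suc k)
      then show ?case using comm[of "(?f ^^ k) u" "q ^ k * \<mu>"] AB(3) by (simp add: mult.assoc)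
    qed (use u in simp)
    then show "(?f ^^ k) u \<in> carrier_vec n" "A *\<^sub>v (?f ^^ k) u = (q ^ k * \<mu>) \<cdot>\<^sub>v (?f ^^ k) u" by blast+
  qed
  have xline: ?thesis if u: "u \<in> carrier_vec n" "u \<noteq> 0\<^sub>v n" "A *\<^sub>v u = \<mu> \<cdot>\<^sub>v u" and z: "(?f ^^ k) u = 0\<^sub>v n" for u \<mu> k
  proof -
    define m where "m = (LEAST k. (?f ^^ k) u = 0\<^sub>v n)"
    have mz: "(?f ^^ m) u = 0\<^sub>v n" unfolding m_def using z by (rule LeastI)
    have "m \<noteq> 0" using mz u(2) by (metis funpow_0)
    then obtain m' where m': "m = Suc m'" by (cases m) auto
    have w: "(?f ^^ m') u \<noteq> 0\<^sub>v n" using not_less_Least[of m' "\<lambda>k. (?f ^^ k) u = 0\<^sub>v n"] m' unfolding m_def by auto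
    note it = iter[OF u(1,3), of m']
    have "B *\<^sub>v (?f ^^ m') u = 0 \<cdot>\<^sub>v (?f ^^ m') u"
      using mz it(1) unfolding m' by (intro eq_vecI) (auto simp: carrier_vecD)
    then have "\<exists>y\<in>qcomm q (n - 1). dsum (line (q ^ m' * \<mu>) 0) y \<in> orbit_closure n {x}" "1 \<le> n"
      using split_line[OF x it(1) w] it(2) AB(1) by simp_all
    then show ?thesis by (intro exI[of _ 1] exI[of _ "line (q ^ m' * \<mu>) 0"]) auto
  qed
  show ?thesis
  proof (cases "\<exists>v \<mu>. v \<in> carrier_vec n \<and> v \<noteq> 0\<^sub>v n \<and> A *\<^sub>v v = \<mu> \<cdot>\<^sub>v v \<and> \<mu> \<noteq> 0")
    case True
    then obtain v \<mu> where v: "v \<in> carrier_vec n" "v \<noteq> 0\<^sub>v n" "A *\<^sub>v v = \<mu> \<cdot>\<^sub>v v" and \<mu>: "\<mu> \<noteq> 0" by blast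
    show ?thesis
    proof (cases "primitive_root q L")
      case False
      then have inf: "\<And>k. k > 0 \<Longrightarrow> q ^ k \<noteq> 1" using per by blast
      have "\<exists>k. (?f ^^ k) v = 0\<^sub>v n"
      proof (rule ccontr)
        assume nz: "\<not> ?thesis"
        have "lin_indep n (Suc n) (\<lambda>k. (?f ^^ k) v)"
        proof (rule eigenvectors_indep[OF AB(2)])
          show "(?f ^^ k) v \<in> carrier_vec n" "A *\<^sub>v (?f ^^ k) v = (q ^ k * \<mu>) \<cdot>\<^sub>v (?f ^^ k) v" for k
            using iter[OF v(1,3), of k] by simp_all
          show "(?f ^^ k) v \<noteq> 0\<^sub>v n" for k using nz by blast
          fix i j :: nat assume "i \<noteq> j"
          then have "q ^ i \<noteq> q ^ j"
            using power_eq_imp[OF q, of i j] power_eq_imp[OF q, of j i] inf[of "j - i"] inf[of "i - j"]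
            by (cases "i < j") auto
          then show "q ^ i * \<mu> \<noteq> q ^ j * \<mu>" using \<mu> by simp
        qed
        then show False using lin_indep_le by fastforce
      qed
      then obtain k where "(?f ^^ k) v = 0\<^sub>v n" ..
      then show ?thesis by (rule xline[OF v])
    next
      case prim: True
      then have L: "L > 0" "q ^ L = 1" unfolding primitive_root_def by auto
      have C: "B ^\<^sub>m L \<in> carrier_mat n n" using AB(3) by simp
      have "\<exists>w \<nu>. w \<in> carrier_vec n \<and> w \<noteq> 0\<^sub>v n \<and> A *\<^sub>v w = \<mu> \<cdot>\<^sub>v w \<and> B ^\<^sub>m L *\<^sub>v w = \<nu> \<cdot>\<^sub>v w"
      proof (rule common_eigenvector[OF AB(2) C v])
        fix u assume u: "u \<in> carrier_vec n" "A *\<^sub>v u = \<mu> \<cdot>\<^sub>v u"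
        show "A *\<^sub>v (B ^\<^sub>m L *\<^sub>v u) = \<mu> \<cdot>\<^sub>v (B ^\<^sub>m L *\<^sub>v u)"
          using iter(2)[OF u, of L] L(2) by (simp add: pow_mat_vec[OF AB(3) u(1)])
      qed
      then obtain u \<nu> where u: "u \<in> carrier_vec n" "u \<noteq> 0\<^sub>v n" "A *\<^sub>v u = \<mu> \<cdot>\<^sub>v u"
        and "B ^\<^sub>m L *\<^sub>v u = \<nu> \<cdot>\<^sub>v u" by blast
      then have uL: "(?f ^^ L) u = \<nu> \<cdot>\<^sub>v u" by (simp add: pow_mat_vec[OF AB(3) u(1)])
      show ?thesis
      proof (cases "\<nu> = 0")
        case True
        then have "(?f ^^ L) u = 0\<^sub>v n" using uL u(1) by (intro eq_vecI) auto
        then show ?thesis by (rule xline[OF u])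
      next
        case False
        \<comment> \<open>Rescaling the iterates by powers of an \<open>L\<close>-th root of \<open>\<nu>\<close> gives all the weights of \<open>B\<close> the same value \<open>b\<close>; they are
          numbered backwards because \<open>B\<close> multiplies the eigenvalue of \<open>A\<close> by \<open>q\<close>, while the diagonal has powers of \<open>inverse q\<close>.\<close>
        obtain b where b: "b ^ L = \<nu>" using nth_root_exists[OF L(1), of \<nu>] by blast
        have b0: "b \<noteq> 0" using b False L(1) by (auto simp: power_0_left)
        note it = iter[OF u(1,3)]
        define w where "w = (\<lambda>j. (b ^ j / \<nu>) \<cdot>\<^sub>v (?f ^^ (L - j)) u)"
        have wc: "w j \<in> carrier_vec n" for j unfolding w_def using it(1) by simp
        have nz: "(?f ^^ k) u \<noteq> 0\<^sub>v n" if k: "k \<le> L" for k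
        proof
          assume z: "(?f ^^ k) u = 0\<^sub>v n"
          have B0: "B *\<^sub>v 0\<^sub>v n = 0\<^sub>v n" using AB(3) by (intro eq_vecI) auto
          have f0: "(?f ^^ m) (0\<^sub>v n) = 0\<^sub>v n" for m by (induction m) (simp_all add: B0)
          have "(?f ^^ L) u = (?f ^^ (L - k)) ((?f ^^ k) u)" using k by (simp flip: funpow_add comp_apply[of "?f ^^ _"])
          then have vu: "\<nu> \<cdot>\<^sub>v u = 0\<^sub>v n" using uL z f0 by simp
          have "u $ i = 0" if "i < n" for i
            using arg_cong[OF vu, of "\<lambda>v. v $ i"] that False u(1) by simp
          then have "u = 0\<^sub>v n" using u(1) by (intro eq_vecI) auto
          then show False using u(2) by simp
        qed
        have wL: "w 0 = w L"
          unfolding w_def using uL b False u(1) by (intro eq_vecI) (auto simp: carrier_vecD)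
        have Bw: "B *\<^sub>v w (Suc j) = b \<cdot>\<^sub>v w j" if "j < L" for j
        proof -
          have "B *\<^sub>v w (Suc j) = (b ^ Suc j / \<nu>) \<cdot>\<^sub>v (?f ^^ Suc (L - Suc j)) u"
            unfolding w_def using mult_mat_vec[OF AB(3) it(1)[of "L - Suc j"]] by simp
          also have "Suc (L - Suc j) = L - j" using that by simp
          also have "(b ^ Suc j / \<nu>) \<cdot>\<^sub>v (?f ^^ (L - j)) u = b \<cdot>\<^sub>v w j"
            unfolding w_def by (simp add: smult_smult_assoc)
          finally show ?thesis .
        qed
        have qinv: "q ^ (L - j) = inverse q ^ j" if "j < L" for j
          using that L(2) q by (simp add: power_diff power_inverse divide_inverse)
        have Aw: "A *\<^sub>v w j = (\<mu> * inverse q ^ j) \<cdot>\<^sub>v w j" if "j < L" for j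
          unfolding w_def mult_mat_vec[OF AB(2) it(1)] it(2) qinv[OF that]
          by (simp add: smult_smult_assoc mult_ac)
        have ind: "lin_indep n L w"
        proof (rule eigenvectors_indep[OF AB(2) wc _ Aw])
          fix j assume "j < L"
          show "w j \<noteq> 0\<^sub>v n"
          proof
            assume z: "w j = 0\<^sub>v n"
            have "(?f ^^ (L - j)) u = 0\<^sub>v n"
            proof (rule eq_vecI)
              fix i assume i: "i < dim_vec (0\<^sub>v n :: 'a vec)"
              have "w j $ i = 0" using z i by simp
              then show "(?f ^^ (L - j)) u $ i = 0\<^sub>v n $ i"
                using i b0 False it(1)[of "L - j"] by (simp add: w_def carrier_vecD)
            qed (use it(1)[of "L - j"] in \<open>simp add: carrier_vecD\<close>)
            then show False using nz[of "L - j"] by simp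
          qed
        next
          fix i j assume "i < L" "j < L" "i \<noteq> j"
          then show "\<mu> * inverse q ^ i \<noteq> \<mu> * inverse q ^ j" using primitive_root_inj[OF prim] \<mu> by auto
        qed
        have "\<exists>y\<in>qcomm q (n - L). dsum (cyclic_pair q L \<mu> b) y \<in> orbit_closure n {x}"
        proof (rule split_invariant_subspace[OF x cyclic_pair_space ind])
          fix j assume j: "j < L"
          show "fst x *\<^sub>v w j = lin_comb n L (\<lambda>k. fst (cyclic_pair q L \<mu> b) $$ (k, j)) w"
          proof -
            have "(\<Sum>k<L. fst (cyclic_pair q L \<mu> b) $$ (k, j) * w k $ i) =
                (\<Sum>k<L. if k = j then \<mu> * inverse q ^ j * w j $ i else 0)" for i
              using j by (intro sum.cong) (auto simp: cyclic_pair_def mat_diag_def)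
            then show ?thesis using Aw[OF j] j carrier_vecD[OF wc, of j] AB(1)
              by (intro eq_vecI) (simp_all add: lin_comb_def sum.delta)
          qed
          define j' where "j' = (if j = 0 then L - 1 else j - 1)"
          have j': "j' < L" "\<And>k. k < L \<Longrightarrow> j = (k + 1) mod L \<longleftrightarrow> k = j'"
          proof -
            show "j' < L" using j unfolding j'_def by auto
            fix k assume "k < L"
            then show "j = (k + 1) mod L \<longleftrightarrow> k = j'"
              using j unfolding j'_def by (cases "k + 1 = L") auto
          qed
          have "B *\<^sub>v w j = b \<cdot>\<^sub>v w j'"
          proof (cases "j = 0")
            case True
            then have "B *\<^sub>v w j = B *\<^sub>v w (Suc (L - 1))" using wL L(1) by simp
            also have "\<dots> = b \<cdot>\<^sub>v w (L - 1)" by (rule Bw) (use L(1) in simp)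
            finally show ?thesis using True j'_def by simp
          next
            case False
            then show ?thesis using Bw[of "j - 1"] j j'_def by simp
          qed
          moreover have "(\<Sum>k<L. snd (cyclic_pair q L \<mu> b) $$ (k, j) * w k $ i) =
              (\<Sum>k<L. if k = j' then b * w j' $ i else 0)" for i
            using j j'(2) by (intro sum.cong) (auto simp: cyclic_pair_def)
          ultimately show "snd x *\<^sub>v w j = lin_comb n L (\<lambda>k. snd (cyclic_pair q L \<mu> b) $$ (k, j)) w"
            using j'(1) carrier_vecD[OF wc, of j'] AB(1)
            by (intro eq_vecI) (simp_all add: lin_comb_def sum.delta)
        qed
        then show ?thesis using lin_indep_le[OF ind] prim L(1)
          by (intro exI[of _ L] exI[of _ "cyclic_pair q L \<mu> b"]) auto
      qed
    qed
  next
    case False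
    obtain v \<mu> where v: "v \<in> carrier_vec n" "v \<noteq> 0\<^sub>v n" "A *\<^sub>v v = \<mu> \<cdot>\<^sub>v v"
      using exists_eigenvector[OF AB(2) n] by blast
    have \<mu>: "\<mu> = 0" using False v by blast
    have "\<exists>w \<nu>. w \<in> carrier_vec n \<and> w \<noteq> 0\<^sub>v n \<and> A *\<^sub>v w = 0 \<cdot>\<^sub>v w \<and> B *\<^sub>v w = \<nu> \<cdot>\<^sub>v w"
      by (rule common_eigenvector[OF AB(2,3) v[unfolded \<mu>]]) (use comm in fastforce)
    then obtain w \<nu> where w: "w \<in> carrier_vec n" "w \<noteq> 0\<^sub>v n" "A *\<^sub>v w = 0 \<cdot>\<^sub>v w" "B *\<^sub>v w = \<nu> \<cdot>\<^sub>v w" by blast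
    have "\<exists>y\<in>qcomm q (n - 1). dsum (line 0 \<nu>) y \<in> orbit_closure n {x}" "1 \<le> n"
      using split_line[OF x w(1,2), of 0 \<nu>] w(3,4) AB(1) by simp_all
    then show ?thesis by (intro exI[of _ 1] exI[of _ "line 0 \<nu>"]) auto
  qed
qed

definition simple_sum :: "'a::field \<Rightarrow> nat \<Rightarrow> ('a \<times> 'a) list \<Rightarrow> 'a list \<Rightarrow> 'a list \<Rightarrow> 'a mat2" where
  "simple_sum q L cs as bs = dsum (dsums (map (\<lambda>(a, b). cyclic_pair q L a b) cs))
     (dsum (dsums (map (\<lambda>a. line a 0) as)) (dsums (map (\<lambda>b. line 0 b) bs)))"

lemma cyclic_sum_space: "dsums (map (\<lambda>(a, b). cyclic_pair q L a b) cs) \<in> mat2_space (L * length cs)"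
proof -
  have "set (map (\<lambda>(a, b). cyclic_pair q L a b) cs) \<subseteq> mat2_space L"
  proof
    fix x assume "x \<in> set (map (\<lambda>(a, b). cyclic_pair q L a b) cs)"
    then obtain a b where "x = cyclic_pair q L a b" by auto
    then show "x \<in> mat2_space L" by (simp only: cyclic_pair_space)
  qed
  from dsums_space[OF this] show ?thesis by simp
qed

lemma line_sum_space: "dsums (map (\<lambda>a. line (f a) (g a)) as) \<in> mat2_space (length as)"
proof -
  have "set (map (\<lambda>a. line (f a) (g a)) as) \<subseteq> mat2_space 1"
  proof
    fix x assume "x \<in> set (map (\<lambda>a. line (f a) (g a)) as)"
    then obtain a where "x = line (f a) (g a)" by auto
    then show "x \<in> mat2_space 1" by (simp only: line_space)
  qed
  from dsums_space[OF this] show ?thesis by simp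
qed

lemma simple_sum_cyclic:
  "dsum (cyclic_pair q L a b) (simple_sum q L cs as bs) = simple_sum q L ((a, b) # cs) as bs"
  unfolding simple_sum_def
  by (simp only: list.map prod.case dsums_simps dsum_assoc[OF cyclic_pair_space cyclic_sum_space
    dsum_space[OF line_sum_space[of "\<lambda>a. a" "\<lambda>_. 0"] line_sum_space[of "\<lambda>_. 0" "\<lambda>b. b"]]])

lemma simple_sum_line1:
  fixes q :: "'a::field"
  assumes n: "n = L * length cs + length as + length bs"
  shows "simple_sum q L cs (a # as) bs \<in> gl_orbit (Suc n) (dsum (line a 0) (simple_sum q L cs as bs))"
proof -
  let ?C = "dsums (map (\<lambda>(a, b). cyclic_pair q L a b) cs)" and ?X = "dsums (map (\<lambda>a. line a 0) as)"
    and ?Y = "dsums (map (\<lambda>b. line 0 b) bs)"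
  have C: "?C \<in> mat2_space (L * length cs)" by (rule cyclic_sum_space)
  have X: "?X \<in> mat2_space (length as)" by (rule line_sum_space)
  have Y: "?Y \<in> mat2_space (length bs)" by (rule line_sum_space)
  note XY = dsum_space[OF X Y]
  have "simple_sum q L cs (a # as) bs = dsum (dsum ?C (line a 0)) (dsum ?X ?Y)"
    unfolding simple_sum_def list.map dsums_simps
    using dsum_assoc[OF line_space X Y, of a 0] dsum_assoc[OF C line_space XY, of a 0] by simp
  moreover have "dsum (line a 0) (simple_sum q L cs as bs) = dsum (dsum (line a 0) ?C) (dsum ?X ?Y)"
    unfolding simple_sum_def using dsum_assoc[OF line_space C XY, of a 0] by simp
  moreover have "dsum (dsum ?C (line a 0)) (dsum ?X ?Y) \<in>
      gl_orbit ((L * length cs + 1) + (length as + length bs)) (dsum (dsum (line a 0) ?C) (dsum ?X ?Y))"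
  proof (rule dsum_orbit[OF _ XY dsum_commute[OF C line_space] gl_orbit_refl[OF XY]])
    show "dsum (line a 0) ?C \<in> mat2_space (L * length cs + 1)"
      using dsum_space[OF line_space C, of a 0] by (simp add: add.commute)
  qed
  moreover have "(L * length cs + 1) + (length as + length bs) = Suc n" using n by simp
  ultimately show ?thesis by simp
qed

lemma simple_sum_line2:
  fixes q :: "'a::field"
  assumes n: "n = L * length cs + length as + length bs"
  shows "simple_sum q L cs as (b # bs) \<in> gl_orbit (Suc n) (dsum (line 0 b) (simple_sum q L cs as bs))"
proof -
  let ?C = "dsums (map (\<lambda>(a, b). cyclic_pair q L a b) cs)" and ?X = "dsums (map (\<lambda>a. line a 0) as)"
    and ?Y = "dsums (map (\<lambda>b. line 0 b) bs)"
  have C: "?C \<in> mat2_space (L * length cs)" by (rule cyclic_sum_space)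
  have X: "?X \<in> mat2_space (length as)" by (rule line_sum_space)
  have Y: "?Y \<in> mat2_space (length bs)" by (rule line_sum_space)
  note CX = dsum_space[OF C X] and bY = dsum_space[OF line_space Y, of 0 b]
  have "simple_sum q L cs as (b # bs) = dsum (dsum (dsum ?C ?X) (line 0 b)) ?Y"
    unfolding simple_sum_def list.map dsums_simps
    using dsum_assoc[OF C X bY] dsum_assoc[OF CX line_space Y, of 0 b] by simp
  moreover have "dsum (line 0 b) (simple_sum q L cs as bs) = dsum (dsum (line 0 b) (dsum ?C ?X)) ?Y"
    unfolding simple_sum_def using dsum_assoc[OF C X Y] dsum_assoc[OF line_space CX Y, of 0 b] by simp
  moreover have "dsum (dsum (dsum ?C ?X) (line 0 b)) ?Y \<in>
      gl_orbit ((L * length cs + length as + 1) + length bs) (dsum (dsum (line 0 b) (dsum ?C ?X)) ?Y)"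
  proof (rule dsum_orbit[OF _ Y dsum_commute[OF CX line_space] gl_orbit_refl[OF Y]])
    show "dsum (line 0 b) (dsum ?C ?X) \<in> mat2_space (L * length cs + length as + 1)"
      using dsum_space[OF line_space CX, of 0 b] by (simp add: add.commute)
  qed
  moreover have "(L * length cs + length as + 1) + length bs = Suc n" using n by simp
  ultimately show ?thesis by simp
qed

text \<open>Split off simple pairs one at a time; each step is a degeneration of the orbit, and so is their composition.\<close>

theorem semisimplification:
  fixes q :: "'a::{alg_closed_field, field_char_0}"
  assumes q: "q \<noteq> 0" and per: "primitive_root q L \<or> (\<forall>k>0. q ^ k \<noteq> 1)" and x: "x \<in> qcomm q n"
  shows "\<exists>cs as bs. L * length cs + length as + length bs = n \<and> (cs \<noteq> [] \<longrightarrow> primitive_root q L) \<and>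
    simple_sum q L cs as bs \<in> orbit_closure n {x}"
  using x
proof (induction n arbitrary: x rule: less_induct)
  case (less n)
  have xs: "x \<in> mat2_space n" using less.prems unfolding qcomm_def by blast
  show ?case
  proof (cases "n = 0")
    case True
    have "simple_sum q L [] [] [] = x"
    proof -
      have u: "(0\<^sub>m 0 0, 0\<^sub>m 0 0) \<in> mat2_space 0" by simp
      have "simple_sum q L [] [] [] = (0\<^sub>m 0 0, 0\<^sub>m 0 0)"
        unfolding simple_sum_def list.map dsums_simps by (simp add: dsum_unit[OF u])
      also have "\<dots> = x" using xs True by (auto simp: prod_eq_iff mem_Times_iff intro!: eq_matI)
      finally show ?thesis .
    qed
    moreover have "x \<in> orbit_closure n {x}" by (rule closure_base) (use xs in simp_all)
    ultimately show ?thesis using True by (intro exI[of _ "[]"]) simp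
  next
    case False
    then have "n > 0" by simp
    from simple_subpair[OF q per less.prems this] obtain d \<beta> where d: "0 < d" "d \<le> n"
      and \<beta>: "(d = 1 \<and> (\<exists>a. \<beta> = line a 0)) \<or> (d = 1 \<and> (\<exists>b. \<beta> = line 0 b)) \<or>
        (primitive_root q L \<and> d = L \<and> (\<exists>a b. \<beta> = cyclic_pair q L a b))"
      and "\<exists>y\<in>qcomm q (n - d). dsum \<beta> y \<in> orbit_closure n {x}" by (elim exE conjE)
    then obtain y where y: "y \<in> qcomm q (n - d)" "dsum \<beta> y \<in> orbit_closure n {x}" by (elim bexE)
    have "n - d < n" using d by simp
    from less.IH[OF this y(1)] obtain cs as bs where l: "L * length cs + length as + length bs = n - d"
      "cs \<noteq> [] \<longrightarrow> primitive_root q L" and o: "simple_sum q L cs as bs \<in> orbit_closure (n - d) {y}"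
      by (elim exE conjE)
    have \<beta>s: "\<beta> \<in> mat2_space d" using \<beta> line_space cyclic_pair_space by auto
    have ys: "y \<in> mat2_space (n - d)" using y(1) unfolding qcomm_def by blast
    have nd: "d + (n - d) = n" using d by simp
    have "dsum \<beta> (simple_sum q L cs as bs) \<in> orbit_closure (d + (n - d)) {dsum s s' | s s'. s \<in> {\<beta>} \<and> s' \<in> {y}}"
      by (rule dsum_closure[OF _ _ closure_base o]) (use \<beta>s ys in auto)
    moreover have "{dsum s s' | s s'. s \<in> {\<beta>} \<and> s' \<in> {y}} = {dsum \<beta> y}" by blast
    ultimately have "dsum \<beta> (simple_sum q L cs as bs) \<in> orbit_closure n {dsum \<beta> y}" unfolding nd by simp
    then have main: "dsum \<beta> (simple_sum q L cs as bs) \<in> orbit_closure n {x}"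
      by (rule orbit_closure_trans[rotated 2]) (use xs y(2) in simp_all)
    note stab = orbit_closure_stable[OF _ main]
    from \<beta> show ?thesis
    proof (elim disjE conjE exE)
      fix a assume a: "d = 1" "\<beta> = line a 0"
      have n: "Suc (n - d) = n" using a(1) d(2) by simp
      have "simple_sum q L cs (a # as) bs \<in> orbit_closure n {x}"
        by (rule stab) (use xs simple_sum_line1[OF l(1)[symmetric], of q a] in \<open>simp_all add: n a(2)\<close>)
      then show ?thesis using l a d(2) by (intro exI[of _ cs] exI[of _ "a # as"] exI[of _ bs]) auto
    next
      fix b assume b: "d = 1" "\<beta> = line 0 b"
      have n: "Suc (n - d) = n" using b(1) d(2) by simp
      have "simple_sum q L cs as (b # bs) \<in> orbit_closure n {x}"
        by (rule stab) (use xs simple_sum_line2[OF l(1)[symmetric], of q b] in \<open>simp_all add: n b(2)\<close>)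
      then show ?thesis using l b d(2) by (intro exI[of _ cs] exI[of _ as] exI[of _ "b # bs"]) auto
    next
      fix a b assume c: "primitive_root q L" "d = L" "\<beta> = cyclic_pair q L a b"
      have "simple_sum q L ((a, b) # cs) as bs \<in> orbit_closure n {x}"
        using main unfolding c(3) simple_sum_cyclic .
      then show ?thesis using l c d(2) by (intro exI[of _ "(a, b) # cs"] exI[of _ as] exI[of _ bs]) auto
    qed
  qed
qed


section \<open>Parametrization of the varieties\<close>

lemma q_order_enat: "q_order q = enat L \<longleftrightarrow> primitive_root q L"
proof
  assume o: "q_order q = enat L"
  then have ex: "\<exists>k>0. q ^ k = 1" unfolding q_order_def by (auto split: if_splits)
  with o have L: "L = (LEAST k. k > 0 \<and> q ^ k = 1)" unfolding q_order_def by simp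
  have "L > 0 \<and> q ^ L = 1" unfolding L using ex by (rule LeastI_ex)
  moreover have "q ^ k \<noteq> 1" if "0 < k" "k < L" for k
    using not_less_Least[of k "\<lambda>k. k > 0 \<and> q ^ k = 1"] that unfolding L by blast
  ultimately show "primitive_root q L" unfolding primitive_root_def by blast
next
  assume p: "primitive_root q L"
  then have ex: "\<exists>k>0. q ^ k = 1" unfolding primitive_root_def by blast
  have "(LEAST k. k > 0 \<and> q ^ k = 1) = L"
  proof (rule Least_equality)
    show "L > 0 \<and> q ^ L = 1" using p unfolding primitive_root_def by blast
    show "L \<le> k" if "k > 0 \<and> q ^ k = 1" for k
      using p that unfolding primitive_root_def by (meson not_le)
  qed
  then show "q_order q = enat L" unfolding q_order_def using ex by simp
qed

lemma q_order_infinity: "q_order q = \<infinity> \<longleftrightarrow> (\<forall>k>0. q ^ k \<noteq> 1)"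
proof -
  have "q_order q = \<infinity> \<longleftrightarrow> \<not> (\<exists>k>0. q ^ k = 1)" unfolding q_order_def by simp
  then show ?thesis by blast
qed

lemma range_cyclic_pair: "range (\<lambda>(a, b). cyclic_pair q L a b) \<subseteq> mat2_space L"
proof
  fix x assume "x \<in> range (\<lambda>(a, b). cyclic_pair q L a b)"
  then obtain a b where "x = cyclic_pair q L a b" by auto
  then show "x \<in> mat2_space L" by (simp only: cyclic_pair_space)
qed

lemma range_line: "range (\<lambda>a. line (f a) (g a)) \<subseteq> mat2_space 1"
proof
  fix x assume "x \<in> range (\<lambda>a. line (f a) (g a))"
  then obtain a where "x = line (f a) (g a)" by blast
  then show "x \<in> mat2_space 1" by (simp only: line_space)
qed

lemma zclosure_base:
  fixes q :: "'a::field"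
  shows "S \<subseteq> qcomm q n \<Longrightarrow> S \<subseteq> zclosure q n S"
  by (intro subsetI, unfold zclosure_iff) blast

lemma zclosure_qcomm:
  fixes q :: "'a::field"
  shows "zclosure q n S \<subseteq> qcomm q n"
  by (intro subsetI, unfold zclosure_iff) blast

text \<open>The weights of a cyclic matrix can be made equal by a diagonal conjugation when they are nonzero;
  adding a parameter \<open>s\<close> to all of them reduces the general case to this one.\<close>

lemma weighted_cycle_orbit:
  fixes q :: "'a::alg_closed_field"
  assumes q: "primitive_root q L" and w: "\<And>i. i < L \<Longrightarrow> w i \<noteq> 0"
  shows "\<exists>b. (mat_diag L (\<lambda>k. a * inverse q ^ k), mat L L (\<lambda>(i, j). if j = (i + 1) mod L then w i else 0))
    \<in> gl_orbit L (cyclic_pair q L a b)"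
proof -
  have L: "L > 0" using q unfolding primitive_root_def by blast
  obtain b where b: "b ^ L = (\<Prod>i<L. w i)" using nth_root_exists[OF L] by blast
  have "(\<Prod>i<L. w i) \<noteq> 0" using w by simp
  then have b0: "b \<noteq> 0" using b L by (auto simp: power_0_left)
  define \<delta> where "\<delta> = (\<lambda>i. \<Prod>k<i. b / w k)"
  have \<delta>0: "\<delta> i \<noteq> 0" if "i \<le> L" for i unfolding \<delta>_def using w b0 that by simp
  have \<delta>S: "\<delta> (Suc i) = \<delta> i * (b / w i)" for i unfolding \<delta>_def by simp
  have \<delta>L: "\<delta> L = 1"
    unfolding \<delta>_def prod_dividef using b \<open>(\<Prod>i<L. w i) \<noteq> 0\<close> by simp
  have cyc: "\<delta> i * b * inverse (\<delta> ((i + 1) mod L)) = w i" if i: "i < L" for i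
  proof -
    have "\<delta> ((i + 1) mod L) = \<delta> (Suc i)"
    proof (cases "Suc i = L")
      case True
      then show ?thesis using \<delta>L by (simp add: \<delta>_def)
    qed (use i in simp)
    then have "\<delta> i * b * inverse (\<delta> ((i + 1) mod L)) = \<delta> i * b * inverse (\<delta> i * (b / w i))" by (simp only: \<delta>S)
    also have "\<dots> = w i" using \<delta>0[of i] w[OF i] b0 i by (simp add: field_simps)
    finally show ?thesis .
  qed
  let ?D = "mat_diag L \<delta>" and ?E = "mat_diag L (\<lambda>i. if i < L then inverse (\<delta> i) else 1)"
  have DE: "inverse_pair L ?D ?E"
  proof -
    have "mat_diag L f = 1\<^sub>m L" if "\<And>i. i < L \<Longrightarrow> f i = 1" for f :: "nat \<Rightarrow> 'a"
      using that by (intro eq_matI) (auto simp: mat_diag_def)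
    then show ?thesis unfolding inverse_pair_def mat_diag_diag using \<delta>0 by simp
  qed
  have m: "?D * M * ?E = mat L L (\<lambda>(i, j). \<delta> i * M $$ (i, j) * inverse (\<delta> j))" if "M \<in> carrier_mat L L" for M
    using that by (simp add: mat_diag_mult_left[OF that] mat_diag_mult_right[of _ L L]) (auto intro!: eq_matI)
  have "(mat_diag L (\<lambda>k. a * inverse q ^ k), mat L L (\<lambda>(i, j). if j = (i + 1) mod L then w i else 0))
      = conj2 ?D ?E (cyclic_pair q L a b)"
    unfolding conj2_def cyclic_pair_def prod_eq_iff
  proof (intro conjI; unfold fst_conv snd_conv)
    show "mat_diag L (\<lambda>k. a * inverse q ^ k) = ?D * mat_diag L (\<lambda>k. a * inverse q ^ k) * ?E"
      using \<delta>0 by (subst m) (auto simp: mat_diag_def intro!: eq_matI)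
    show "mat L L (\<lambda>(i, j). if j = (i + 1) mod L then w i else 0) =
        ?D * mat L L (\<lambda>(i, j). if j = (i + 1) mod L then b else 0) * ?E"
      using cyc by (subst m) (auto intro!: eq_matI)
  qed
  then show ?thesis unfolding in_gl_orbit[OF cyclic_pair_space] using DE by blast
qed

lemma Dvar_closure:
  fixes q :: "'a::{alg_closed_field, field_char_0}"
  assumes q: "primitive_root q L"
  shows "Dvar q L \<subseteq> orbit_closure L (range (\<lambda>(a, b). cyclic_pair q L a b))" (is "_ \<subseteq> orbit_closure _ ?S")
proof -
  have q0: "q \<noteq> 0" by (rule primitive_root_nonzero[OF q])
  have S: "?S \<subseteq> mat2_space L" by (rule range_cyclic_pair)
  have base: "(A, B) \<in> orbit_closure L ?S"
    if AB: "(A, B) \<in> qcomm q L" and a: "a \<noteq> 0" "A = mat_diag L (\<lambda>k. a * inverse q ^ k)" for A B a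
  proof -
    have B: "B \<in> carrier_mat L L" and eq: "A * B = q \<cdot>\<^sub>m (B * A)" using AB unfolding qcomm_def by auto
    have zero: "B $$ (i, j) = 0" if ij: "i < L" "j < L" "j \<noteq> (i + 1) mod L" for i j
    proof (rule ccontr)
      assume nz: "B $$ (i, j) \<noteq> 0"
      have "(A * B) $$ (i, j) = (q \<cdot>\<^sub>m (B * A)) $$ (i, j)" using eq by simp
      then have "a * inverse q ^ i * B $$ (i, j) = q * (B $$ (i, j) * (a * inverse q ^ j))"
        unfolding a(2) mat_diag_mult_left[OF B] mat_diag_mult_right[OF B] using ij by simp
      then have "inverse q ^ i = q * inverse q ^ j" using nz a(1) by simp
      then have "inverse q ^ ((i + 1) mod L) = inverse q ^ j"
        using primitive_root_shift[OF q ij(1)] q0 by simp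
      then show False using primitive_root_inj[OF q _ ij(2), of "(i + 1) mod L"] ij by simp
    qed
    define W where "W = (\<lambda>s. mat L L (\<lambda>(i, j). if j = (i + 1) mod L then B $$ (i, (i + 1) mod L) + s else 0))"
    have "B = W 0" unfolding W_def using B zero by (intro eq_matI) auto
    moreover have "(A, W 0) \<in> orbit_closure L ?S"
    proof (rule orbit_closure_curve[of "\<lambda>s. (A, W s)"])
      show "(A, W s) \<in> mat2_space L" for s unfolding a(2) W_def by simp
      show "\<exists>p. \<forall>s. fst (A, W s) $$ (i, j) = poly p s" for i j
        by (intro exI[of _ "[:A $$ (i, j):]"]) simp
      show "\<exists>p. \<forall>s. snd (A, W s) $$ (i, j) = poly p s" if "i < L" "j < L" for i j
      proof (cases "j = (i + 1) mod L")
        case True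
        then show ?thesis using that by (intro exI[of _ "[:B $$ (i, (i + 1) mod L), 1:]"]) (simp add: W_def)
      next
        case False
        then show ?thesis using that by (intro exI[of _ 0]) (simp add: W_def)
      qed
      have "(A, W s) \<in> orbit_closure L ?S" if s: "s \<notin> (\<lambda>i. - B $$ (i, (i + 1) mod L)) ` {..<L}" for s
      proof -
        have nz: "B $$ (i, (i + 1) mod L) + s \<noteq> 0" if "i < L" for i
        proof
          assume "B $$ (i, (i + 1) mod L) + s = 0"
          then have "s = - B $$ (i, (i + 1) mod L)" by (simp add: add_eq_0_iff)
          then show False using s that by simp
        qed
        have "\<exists>b. (A, W s) \<in> gl_orbit L (cyclic_pair q L a b)"
          unfolding a(2) W_def by (rule weighted_cycle_orbit[OF q], rule nz)
        then obtain b where "(A, W s) \<in> gl_orbit L (cyclic_pair q L a b)" ..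
        then show ?thesis by (rule orbit_in_closure[rotated]) auto
      qed
      then have "{s. (A, W s) \<notin> orbit_closure L ?S} \<subseteq> (\<lambda>i. - B $$ (i, (i + 1) mod L)) ` {..<L}" by blast
      then show "finite {s. (A, W s) \<notin> orbit_closure L ?S}" by (rule finite_subset) simp
    qed
    ultimately show ?thesis by simp
  qed
  show ?thesis
    unfolding Dvar_def
  proof (rule zclosure_orbit_closure, rule subsetI)
    fix x assume "x \<in> \<Union> (gl_orbit L ` {(A, B) \<in> qcomm q L. \<exists>a. a \<noteq> 0 \<and> A = mat_diag L (\<lambda>k. a * inverse q ^ k)})"
    then obtain y where y: "y \<in> {(A, B) \<in> qcomm q L. \<exists>a. a \<noteq> 0 \<and> A = mat_diag L (\<lambda>k. a * inverse q ^ k)}"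
      "x \<in> gl_orbit L y" by blast
    then have "y \<in> orbit_closure L ?S" using base by auto
    then show "x \<in> orbit_closure L ?S" by (rule orbit_closure_stable[OF S _ y(2)])
  qed
qed

lemma Dvar_memI:
  fixes q :: "'a::field"
  assumes "(A, B) \<in> qcomm q i" "a \<noteq> 0" "A = mat_diag i (\<lambda>k. a * inverse q ^ k)"
  shows "(A, B) \<in> Dvar q i"
proof -
  let ?S = "\<Union> (gl_orbit i ` {(A, B) \<in> qcomm q i. \<exists>a. a \<noteq> 0 \<and> A = mat_diag i (\<lambda>k. a * inverse q ^ k)})"
  have "?S \<subseteq> qcomm q i" using qcomm_stable by blast
  moreover have "(A, B) \<in> gl_orbit i (A, B)" by (rule gl_orbit_refl) (use assms(1) in \<open>simp add: qcomm_def\<close>)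
  then have "(A, B) \<in> ?S" using assms by blast
  ultimately show ?thesis unfolding Dvar_def by (rule subsetD[OF zclosure_base])
qed

lemma zclosure_idem:
  fixes q :: "'a::field"
  assumes "x \<in> qcomm q n" "\<And>f. f \<in> polyfun n \<Longrightarrow> (\<And>s. s \<in> zclosure q n S \<Longrightarrow> f s = 0) \<Longrightarrow> f x = 0"
  shows "x \<in> zclosure q n S"
  unfolding zclosure_iff
proof (intro conjI ballI impI)
  fix f assume f: "f \<in> polyfun n" "\<forall>s\<in>S \<inter> qcomm q n. f s = 0"
  show "f x = 0" by (rule assms(2)[OF f(1)]) (use f in \<open>simp add: zclosure_iff\<close>)
qed (rule assms(1))

text \<open>Letting \<open>a\<close> tend to zero includes the pairs with \<open>a = 0\<close>.\<close>

lemma cyclic_pair_in_Dvar: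
  fixes q :: "'a::field_char_0"
  assumes q: "primitive_root q L"
  shows "cyclic_pair q L a b \<in> Dvar q L"
proof -
  have nz: "cyclic_pair q L s b \<in> Dvar q L" if "s \<noteq> 0" for s
    using cyclic_pair_qcomm[OF q, of s b] that unfolding cyclic_pair_def by (intro Dvar_memI) auto
  show ?thesis
    unfolding Dvar_def
  proof (rule zclosure_idem[OF cyclic_pair_qcomm[OF q]])
    fix f assume f: "f \<in> polyfun L" and *: "\<And>s. s \<in> zclosure q L (\<Union> (gl_orbit L `
         {(A, B) \<in> qcomm q L. \<exists>a. a \<noteq> 0 \<and> A = mat_diag L (\<lambda>k. a * inverse q ^ k)})) \<Longrightarrow> f s = 0"
    show "f (cyclic_pair q L a b) = 0"
    proof (rule polyfun_curve[OF f, of "\<lambda>s. cyclic_pair q L s b"])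
      show "\<exists>p. \<forall>s. fst (cyclic_pair q L s b) $$ (i, j) = poly p s" if "i < L" "j < L" for i j
        using that by (intro exI[of _ "if i = j then [:0, inverse q ^ j:] else 0"])
          (simp add: cyclic_pair_def mat_diag_def)
      show "\<exists>p. \<forall>s. snd (cyclic_pair q L s b) $$ (i, j) = poly p s" for i j
        by (intro exI[of _ "[:snd (cyclic_pair q L 0 b) $$ (i, j):]"]) (simp add: cyclic_pair_def)
      have "f (cyclic_pair q L s b) = 0" if "s \<noteq> 0" for s
        by (rule *) (rule nz[OF that, unfolded Dvar_def])
      then have "{s. f (cyclic_pair q L s b) \<noteq> 0} \<subseteq> {0}" by auto
      then show "finite {s. f (cyclic_pair q L s b) \<noteq> 0}" by (rule finite_subset) simp
    qed
  qed
qed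

lemma mat1_eq:
  assumes "A \<in> carrier_mat 1 1" shows "A = mat 1 1 (\<lambda>_. A $$ (0, 0))"
  using assms by (intro eq_matI) auto

lemma line_in_Dvar:
  fixes q :: "'a::field_char_0"
  shows "line a 0 \<in> Dvar q 1"
proof -
  have q: "line s 0 \<in> qcomm q 1" for s unfolding line_qcomm[symmetric] by simp
  have nz: "line s 0 \<in> Dvar q 1" if "s \<noteq> 0" for s
    using q[of s] that unfolding line_def by (intro Dvar_memI) (auto simp: mat_diag_def intro!: eq_matI)
  show ?thesis
    unfolding Dvar_def
  proof (rule zclosure_idem[OF q])
    fix f assume f: "f \<in> polyfun 1" and *: "\<And>s. s \<in> zclosure q 1 (\<Union> (gl_orbit 1 `
         {(A, B) \<in> qcomm q 1. \<exists>a. a \<noteq> 0 \<and> A = mat_diag 1 (\<lambda>k. a * inverse q ^ k)})) \<Longrightarrow> f s = 0"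
    show "f (line a 0) = 0"
    proof (rule polyfun_curve[OF f, of "\<lambda>s. line s 0"])
      show "\<exists>p. \<forall>s::'a. fst (line s 0) $$ (i, j) = poly p s" if "i < 1" "j < 1" for i j
        using that by (intro exI[of _ "[:0, 1:]"]) (simp add: line_def)
      show "\<exists>p. \<forall>s::'a. snd (line s 0) $$ (i, j) = poly p s" if "i < 1" "j < 1" for i j
        using that by (intro exI[of _ 0]) (simp add: line_def)
      have "f (line s 0) = 0" if "s \<noteq> 0" for s
        by (rule *) (rule nz[OF that, unfolded Dvar_def])
      then have "{s. f (line s 0) \<noteq> 0} \<subseteq> {0}" by auto
      then show "finite {s. f (line s 0) \<noteq> 0}" by (rule finite_subset) simp
    qed
  qed
qed

text \<open>For \<open>q \<noteq> 1\<close> the equation \<open>a b = q b a\<close> with \<open>a \<noteq> 0\<close> forces \<open>b = 0\<close>.\<close>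

lemma Dvar_line_closure:
  fixes q :: "'a::field_char_0"
  assumes "q \<noteq> 1"
  shows "Dvar q 1 \<subseteq> orbit_closure 1 (range (\<lambda>a. line a 0))"
  unfolding Dvar_def
proof (rule zclosure_orbit_closure, rule subsetI)
  fix x assume "x \<in> \<Union> (gl_orbit 1 ` {(A, B) \<in> qcomm q 1. \<exists>a. a \<noteq> 0 \<and> A = mat_diag 1 (\<lambda>k. a * inverse q ^ k)})"
  then obtain A B a where y: "(A, B) \<in> qcomm q 1" "a \<noteq> 0" "A = mat_diag 1 (\<lambda>k. a * inverse q ^ k)"
    and x: "x \<in> gl_orbit 1 (A, B)" by blast
  have A: "A = mat 1 1 (\<lambda>_. a)" unfolding y(3) by (rule eq_matI) (auto simp: mat_diag_def)
  have B: "B = mat 1 1 (\<lambda>_. B $$ (0, 0))" by (rule mat1_eq) (use y(1) in \<open>auto simp: qcomm_def\<close>)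
  have "(A, B) = line a (B $$ (0, 0))" unfolding line_def using A B by simp
  then have "a * B $$ (0, 0) = q * (B $$ (0, 0) * a)" unfolding line_qcomm using y(1) by simp
  then have "B $$ (0, 0) = 0" using y(2) assms by (simp add: mult.commute[of a])
  with \<open>(A, B) = line a (B $$ (0, 0))\<close> have "(A, B) = line a 0" by simp
  then show "x \<in> orbit_closure 1 (range (\<lambda>a. line a 0))" using x by (intro orbit_in_closure[of "(A, B)"]) auto
qed

lemma Nvar_line:
  fixes q :: "'a::field"
  shows "Nvar q 1 \<subseteq> orbit_closure 1 (range (\<lambda>b. line 0 b))" "line 0 b \<in> Nvar q 1"
proof -
  let ?S = "\<Union> (gl_orbit 1 ` {(A, B) \<in> qcomm q 1. A = jordan_block 1 0})"
  have j: "jordan_block 1 0 = mat 1 1 (\<lambda>_. 0 :: 'a)" by (rule eq_matI) (auto simp: jordan_block_def)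
  show "Nvar q 1 \<subseteq> orbit_closure 1 (range (\<lambda>b. line 0 b))"
    unfolding Nvar_def
  proof (rule zclosure_orbit_closure, rule subsetI)
    fix x assume "x \<in> ?S"
    then obtain A B where y: "(A, B) \<in> qcomm q 1" "A = jordan_block 1 0" "x \<in> gl_orbit 1 (A, B)" by blast
    have "B = mat 1 1 (\<lambda>_. B $$ (0, 0))" by (rule mat1_eq) (use y(1) in \<open>auto simp: qcomm_def\<close>)
    then have "(A, B) = line 0 (B $$ (0, 0))" unfolding line_def y(2) j by simp
    then show "x \<in> orbit_closure 1 (range (\<lambda>b. line 0 b))" using y(3) by (intro orbit_in_closure[of "(A, B)"]) auto
  qed
  have "line 0 b \<in> qcomm q 1" unfolding line_qcomm[symmetric] by simp
  moreover have "line 0 b \<in> gl_orbit 1 (line 0 b)" by (rule gl_orbit_refl[OF line_space])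
  ultimately have mem: "line 0 b \<in> ?S" unfolding line_def j by blast
  have "?S \<subseteq> qcomm q 1" using qcomm_stable by blast
  from subsetD[OF zclosure_base[OF this] mem] show "line 0 b \<in> Nvar q 1" unfolding Nvar_def .
qed

text \<open>The family over affine space of dimension \<open>2 p + m + r\<close> that parametrizes the component of type \<open>(p, m, r)\<close>. The
  first \<open>p + m\<close> parameters are eigenvalues of \<open>A\<close>, the others are eigenvalues of \<open>B\<close>.\<close>

definition generic_pair :: "'a::field \<Rightarrow> nat \<Rightarrow> nat \<times> nat \<times> nat \<Rightarrow> (nat \<Rightarrow> 'a) \<Rightarrow> 'a mat2" where
  "generic_pair q L = (\<lambda>(p, m, r) v. simple_sum q L (map (\<lambda>i. (v i, v (p + m + i))) [0..<p])
     (map (\<lambda>j. v (p + j)) [0..<m]) (map (\<lambda>k. v (2 * p + m + k)) [0..<r]))"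

lemma generic_pair_surj:
  "\<exists>v. generic_pair q L (length cs, length as, length bs) v = simple_sum q L cs as bs"
proof -
  define p m where "p = length cs" and "m = length as"
  define v where "v = (\<lambda>i. if i < p then fst (cs ! i) else if i < p + m then as ! (i - p)
    else if i < 2 * p + m then snd (cs ! (i - (p + m))) else bs ! (i - (2 * p + m)))"
  have "map (\<lambda>i. (v i, v (p + m + i))) [0..<p] = cs"
    by (rule nth_equalityI) (auto simp: v_def p_def)
  moreover have "map (\<lambda>j. v (p + j)) [0..<m] = as"
    by (rule nth_equalityI) (auto simp: v_def m_def)
  moreover have "map (\<lambda>k. v (2 * p + m + k)) [0..<length bs] = bs"
    by (rule nth_equalityI) (auto simp: v_def)
  ultimately show ?thesis unfolding generic_pair_def p_def[symmetric] m_def[symmetric] by (intro exI[of _ v]) simp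
qed

lemma simple_sum_qcomm:
  assumes "cs \<noteq> [] \<Longrightarrow> primitive_root q L"
  shows "simple_sum q L cs as bs \<in> qcomm q (L * length cs + length as + length bs)"
proof -
  have "set (map (\<lambda>(a, b). cyclic_pair q L a b) cs) \<subseteq> qcomm q L"
  proof
    fix x assume x: "x \<in> set (map (\<lambda>(a, b). cyclic_pair q L a b) cs)"
    then obtain a b where "x = cyclic_pair q L a b" by auto
    moreover have "primitive_root q L" by (rule assms) (use x in auto)
    ultimately show "x \<in> qcomm q L" by (simp only: cyclic_pair_qcomm)
  qed
  note c = dsums_qcomm[OF this]
  have "set (map (\<lambda>a. line a 0) as) \<subseteq> qcomm q 1" using line_qcomm[of _ "0::'a" q] by auto
  note a = dsums_qcomm[OF this]
  have "set (map (\<lambda>b. line 0 b) bs) \<subseteq> qcomm q 1" using line_qcomm[of "0::'a" _ q] by auto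
  note b = dsums_qcomm[OF this]
  show ?thesis unfolding simple_sum_def using dsum_qcomm[OF c dsum_qcomm[OF a b]] by (simp add: add.assoc)
qed

lemma generic_pair_qcomm:
  assumes "p = 0 \<or> primitive_root q L" "n = L * p + m + r"
  shows "generic_pair q L (p, m, r) v \<in> qcomm q n"
  unfolding generic_pair_def prod.case assms(2)
  using simple_sum_qcomm[of "map (\<lambda>i. (v i, v (p + m + i))) [0..<p]" q L "map (\<lambda>j. v (p + j)) [0..<m]"
    "map (\<lambda>k. v (2 * p + m + k)) [0..<r]"] assms(1) by auto

text \<open>Pairs of matrices whose entries are polynomials in \<open>N\<close> parameters.\<close>

definition param_map :: "nat \<Rightarrow> nat \<Rightarrow> ((nat \<Rightarrow> 'a::comm_ring_1) \<Rightarrow> 'a mat2) \<Rightarrow> bool" where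
  "param_map N n F \<longleftrightarrow> (\<forall>v. F v \<in> mat2_space n) \<and>
     (\<forall>i<n. \<forall>j<n. (\<lambda>v. fst (F v) $$ (i, j)) \<in> mpfun N \<and> (\<lambda>v. snd (F v) $$ (i, j)) \<in> mpfun N)"

lemma param_map_comp:
  assumes F: "param_map N n F" and f: "f \<in> polyfun n" shows "(\<lambda>v. f (F v)) \<in> mpfun N"
  using f
proof induction
  case (const c)
  show ?case by (rule mpfun.const)
next
  case (coord1 i j)
  then show ?case using F unfolding param_map_def by (simp add: split_beta)
next
  case (coord2 i j)
  then show ?case using F unfolding param_map_def by (simp add: split_beta)
next
  case (add f g)
  show ?case using mpfun.add[OF add.IH] by (simp add: plus_fun_def)
next
  case (mult f g)
  show ?case using mpfun.mult[OF mult.IH] by (simp add: times_fun_def)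
qed

lemma param_map_dsum:
  assumes F: "param_map N i F" and G: "param_map N j G" shows "param_map N (i + j) (\<lambda>v. dsum (F v) (G v))"
proof -
  have s: "F v \<in> mat2_space i" "G v \<in> mat2_space j" for v using F G unfolding param_map_def by blast+
  have eF: "(\<lambda>v. fst (F v) $$ (a, b)) \<in> mpfun N" "(\<lambda>v. snd (F v) $$ (a, b)) \<in> mpfun N" if "a < i" "b < i" for a b
    using F that unfolding param_map_def by simp_all
  have eG: "(\<lambda>v. fst (G v) $$ (a, b)) \<in> mpfun N" "(\<lambda>v. snd (G v) $$ (a, b)) \<in> mpfun N" if "a < j" "b < j" for a b
    using G that unfolding param_map_def by simp_all
  show ?thesis
    unfolding param_map_def
  proof (intro conjI allI impI)
    show "dsum (F v) (G v) \<in> mat2_space (i + j)" for v by (rule dsum_space[OF s])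
    fix a b assume ab: "a < i + j" "b < i + j"
    show "(\<lambda>v. fst (dsum (F v) (G v)) $$ (a, b)) \<in> mpfun N"
      unfolding dsum_entry(1)[OF s ab] using ab
      by (cases "a < i"; cases "b < i"; simp add: eF eG mpfun.const)
    show "(\<lambda>v. snd (dsum (F v) (G v)) $$ (a, b)) \<in> mpfun N"
      unfolding dsum_entry(2)[OF s ab] using ab
      by (cases "a < i"; cases "b < i"; simp add: eF eG mpfun.const)
  qed
qed

lemma param_map_dsums:
  assumes "\<And>k. k \<in> set ks \<Longrightarrow> param_map N d (F k)"
  shows "param_map N (d * length ks) (\<lambda>v. dsums (map (\<lambda>k. F k v) ks))"
  using assms
proof (induction ks)
  case Nil
  show ?case by (simp add: param_map_def dsums_simps)
next
  case (Cons k ks)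
  have "param_map N (d + d * length ks) (\<lambda>v. dsum (F k v) (dsums (map (\<lambda>k. F k v) ks)))"
    by (rule param_map_dsum) (use Cons in simp_all)
  then show ?case by (simp add: dsums_simps)
qed

lemma var_mpfun: "i < N \<Longrightarrow> (\<lambda>v. v i) \<in> mpfun N"
  using mpfun.var[of i N] by (simp add: var_def)

lemma param_map_generic_pair:
  fixes q :: "'a::field"
  shows "param_map (2 * p + m + r) (L * p + m + r) (generic_pair q L (p, m, r))"
proof -
  let ?N = "2 * p + m + r"
  have c: "param_map ?N L (\<lambda>v. cyclic_pair q L (v i) (v (p + m + i)))" if "i \<in> set [0..<p]" for i
    unfolding param_map_def
  proof (intro conjI allI impI cyclic_pair_space)
    fix a b assume ab: "a < L" "b < L"
    have "(\<lambda>v. v i) * (\<lambda>_. inverse q ^ b) \<in> mpfun ?N"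
      by (intro mpfun.mult var_mpfun mpfun.const) (use that in simp)
    then show "(\<lambda>v. fst (cyclic_pair q L (v i) (v (p + m + i))) $$ (a, b)) \<in> mpfun ?N"
      using ab by (cases "a = b") (simp_all add: cyclic_pair_def mat_diag_def times_fun_def mpfun.const)
    have "(\<lambda>v. v (p + m + i)) \<in> mpfun ?N" by (rule var_mpfun) (use that in simp)
    then show "(\<lambda>v. snd (cyclic_pair q L (v i) (v (p + m + i))) $$ (a, b)) \<in> mpfun ?N"
      using ab by (cases "b = (a + 1) mod L") (simp_all add: cyclic_pair_def mpfun.const)
  qed
  have l: "param_map ?N 1 (\<lambda>v. line (f v) (g v))" if "f \<in> mpfun ?N" "g \<in> mpfun ?N" for f g :: "(nat \<Rightarrow> 'a) \<Rightarrow> 'a"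
    unfolding param_map_def using that by (auto simp: line_def)
  have a: "param_map ?N 1 (\<lambda>v::nat \<Rightarrow> 'a. line (v (p + j)) 0)" if "j \<in> set [0..<m]" for j
    by (intro l var_mpfun mpfun.const) (use that in simp)
  have b: "param_map ?N 1 (\<lambda>v::nat \<Rightarrow> 'a. line 0 (v (2 * p + m + k)))" if "k \<in> set [0..<r]" for k
    by (intro l var_mpfun mpfun.const) (use that in simp)
  have "param_map ?N (L * length [0..<p]) (\<lambda>v. dsums (map (\<lambda>i. cyclic_pair q L (v i) (v (p + m + i))) [0..<p]))"
    by (rule param_map_dsums, rule c)
  moreover have "param_map ?N (1 * length [0..<m]) (\<lambda>v::nat \<Rightarrow> 'a. dsums (map (\<lambda>j. line (v (p + j)) 0) [0..<m]))"
    by (rule param_map_dsums, rule a)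
  moreover have "param_map ?N (1 * length [0..<r]) (\<lambda>v::nat \<Rightarrow> 'a. dsums (map (\<lambda>k. line 0 (v (2 * p + m + k))) [0..<r]))"
    by (rule param_map_dsums, rule b)
  ultimately have "param_map ?N (L * length [0..<p] + (1 * length [0..<m] + 1 * length [0..<r]))
     (\<lambda>v. dsum (dsums (map (\<lambda>i. cyclic_pair q L (v i) (v (p + m + i))) [0..<p]))
     (dsum (dsums (map (\<lambda>j. line (v (p + j)) 0) [0..<m])) (dsums (map (\<lambda>k. line 0 (v (2 * p + m + k))) [0..<r]))))"
    by (intro param_map_dsum)
  then show ?thesis by (simp add: generic_pair_def simple_sum_def o_def add.assoc)
qed

lemma closure_of_generic:
  fixes q :: "'a::field"
  assumes S: "S \<subseteq> qcomm q n" and stable: "\<And>x y. x \<in> S \<Longrightarrow> y \<in> gl_orbit n x \<Longrightarrow> y \<in> S"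
    and gen: "\<And>v. \<phi> v \<in> S" and cl: "S \<subseteq> orbit_closure n (range \<phi>)"
  shows "\<phi> v \<in> zclosure q n S" "zclosure q n S \<subseteq> orbit_closure n (range \<phi>)"
    "x \<in> zclosure q n S \<Longrightarrow> y \<in> gl_orbit n x \<Longrightarrow> y \<in> zclosure q n S"
proof -
  show "\<phi> v \<in> zclosure q n S" by (rule subsetD[OF zclosure_base[OF S] gen])
  show "zclosure q n S \<subseteq> orbit_closure n (range \<phi>)" by (rule zclosure_orbit_closure[OF cl])
  show "x \<in> zclosure q n S \<Longrightarrow> y \<in> gl_orbit n x \<Longrightarrow> y \<in> zclosure q n S"
    by (rule zclosure_stable[OF stable])
qed

text \<open>What the varieties are needed for: modulo invariants, \<open>Zvar q n t\<close> is the closure of the generic pairs of its type. If \<open>q\<close> is not a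
  root of unity, there are no cyclic pairs, as \<open>p = 0\<close>, and the value \<open>1\<close> for \<open>L\<close> is arbitrary but positive.\<close>

lemma Zvar_generic:
  fixes q :: "'a::{alg_closed_field, field_char_0}"
  assumes t: "(p, m, r) \<in> PG q n" and L: "L = (case q_order q of enat l \<Rightarrow> l | \<infinity> \<Rightarrow> 1)"
  shows "generic_pair q L (p, m, r) v \<in> Zvar q n (p, m, r)"
    "Zvar q n (p, m, r) \<subseteq> orbit_closure n (range (generic_pair q L (p, m, r)))"
    "x \<in> Zvar q n (p, m, r) \<Longrightarrow> y \<in> gl_orbit n x \<Longrightarrow> y \<in> Zvar q n (p, m, r)"
    "n = L * p + m + r" "p = 0 \<or> primitive_root q L"
proof -
  let ?\<phi> = "generic_pair q L (p, m, r)"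
  let ?C = "\<lambda>v. dsums (map (\<lambda>i. cyclic_pair q L (v i) (v (p + m + i))) [0..<p])"
  let ?X = "\<lambda>v. dsums (map (\<lambda>j. line (v (p + j)) 0) [0..<m])"
  let ?Y = "\<lambda>v. dsums (map (\<lambda>k. line 0 (v (2 * p + m + k))) [0..<r])"
  have \<phi>: "?\<phi> v = dsum (?C v) (dsum (?X v) (?Y v))" for v
    by (simp add: generic_pair_def simple_sum_def o_def)
  have any: "simple_sum q L cs as bs \<in> range ?\<phi>" if "length cs = p" "length as = m" "length bs = r" for cs as bs
    using generic_pair_surj[of q L cs as bs] that by (metis rangeI)
  define SC where "SC = {dsums xs | xs. length xs = p \<and> set xs \<subseteq> range (\<lambda>(a, b). cyclic_pair q L a b)}"
  define SX where "SX = {dsums xs | xs. length xs = m \<and> set xs \<subseteq> range (\<lambda>a. line a (0::'a))}"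
  define SY where "SY = {dsums xs | xs. length xs = r \<and> set xs \<subseteq> range (\<lambda>b. line (0::'a) b)}"
  have listed: "\<exists>ys. length ys = length xs \<and> xs = map f ys" if "set xs \<subseteq> range f" for f :: "'b \<Rightarrow> 'a mat2" and xs
    using that by (metis ex_map_conv length_map rangeE subsetD)
  have SCE: "\<exists>cs. length cs = p \<and> s = dsums (map (\<lambda>(a, b). cyclic_pair q L a b) cs)" if s: "s \<in> SC" for s
  proof -
    obtain xs where xs: "s = dsums xs" "length xs = p" "set xs \<subseteq> range (\<lambda>(a, b). cyclic_pair q L a b)"
      using s unfolding SC_def by blast
    from listed[OF xs(3)] show ?thesis using xs(1,2) by auto
  qed
  have SXE: "\<exists>as. length as = m \<and> s = dsums (map (\<lambda>a. line a 0) as)" if s: "s \<in> SX" for s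
  proof -
    obtain xs where xs: "s = dsums xs" "length xs = m" "set xs \<subseteq> range (\<lambda>a. line a (0::'a))"
      using s unfolding SX_def by blast
    from listed[OF xs(3)] show ?thesis using xs(1,2) by auto
  qed
  have SYE: "\<exists>bs. length bs = r \<and> s = dsums (map (\<lambda>b. line 0 b) bs)" if s: "s \<in> SY" for s
  proof -
    obtain xs where xs: "s = dsums xs" "length xs = r" "set xs \<subseteq> range (\<lambda>b. line (0::'a) b)"
      using s unfolding SY_def by blast
    from listed[OF xs(3)] show ?thesis using xs(1,2) by auto
  qed
  have sC: "range (\<lambda>(a, b). cyclic_pair q L a b) \<subseteq> mat2_space L" by (rule range_cyclic_pair)
  have sX: "range (\<lambda>a. line a (0::'a)) \<subseteq> mat2_space 1" "range (\<lambda>b. line (0::'a) b) \<subseteq> mat2_space 1"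
    using range_line[of "\<lambda>a. a" "\<lambda>_. 0"] range_line[of "\<lambda>_. 0" "\<lambda>b. b"] by blast+
  have sp: "{dsums xs | xs. length xs = k \<and> set xs \<subseteq> S} \<subseteq> mat2_space (i * k)"
    if S: "S \<subseteq> mat2_space i" for S :: "'a mat2 set" and i k
  proof
    fix x assume "x \<in> {dsums xs | xs. length xs = k \<and> set xs \<subseteq> S}"
    then obtain xs where xs: "x = dsums xs" "length xs = k" "set xs \<subseteq> S" by blast
    show "x \<in> mat2_space (i * k)" using dsums_space[OF order_trans[OF xs(3) S]] unfolding xs(1) xs(2) .
  qed
  have spC: "SC \<subseteq> mat2_space (L * p)" unfolding SC_def by (rule sp[OF sC])
  have spX: "SX \<subseteq> mat2_space m" using sp[OF sX(1), of m] unfolding SX_def by simp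
  have spY: "SY \<subseteq> mat2_space r" using sp[OF sX(2), of r] unfolding SY_def by simp
  have Dq: "Dvar q i \<subseteq> qcomm q i" "Nvar q i \<subseteq> qcomm q i" for i
    unfolding Dvar_def Nvar_def by (rule zclosure_qcomm)+
  have u0: "dsum (0\<^sub>m 0 0, 0\<^sub>m 0 0) (0\<^sub>m 0 0, 0\<^sub>m 0 0) = ((0\<^sub>m 0 0, 0\<^sub>m 0 0) :: 'a mat2)"
    by (rule dsum_unit(2)[of _ 0]) simp
  let ?DX = "direct_power q 1 (Dvar q 1) m" and ?NY = "direct_power q 1 (Nvar q 1) r"
  have NY: "?NY \<subseteq> orbit_closure r SY" "?Y v \<in> ?NY" "?NY \<subseteq> qcomm q r" for v
  proof -
    show "?NY \<subseteq> orbit_closure r SY"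
      using direct_power_closure[OF sX(2) Nvar_line(1)[of q], of q r] unfolding SY_def by simp
    have "set (map (\<lambda>k. line 0 (v (2 * p + m + k))) [0..<r]) \<subseteq> Nvar q 1" using Nvar_line(2) by auto
    from direct_power_mem[OF Dq(2) this] show "?Y v \<in> ?NY" by simp
    show "?NY \<subseteq> qcomm q r" using direct_power_qcomm[of q 1 "Nvar q 1" r] by simp
  qed
  have DXq: "?X v \<in> ?DX" "?DX \<subseteq> qcomm q m" for v
  proof -
    have "set (map (\<lambda>j. line (v (p + j)) 0) [0..<m]) \<subseteq> Dvar q 1" using line_in_Dvar by auto
    from direct_power_mem[OF Dq(1) this] show "?X v \<in> ?DX" by simp
    show "?DX \<subseteq> qcomm q m" using direct_power_qcomm[of q 1 "Dvar q 1" m] by simp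
  qed
  have DXc: "?DX \<subseteq> orbit_closure m SX" if q1: "q \<noteq> 1"
    using direct_power_closure[OF sX(1) Dvar_line_closure[OF q1], of q m] unfolding SX_def by simp
  let ?XY = "direct_sum q m r ?DX ?NY"
  have qs: "qcomm q i \<subseteq> mat2_space i" for i unfolding qcomm_def by blast
  have XYq: "?XY \<subseteq> qcomm q (m + r)" unfolding direct_sum_def by blast
  have XYm: "dsum (?X v) (?Y v) \<in> ?XY" for v
    by (rule direct_sum_mem[OF DXq(1) NY(2)]) (use DXq NY in blast)+
  have XYs: "y \<in> ?XY" if "x \<in> ?XY" "y \<in> gl_orbit (m + r) x" for x y
    by (rule direct_sum_stable[OF _ _ that]) (use DXq(2) NY(3) qs in blast)+
  have XYc: "?XY \<subseteq> orbit_closure (m + r) {dsum s s' | s s'. s \<in> SX \<and> s' \<in> SY}" if "q \<noteq> 1"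
    by (rule direct_sum_closure[OF spX spY DXc[OF that] NY(1)])
  have spXY: "{dsum s s' | s s'. s \<in> SX \<and> s' \<in> SY} \<subseteq> mat2_space (m + r)" using dsum_space spX spY by blast
  have "generic_pair q L (p, m, r) v \<in> Zvar q n (p, m, r) \<and>
    Zvar q n (p, m, r) \<subseteq> orbit_closure n (range ?\<phi>) \<and>
    (\<forall>x y. x \<in> Zvar q n (p, m, r) \<longrightarrow> y \<in> gl_orbit n x \<longrightarrow> y \<in> Zvar q n (p, m, r)) \<and>
    n = L * p + m + r \<and> (p = 0 \<or> primitive_root q L)" for v
  proof (cases "q_order q")
    case (enat l)
    then have Ll: "L = l" using L by simp
    have prim: "primitive_root q L" using enat unfolding Ll q_order_enat .
    let ?DC = "direct_power q L (Dvar q L) p"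
    have DC: "?DC \<subseteq> orbit_closure (L * p) SC" "?C v \<in> ?DC" "?DC \<subseteq> qcomm q (L * p)" for v
    proof -
      show "?DC \<subseteq> orbit_closure (L * p) SC"
        using direct_power_closure[OF sC Dvar_closure[OF prim], of q p] unfolding SC_def .
      have "set (map (\<lambda>i. cyclic_pair q L (v i) (v (p + m + i))) [0..<p]) \<subseteq> Dvar q L"
        using cyclic_pair_in_Dvar[OF prim] by auto
      from direct_power_mem[OF Dq(1) this] show "?C v \<in> ?DC" by simp
      show "?DC \<subseteq> qcomm q (L * p)" by (rule direct_power_qcomm)
    qed
    show ?thesis
    proof (cases "l = 1")
      case True
      then have mr: "m = 0" "r = 0" "n = p" using t enat unfolding PG_def by (simp_all add: one_enat_def)
      have Z: "Zvar q n (p, m, r) = zclosure q n ?DC"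
        unfolding Zvar_def prod.case enat enat.case using True Ll by (simp add: one_enat_def)
      have u: "?C v \<in> mat2_space n" for v using DC(2,3) qs mr True Ll by fastforce
      have \<phi>C: "?\<phi> v = ?C v" for v
        unfolding \<phi> using dsum_unit(2)[OF u] u0 mr by (simp add: dsums_simps)
      have DCn: "?DC \<subseteq> qcomm q n" using DC(3) mr True Ll by simp
      have sub: "SC \<subseteq> range ?\<phi>"
      proof
        fix s assume "s \<in> SC"
        then obtain cs where cs: "length cs = p" "s = dsums (map (\<lambda>(a, b). cyclic_pair q L a b) cs)" using SCE by blast
        have "s \<in> mat2_space n" using cyclic_sum_space[of q L cs] cs mr True Ll by simp
        then have "simple_sum q L cs [] [] = s" unfolding simple_sum_def cs(2)
          using u0 dsum_unit(2)[of s n] cs by (simp add: dsums_simps)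
        then show "s \<in> range ?\<phi>" using any[OF cs(1), of "[]" "[]"] mr by simp
      qed
      have rs: "range ?\<phi> \<subseteq> mat2_space n" by (rule image_subsetI) (simp only: \<phi>C u)
      have cl: "?DC \<subseteq> orbit_closure n (range ?\<phi>)"
      proof
        fix x assume "x \<in> ?DC"
        then have "x \<in> orbit_closure n SC" using DC(1) mr True Ll by auto
        then show "x \<in> orbit_closure n (range ?\<phi>)"
          by (rule orbit_closure_trans[OF rs, rotated]) (use sub closure_base[OF rs] in blast)
      qed
      have st: "y \<in> ?DC" if "x \<in> ?DC" "y \<in> gl_orbit n x" for x y
      proof (cases p)
        case 0
        then show ?thesis using that mr qcomm_stable[of x q 0 y] by simp
      next
        case (Suc p')
        have "y \<in> gl_orbit (L + L * p') x" using that(2) mr Suc True Ll by simp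
        moreover have "x \<in> direct_sum q L (L * p') (Dvar q L) (direct_power q L (Dvar q L) p')"
          using that(1) Suc by simp
        moreover have "Dvar q L \<subseteq> mat2_space L" using Dq(1) qs by blast
        moreover have "direct_power q L (Dvar q L) p' \<subseteq> mat2_space (L * p')" using direct_power_qcomm qs by blast
        ultimately show ?thesis using direct_sum_stable[of "Dvar q L" L "direct_power q L (Dvar q L) p'" "L * p'" x q y] Suc by simp
      qed
      have gen: "?\<phi> v \<in> ?DC" for v using DC(2) \<phi>C by simp
      note c = closure_of_generic[OF DCn st gen cl]
      show ?thesis unfolding Z using c(1)[where v = v] c(2,3) mr True Ll prim by auto
    next
      case False
      then have n: "n = L * p + m + r" using t enat Ll unfolding PG_def by (simp add: one_enat_def)
      have q1: "q \<noteq> 1"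
      proof
        assume "q = 1"
        then have "\<not> (1 < L)" using prim unfolding primitive_root_def by auto
        then show False using prim False Ll unfolding primitive_root_def by auto
      qed
      let ?S = "direct_sum q (L * p) (m + r) ?DC ?XY"
      have n': "L * p + (m + r) = n" using n by simp
      have Z: "Zvar q n (p, m, r) = zclosure q n ?S"
        unfolding Zvar_def prod.case enat enat.case using False Ll by (simp add: one_enat_def)
      have Sq: "?S \<subseteq> qcomm q n" unfolding direct_sum_def n' by blast
      have st: "y \<in> ?S" if "x \<in> ?S" "y \<in> gl_orbit n x" for x y
        by (rule direct_sum_stable[OF _ _ that(1) that(2)[folded n']]) (use DC(3) XYq qs in blast)+
      have gen: "?\<phi> v \<in> ?S" for v unfolding \<phi>
        by (rule direct_sum_mem[OF DC(2) XYm]) (use DC XYq XYm in blast)+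
      have rs: "range ?\<phi> \<subseteq> mat2_space n" using gen Sq qs by blast
      let ?G = "{dsum s s' | s s'. s \<in> SC \<and> s' \<in> {dsum s s' | s s'. s \<in> SX \<and> s' \<in> SY}}"
      have G: "?G \<subseteq> range ?\<phi>"
      proof
        fix x assume "x \<in> ?G"
        then obtain s1 s2 s3 where s: "s1 \<in> SC" "s2 \<in> SX" "s3 \<in> SY" "x = dsum s1 (dsum s2 s3)" by blast
        obtain cs where cs: "length cs = p" "s1 = dsums (map (\<lambda>(a, b). cyclic_pair q L a b) cs)" using SCE[OF s(1)] by blast
        obtain as where as: "length as = m" "s2 = dsums (map (\<lambda>a. line a 0) as)" using SXE[OF s(2)] by blast
        obtain bs where bs: "length bs = r" "s3 = dsums (map (\<lambda>b. line 0 b) bs)" using SYE[OF s(3)] by blast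
        have "x = simple_sum q L cs as bs" unfolding simple_sum_def s(4) cs(2) as(2) bs(2) ..
        then show "x \<in> range ?\<phi>" using any[OF cs(1) as(1) bs(1)] by simp
      qed
      have cl: "?S \<subseteq> orbit_closure n (range ?\<phi>)"
      proof
        fix x assume "x \<in> ?S"
        then have "x \<in> orbit_closure n ?G"
          using direct_sum_closure[OF spC spXY DC(1) XYc[OF q1]] unfolding n' by blast
        then show "x \<in> orbit_closure n (range ?\<phi>)"
          by (rule orbit_closure_trans[OF rs, rotated]) (use G closure_base[OF rs] in blast)
      qed
      note c = closure_of_generic[OF Sq st gen cl]
      show ?thesis unfolding Z using c(1)[where v = v] c(2,3) n prim by auto
    qed
  next
    case infinity
    then have p: "p = 0" and n: "m + r = n" using t unfolding PG_def by simp_all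
    have "\<forall>k>0. q ^ k \<noteq> 1" using infinity unfolding q_order_infinity .
    from this[rule_format, of 1] have q1: "q \<noteq> 1" by simp
    have Z: "Zvar q n (p, m, r) = zclosure q n ?XY"
      unfolding Zvar_def prod.case infinity enat.case by simp
    have XYn: "?XY \<subseteq> qcomm q n" using XYq n by simp
    have \<phi>XY: "?\<phi> v = dsum (?X v) (?Y v)" for v
    proof -
      have "dsum (?X v) (?Y v) \<in> mat2_space n" by (rule subsetD[OF qs subsetD[OF XYn XYm]])
      then show ?thesis unfolding \<phi> using dsum_unit(1) p by (simp add: dsums_simps)
    qed
    have gen: "?\<phi> v \<in> ?XY" for v unfolding \<phi>XY by (rule XYm)
    have rs: "range ?\<phi> \<subseteq> mat2_space n" using gen XYn qs by blast
    let ?G = "{dsum s s' | s s'. s \<in> SX \<and> s' \<in> SY}"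
    have G: "?G \<subseteq> range ?\<phi>"
    proof
      fix x assume x: "x \<in> ?G"
      then obtain s2 s3 where s: "s2 \<in> SX" "s3 \<in> SY" "x = dsum s2 s3" by blast
      obtain as where as: "length as = m" "s2 = dsums (map (\<lambda>a. line a 0) as)" using SXE[OF s(1)] by blast
      obtain bs where bs: "length bs = r" "s3 = dsums (map (\<lambda>b. line 0 b) bs)" using SYE[OF s(2)] by blast
      have "x \<in> mat2_space (m + r)" using x spXY by blast
      then have "x = simple_sum q L [] as bs"
        unfolding simple_sum_def using dsum_unit(1)[of x "m + r"] s(3) as(2) bs(2) by (simp add: dsums_simps)
      then show "x \<in> range ?\<phi>" using any[of "[]", OF _ as(1) bs(1)] p by simp
    qed
    have cl: "?XY \<subseteq> orbit_closure n (range ?\<phi>)"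
    proof
      fix x assume "x \<in> ?XY"
      then have "x \<in> orbit_closure n ?G" using XYc[OF q1] unfolding n by blast
      then show "x \<in> orbit_closure n (range ?\<phi>)"
        by (rule orbit_closure_trans[OF rs, rotated]) (use G closure_base[OF rs] in blast)
    qed
    have st: "y \<in> ?XY" if "x \<in> ?XY" "y \<in> gl_orbit n x" for x y by (rule XYs[OF that(1) that(2)[folded n]])
    note c = closure_of_generic[OF XYn st gen cl]
    show ?thesis unfolding Z using c(1)[where v = v] c(2,3) n p by auto
  qed
  then show "generic_pair q L (p, m, r) v \<in> Zvar q n (p, m, r)"
    "Zvar q n (p, m, r) \<subseteq> orbit_closure n (range (generic_pair q L (p, m, r)))"
    "x \<in> Zvar q n (p, m, r) \<Longrightarrow> y \<in> gl_orbit n x \<Longrightarrow> y \<in> Zvar q n (p, m, r)"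
    "n = L * p + m + r" "p = 0 \<or> primitive_root q L" by blast+
qed


section \<open>Characteristic polynomials and traces as invariants\<close>

definition poly_mat :: "nat \<Rightarrow> ('a::comm_ring_1 mat2 \<Rightarrow> 'a mat) \<Rightarrow> bool" where
  "poly_mat n M \<longleftrightarrow> (\<forall>x\<in>mat2_space n. M x \<in> carrier_mat n n) \<and>
     (\<forall>i<n. \<forall>j<n. poly_on n (\<lambda>x. M x $$ (i, j)))"

lemma poly_mat_fst_snd: "poly_mat n fst" "poly_mat n snd"
  unfolding poly_mat_def by (auto simp: poly_on_coord)

lemma poly_mat_mult:
  assumes M: "poly_mat n M" and M': "poly_mat n M'" shows "poly_mat n (\<lambda>x. M x * M' x)"
proof -
  have c: "M x \<in> carrier_mat n n" "M' x \<in> carrier_mat n n" if "x \<in> mat2_space n" for x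
    using M M' that unfolding poly_mat_def by blast+
  have e: "poly_on n (\<lambda>x. M x $$ (i, j))" "poly_on n (\<lambda>x. M' x $$ (i, j))" if "i < n" "j < n" for i j
    using M M' that unfolding poly_mat_def by simp_all
  show ?thesis
    unfolding poly_mat_def
  proof (intro conjI ballI allI impI)
    show "M x * M' x \<in> carrier_mat n n" if "x \<in> mat2_space n" for x using c[OF that] by simp
    fix i j assume ij: "i < n" "j < n"
    have "poly_on n (\<lambda>x. \<Sum>k<n. M x $$ (i, k) * M' x $$ (k, j))"
      by (intro poly_on_sum poly_on_mult e) (use ij in auto)
    then show "poly_on n (\<lambda>x. (M x * M' x) $$ (i, j))"
      by (rule poly_on_cong) (rule mat_mult_entry[OF c ij])
  qed
qed

lemma poly_mat_pow:
  assumes M: "poly_mat n M" shows "poly_mat n (\<lambda>x. M x ^\<^sub>m k)"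
proof (induction k)
  case 0
  have c: "M x \<in> carrier_mat n n" if "x \<in> mat2_space n" for x using M that unfolding poly_mat_def by blast
  have "poly_on n (\<lambda>x. (M x ^\<^sub>m 0) $$ (i, j))" if "i < n" "j < n" for i j
    by (rule poly_on_cong[OF poly_on_const[of n "if i = j then 1 else 0"]])
      (use c that in \<open>simp add: carrier_matD(1)[OF c]\<close>)
  then show ?case unfolding poly_mat_def using pow_carrier_mat[OF c] by blast
next
  case (Suc k)
  show ?case using poly_mat_mult[OF Suc M] by simp
qed

definition trace :: "'a::comm_ring_1 mat \<Rightarrow> 'a" where
  "trace M = (\<Sum>i<dim_row M. M $$ (i, i))"

lemma poly_on_trace:
  assumes "poly_mat n M" shows "poly_on n (\<lambda>x. trace (M x))"
proof -
  have c: "M x \<in> carrier_mat n n" if "x \<in> mat2_space n" for x using assms that unfolding poly_mat_def by blast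
  have "poly_on n (\<lambda>x. \<Sum>i<n. M x $$ (i, i))"
    by (rule poly_on_sum) (use assms in \<open>simp add: poly_mat_def\<close>)
  then show ?thesis
    by (rule poly_on_cong) (simp add: trace_def carrier_matD(1)[OF c])
qed

lemma trace_conj:
  assumes M: "M \<in> carrier_mat n n" and PQ: "inverse_pair n P Q"
  shows "trace (P * M * Q) = trace M"
proof -
  have c: "P \<in> carrier_mat n n" "Q \<in> carrier_mat n n" "Q * P = 1\<^sub>m n" using PQ unfolding inverse_pair_def by auto
  have comm: "trace (U * V) = trace (V * U)" if "U \<in> carrier_mat n n" "V \<in> carrier_mat n n" for U V :: "'a mat"
  proof -
    have "trace (U * V) = (\<Sum>i<n. \<Sum>k<n. U $$ (i, k) * V $$ (k, i))"
      unfolding trace_def using that by (simp add: mat_mult_entry[OF that] del: index_mult_mat(1))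
    also have "\<dots> = (\<Sum>k<n. \<Sum>i<n. V $$ (k, i) * U $$ (i, k))" by (subst sum.swap) (simp add: mult.commute)
    also have "\<dots> = trace (V * U)"
      unfolding trace_def using that by (simp add: mat_mult_entry[OF that(2,1)] del: index_mult_mat(1))
    finally show ?thesis .
  qed
  have "trace (P * M * Q) = trace (Q * (P * M))" by (rule comm) (use c M in auto)
  also have "Q * (P * M) = M" using c M by (simp add: assoc_mult_mat[of Q n n P n M n, symmetric])
  finally show ?thesis .
qed

lemma conj_mult:
  fixes M :: "'a::comm_ring_1 mat"
  assumes M: "M \<in> carrier_mat n n" "M' \<in> carrier_mat n n" and PQ: "inverse_pair n P Q"
  shows "(P * M * Q) * (P * M' * Q) = P * (M * M') * Q"
proof -
  have c: "P \<in> carrier_mat n n" "Q \<in> carrier_mat n n" "Q * P = 1\<^sub>m n"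
    using PQ unfolding inverse_pair_def by auto
  have "(P * M * Q) * (P * M' * Q) = P * M * (Q * P) * M' * Q"
    using c(1,2) M by (simp add: assoc_mult_mat[of _ n n _ n _ n])
  also have "\<dots> = P * (M * M') * Q" unfolding c(3) using c M by (simp add: assoc_mult_mat[of _ n n _ n _ n])
  finally show ?thesis .
qed

lemma pow_conj:
  fixes M :: "'a::comm_ring_1 mat"
  assumes M: "M \<in> carrier_mat n n" and PQ: "inverse_pair n P Q"
  shows "(P * M * Q) ^\<^sub>m k = P * M ^\<^sub>m k * Q"
proof -
  have c: "P \<in> carrier_mat n n" "Q \<in> carrier_mat n n" "Q * P = 1\<^sub>m n" "P * Q = 1\<^sub>m n"
    using PQ unfolding inverse_pair_def by auto
  show ?thesis
  proof (induction k)
    case 0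
    show ?case using c M by simp
  next
    case (Suc k)
    have Mk: "M ^\<^sub>m k \<in> carrier_mat n n" using M by simp
    show ?case using conj_mult[OF Mk M PQ] Suc by simp
  qed
qed

lemma trace_word_invariant:
  fixes x :: "'a::comm_ring_1 mat2"
  assumes x: "x \<in> mat2_space n" and y: "y \<in> gl_orbit n x"
  shows "trace (fst y ^\<^sub>m k * snd y ^\<^sub>m l) = trace (fst x ^\<^sub>m k * snd x ^\<^sub>m l)"
proof -
  obtain P Q where PQ: "inverse_pair n P Q" "y = conj2 P Q x" using y in_gl_orbit[OF x] by blast
  have c: "P \<in> carrier_mat n n" "Q \<in> carrier_mat n n" "Q * P = 1\<^sub>m n" using PQ(1) unfolding inverse_pair_def by auto
  have xc: "fst x ^\<^sub>m k \<in> carrier_mat n n" "snd x ^\<^sub>m l \<in> carrier_mat n n" using x by (auto simp: mem_Times_iff)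
  have "fst y ^\<^sub>m k * snd y ^\<^sub>m l = (P * fst x ^\<^sub>m k * Q) * (P * snd x ^\<^sub>m l * Q)"
    unfolding PQ(2) conj2_def using pow_conj[OF _ PQ(1)] x by (simp add: mem_Times_iff)
  also have "\<dots> = P * (fst x ^\<^sub>m k * snd x ^\<^sub>m l) * Q" by (rule conj_mult[OF xc PQ(1)])
  finally show ?thesis using trace_conj[OF _ PQ(1), of "fst x ^\<^sub>m k * snd x ^\<^sub>m l"] xc by simp
qed

lemma char_poly_coeff_poly_on:
  fixes M :: "'a::comm_ring_1 mat2 \<Rightarrow> 'a mat"
  assumes M: "poly_mat n M" shows "poly_on n (\<lambda>x. coeff (char_poly (M x)) k)"
proof -
  define pc where "pc = (\<lambda>F :: 'a mat2 \<Rightarrow> 'a poly. \<forall>k. poly_on n (\<lambda>x. coeff (F x) k))"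
  have c: "M x \<in> carrier_mat n n" if "x \<in> mat2_space n" for x using M that unfolding poly_mat_def by blast
  have mult: "pc (\<lambda>x. F x * G x)" if "pc F" "pc G" for F G
    using that unfolding pc_def coeff_mult by (auto intro!: poly_on_sum poly_on_mult)
  have const: "pc (\<lambda>_. p)" for p unfolding pc_def by (simp add: poly_on_const)
  have prod: "pc (\<lambda>x. \<Prod>i\<in>I. F i x)" if "\<And>i. i \<in> I \<Longrightarrow> pc (F i)" for F and I :: "nat set"
    using that
  proof (induction I rule: infinite_finite_induct)
    case (insert i I)
    have "pc (\<lambda>x. F i x * (\<Prod>i\<in>I. F i x))" by (rule mult) (use insert in simp_all)
    then show ?case using insert.hyps by simp
  qed (simp_all add: const)
  have sum: "pc (\<lambda>x. \<Sum>i\<in>I. F i x)" if "\<And>i. i \<in> I \<Longrightarrow> pc (F i)" for F and I :: "(nat \<Rightarrow> nat) set"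
    using that unfolding pc_def coeff_sum by (auto intro!: poly_on_sum)
  define E where "E = (\<lambda>i j x. if i = j then [:- M x $$ (i, j), 1:] else [:- M x $$ (i, j):])"
  have E: "pc (E i j)" if ij: "i < n" "j < n" for i j
    unfolding pc_def
  proof
    fix k
    have "poly_on n (\<lambda>x. - 1 * M x $$ (i, j))"
      by (intro poly_on_mult poly_on_const) (use M ij in \<open>simp add: poly_mat_def\<close>)
    then have m: "poly_on n (\<lambda>x. - M x $$ (i, j))" by simp
    show "poly_on n (\<lambda>x. coeff (E i j x) k)"
    proof (cases k)
      case 0
      then show ?thesis using m by (cases "i = j") (simp_all add: E_def)
    next
      case (Suc k')
      have "(\<lambda>x. coeff (E i j x) k) = (\<lambda>_. if i = j \<and> k' = 0 then 1 else 0)"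
        unfolding Suc E_def by (auto simp: coeff_pCons split: nat.split)
      then show ?thesis by (simp only: poly_on_const)
    qed
  qed
  define D where "D = (\<lambda>x. \<Sum>p | p permutes {0..<n}. signof p * (\<Prod>i = 0..<n. E i (p i) x))"
  have "pc D" unfolding D_def
  proof (intro sum mult const prod)
    fix p i assume "p \<in> {p. p permutes {0..<n}}" "i \<in> {0..<n}"
    then show "pc (E i (p i))" using permutes_in_image[of p "{0..<n}" i] by (intro E) auto
  qed
  then have "poly_on n (\<lambda>x. coeff (D x) k)" unfolding pc_def by blast
  then show ?thesis
  proof (rule poly_on_cong)
    fix x :: "'a mat2" assume x: "x \<in> mat2_space n"
    have "char_poly (M x) = D x"
      unfolding char_poly_def D_def det_def'[OF char_poly_matrix_closed[OF c[OF x]]]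
    proof (rule sum.cong[OF refl])
      fix p assume p: "p \<in> {p. p permutes {0..<n}}"
      have "(\<Prod>i = 0..<n. char_poly_matrix (M x) $$ (i, p i)) = (\<Prod>i = 0..<n. E i (p i) x)"
      proof (rule prod.cong[OF refl])
        fix i assume i: "i \<in> {0..<n}"
        then have "p i < n" using p permutes_in_image[of p "{0..<n}" i] by auto
        then show "char_poly_matrix (M x) $$ (i, p i) = E i (p i) x"
          using i c[OF x] by (auto simp: char_poly_matrix_def E_def)
      qed
      then show "signof p * (\<Prod>i = 0..<n. char_poly_matrix (M x) $$ (i, p i)) = signof p * (\<Prod>i = 0..<n. E i (p i) x)"
        by simp
    qed
    then show "coeff (char_poly (M x)) k = coeff (D x) k" by simp
  qed
qed

lemma char_poly_invariant:
  assumes "y \<in> gl_orbit n x"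
  shows "char_poly (fst y) = char_poly (fst x)" "char_poly (snd y) = char_poly (snd x)"
proof -
  obtain P Q where "similar_mat_wit (fst y) (fst x) P Q" "similar_mat_wit (snd y) (snd x) P Q"
    using assms unfolding gl_orbit_def by blast
  then have "similar_mat (fst y) (fst x)" "similar_mat (snd y) (snd x)" unfolding similar_mat_def by blast+
  then show "char_poly (fst y) = char_poly (fst x)" "char_poly (snd y) = char_poly (snd x)"
    by (auto intro: char_poly_similar)
qed

lemma invariant_restrict:
  assumes Z: "Z \<subseteq> mat2_space n" and F: "poly_on n F"
    and inv: "\<And>x y. x \<in> Z \<Longrightarrow> y \<in> gl_orbit n x \<Longrightarrow> F y = F x"
  shows "restrict F Z \<in> carrier (inv_ring n Z)"
proof -
  obtain g where g: "g \<in> polyfun n" "\<And>x. x \<in> mat2_space n \<Longrightarrow> F x = g x" using F unfolding poly_on_def by blast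
  have "restrict F Z = restrict g Z" using g(2) Z by (intro restrict_ext) auto
  then have "\<exists>g\<in>polyfun n. restrict F Z = restrict g Z" using g(1) by (rule bexI)
  moreover have "restrict F Z y = restrict F Z x" if "x \<in> Z" "y \<in> gl_orbit n x \<inter> Z" for x y
    using inv[of x y] that by simp
  ultimately show ?thesis unfolding inv_ring_carrier by blast
qed

lemma char_poly_dsum:
  fixes x y :: "'a::idom mat2"
  assumes x: "x \<in> mat2_space i" and y: "y \<in> mat2_space j"
  shows "char_poly (fst (dsum x y)) = char_poly (fst x) * char_poly (fst y)"
    "char_poly (snd (dsum x y)) = char_poly (snd x) * char_poly (snd y)"
proof -
  have c: "fst x \<in> carrier_mat i i" "snd x \<in> carrier_mat i i" "fst y \<in> carrier_mat j j" "snd y \<in> carrier_mat j j"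
    using x y by (auto simp: mem_Times_iff)
  have m: "char_poly (four_block_mat A (0\<^sub>m i j) (0\<^sub>m j i) B) = char_poly A * char_poly B"
    if A: "A \<in> carrier_mat i i" and B: "B \<in> carrier_mat j j" for A B :: "'a mat"
  proof -
    have "char_poly_matrix (four_block_mat A (0\<^sub>m i j) (0\<^sub>m j i) B) =
        four_block_mat (char_poly_matrix A) (0\<^sub>m i j) (0\<^sub>m j i) (char_poly_matrix B)"
      using A B by (intro eq_matI) (auto simp: char_poly_matrix_def)
    then show ?thesis unfolding char_poly_def
      using det_four_block_mat_upper_right_zero[OF char_poly_matrix_closed[OF A] refl _ char_poly_matrix_closed[OF B]] by simp
  qed
  show "char_poly (fst (dsum x y)) = char_poly (fst x) * char_poly (fst y)"
    "char_poly (snd (dsum x y)) = char_poly (snd x) * char_poly (snd y)"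
    unfolding dsum_four_block[OF x y] fst_conv snd_conv using m c by simp_all
qed

lemma char_poly_dsums:
  fixes xs :: "'a::idom mat2 list"
  shows "set xs \<subseteq> mat2_space i \<Longrightarrow> char_poly (fst (dsums xs)) = prod_list (map (\<lambda>x. char_poly (fst x)) xs)"
    and "set xs \<subseteq> mat2_space i \<Longrightarrow> char_poly (snd (dsums xs)) = prod_list (map (\<lambda>x. char_poly (snd x)) xs)"
proof -
  have e: "char_poly (0\<^sub>m 0 0) = (1 :: 'a poly)"
  proof -
    have "upper_triangular (0\<^sub>m 0 0 :: 'a mat)" "diag_mat (0\<^sub>m 0 0 :: 'a mat) = []" by (auto simp: diag_mat_def)
    then show ?thesis using char_poly_upper_triangular[of "0\<^sub>m 0 0 :: 'a mat" 0] by simp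
  qed
  show "set xs \<subseteq> mat2_space i \<Longrightarrow> char_poly (fst (dsums xs)) = prod_list (map (\<lambda>x. char_poly (fst x)) xs)"
  proof (induction xs)
    case (Cons x xs)
    then show ?case using char_poly_dsum(1)[of x i "dsums xs" "i * length xs"] dsums_space[of xs i] by (simp add: dsums_simps)
  qed (simp add: dsums_simps e)
  show "set xs \<subseteq> mat2_space i \<Longrightarrow> char_poly (snd (dsums xs)) = prod_list (map (\<lambda>x. char_poly (snd x)) xs)"
  proof (induction xs)
    case (Cons x xs)
    then show ?case using char_poly_dsum(2)[of x i "dsums xs" "i * length xs"] dsums_space[of xs i] by (simp add: dsums_simps)
  qed (simp add: dsums_simps e)
qed

lemma char_poly_line:
  fixes a b :: "'a::idom"
  shows "char_poly (fst (line a b)) = [:- a, 1:]" "char_poly (snd (line a b)) = [:- b, 1:]"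
proof -
  have m: "char_poly (mat 1 1 (\<lambda>_. a)) = [:- a, 1:]" for a :: 'a
    using char_poly_upper_triangular[of "mat 1 1 (\<lambda>_. a)" 1] by (simp add: diag_mat_def upper_triangular_def)
  show "char_poly (fst (line a b)) = [:- a, 1:]" "char_poly (snd (line a b)) = [:- b, 1:]"
    unfolding line_def using m by simp_all
qed

lemma char_poly_cyclic_fst:
  "char_poly (fst (cyclic_pair q L a b)) = (\<Prod>k\<leftarrow>[0..<L]. [:- (a * inverse q ^ k), 1:])"
proof -
  have "diag_mat (mat_diag L (\<lambda>k. a * inverse q ^ k)) = map (\<lambda>k. a * inverse q ^ k) [0..<L]"
    unfolding diag_mat_def by (auto simp: mat_diag_def)
  then show ?thesis
    unfolding cyclic_pair_def fst_conv
    by (subst char_poly_upper_triangular[of _ L]) (auto simp: mat_diag_def o_def)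
qed

lemma cyclic_snd_mult_vec:
  assumes "u \<in> carrier_vec L" "i < L"
  shows "(snd (cyclic_pair q L a b) *\<^sub>v u) $ i = b * u $ ((i + 1) mod L)"
proof -
  have "(snd (cyclic_pair q L a b) *\<^sub>v u) $ i = (\<Sum>k<L. snd (cyclic_pair q L a b) $$ (i, k) * u $ k)"
    by (rule mult_mat_vec_index) (use assms in \<open>auto simp: cyclic_pair_def\<close>)
  also have "\<dots> = (\<Sum>k<L. if k = (i + 1) mod L then b * u $ k else 0)"
    by (rule sum.cong) (use assms in \<open>auto simp: cyclic_pair_def\<close>)
  also have "\<dots> = b * u $ ((i + 1) mod L)" using assms(2) by (simp add: sum.delta)
  finally show ?thesis .
qed

text \<open>The vector with all entries \<open>1\<close> is an eigenvector.\<close>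

lemma cyclic_snd_root:
  fixes b :: "'a::field"
  assumes "L > 0" shows "poly (char_poly (snd (cyclic_pair q L a b))) b = 0"
proof -
  let ?B = "snd (cyclic_pair q L a b)" and ?u = "vec L (\<lambda>_. 1 :: 'a)"
  have B: "?B \<in> carrier_mat L L" by (simp add: cyclic_pair_def)
  have "?B *\<^sub>v ?u = b \<cdot>\<^sub>v ?u"
    by (rule eq_vecI) (use B assms in \<open>simp_all add: cyclic_snd_mult_vec del: index_mult_mat_vec\<close>)
  moreover have "?u \<noteq> 0\<^sub>v L"
  proof
    assume "?u = 0\<^sub>v L"
    then have "?u $ 0 = 0\<^sub>v L $ 0" by simp
    then show False using assms by simp
  qed
  ultimately have "eigenvector ?B ?u b" unfolding eigenvector_def using B by simp
  then show ?thesis using eigenvalue_root_char_poly[OF B] unfolding eigenvalue_def by blast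
qed

lemma cyclic_snd_root_power:
  fixes b c :: "'a::field"
  assumes L: "L > 0" and root: "poly (char_poly (snd (cyclic_pair q L a b))) c = 0"
  shows "c ^ L = b ^ L"
proof -
  let ?B = "snd (cyclic_pair q L a b)"
  have B: "?B \<in> carrier_mat L L" by (simp add: cyclic_pair_def)
  obtain u where u: "u \<in> carrier_vec L" "u \<noteq> 0\<^sub>v L" "?B *\<^sub>v u = c \<cdot>\<^sub>v u"
    using root eigenvalue_root_char_poly[OF B] B unfolding eigenvalue_def eigenvector_def by auto
  have shift: "c * u $ i = b * u $ ((i + 1) mod L)" if "i < L" for i
    using cyclic_snd_mult_vec[OF u(1) that, of q a b] u(3) that u(1) by simp
  have iter: "c ^ k * u $ i = b ^ k * u $ ((i + k) mod L)" if "i < L" for i k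
  proof (induction k)
    case 0
    show ?case using that by simp
  next
    case (Suc k)
    have "c ^ Suc k * u $ i = b ^ k * (c * u $ ((i + k) mod L))" using Suc by (simp add: mult_ac)
    also have "c * u $ ((i + k) mod L) = b * u $ ((i + Suc k) mod L)"
      using shift[of "(i + k) mod L"] L by (simp add: mod_Suc_eq)
    finally show ?case by (simp add: mult_ac)
  qed
  have "\<exists>i<L. u $ i \<noteq> 0"
  proof (rule ccontr)
    assume "\<not> ?thesis"
    then have "u = 0\<^sub>v L" using u(1) by (intro eq_vecI) auto
    then show False using u(2) by simp
  qed
  then obtain i where "i < L" "u $ i \<noteq> 0" by blast
  then show ?thesis using iter[of i L] by simp
qed

lemma char_poly_simple_sum:
  fixes q :: "'a::field"
  shows "char_poly (fst (simple_sum q L cs as bs)) =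
      (\<Prod>(a, b)\<leftarrow>cs. char_poly (fst (cyclic_pair q L a b))) * (\<Prod>a\<leftarrow>as. [:- a, 1:]) * (\<Prod>b\<leftarrow>bs. [:0, 1:])"
    "char_poly (snd (simple_sum q L cs as bs)) =
      (\<Prod>(a, b)\<leftarrow>cs. char_poly (snd (cyclic_pair q L a b))) * (\<Prod>a\<leftarrow>as. [:0, 1:]) * (\<Prod>b\<leftarrow>bs. [:- b, 1:])"
proof -
  have C: "set (map (\<lambda>(a, b). cyclic_pair q L a b) cs) \<subseteq> mat2_space L"
    using range_cyclic_pair[of q L] by (simp only: set_map) blast
  have l: "set (map (\<lambda>a. line (f a) (g a)) as) \<subseteq> mat2_space 1" for f g :: "'a \<Rightarrow> 'a" and as
    using range_line[of f g] by (simp only: set_map) blast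
  note A = l[of "\<lambda>a. a" "\<lambda>_. 0" as] and B = l[of "\<lambda>_. 0" "\<lambda>b. b" bs]
  note d = char_poly_dsum[OF cyclic_sum_space dsum_space[OF line_sum_space[of "\<lambda>a. a" "\<lambda>_. 0"] line_sum_space[of "\<lambda>_. 0" "\<lambda>b. b"]]]
    char_poly_dsum[OF line_sum_space[of "\<lambda>a. a" "\<lambda>_. 0"] line_sum_space[of "\<lambda>_. 0" "\<lambda>b. b"]]
  have cm: "map (\<lambda>x. char_poly (f x)) (map (\<lambda>(a, b). cyclic_pair q L a b) cs) =
      map (\<lambda>(a, b). char_poly (f (cyclic_pair q L a b))) cs" for f :: "'a mat2 \<Rightarrow> 'a mat"
    by (simp add: split_beta)
  show "char_poly (fst (simple_sum q L cs as bs)) =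
      (\<Prod>(a, b)\<leftarrow>cs. char_poly (fst (cyclic_pair q L a b))) * (\<Prod>a\<leftarrow>as. [:- a, 1:]) * (\<Prod>b\<leftarrow>bs. [:0, 1:])"
    unfolding simple_sum_def d char_poly_dsums(1)[OF C] char_poly_dsums(1)[OF A] char_poly_dsums(1)[OF B] cm
    by (simp add: o_def char_poly_line mult.assoc)
  show "char_poly (snd (simple_sum q L cs as bs)) =
      (\<Prod>(a, b)\<leftarrow>cs. char_poly (snd (cyclic_pair q L a b))) * (\<Prod>a\<leftarrow>as. [:0, 1:]) * (\<Prod>b\<leftarrow>bs. [:- b, 1:])"
    unfolding simple_sum_def d char_poly_dsums(2)[OF C] char_poly_dsums(2)[OF A] char_poly_dsums(2)[OF B] cm
    by (simp add: o_def char_poly_line mult.assoc)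
qed

lemma prod_list_poly_root:
  fixes F :: "'b \<Rightarrow> 'a::idom poly"
  shows "poly (\<Prod>x\<leftarrow>xs. F x) c = 0 \<longleftrightarrow> (\<exists>x\<in>set xs. poly (F x) c = 0)"
  by (induction xs) auto

lemma simple_sum_root_fst:
  fixes q :: "'a::field"
  shows "poly (char_poly (fst (simple_sum q L cs as bs))) c = 0 \<longleftrightarrow>
    (\<exists>(a, b)\<in>set cs. \<exists>k<L. c = a * inverse q ^ k) \<or> c \<in> set as \<or> (bs \<noteq> [] \<and> c = 0)"
proof -
  have "poly (char_poly (fst (cyclic_pair q L a b))) c = 0 \<longleftrightarrow> (\<exists>k<L. c = a * inverse q ^ k)" for a b
    unfolding char_poly_cyclic_fst prod_list_poly_root by auto
  then show ?thesis
    unfolding char_poly_simple_sum(1) poly_mult mult_eq_0_iff prod_list_poly_root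
    by (auto simp: split_beta add_eq_0_iff2)
qed

lemma simple_sum_root_snd:
  fixes q :: "'a::field"
  shows "poly (char_poly (snd (simple_sum q L cs as bs))) c = 0 \<longleftrightarrow>
    (\<exists>(a, b)\<in>set cs. poly (char_poly (snd (cyclic_pair q L a b))) c = 0) \<or> c \<in> set bs \<or> (as \<noteq> [] \<and> c = 0)"
  unfolding char_poly_simple_sum(2) poly_mult mult_eq_0_iff prod_list_poly_root
  by (auto simp: split_beta add_eq_0_iff2)

lemma block_diag_pow:
  fixes A B :: "'a::comm_ring_1 mat"
  assumes "A \<in> carrier_mat i i" "B \<in> carrier_mat j j"
  shows "four_block_mat A (0\<^sub>m i j) (0\<^sub>m j i) B ^\<^sub>m k = four_block_mat (A ^\<^sub>m k) (0\<^sub>m i j) (0\<^sub>m j i) (B ^\<^sub>m k)"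
proof (induction k)
  case 0
  show ?case using assms by simp
next
  case (Suc k)
  then show ?case using block_diag_mult[of "A ^\<^sub>m k" i "B ^\<^sub>m k" j A B] assms by simp
qed

lemma trace_block_diag:
  assumes "A \<in> carrier_mat i i" "B \<in> carrier_mat j j"
  shows "trace (four_block_mat A (0\<^sub>m i j) (0\<^sub>m j i) B) = trace A + trace B"
  using assms by (simp add: trace_def sum_lessThan_split)

definition word_trace :: "nat \<Rightarrow> nat \<Rightarrow> 'a::comm_ring_1 mat2 \<Rightarrow> 'a" where
  "word_trace k l x = trace (fst x ^\<^sub>m k * snd x ^\<^sub>m l)"

lemma word_trace_dsum:
  assumes x: "x \<in> mat2_space i" and y: "y \<in> mat2_space j"
  shows "word_trace k l (dsum x y) = word_trace k l x + word_trace k l y"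
proof -
  have c: "fst x \<in> carrier_mat i i" "snd x \<in> carrier_mat i i" "fst y \<in> carrier_mat j j" "snd y \<in> carrier_mat j j"
    using x y by (auto simp: mem_Times_iff)
  show ?thesis
    unfolding word_trace_def dsum_four_block[OF x y] fst_conv snd_conv block_diag_pow[OF c(1,3)] block_diag_pow[OF c(2,4)]
    using c trace_block_diag[of "fst x ^\<^sub>m k * snd x ^\<^sub>m l" i "fst y ^\<^sub>m k * snd y ^\<^sub>m l" j]
      mult_carrier_mat[of "fst x ^\<^sub>m k" i i "snd x ^\<^sub>m l" i] mult_carrier_mat[of "fst y ^\<^sub>m k" j j "snd y ^\<^sub>m l" j]
    by (simp add: block_diag_mult[of _ i _ j])
qed

lemma word_trace_dsums:
  assumes "set xs \<subseteq> mat2_space i"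
  shows "word_trace k l (dsums xs) = (\<Sum>x\<leftarrow>xs. word_trace k l x)"
  using assms
proof (induction xs)
  case Nil
  show ?case by (simp add: word_trace_def dsums_simps trace_def)
next
  case (Cons x xs)
  then show ?case using word_trace_dsum[of x i "dsums xs" "i * length xs" k l] dsums_space[of xs i] by (simp add: dsums_simps)
qed

lemma word_trace_line: "word_trace k l (line a b) = a ^ k * b ^ l"
proof -
  have p: "mat 1 1 (\<lambda>_. a) ^\<^sub>m k = mat 1 1 (\<lambda>_. a ^ k)" for a :: 'a and k
    by (induction k) (auto simp: scalar_prod_def mult.commute intro!: eq_matI)
  show ?thesis unfolding word_trace_def line_def fst_conv snd_conv p by (simp add: trace_def scalar_prod_def)
qed

lemma mat_diag_pow: "mat_diag n f ^\<^sub>m k = mat_diag n (\<lambda>i. f i ^ k :: 'a::comm_ring_1)"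
proof (induction k)
  case 0
  show ?case by (rule eq_matI) (auto simp: mat_diag_def)
next
  case (Suc k)
  then show ?case by (simp add: mult.commute)
qed

lemma cyclic_snd_pow:
  assumes L: "L > 0"
  shows "snd (cyclic_pair q L a b) ^\<^sub>m k = mat L L (\<lambda>(i, j). if j = (i + k) mod L then b ^ k else 0)"
proof (induction k)
  case 0
  show ?case by (rule eq_matI) (auto simp: cyclic_pair_def)
next
  case (Suc k)
  let ?B = "snd (cyclic_pair q L a b)" and ?M = "mat L L (\<lambda>(i, j). if j = (i + k) mod L then b ^ k else 0)"
  have B: "?B \<in> carrier_mat L L" by (simp add: cyclic_pair_def)
  have "?M * ?B = mat L L (\<lambda>(i, j). if j = (i + Suc k) mod L then b ^ Suc k else 0)"
  proof (rule eq_matI)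
    fix i j assume "i < dim_row (mat L L (\<lambda>(i, j). if j = (i + Suc k) mod L then b ^ Suc k else 0))"
      "j < dim_col (mat L L (\<lambda>(i, j). if j = (i + Suc k) mod L then b ^ Suc k else 0))"
    then have ij: "i < L" "j < L" by auto
    have "(?M * ?B) $$ (i, j) = (\<Sum>l<L. ?M $$ (i, l) * ?B $$ (l, j))"
      by (rule mat_mult_entry) (use B ij in auto)
    also have "\<dots> = (\<Sum>l<L. if l = (i + k) mod L then b ^ k * ?B $$ (l, j) else 0)"
      by (rule sum.cong) (use ij in auto)
    also have "\<dots> = b ^ k * ?B $$ ((i + k) mod L, j)" using L by (simp add: sum.delta)
    also have "\<dots> = mat L L (\<lambda>(i, j). if j = (i + Suc k) mod L then b ^ Suc k else 0) $$ (i, j)"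
      using ij L by (simp add: cyclic_pair_def mod_Suc_eq mult.commute)
    finally show "(?M * ?B) $$ (i, j) = mat L L (\<lambda>(i, j). if j = (i + Suc k) mod L then b ^ Suc k else 0) $$ (i, j)" .
  qed (use B in auto)
  then show ?case using Suc by simp
qed

lemma geometric_zero:
  fixes z :: "'a::field"
  assumes "z ^ L = 1" "z \<noteq> 1" shows "(\<Sum>k<L. z ^ k) = 0"
  using geometric_sum[OF assms(2), of L] assms(1) by simp

lemma word_trace_cyclic:
  fixes q :: "'a::field"
  assumes q: "primitive_root q L"
  shows "0 < k \<Longrightarrow> k < L \<Longrightarrow> word_trace k 0 (cyclic_pair q L a b) = 0"
    "0 < k \<Longrightarrow> k < L \<Longrightarrow> word_trace 0 k (cyclic_pair q L a b) = 0"
    "word_trace L L (cyclic_pair q L a b) = of_nat L * (a * b) ^ L"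
proof -
  have L: "L > 0" "q ^ L = 1" using q unfolding primitive_root_def by auto
  have A: "fst (cyclic_pair q L a b) ^\<^sub>m k = mat_diag L (\<lambda>i. (a * inverse q ^ i) ^ k)" for k
    unfolding cyclic_pair_def fst_conv by (rule mat_diag_pow)
  note B = cyclic_snd_pow[OF L(1), of q a b]
  have c: "fst (cyclic_pair q L a b) \<in> carrier_mat L L" "snd (cyclic_pair q L a b) \<in> carrier_mat L L"
    by (simp_all add: cyclic_pair_def)
  show "word_trace k 0 (cyclic_pair q L a b) = 0" if k: "0 < k" "k < L"
  proof -
    have "word_trace k 0 (cyclic_pair q L a b) = trace (mat_diag L (\<lambda>i. (a * inverse q ^ i) ^ k))"
      unfolding word_trace_def A using c by (simp add: carrier_matD(1)[OF c(2)] right_mult_one_mat[of _ L L])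
    also have "\<dots> = (\<Sum>i<L. (a * inverse q ^ i) ^ k)" by (simp add: trace_def mat_diag_def)
    also have "\<dots> = a ^ k * (\<Sum>i<L. (inverse q ^ k) ^ i)"
      by (simp add: power_mult_distrib sum_distrib_left flip: power_mult) (simp add: mult.commute)
    also have "(\<Sum>i<L. (inverse q ^ k) ^ i) = 0"
    proof (rule geometric_zero)
      have "(inverse q ^ k) ^ L = (inverse q ^ L) ^ k" by (simp flip: power_mult add: mult.commute)
      then show "(inverse q ^ k) ^ L = 1" using L(2) by (simp add: power_inverse)
      have "q ^ k \<noteq> 1" using q k unfolding primitive_root_def by blast
      then show "inverse q ^ k \<noteq> 1" by (simp add: power_inverse)
    qed
    finally show ?thesis by simp
  qed
  show "word_trace 0 k (cyclic_pair q L a b) = 0" if k: "0 < k" "k < L"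
  proof -
    have "word_trace 0 k (cyclic_pair q L a b) = trace (snd (cyclic_pair q L a b) ^\<^sub>m k)"
      unfolding word_trace_def using c by (simp add: carrier_matD(1)[OF c(1)])
    also have "\<dots> = 0"
    proof -
      have "i \<noteq> (i + k) mod L" if "i < L" for i
        using that k by (cases "i + k < L") (auto simp: mod_if)
      then show ?thesis unfolding B trace_def by simp
    qed
    finally show ?thesis .
  qed
  show "word_trace L L (cyclic_pair q L a b) = of_nat L * (a * b) ^ L"
  proof -
    have "fst (cyclic_pair q L a b) ^\<^sub>m L = mat_diag L (\<lambda>i. a ^ L)"
    proof -
      have "(a * inverse q ^ i) ^ L = a ^ L" for i
      proof -
        have "(inverse q ^ i) ^ L = (inverse q ^ L) ^ i" by (simp flip: power_mult add: mult.commute)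
        then show ?thesis using L(2) by (simp add: power_mult_distrib power_inverse)
      qed
      then show ?thesis unfolding A by simp
    qed
    moreover have "snd (cyclic_pair q L a b) ^\<^sub>m L = mat_diag L (\<lambda>i. b ^ L)"
      unfolding B by (rule eq_matI) (auto simp: mat_diag_def)
    ultimately have "word_trace L L (cyclic_pair q L a b) = trace (mat_diag L (\<lambda>i. a ^ L * b ^ L))"
      unfolding word_trace_def by simp
    then show ?thesis by (simp add: trace_def mat_diag_def power_mult_distrib)
  qed
qed

lemma word_trace_simple_sum:
  fixes q :: "'a::field"
  shows "word_trace k l (simple_sum q L cs as bs) = (\<Sum>(a, b)\<leftarrow>cs. word_trace k l (cyclic_pair q L a b)) +
    (\<Sum>a\<leftarrow>as. a ^ k * 0 ^ l) + (\<Sum>b\<leftarrow>bs. 0 ^ k * b ^ l)"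
proof -
  have C: "set (map (\<lambda>(a, b). cyclic_pair q L a b) cs) \<subseteq> mat2_space L"
    using range_cyclic_pair[of q L] by (simp only: set_map) blast
  have li: "set (map (\<lambda>a. line (f a) (g a)) as) \<subseteq> mat2_space 1" for f g :: "'a \<Rightarrow> 'a" and as
    using range_line[of f g] by (simp only: set_map) blast
  note A = li[of "\<lambda>a. a" "\<lambda>_. 0" as] and B = li[of "\<lambda>_. 0" "\<lambda>b. b" bs]
  note d = word_trace_dsum[OF cyclic_sum_space dsum_space[OF line_sum_space[of "\<lambda>a. a" "\<lambda>_. 0"] line_sum_space[of "\<lambda>_. 0" "\<lambda>b. b"]]]
    word_trace_dsum[OF line_sum_space[of "\<lambda>a. a" "\<lambda>_. 0"] line_sum_space[of "\<lambda>_. 0" "\<lambda>b. b"]]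
  have cm: "map (word_trace k l) (map (\<lambda>(a, b). cyclic_pair q L a b) cs) =
      map (\<lambda>(a, b). word_trace k l (cyclic_pair q L a b)) cs" by (simp add: split_beta)
  show ?thesis
    unfolding simple_sum_def d word_trace_dsums[OF C] word_trace_dsums[OF A] word_trace_dsums[OF B] cm
    by (simp add: o_def word_trace_line add.assoc)
qed


section \<open>Separating the types\<close>

text \<open>The coefficients of the characteristic polynomial are invariant, so its equation for an eigenvalue is an integral equation.\<close>

lemma integral_of_root:
  fixes Z :: "'a::field mat2 set"
  assumes Z: "Z \<subseteq> mat2_space n" and \<phi>: "\<And>v. \<phi> v \<in> Z" and M: "poly_mat n M"
    and inv: "\<And>x y. y \<in> gl_orbit n x \<Longrightarrow> char_poly (M y) = char_poly (M x)"
    and root: "\<And>v. poly (char_poly (M (\<phi> v))) (v i) = 0"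
  shows "integral_over ((\<lambda>f v. f (\<phi> v)) ` carrier (inv_ring n Z)) (var i)"
proof -
  define c where "c = (\<lambda>k v. - coeff (char_poly (M (\<phi> v))) k)"
  have cT: "c k \<in> (\<lambda>f v. f (\<phi> v)) ` carrier (inv_ring n Z)" for k
  proof -
    have "poly_on n (\<lambda>x. - 1 * coeff (char_poly (M x)) k)"
      by (intro poly_on_mult poly_on_const char_poly_coeff_poly_on M)
    then have "restrict (\<lambda>x. - 1 * coeff (char_poly (M x)) k) Z \<in> carrier (inv_ring n Z)"
      by (rule invariant_restrict[OF Z]) (simp add: inv)
    then show ?thesis by (rule rev_image_eqI) (simp add: c_def \<phi> fun_eq_iff)
  qed
  have pw: "(f ^ k) v = f v ^ k" for f :: "(nat \<Rightarrow> 'a) \<Rightarrow> 'a" and k v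
    by (induction k) simp_all
  have sm: "(\<Sum>k<d. F k) v = (\<Sum>k<d. F k v)" for F :: "nat \<Rightarrow> (nat \<Rightarrow> 'a) \<Rightarrow> 'a" and v and d :: nat
    by (induction d) simp_all
  have "(var i ^ n) v = (\<Sum>k<n. c k * var i ^ k) v" for v
  proof -
    have "M (\<phi> v) \<in> carrier_mat n n" using M Z \<phi>[of v] unfolding poly_mat_def by blast
    from degree_monic_char_poly[OF this] have dm: "degree (char_poly (M (\<phi> v))) = n" "coeff (char_poly (M (\<phi> v))) n = 1" by blast+
    have "(\<Sum>k\<le>n. coeff (char_poly (M (\<phi> v))) k * v i ^ k) = 0"
      using root[of v] unfolding poly_altdef dm .
    then have "(\<Sum>k<n. coeff (char_poly (M (\<phi> v))) k * v i ^ k) + v i ^ n = 0"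
      unfolding lessThan_Suc_atMost[symmetric] by (simp add: dm)
    then have "v i ^ n = (\<Sum>k<n. c k v * v i ^ k)"
      by (simp add: c_def sum_negf eq_neg_iff_add_eq_0 add.commute)
    then show ?thesis unfolding sm pw by (simp add: pw) (simp add: var_def)
  qed
  then have "var i ^ n = (\<Sum>k<n. c k * var i ^ k)" by (rule ext)
  then show ?thesis unfolding integral_over_def using cT by blast
qed

lemma generic_pair_root:
  fixes q :: "'a::field"
  assumes i: "i < 2 * p + m + r" and L: "L > 0"
  shows "(\<forall>v. poly (char_poly (fst (generic_pair q L (p, m, r) v))) (v i) = 0) \<or>
    (\<forall>v. poly (char_poly (snd (generic_pair q L (p, m, r) v))) (v i) = 0)"
proof -
  consider "i < p" | "p \<le> i" "i < p + m" | "p + m \<le> i" "i < 2 * p + m" | "2 * p + m \<le> i" by linarith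
  then show ?thesis
  proof cases
    case 1
    have "poly (char_poly (fst (generic_pair q L (p, m, r) v))) (v i) = 0" for v
    proof -
      have "(v i, v (p + m + i)) \<in> set (map (\<lambda>i. (v i, v (p + m + i))) [0..<p])" using 1 by force
      moreover have "\<exists>k<L. v i = v i * inverse q ^ k" using L by (intro exI[of _ 0]) simp
      ultimately show ?thesis unfolding generic_pair_def prod.case simple_sum_root_fst by blast
    qed
    then show ?thesis by blast
  next
    case 2
    have "poly (char_poly (fst (generic_pair q L (p, m, r) v))) (v i) = 0" for v
    proof -
      have "v i \<in> set (map (\<lambda>j. v (p + j)) [0..<m])" using 2 by (auto intro!: image_eqI[of _ _ "i - p"])
      then show ?thesis unfolding generic_pair_def prod.case simple_sum_root_fst by blast
    qed
    then show ?thesis by blast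
  next
    case 3
    have "poly (char_poly (snd (generic_pair q L (p, m, r) v))) (v i) = 0" for v
    proof -
      have "(v (i - (p + m)), v i) \<in> set (map (\<lambda>i. (v i, v (p + m + i))) [0..<p])"
        using 3 by (auto intro!: image_eqI[of _ _ "i - (p + m)"])
      then show ?thesis unfolding generic_pair_def prod.case simple_sum_root_snd using cyclic_snd_root[OF L] by blast
    qed
    then show ?thesis by blast
  next
    case 4
    have "poly (char_poly (snd (generic_pair q L (p, m, r) v))) (v i) = 0" for v
    proof -
      have "v i \<in> set (map (\<lambda>k. v (2 * p + m + k)) [0..<r])" using 4 i by (auto intro!: image_eqI[of _ _ "i - (2 * p + m)"])
      then show ?thesis unfolding generic_pair_def prod.case simple_sum_root_snd by blast
    qed
    then show ?thesis by blast
  qed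
qed

lemma quotient_param_generic:
  fixes q :: "'a::{alg_closed_field, field_char_0}"
  assumes Z: "Z \<subseteq> mat2_space n" and \<phi>: "\<And>v. generic_pair q L (p, m, r) v \<in> Z"
    and n: "n = L * p + m + r" and L: "L > 0"
  shows "quotient_param n Z (generic_pair q L (p, m, r)) (2 * p + m + r)"
proof
  show "generic_pair q L (p, m, r) v \<in> Z" for v by (rule \<phi>)
  show "(\<lambda>v. f (generic_pair q L (p, m, r) v)) \<in> mpfun (2 * p + m + r)" if "f \<in> polyfun n" for f
    by (rule param_map_comp[OF param_map_generic_pair that[unfolded n]])
  show "integral_over ((\<lambda>f v. f (generic_pair q L (p, m, r) v)) ` carrier (inv_ring n Z)) (var i)"
    if i: "i < 2 * p + m + r" for i
    using generic_pair_root[OF i L, of q]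
  proof
    assume "\<forall>v. poly (char_poly (fst (generic_pair q L (p, m, r) v))) (v i) = 0"
    then show ?thesis by (intro integral_of_root[OF Z \<phi> poly_mat_fst_snd(1) char_poly_invariant(1)]) blast+
  next
    assume "\<forall>v. poly (char_poly (snd (generic_pair q L (p, m, r) v))) (v i) = 0"
    then show ?thesis by (intro integral_of_root[OF Z \<phi> poly_mat_fst_snd(2) char_poly_invariant(2)]) blast+
  qed
qed

text \<open>Add up the power sums for \<open>0 < k < L\<close> with the weights \<open>q ^ k\<close>. The contribution of every \<open>y\<close> is an integer that is at
  least \<open>- 1\<close>, while the total is \<open>- m\<close>; so there are at least \<open>m\<close> summands.\<close>

lemma power_sums_count:
  fixes q :: "'a::field_char_0" and ys :: "'a list"
  assumes q: "primitive_root q L" and q1: "q \<noteq> 1"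
    and ys: "\<And>y. y \<in> set ys \<Longrightarrow> y = 0 \<or> y ^ L = 1"
    and sums: "\<And>k. 0 < k \<Longrightarrow> k < L \<Longrightarrow> (\<Sum>y\<leftarrow>ys. y ^ k) = of_nat m"
  shows "m \<le> length ys"
proof -
  have L: "L > 0" "q ^ L = 1" using q unfolding primitive_root_def by auto
  have split: "(\<Sum>k\<in>{1..<L}. z ^ k) = (\<Sum>k<L. z ^ k) - 1" for z :: 'a
    using sum.atLeast_Suc_lessThan[OF L(1), of "\<lambda>k. z ^ k"] by (simp add: lessThan_atLeast0)
  have part: "\<exists>t::int. t \<le> 1 \<and> (\<Sum>k\<in>{1..<L}. (q * y) ^ k) = - of_int t" if y: "y = 0 \<or> y ^ L = 1" for y
  proof -
    consider "y = 0" | "q * y = 1" | "y ^ L = 1" "q * y \<noteq> 1" using y by blast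
    then show ?thesis
    proof cases
      case 1
      then show ?thesis by (intro exI[of _ 0]) (simp add: power_0_left)
    next
      case 2
      have "(\<Sum>k\<in>{1..<L}. (q * y) ^ k) = of_nat L - 1" unfolding split 2 by simp
      then show ?thesis using L by (intro exI[of _ "1 - int L"]) simp
    next
      case 3
      have "(q * y) ^ L = 1" using 3(1) L(2) by (simp add: power_mult_distrib)
      then have "(\<Sum>k\<in>{1..<L}. (q * y) ^ k) = - 1" unfolding split using geometric_zero[OF _ 3(2)] by simp
      then show ?thesis by (intro exI[of _ 1]) simp
    qed
  qed
  have "\<exists>t::int. t \<le> int (length zs) \<and> (\<Sum>y\<leftarrow>zs. \<Sum>k\<in>{1..<L}. (q * y) ^ k) = - of_int t"
    if "set zs \<subseteq> set ys" for zs :: "'a list"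
    using that
  proof (induction zs)
    case Nil
    show ?case by (intro exI[of _ 0]) simp
  next
    case (Cons y zs)
    then obtain t where t: "t \<le> int (length zs)" "(\<Sum>y\<leftarrow>zs. \<Sum>k\<in>{1..<L}. (q * y) ^ k) = - of_int t" by auto
    have "y \<in> set ys" using Cons.prems by simp
    then obtain t' :: int where t': "t' \<le> 1" "(\<Sum>k\<in>{1..<L}. (q * y) ^ k) = - of_int t'" using part ys by blast
    show ?case using t t' by (intro exI[of _ "t + t'"]) simp
  qed
  then obtain t :: int where t: "t \<le> int (length ys)" "(\<Sum>y\<leftarrow>ys. \<Sum>k\<in>{1..<L}. (q * y) ^ k) = - of_int t" by blast
  have swap: "(\<Sum>y\<leftarrow>zs. \<Sum>k\<in>{1..<L}. (q * y) ^ k) = (\<Sum>k\<in>{1..<L}. q ^ k * (\<Sum>y\<leftarrow>zs. y ^ k))" for zs :: "'a list"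
    by (induction zs) (simp_all add: sum.distrib distrib_left power_mult_distrib)
  have "(\<Sum>y\<leftarrow>ys. \<Sum>k\<in>{1..<L}. (q * y) ^ k) = (\<Sum>k\<in>{1..<L}. q ^ k * of_nat m)"
    unfolding swap by (rule sum.cong) (simp_all add: sums)
  also have "\<dots> = (\<Sum>k\<in>{1..<L}. q ^ k) * of_nat m" by (simp only: sum_distrib_right)
  also have "\<dots> = - of_nat m" unfolding split using geometric_zero[OF L(2) q1] by simp
  finally have "of_int t = (of_int (int m) :: 'a)" using t(2) by simp
  then have "t = int m" by (simp only: of_int_eq_iff)
  then show ?thesis using t(1) by simp
qed

lemma zero_one_sum_count:
  fixes ys :: "'a::field_char_0 list"
  assumes "\<And>y. y \<in> set ys \<Longrightarrow> y = 0 \<or> y = 1" and "sum_list ys = of_nat m"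
  shows "m \<le> length ys"
proof -
  have "\<exists>t\<le>length zs. sum_list zs = of_nat t" if "set zs \<subseteq> set ys" for zs
    using that
  proof (induction zs)
    case (Cons y zs)
    then obtain t where t: "t \<le> length zs" "sum_list zs = of_nat t" by auto
    have "y = 0 \<or> y = 1" using Cons.prems assms(1) by simp
    then show ?case
    proof
      assume "y = 0"
      then show ?thesis using t by (intro exI[of _ t]) simp
    next
      assume "y = 1"
      then show ?thesis using t by (intro exI[of _ "Suc t"]) simp
    qed
  qed simp
  then obtain t where "t \<le> length ys" "sum_list ys = of_nat t" by blast
  then show ?thesis using assms(2) by simp
qed

text \<open>If all parameters of a generic pair are \<open>1\<close>, every eigenvalue is zero or an \<open>L\<close>-th root of unity, and
  hence so are the parameters of any pair with the same invariants. The traces of \<open>A ^ k\<close> and \<open>B ^ k\<close> for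
  \<open>0 < k < L\<close> see only the lines, and the trace of \<open>A ^ L * B ^ L\<close> counts the cyclic pairs with nonzero parameters.\<close>

lemma types_le_finite:
  fixes q :: "'a::field_char_0"
  assumes q: "primitive_root q L" and q1: "q \<noteq> 1"
    and x: "x = simple_sum q L (replicate p (1, 1)) (replicate m 1) (replicate r 1)"
    and y: "y = simple_sum q L cs as bs"
    and cp: "char_poly (fst y) = char_poly (fst x)" "char_poly (snd y) = char_poly (snd x)"
    and wt: "\<And>k l. word_trace k l y = word_trace k l x"
  shows "p \<le> length cs" "m \<le> length as" "r \<le> length bs"
proof -
  have L: "L > 0" "q ^ L = 1" using q unfolding primitive_root_def by auto
  have z: "(0::'a) ^ L = 0" using L(1) by (simp add: power_0_left)
  have inv: "(inverse q ^ k) ^ L = 1" for k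
  proof -
    have "(inverse q ^ k) ^ L = (inverse q ^ L) ^ k" by (simp flip: power_mult add: mult.commute)
    then show ?thesis using L(2) by (simp add: power_inverse)
  qed
  have rA: "c = 0 \<or> c ^ L = 1" if "poly (char_poly (fst y)) c = 0" for c
    using that inv unfolding cp x simple_sum_root_fst by (auto simp: set_replicate_conv_if split: if_splits)
  have rB: "c = 0 \<or> c ^ L = 1" if "poly (char_poly (snd y)) c = 0" for c
  proof -
    have "c ^ L = 1" if "poly (char_poly (snd (cyclic_pair q L 1 1))) c = 0"
      using cyclic_snd_root_power[OF L(1) that] by simp
    then show ?thesis using that unfolding cp x simple_sum_root_snd by (auto simp: set_replicate_conv_if split: if_splits)
  qed
  have as: "a = 0 \<or> a ^ L = 1" if "a \<in> set as" for a
    by (rule rA) (use that in \<open>simp add: y simple_sum_root_fst\<close>)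
  have bs: "b = 0 \<or> b ^ L = 1" if "b \<in> set bs" for b
    by (rule rB) (use that in \<open>simp add: y simple_sum_root_snd\<close>)
  have cs: "(a * b) ^ L = 0 \<or> (a * b) ^ L = 1" if ab: "(a, b) \<in> set cs" for a b
  proof -
    have "\<exists>k<L. a = a * inverse q ^ k" using L by (intro exI[of _ 0]) simp
    then have "poly (char_poly (fst y)) a = 0" unfolding y simple_sum_root_fst using ab by blast
    then have "a = 0 \<or> a ^ L = 1" by (rule rA)
    moreover have "poly (char_poly (snd y)) b = 0"
      unfolding y simple_sum_root_snd using ab cyclic_snd_root[OF L(1), of q a b] by blast
    then have "b = 0 \<or> b ^ L = 1" by (rule rB)
    ultimately show ?thesis using z by (auto simp: power_mult_distrib)
  qed
  have cyc0: "(\<Sum>(a, b)\<leftarrow>cs. word_trace k 0 (cyclic_pair q L a b)) = 0"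
    "(\<Sum>(a, b)\<leftarrow>cs. word_trace 0 k (cyclic_pair q L a b)) = 0" if "0 < k" "k < L" for k and cs :: "('a \<times> 'a) list"
    using word_trace_cyclic(1,2)[OF q that] by (induction cs) auto
  have sA: "(\<Sum>a\<leftarrow>as. a ^ k) = of_nat m" if k: "0 < k" "k < L" for k
    using wt[of k 0] k unfolding x y word_trace_simple_sum cyc0[OF k]
    by (simp add: sum_list_replicate power_0_left)
  show "m \<le> length as" by (rule power_sums_count[OF q q1 as sA])
  have sB: "(\<Sum>b\<leftarrow>bs. b ^ k) = of_nat r" if k: "0 < k" "k < L" for k
    using wt[of 0 k] k unfolding x y word_trace_simple_sum cyc0[OF k]
    by (simp add: sum_list_replicate power_0_left)
  show "r \<le> length bs" by (rule power_sums_count[OF q q1 bs sB])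
  have "of_nat L * (\<Sum>(a, b)\<leftarrow>cs. (a * b) ^ L) = (of_nat L * of_nat p :: 'a)"
  proof -
    have "(\<Sum>(a, b)\<leftarrow>ds. word_trace L L (cyclic_pair q L a b)) = of_nat L * (\<Sum>(a, b)\<leftarrow>ds. (a * b) ^ L)" for ds
      by (induction ds) (auto simp: word_trace_cyclic(3)[OF q] distrib_left)
    then show ?thesis using wt[of L L] unfolding x y word_trace_simple_sum
      by (simp add: z sum_list_replicate word_trace_cyclic(3)[OF q])
  qed
  then have "sum_list (map (\<lambda>(a, b). (a * b) ^ L) cs) = of_nat p" using L(1) by simp
  then have "p \<le> length (map (\<lambda>(a, b). (a * b) ^ L) cs)"
  proof (rule zero_one_sum_count[rotated])
    fix y assume "y \<in> set (map (\<lambda>(a, b). (a * b) ^ L) cs)"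
    then obtain a b where "(a, b) \<in> set cs" "y = (a * b) ^ L" by auto
    then show "y = 0 \<or> y = 1" using cs by blast
  qed
  then show "p \<le> length cs" by simp
qed

lemma types_le_infinite:
  fixes q :: "'a::field_char_0"
  assumes x: "x = simple_sum q L [] (replicate m 1) (replicate r 1)"
    and y: "y = simple_sum q L [] as bs"
    and cp: "char_poly (fst y) = char_poly (fst x)" "char_poly (snd y) = char_poly (snd x)"
    and wt: "\<And>k l. word_trace k l y = word_trace k l x"
  shows "m \<le> length as" "r \<le> length bs"
proof -
  have "a = 0 \<or> a = 1" if "a \<in> set as" for a
  proof -
    have "poly (char_poly (fst y)) a = 0" using that by (simp add: y simple_sum_root_fst)
    then show ?thesis unfolding cp x simple_sum_root_fst by (auto simp: set_replicate_conv_if split: if_splits)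
  qed
  moreover have "sum_list as = of_nat m"
    using wt[of 1 0] unfolding x y word_trace_simple_sum by (simp add: sum_list_replicate)
  ultimately show "m \<le> length as" by (rule zero_one_sum_count)
  have "b = 0 \<or> b = 1" if "b \<in> set bs" for b
  proof -
    have "poly (char_poly (snd y)) b = 0" using that by (simp add: y simple_sum_root_snd)
    then show ?thesis unfolding cp x simple_sum_root_snd by (auto simp: set_replicate_conv_if split: if_splits)
  qed
  moreover have "sum_list bs = of_nat r"
    using wt[of 0 1] unfolding x y word_trace_simple_sum by (simp add: sum_list_replicate)
  ultimately show "r \<le> length bs" by (rule zero_one_sum_count)
qed

section \<open>Irreducible components and dimensions\<close>

lemma irreducible_in_finite_union:
  assumes "finite I" and T: "irreducible_in X T" and "\<And>t. t \<in> I \<Longrightarrow> closedin X (S t)" and "T \<subseteq> (\<Union>t\<in>I. S t)"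
  shows "\<exists>t\<in>I. T \<subseteq> S t"
  using assms(1,3,4)
proof (induction I rule: finite_induct)
  case empty
  then show ?case using T unfolding irreducible_in_def by auto
next
  case (insert t I)
  have "closedin X (\<Union>t\<in>I. S t)" using insert by (intro closedin_Union) auto
  moreover have "closedin X (S t)" using insert by simp
  moreover have "T \<subseteq> S t \<union> (\<Union>t\<in>I. S t)" using insert.prems(2) by simp
  ultimately have "T \<subseteq> S t \<or> T \<subseteq> (\<Union>t\<in>I. S t)" using T unfolding irreducible_in_def by blast
  then show ?case
  proof
    assume "T \<subseteq> (\<Union>t\<in>I. S t)"
    then have "\<exists>t\<in>I. T \<subseteq> S t" using insert.IH insert.prems(1) by simp
    then show ?thesis by blast
  qed blast
qed

text \<open>An invariant is constant on orbits and continuous.\<close>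

lemma invariant_on_closure:
  fixes Z :: "'a::comm_ring_1 mat2 set"
  assumes f: "f \<in> carrier (inv_ring n Z)" and stable: "\<And>s y. s \<in> S \<Longrightarrow> y \<in> gl_orbit n s \<Longrightarrow> y \<in> Z"
    and S: "S \<subseteq> Z" and x: "x \<in> orbit_closure n S" "x \<in> Z" and c: "\<And>s. s \<in> S \<Longrightarrow> f s = c"
  shows "f x = c"
proof -
  obtain g where g: "g \<in> polyfun n" "f = restrict g Z" using f unfolding inv_ring_carrier by blast
  have "poly_on n (\<lambda>x. g x + (- c))" by (intro poly_on_add poly_on_const polyfun_poly_on g(1))
  then have "g x + (- c) = 0"
  proof (rule orbit_closureD[OF x(1)])
    fix s y assume s: "s \<in> S" and y: "y \<in> gl_orbit n s"
    have "y \<in> Z" "s \<in> Z" using stable[OF s y] S s by auto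
    then have "f y = f s" using f y unfolding inv_ring_carrier by blast
    then show "g y + (- c) = 0" using c[OF s] \<open>y \<in> Z\<close> by (simp add: g(2))
  qed
  then show ?thesis using x(2) by (simp add: g(2))
qed

lemma dsum_dsums_append:
  assumes "set xs \<subseteq> mat2_space i" "set ys \<subseteq> mat2_space i"
  shows "dsum (dsums xs) (dsums ys) = dsums (xs @ ys)"
  using assms(1)
proof (induction xs)
  case Nil
  then show ?case using dsum_unit(1)[OF dsums_space[OF assms(2)]] by (simp add: dsums_simps)
next
  case (Cons x xs)
  then show ?case
    using dsum_assoc[of x i "dsums xs" "i * length xs" "dsums ys" "i * length ys"] dsums_space[of xs i] dsums_space[OF assms(2)]
    by (simp add: dsums_simps)
qed

text \<open>For \<open>q = 1\<close> a cyclic pair of size one is a line with two free parameters, and it includes the lines of the other kinds.\<close>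

lemma simple_sum_one:
  fixes q :: "'a::field"
  shows "simple_sum q 1 cs as bs = simple_sum q 1 (cs @ map (\<lambda>a. (a, 0)) as @ map (\<lambda>b. (0, b)) bs) [] []"
proof -
  let ?f = "\<lambda>(a, b). cyclic_pair q 1 a b"
  have l: "line a b = cyclic_pair q 1 a b" for a b :: 'a
    unfolding line_def cyclic_pair_def by (auto simp: mat_diag_def intro!: eq_matI)
  have s: "set (map ?f zs) \<subseteq> mat2_space 1" for zs
    using range_cyclic_pair[of q 1] by (simp only: set_map) blast
  have A: "map (\<lambda>a. line a 0) as = map ?f (map (\<lambda>a. (a, 0)) as)" by (simp add: l)
  have B: "map (\<lambda>b. line 0 b) bs = map ?f (map (\<lambda>b. (0, b)) bs)" by (simp add: l)
  have u0: "dsum (0\<^sub>m 0 0, 0\<^sub>m 0 0) (0\<^sub>m 0 0, 0\<^sub>m 0 0) = ((0\<^sub>m 0 0, 0\<^sub>m 0 0) :: 'a mat2)"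
    by (rule dsum_unit(2)[of _ 0]) simp
  have "simple_sum q 1 cs as bs = dsums (map ?f cs @ map ?f (map (\<lambda>a. (a, 0)) as) @ map ?f (map (\<lambda>b. (0, b)) bs))"
    unfolding simple_sum_def A B dsum_dsums_append[OF s s]
    by (rule dsum_dsums_append[OF s, of _ cs]) (use s[of "map (\<lambda>a. (a, 0)) as"] s[of "map (\<lambda>b. (0, b)) bs"] in simp)
  also have "\<dots> = dsums (map ?f (cs @ map (\<lambda>a. (a, 0)) as @ map (\<lambda>b. (0, b)) bs))" by simp
  also have "\<dots> = simple_sum q 1 (cs @ map (\<lambda>a. (a, 0)) as @ map (\<lambda>b. (0, b)) bs) [] []"
    unfolding simple_sum_def list.map(1) dsums_simps(1) u0
    using dsum_unit(2)[OF dsums_space[OF s]] by (simp only:)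
  finally show ?thesis .
qed

lemma degenerates_to_generic:
  fixes q :: "'a::{alg_closed_field, field_char_0}"
  assumes q: "q \<noteq> 0" and x: "x \<in> qcomm q n" and L: "L = (case q_order q of enat l \<Rightarrow> l | \<infinity> \<Rightarrow> 1)"
  shows "\<exists>t\<in>PG q n. \<exists>v. generic_pair q L t v \<in> orbit_closure n {x}"
proof (cases "q_order q")
  case (enat l)
  then have Ll: "L = l" using L by simp
  have prim: "primitive_root q L" using enat unfolding Ll q_order_enat .
  then obtain cs as bs where c: "L * length cs + length as + length bs = n"
    "simple_sum q L cs as bs \<in> orbit_closure n {x}" using semisimplification[OF q _ x] by blast
  show ?thesis
  proof (cases "L = 1")
    case True
    let ?cs = "cs @ map (\<lambda>a. (a, 0)) as @ map (\<lambda>b. (0, b)) bs"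
    have "simple_sum q L ?cs [] [] \<in> orbit_closure n {x}" using c(2) unfolding True simple_sum_one[of q cs] .
    moreover have "(length ?cs, 0, 0) \<in> PG q n" using c(1) True Ll enat unfolding PG_def by (simp add: one_enat_def)
    moreover obtain v where "generic_pair q L (length ?cs, length ([] :: 'a list), length ([] :: 'a list)) v = simple_sum q L ?cs [] []"
      using generic_pair_surj by blast
    ultimately show ?thesis by (intro bexI[of _ "(length ?cs, 0, 0)"] exI[of _ v]) simp_all
  next
    case False
    then have "(length cs, length as, length bs) \<in> PG q n" using c(1) Ll enat unfolding PG_def by (simp add: one_enat_def)
    moreover obtain v where "generic_pair q L (length cs, length as, length bs) v = simple_sum q L cs as bs"
      using generic_pair_surj by blast
    ultimately show ?thesis using c(2) by (intro bexI[of _ "(length cs, length as, length bs)"] exI[of _ v]) simp_all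
  qed
next
  case infinity
  then have inf: "\<forall>k>0. q ^ k \<noteq> 1" unfolding q_order_infinity .
  then obtain cs as bs where c: "L * length cs + length as + length bs = n" "cs \<noteq> [] \<longrightarrow> primitive_root q L"
    "simple_sum q L cs as bs \<in> orbit_closure n {x}" using semisimplification[OF q _ x] by blast
  have cs: "cs = []" using c(2) inf unfolding primitive_root_def by blast
  have "(0, length as, length bs) \<in> PG q n" using c(1) cs infinity unfolding PG_def by simp
  moreover obtain v where "generic_pair q L (length cs, length as, length bs) v = simple_sum q L cs as bs"
    using generic_pair_surj by blast
  ultimately show ?thesis using c(3) cs by (intro bexI[of _ "(0, length as, length bs)"] exI[of _ v]) simp_all
qed

lemma finite_PG: "finite (PG q n)"
proof (cases "q_order q")
  case (enat l)
  then have "l > 0" unfolding q_order_enat primitive_root_def by blast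
  have "PG q n \<subseteq> {..n} \<times> {..n} \<times> {..n}"
  proof
    fix t assume t: "t \<in> PG q n"
    obtain p m r where pmr: "t = (p, m, r)" by (cases t)
    have "p \<le> l * p" using \<open>l > 0\<close> by simp
    moreover have "l * p + m + r = n"
      using t enat unfolding PG_def pmr by (auto simp: one_enat_def split: if_splits)
    ultimately have "p \<le> n" "m \<le> n" "r \<le> n" by linarith+
    then show "t \<in> {..n} \<times> {..n} \<times> {..n}" unfolding pmr by simp
  qed
  then show ?thesis by (rule finite_subset) simp
next
  case infinity
  then have "PG q n \<subseteq> {..n} \<times> {..n} \<times> {..n}" unfolding PG_def by auto
  then show ?thesis by (rule finite_subset) simp
qed

text \<open>At the generic pair with all parameters \<open>1\<close> the invariants bound each entry of \<open>t'\<close> from below by the one of \<open>(p, m, r)\<close>. As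
  both types have the total size \<open>n\<close>, they agree.\<close>

lemma PG_separated:
  fixes q :: "'a::{alg_closed_field, field_char_0}"
  assumes t: "(p, m, r) \<in> PG q n" and t': "t' \<in> PG q n" and L: "L = (case q_order q of enat l \<Rightarrow> l | \<infinity> \<Rightarrow> 1)"
    and same: "\<And>f. f \<in> carrier (inv_ring n (qcomm q n)) \<Longrightarrow>
      f (generic_pair q L t' v) = f (generic_pair q L (p, m, r) (\<lambda>_. 1))"
  shows "t' = (p, m, r)"
proof -
  obtain p' m' r' where t'': "t' = (p', m', r')" by (cases t')
  define cs as bs where "cs = map (\<lambda>i. (v i, v (p' + m' + i))) [0..<p']"
    and "as = map (\<lambda>j. v (p' + j)) [0..<m']" and "bs = map (\<lambda>k. v (2 * p' + m' + k)) [0..<r']"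
  have len: "length cs = p'" "length as = m'" "length bs = r'" by (simp_all add: cs_def as_def bs_def)
  let ?x = "generic_pair q L (p, m, r) (\<lambda>_. 1)" and ?y = "generic_pair q L t' v"
  have y: "?y = simple_sum q L cs as bs" unfolding t'' generic_pair_def cs_def as_def bs_def by simp
  have x: "?x = simple_sum q L (replicate p (1, 1)) (replicate m 1) (replicate r 1)"
    unfolding generic_pair_def by (simp add: map_replicate_const)
  note Z = Zvar_generic[OF t L] and Z' = Zvar_generic[OF t'[unfolded t''] L]
  have K: "qcomm q n \<subseteq> mat2_space n" unfolding qcomm_def by blast
  have xq: "?x \<in> qcomm q n" by (rule generic_pair_qcomm[OF Z(5,4)])
  have yq: "?y \<in> qcomm q n" unfolding t'' by (rule generic_pair_qcomm[OF Z'(5,4)])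
  have eq: "F ?y = F ?x" if F: "poly_on n F" "\<And>x y. x \<in> mat2_space n \<Longrightarrow> y \<in> gl_orbit n x \<Longrightarrow> F y = F x" for F
  proof -
    have "restrict F (qcomm q n) \<in> carrier (inv_ring n (qcomm q n))"
      by (rule invariant_restrict[OF K F(1)]) (use F(2) K in blast)
    from same[OF this] show ?thesis using xq yq by simp
  qed
  have cp: "char_poly (fst ?y) = char_poly (fst ?x)" "char_poly (snd ?y) = char_poly (snd ?x)"
    by (rule poly_eqI, rule eq[OF char_poly_coeff_poly_on[OF poly_mat_fst_snd(1)]], simp only: char_poly_invariant(1))
      (rule poly_eqI, rule eq[OF char_poly_coeff_poly_on[OF poly_mat_fst_snd(2)]], simp only: char_poly_invariant(2))
  have wt: "word_trace k l ?y = word_trace k l ?x" for k l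
    unfolding word_trace_def
    by (rule eq[OF poly_on_trace[OF poly_mat_mult[OF poly_mat_pow[OF poly_mat_fst_snd(1)] poly_mat_pow[OF poly_mat_fst_snd(2)]]]
      trace_word_invariant])
  show ?thesis
  proof (cases "q_order q")
    case (enat l)
    then have Ll: "L = l" using L by simp
    have prim: "primitive_root q L" using enat unfolding Ll q_order_enat .
    then have L0: "L > 0" unfolding primitive_root_def by blast
    show ?thesis
    proof (cases "l = 1")
      case True
      then show ?thesis using t t' enat unfolding PG_def by (simp add: one_enat_def)
    next
      case False
      have q1: "q \<noteq> 1"
      proof
        assume "q = 1"
        then have "\<not> 1 < L" using prim unfolding primitive_root_def by auto
        then show False using L0 False Ll by simp
      qed
      note le = types_le_finite[OF prim q1 x y cp wt, unfolded len]
      have "L * p \<le> L * p'" using le(1) by simp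
      then have "L * p = L * p'" "m = m'" "r = r'" using le Z(4) Z'(4) by linarith+
      then show ?thesis using L0 t'' by simp
    qed
  next
    case infinity
    then have p: "p = 0" "p' = 0" and n: "m + r = n" "m' + r' = n" using t t' t'' unfolding PG_def by auto
    have "cs = []" using p(2) by (simp add: cs_def)
    have "?x = simple_sum q L [] (replicate m 1) (replicate r 1)" using x unfolding p(1) by simp
    moreover have "?y = simple_sum q L [] as bs" using y unfolding \<open>cs = []\<close> .
    ultimately have "m \<le> length as" "r \<le> length bs" by (rule types_le_infinite[OF _ _ cp wt])+
    then have "m \<le> m'" "r \<le> r'" unfolding len .
    then show ?thesis using n p t'' by simp
  qed
qed

theorem theorem1p2:
  fixes q :: "'a :: {alg_closed_field, field_char_0}" and n :: nat
  assumes "q \<noteq> 0" and "n \<ge> 1"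
  shows "(\<forall>t \<in> PG q n. irreducible_component_of (Kquot q n) (quot_image q n (Zvar q n t)))
    \<and> topspace (Kquot q n) = (\<Union>t \<in> PG q n. quot_image q n (Zvar q n t))
    \<and> (\<forall>(p, m, r) \<in> PG q n.
         \<forall>X \<in> {krull_dim (git_quotient n (Zvar q n (p, m, r))),
               krull_dim (subtopology (Kquot q n) (quot_image q n (Zvar q n (p, m, r))))}.
           (case q_order q of
              enat l \<Rightarrow> \<exists>d. X = enat d \<and> int d = int n + (2 - int l) * int p
            | \<infinity> \<Rightarrow> X = enat n))"
proof -
  define L where "L = (case q_order q of enat l \<Rightarrow> l | \<infinity> \<Rightarrow> 1)"
  define N where "N = (\<lambda>(p, m, r). 2 * p + m + r :: nat)"
  let ?K = "qcomm q n" and ?\<phi> = "generic_pair q L"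
  have L0: "L > 0"
    unfolding L_def using q_order_enat[of q] by (auto simp: primitive_root_def split: enat.split)
  have K: "?K \<subseteq> mat2_space n" unfolding qcomm_def by blast
  have Zq: "Zvar q n t \<subseteq> ?K" for t unfolding Zvar_def by (cases t) (simp add: zclosure_qcomm)
  have gen: "?\<phi> t v \<in> Zvar q n t" and cl: "Zvar q n t \<subseteq> orbit_closure n (range (?\<phi> t))"
    and stable: "\<And>x y. x \<in> Zvar q n t \<Longrightarrow> y \<in> gl_orbit n x \<Longrightarrow> y \<in> Zvar q n t" if "t \<in> PG q n" for t v
  proof -
    obtain p m r where t: "t = (p, m, r)" by (cases t)
    note Z = Zvar_generic[OF that[unfolded t] L_def]
    show "?\<phi> t v \<in> Zvar q n t" unfolding t by (rule Z(1))
    show "Zvar q n t \<subseteq> orbit_closure n (range (?\<phi> t))" unfolding t by (rule Z(2))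
    show "y \<in> Zvar q n t" if "x \<in> Zvar q n t" "y \<in> gl_orbit n x" for x y
      using Z(3) that unfolding t by blast
  qed
  have par: "quotient_param n Z (?\<phi> t) (N t)" if t: "t \<in> PG q n" and Z: "Z \<subseteq> mat2_space n" "Zvar q n t \<subseteq> Z" for t Z
  proof -
    obtain p m r where pmr: "t = (p, m, r)" by (cases t)
    have "n = L * p + m + r" by (rule Zvar_generic(4)[OF t[unfolded pmr] L_def])
    moreover have "generic_pair q L (p, m, r) v \<in> Z" for v using gen[OF t, of v] Z(2) unfolding pmr by blast
    ultimately show ?thesis unfolding pmr N_def prod.case by (intro quotient_param_generic[OF Z(1) _ _ L0])
  qed
  note parK = par[OF _ K Zq]
  \<comment> \<open>The image of the family of type \<open>t\<close> in the quotient; it turns out to be the whole image of \<open>Zvar q n t\<close>.\<close>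
  define Y where "Y = (\<lambda>t. range (\<lambda>v. quotient_map_on n ?K (?\<phi> t v)))"
  have points: "quotient_param.points n ?K (?\<phi> t) = Y t" if "t \<in> PG q n" for t
    unfolding Y_def by (rule quotient_param.points_def[OF parK[OF that]])
  \<comment> \<open>The orbits of the generic pairs are dense in \<open>Zvar q n t\<close>.\<close>
  have vanish: "f x = 0" if t: "t \<in> PG q n" and Z: "Zvar q n t \<subseteq> Z" and f: "f \<in> carrier (inv_ring n Z)"
    and x: "x \<in> Zvar q n t" and van: "\<And>v. f (?\<phi> t v) = 0" for t Z f x
  proof (rule invariant_on_closure[OF f, of "range (?\<phi> t)"])
    show "y \<in> Z" if "s \<in> range (?\<phi> t)" "y \<in> gl_orbit n s" for s y
      using that gen[OF t] stable[OF t] Z by blast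
    show "range (?\<phi> t) \<subseteq> Z" using gen[OF t] Z by blast
    show "x \<in> orbit_closure n (range (?\<phi> t))" using cl[OF t] x by blast
    show "x \<in> Z" using x Z by blast
    show "f s = 0" if "s \<in> range (?\<phi> t)" for s using that van by blast
  qed
  have image: "quot_image q n (Zvar q n t) = Y t" if t: "t \<in> PG q n" for t
  proof
    show "Y t \<subseteq> quot_image q n (Zvar q n t)" unfolding Y_def quot_image_def using gen[OF t] by blast
    show "quot_image q n (Zvar q n t) \<subseteq> Y t"
    proof
      fix M assume "M \<in> quot_image q n (Zvar q n t)"
      then obtain x where x: "x \<in> Zvar q n t" "M = quotient_map_on n ?K x" unfolding quot_image_def by blast
      have "x \<in> ?K" using x(1) Zq by blast
      have "{f \<in> carrier (inv_ring n ?K). \<forall>v. f (?\<phi> t v) = 0} \<subseteq> M"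
        unfolding x(2) quotient_map_on_def using vanish[OF t Zq _ x(1)] by blast
      then have "M \<in> quotient_param.points n ?K (?\<phi> t)"
        unfolding quotient_param.points_iff[OF parK[OF t]] x(2)
        using maximalideal_at_point[OF \<open>x \<in> ?K\<close>] by blast
      then show "M \<in> Y t" unfolding points[OF t] .
    qed
  qed
  \<comment> \<open>Every point has the same invariants as some generic pair, to which its orbit degenerates.\<close>
  have denseK: "f x = 0" if f: "f \<in> carrier (inv_ring n ?K)" and x: "x \<in> ?K"
    and van: "\<And>t v. t \<in> PG q n \<Longrightarrow> f (?\<phi> t v) = 0" for f x
  proof -
    obtain t v where t: "t \<in> PG q n" "?\<phi> t v \<in> orbit_closure n {x}"
      using degenerates_to_generic[OF assms(1) x L_def] by blast
    have "f (?\<phi> t v) = f x"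
    proof (rule invariant_on_closure[OF f, of "{x}"])
      show "?\<phi> t v \<in> ?K" using gen[OF t(1)] Zq by blast
      show "y \<in> ?K" if "s \<in> {x}" "y \<in> gl_orbit n s" for s y using that x qcomm_stable by blast
    qed (use t(2) x in simp_all)
    then show ?thesis using van[OF t(1)] by simp
  qed
  obtain t0 where t0: "t0 \<in> PG q n"
    using degenerates_to_generic[OF assms(1) _ L_def, of "(0\<^sub>m n n, 0\<^sub>m n n)" n] by (auto simp: qcomm_def)
  have top: "topspace (Kquot q n) = (\<Union>t \<in> PG q n. quot_image q n (Zvar q n t))"
  proof -
    have "topspace (Kquot q n) = {M. maximalideal M (inv_ring n ?K)}"
      by (rule quotient_param.topspace_git_quotient[OF parK[OF t0]])
    also have "\<dots> = (\<Union>t \<in> PG q n. Y t)"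
    proof (intro equalityI subsetI)
      fix M assume "M \<in> {M. maximalideal M (inv_ring n ?K)}"
      then have M: "maximalideal M (inv_ring n ?K)" by simp
      have "\<exists>t\<in>PG q n. \<exists>v. M = quotient_map_on n ?K (?\<phi> t v)"
      proof (rule maximal_ideals_are_points[where N = N, OF finite_PG _ _ M])
        show "quotient_param n ?K (?\<phi> t) (N t)" if "t \<in> PG q n" for t by (rule parK[OF that])
        show "f x = 0" if "f \<in> carrier (inv_ring n ?K)" "x \<in> ?K" "\<And>t v. t \<in> PG q n \<Longrightarrow> f (?\<phi> t v) = 0" for f x
          by (rule denseK[OF that])
      qed
      then show "M \<in> (\<Union>t \<in> PG q n. Y t)" unfolding Y_def by blast
    next
      fix M assume "M \<in> (\<Union>t \<in> PG q n. Y t)"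
      then obtain t v where "t \<in> PG q n" "M = quotient_map_on n ?K (?\<phi> t v)" unfolding Y_def by blast
      then show "M \<in> {M. maximalideal M (inv_ring n ?K)}"
        using maximalideal_at_point[of "?\<phi> t v" ?K n] gen Zq by blast
    qed
    finally show ?thesis using image by simp
  qed
  have closed: "closedin (Kquot q n) (Y t)" if "t \<in> PG q n" for t
    using quotient_param.closedin_points[OF parK[OF that]] unfolding points[OF that] .
  have irr: "irreducible_in (Kquot q n) (Y t)" if "t \<in> PG q n" for t
    using quotient_param.irreducible_points[OF parK[OF that]] unfolding points[OF that] .
  have sep: "t' = t" if t: "t \<in> PG q n" and t': "t' \<in> PG q n" and sub: "Y t \<subseteq> Y t'" for t t'
  proof -
    obtain p m r where pmr: "t = (p, m, r)" by (cases t)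
    have "quotient_map_on n ?K (?\<phi> t (\<lambda>_. 1)) \<in> Y t'" using sub unfolding Y_def by blast
    then obtain v where v: "quotient_map_on n ?K (?\<phi> t (\<lambda>_. 1)) = quotient_map_on n ?K (?\<phi> t' v)" unfolding Y_def by blast
    have "f (?\<phi> t' v) = f (?\<phi> t (\<lambda>_. 1))" if f: "f \<in> carrier (inv_ring n ?K)" for f
    proof -
      have k: "?\<phi> t (\<lambda>_. 1) \<in> ?K" "?\<phi> t' v \<in> ?K" using gen[OF t] gen[OF t'] Zq by blast+
      define h where "h = (\<lambda>x\<in>?K. f x + (\<lambda>x\<in>?K. - f (?\<phi> t (\<lambda>_. 1))) x)"
      have "h \<in> quotient_map_on n ?K (?\<phi> t (\<lambda>_. 1))"
        unfolding quotient_map_on_def h_def using inv_ring_closed(1)[OF f inv_ring_const] k by simp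
      then have "h \<in> quotient_map_on n ?K (?\<phi> t' v)" unfolding v .
      then have "h (?\<phi> t' v) = 0" unfolding quotient_map_on_def by simp
      then show ?thesis using k by (simp add: h_def)
    qed
    then show ?thesis using PG_separated[OF t[unfolded pmr] t' L_def, of v] unfolding pmr by blast
  qed
  have comp: "irreducible_component_of (Kquot q n) (quot_image q n (Zvar q n t))" if t: "t \<in> PG q n" for t
    unfolding irreducible_component_of_def image[OF t]
  proof (intro conjI allI impI)
    show "irreducible_in (Kquot q n) (Y t)" by (rule irr[OF t])
    fix T assume T: "irreducible_in (Kquot q n) T" "Y t \<subseteq> T"
    have "T \<subseteq> (\<Union>t \<in> PG q n. Y t)" using T(1) top image unfolding irreducible_in_def by simp
    then have "\<exists>t'\<in>PG q n. T \<subseteq> Y t'"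
      by (rule irreducible_in_finite_union[OF finite_PG T(1), rotated]) (rule closed)
    then obtain t' where t': "t' \<in> PG q n" "T \<subseteq> Y t'" by blast
    then have "t' = t" using sep[OF t t'(1)] T(2) by blast
    then show "T = Y t" using t'(2) T(2) by blast
  qed
  have dimK: "krull_dim (subtopology (Kquot q n) (quot_image q n (Zvar q n t))) = enat (N t)" if t: "t \<in> PG q n" for t
  proof -
    interpret Q: quotient_param n ?K "?\<phi> t" "N t" by (rule parK[OF t])
    show ?thesis using Q.krull_dim_eq unfolding image[OF t] points[OF t] .
  qed
  \<comment> \<open>The same family parametrizes the quotient of \<open>Zvar q n t\<close>, which is formed with invariants on \<open>Zvar q n t\<close> that a priori do
    not extend to \<open>qcomm q n\<close>.\<close>
  have dimZ: "krull_dim (git_quotient n (Zvar q n t)) = enat (N t)" if t: "t \<in> PG q n" for t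
  proof -
    let ?Z = "Zvar q n t"
    have p: "quotient_param n ?Z (?\<phi> t) (N t)" by (rule par[OF t order_trans[OF Zq K] order_refl])
    interpret Q: quotient_param n ?Z "?\<phi> t" "N t" by (rule p)
    have "M \<in> Q.points" if M: "maximalideal M (inv_ring n ?Z)" for M
    proof -
      have "\<exists>s\<in>{t}. \<exists>v. M = quotient_map_on n ?Z (?\<phi> s v)"
      proof (rule maximal_ideals_are_points[where N = N, OF _ _ _ M])
        show "quotient_param n ?Z (?\<phi> s) (N s)" if "s \<in> {t}" for s using that p by simp
        show "f x = 0" if "f \<in> carrier (inv_ring n ?Z)" "x \<in> ?Z" "\<And>s v. s \<in> {t} \<Longrightarrow> f (?\<phi> s v) = 0" for f x
          by (rule vanish[OF t order_refl that(1,2)]) (use that(3) in blast)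
      qed simp
      then show ?thesis unfolding Q.points_def by blast
    qed
    then have "Q.points = topspace (git_quotient n ?Z)"
      unfolding Q.topspace_git_quotient using Q.points_iff by blast
    then have "subtopology (git_quotient n ?Z) Q.points = git_quotient n ?Z" by (simp add: subtopology_topspace)
    then show ?thesis using Q.krull_dim_eq by simp
  qed
  \<comment> \<open>\<open>2 p + m + r = n + (2 - L) p\<close>, as \<open>n = L p + m + r\<close>.\<close>
  have "case q_order q of enat l \<Rightarrow> \<exists>d. X = enat d \<and> int d = int n + (2 - int l) * int p | \<infinity> \<Rightarrow> X = enat n"
    if t: "(p, m, r) \<in> PG q n" and X: "X = enat (N (p, m, r))" for p m r X
  proof (cases "q_order q")
    case (enat l)
    have "n = L * p + m + r" by (rule Zvar_generic(4)[OF t L_def])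
    then have "int (N (p, m, r)) = int n + (2 - int l) * int p"
      unfolding N_def L_def enat by (simp add: algebra_simps)
    then show ?thesis using X enat by simp
  next
    case infinity
    then have "N (p, m, r) = n" using t unfolding PG_def N_def by simp
    then show ?thesis using X infinity by simp
  qed
  then show ?thesis using comp top dimK dimZ by auto
qed

end
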